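(* Let $m$ be a natural number ($m\ge1$) or $m=\infty$, and let $Y$ be a graded $\mathbf k$-vector space. The free $L(m)$-algebra generated by $Y$ (left adjoint to the forgetful functor from $L(m)$-algebras with strict homomorphisms to graded vector spaces) can be defined as $\mathfrak L_m(Y)=\bigoplus_{n\ge1}\mathfrak L_m^n(Y)$, where $$\mathfrak L_m^n(Y):=\mathcal L_m(n)\otimes_{\Sigma_n}Y^{\otimes n},$$ with structure operations $l_k$, $1\le k\le m$, $k<\infty$, given by the following rule. Let $\vec v_j\in Y^{\otimes k_j}$ be homogeneous and $T_j\in\mathrm{Adm}_m(k_j)$, $1\le j\le k$. Then $$l_k(T_1\otimes_{\Sigma_{k_1}}\vec v_1,\dots,T_k\otimes_{\Sigma_{k_k}}\vec v_k):=(-1)^{\varepsilon}\,\Omega(\zeta_k(T_1,\dots,T_k))\otimes_{\Sigma_{k_1+\cdots+k_k}}(\vec v_1\otimes\cdots\otimes\vec v_k),$$ where $\varepsilon=\sum_{1\le i<j\le k}|\vec v_i|\deg(T_j)$ is the Koszul sign exponent.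
   Context: $\mathbf k$ is a field of characteristic zero. $L(m)$-algebras. For $\sigma\in\Sigma_k$ and homogeneous $x_1,\dots,x_k$, put $\chi(\sigma)=\mathrm{sgn}(\sigma)\epsilon(\sigma)$, where $\epsilon(\sigma)$ is the Koszul sign defined by $x_1\cdots x_k=\epsilon(\sigma)x_{\sigma(1)}\cdots x_{\sigma(k)}$ in the free graded commutative algebra. An $L(m)$-algebra is a graded vector space $L$ with linear maps $l_k:L^{\otimes k}\to L$ of degree $k-2$, $1\le k\le m$, $k<\infty$, such that $l_k(x_{\sigma(1)},\dots,x_{\sigma(k)})=\chi(\sigma)l_k(x_1,\dots,x_k)$ for all $\sigma\in\Sigma_k$, and for every $n\le m$, $n<\infty$, $$\sum_{i+j=n+1}\sum_\sigma\chi(\sigma)(-1)^{i(j-1)}l_j(l_i(x_{\sigma(1)},\dots,x_{\sigma(i)}),x_{\sigma(i+1)},\dots,x_{\sigma(n)})=0,$$ where $i\ge1$ and $\sigma$ runs over $(i,n-i)$-unshuffles ($\sigma(1)<\dots<\sigma(i)$ and $\sigma(i+1)<\dots<\sigma(n)$). Strict homomorphisms are degree $0$ linear maps commuting with all $l_k$. Trees. An $n$-tree is a finite connected acyclic rooted tree with one output leg (the root) and $n$ input legs; legs are half-edges attached to only one vertex. $\mathrm{val}(v)\ge 1$ is the number of input edges of a vertex $v$; $v$ is unary if $\mathrm{val}(v)=1$. The trivial $1$-tree (one edge, no vertices) is allowed. $T_m(n)$ is the set of (isomorphism classes of) abstract, non-planar $n$-trees with input legs labeled bijectively by $1,\dots,n$,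 all of whose vertices have at most $m$ input edges (unary vertices allowed); $\deg(T)=\sum_v(\mathrm{val}(v)-2)$. An input vertex is a vertex all of whose input edges are input legs. A tree is admissible if all its unary vertices are input vertices; $\mathrm{Adm}_m(n)\subset T_m(n)$ is the set of admissible trees. Operad. $\mathcal F_m$ is the free graded $\Sigma$-operad (with Koszul signs) on generators $\zeta_i$, $1\le i\le m$, $i<\infty$, where $\zeta_i$ has arity $i$, degree $i-2$ and spans the signum representation of $\Sigma_i$. One has $\mathcal F_m(n)\cong\mathrm{Span}_{\mathbf k}(T_m(n))$, where $\zeta_j$ is the $j$-corolla and each labeled tree is identified with the operadic composite of generators it describes (well defined up to sign; the sign is fixed by choosing a planar representative for each tree). $\zeta_k(T_1,\dots,T_k)$ denotes the operadic composite, i.e. (up to the corresponding sign) the tree obtained by grafting $T_j$ to the $j$-th input of $\zeta_k$, the labels of $T_j$ being shifted by $k_1+\dots+k_{j-1}$. Put $\mathcal L_m=\mathcal F_m/\mathcal I_m$, where $\mathcal I_m$ is the operadic ideal generated, for $1\le n\le m$, $n<\infty$, by the elements of $\mathcal F_m(n)$ expressing the generalized Jacobi identities above, $$\sum_{i+j=n+1}\sum_\sigma\mathrm{sgn}(\sigma)(-1)^{i(j-1)}\zeta_j(\zeta_i(\sigma(1),\dots,\sigma(i)),\sigma(i+1),\dots,\sigma(n)),$$ where the summand is $\zeta_j\circ_1\zeta_i$ with inputs labeled as indicated. The classes of trees in $\mathrm{Adm}_m(n)$ form a basis of $\mathcal L_m(n)$, and $\Omega:\mathcal F_m(n)\to\mathrm{Span}_{\mathbf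 k}(\mathrm{Adm}_m(n))\cong\mathcal L_m(n)$ is the unique linear map with $\Omega(T)\equiv T$ modulo $\mathcal I_m(n)$ for all $T\in T_m(n)$. $\Sigma_n$ acts on $\mathcal L_m(n)$ by the operad (relabeling) action and on $Y^{\otimes n}$ by permutation of factors with Koszul signs. The space $Y$ is included in $\mathfrak L_m(Y)$ as $y\mapsto(\text{trivial tree})\otimes y$. *)

theory Defs
  imports
    "HOL-Algebra.Algebraic_Closure_Type"
    "HOL-Combinatorics.Permutations"
    "HOL-Library.Extended_Nat"
    "HOL-Library.Poly_Mapping"
    "HOL-Library.Set_Algebras"
begin

section \<open>Signs and unshuffles\<close>

text \<open>Everything is indexed from \<open>0\<close>: a permutation of \<open>n\<close> letters permutes \<open>{..<n}\<close>, and the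
  legs of an \<open>n\<close>-tree are labelled by \<open>0, \<dots>, n - 1\<close>.\<close>

definition psign :: "int \<Rightarrow> int" where
  "psign d = (if even d then 1 else - 1)"

text \<open>The sign \<open>\<epsilon>\<close> with \<open>x\<^sub>0 \<cdots> x\<^sub>n\<^sub>-\<^sub>1 = \<epsilon> x\<^bsub>\<sigma> 0\<^esub> \<cdots> x\<^bsub>\<sigma> (n-1)\<^esub>\<close> for graded commuting \<open>x\<^sub>i\<close> of degree \<open>ds ! i\<close>:
  every pair of letters that changes its order contributes \<open>(-1)\<close> to the product of the degrees.\<close>

definition koszul :: "(nat \<Rightarrow> nat) \<Rightarrow> int list \<Rightarrow> int" where
  "koszul \<sigma> ds = (\<Prod>(p, q) \<in> {(p, q). p < q \<and> q < length ds \<and> \<sigma> q < \<sigma> p}. psign (ds ! \<sigma> p * ds ! \<sigma> q))"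

definition chi :: "(nat \<Rightarrow> nat) \<Rightarrow> int list \<Rightarrow> int" where
  "chi \<sigma> ds = sign \<sigma> * koszul \<sigma> ds"

definition unshuffles :: "nat \<Rightarrow> nat \<Rightarrow> (nat \<Rightarrow> nat) set" where
  "unshuffles i n = {\<sigma>. \<sigma> permutes {..<n} \<and> strict_mono_on {..<i} \<sigma> \<and> strict_mono_on {i..<n} \<sigma>}"


section \<open>Graded vector spaces and $L(m)$-algebras\<close>

text \<open>A graded vector space is a family of vector spaces \<open>V d\<close> indexed by the degree \<open>d\<close>. Homogeneous
  elements are therefore always handled together with their degree, and a linear map out of a
  \<open>k\<close>-fold tensor power is a multilinear function on lists of such pairs. The multiplicative part
  of the record \<^typ>\<open>('k, 'v) module\<close> plays no role.\<close>

type_synonym ('k, 'v) graded = "int \<Rightarrow> ('k, 'v) module"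

definition graded_vector_space :: "('k::field_char_0, 'v) graded \<Rightarrow> bool" where
  "graded_vector_space V \<longleftrightarrow> (\<forall>d. Module.module (ring_of_type_algebra :: 'k ring) (V d))"

definition graded_linear ::
    "('k, 'v) graded \<Rightarrow> ('k, 'w) graded \<Rightarrow> (int \<Rightarrow> 'v \<Rightarrow> 'w) \<Rightarrow> bool" where
  "graded_linear V W f \<longleftrightarrow>
    (\<forall>d. \<forall>x \<in> carrier (V d). f d x \<in> carrier (W d)) \<and>
    (\<forall>d c. \<forall>x \<in> carrier (V d). \<forall>y \<in> carrier (V d).
      f d (c \<odot>\<^bsub>V d\<^esub> x \<oplus>\<^bsub>V d\<^esub> y) = c \<odot>\<^bsub>W d\<^esub> f d x \<oplus>\<^bsub>W d\<^esub> f d y)"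

definition homogeneous_list :: "('k, 'v) graded \<Rightarrow> (int \<times> 'v) list \<Rightarrow> bool" where
  "homogeneous_list V w \<longleftrightarrow> (\<forall>(d, x) \<in> set w. x \<in> carrier (V d))"

definition total_degree :: "(int \<times> 'v) list \<Rightarrow> int" where
  "total_degree w = sum_list (map fst w)"

definition op_degree :: "(int \<times> 'v) list \<Rightarrow> int" where
  "op_degree w = total_degree w + int (length w) - 2"

text \<open>The arguments on which the operations are defined; \<open>l\<^sub>k\<close> is the restriction of \<open>l\<close> to lists of
  length \<open>k\<close>.\<close>

definition op_args :: "enat \<Rightarrow> ('k, 'v) graded \<Rightarrow> (int \<times> 'v) list set" where
  "op_args m V = {w. homogeneous_list V w \<and> 1 \<le> length w \<and> enat (length w) \<le> m}"

definition multilinear_ops ::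
    "enat \<Rightarrow> ('k, 'v) graded \<Rightarrow> ((int \<times> 'v) list \<Rightarrow> 'v) \<Rightarrow> bool" where
  "multilinear_ops m V l \<longleftrightarrow> (\<forall>w \<in> op_args m V.
    l w \<in> carrier (V (op_degree w)) \<and>
    (\<forall>i < length w. \<forall>c. \<forall>x \<in> carrier (V (fst (w ! i))). \<forall>y \<in> carrier (V (fst (w ! i))).
      (let e = fst (w ! i) in
        l (w[i := (e, c \<odot>\<^bsub>V e\<^esub> x \<oplus>\<^bsub>V e\<^esub> y)]) =
          c \<odot>\<^bsub>V (op_degree w)\<^esub> l (w[i := (e, x)]) \<oplus>\<^bsub>V (op_degree w)\<^esub> l (w[i := (e, y)]))))"

definition antisymmetric_ops ::
    "enat \<Rightarrow> ('k::field_char_0, 'v) graded \<Rightarrow> ((int \<times> 'v) list \<Rightarrow> 'v) \<Rightarrow> bool" where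
  "antisymmetric_ops m V l \<longleftrightarrow> (\<forall>w \<in> op_args m V. \<forall>\<sigma>. \<sigma> permutes {..<length w} \<longrightarrow>
    l (permute_list \<sigma> w) = of_int (chi \<sigma> (map fst w)) \<odot>\<^bsub>V (op_degree w)\<^esub> l w)"

text \<open>In the summand indexed by \<open>(i, \<sigma>)\<close> one has \<open>j = n + 1 - i\<close>, so \<open>i (j - 1) = i (n - i)\<close>.\<close>

definition jacobi_ops ::
    "enat \<Rightarrow> ('k::field_char_0, 'v) graded \<Rightarrow> ((int \<times> 'v) list \<Rightarrow> 'v) \<Rightarrow> bool" where
  "jacobi_ops m V l \<longleftrightarrow> (\<forall>w \<in> op_args m V.
    (let n = length w; D = V (total_degree w + int n - 3) in
      finsum D
        (\<lambda>(i, \<sigma>). let u = take i (permute_list \<sigma> w); v = drop i (permute_list \<sigma> w) in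
          of_int (chi \<sigma> (map fst w) * psign (int (i * (n - i)))) \<odot>\<^bsub>D\<^esub> l ((op_degree u, l u) # v))
        (SIGMA i:{1..n}. unshuffles i n)
      = \<zero>\<^bsub>D\<^esub>))"

definition L_algebra ::
    "enat \<Rightarrow> ('k::field_char_0, 'v) graded \<Rightarrow> ((int \<times> 'v) list \<Rightarrow> 'v) \<Rightarrow> bool" where
  "L_algebra m V l \<longleftrightarrow> graded_vector_space V \<and> multilinear_ops m V l \<and>
    antisymmetric_ops m V l \<and> jacobi_ops m V l"

definition strict_hom ::
    "enat \<Rightarrow> ('k, 'v) graded \<Rightarrow> ((int \<times> 'v) list \<Rightarrow> 'v) \<Rightarrow>
      ('k, 'w) graded \<Rightarrow> ((int \<times> 'w) list \<Rightarrow> 'w) \<Rightarrow> (int \<Rightarrow> 'v \<Rightarrow> 'w) \<Rightarrow> bool" where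
  "strict_hom m V l W l' \<phi> \<longleftrightarrow> graded_linear V W \<phi> \<and>
    (\<forall>w \<in> op_args m V. \<phi> (op_degree w) (l w) = l' (map (\<lambda>(d, x). (d, \<phi> d x)) w))"


section \<open>Vector spaces given by generators and relations\<close>

definition fscale :: "'k::field \<Rightarrow> ('a \<Rightarrow>\<^sub>0 'k) \<Rightarrow> ('a \<Rightarrow>\<^sub>0 'k)" where
  "fscale c = Poly_Mapping.map ((*) c)"

lemma lookup_fscale [simp]: "Poly_Mapping.lookup (fscale c x) t = c * Poly_Mapping.lookup x t"
  by (simp add: fscale_def Poly_Mapping.map.rep_eq when_def)

global_interpretation free: vector_space fscale
  by unfold_locales (auto intro!: poly_mapping_eqI simp: lookup_add algebra_simps)

abbreviation gen :: "'a \<Rightarrow> ('a \<Rightarrow>\<^sub>0 'k::field)" where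
  "gen t \<equiv> Poly_Mapping.single t 1"

definition lin_ext :: "('a \<Rightarrow> ('b \<Rightarrow>\<^sub>0 'k)) \<Rightarrow> ('a \<Rightarrow>\<^sub>0 'k::field) \<Rightarrow> ('b \<Rightarrow>\<^sub>0 'k)" where
  "lin_ext g x = (\<Sum>t \<in> Poly_Mapping.keys x. fscale (Poly_Mapping.lookup x t) (g t))"

definition span_on :: "'a set \<Rightarrow> ('a \<Rightarrow>\<^sub>0 'k::field) set" where
  "span_on S = {x. Poly_Mapping.keys x \<subseteq> S}"

text \<open>The function on cosets of \<open>N\<close> induced by \<open>g\<close>; the union is over representatives, and it is a
  coset whenever \<open>g\<close> is compatible with the cosets.\<close>

definition coset_map :: "('b \<Rightarrow>\<^sub>0 'k::field) set \<Rightarrow> ('a \<Rightarrow> ('b \<Rightarrow>\<^sub>0 'k)) \<Rightarrow> 'a set \<Rightarrow> ('b \<Rightarrow>\<^sub>0 'k) set" where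
  "coset_map N g A = (\<Union>x \<in> A. g x +o N)"

text \<open>The image of the span of \<open>S\<close> in the quotient by the subspace \<open>N\<close>. In the graded quotients below
  \<open>N\<close> is the space of all relations and \<open>S\<close> the set of generators of a given degree.\<close>

definition presented :: "'a set \<Rightarrow> ('a \<Rightarrow>\<^sub>0 'k::field) set \<Rightarrow> ('k, ('a \<Rightarrow>\<^sub>0 'k) set) module" where
  "presented S N = \<lparr>carrier = (\<lambda>x. x +o N) ` span_on S, monoid.mult = undefined, monoid.one = undefined,
    ring.zero = N, add = (\<lambda>A B. A + B), module.smult = (\<lambda>c. coset_map N (fscale c))\<rparr>"


section \<open>Trees\<close>

text \<open>Planar trees: the children of a vertex form a list. \<open>Leg a\<close> is an input leg with label \<open>a\<close>; as a
  tree of its own it is the trivial tree.\<close>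

datatype 'a tree = Leg 'a | Vert "'a tree list"

fun labels :: "'a tree \<Rightarrow> 'a list" where
  "labels (Leg a) = [a]"
| "labels (Vert ts) = concat (map labels ts)"

definition arity :: "'a tree \<Rightarrow> nat" where
  "arity t = length (labels t)"

fun tdeg :: "'a tree \<Rightarrow> int" where
  "tdeg (Leg a) = 0"
| "tdeg (Vert ts) = (int (length ts) - 2) + sum_list (map tdeg ts)"

fun vals_le :: "enat \<Rightarrow> 'a tree \<Rightarrow> bool" where
  "vals_le m (Leg a) = True"
| "vals_le m (Vert ts) = (1 \<le> length ts \<and> enat (length ts) \<le> m \<and> (\<forall>t \<in> set ts. vals_le m t))"

fun admissible :: "'a tree \<Rightarrow> bool" where
  "admissible (Leg a) = True"
| "admissible (Vert ts) =
    ((length ts = 1 \<longrightarrow> (\<forall>t \<in> set ts. \<exists>a. t = Leg a)) \<and> (\<forall>t \<in> set ts. admissible t))"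

text \<open>An abstract tree is represented by its planar embedding in which the children of every vertex
  are ordered by their smallest labels. As distinct subtrees have disjoint nonempty sets of labels,
  every isomorphism class contains exactly one such planar tree.\<close>

definition low :: "nat tree \<Rightarrow> nat" where
  "low t = Min (set_tree t)"

fun nform :: "nat tree \<Rightarrow> nat tree" where
  "nform (Leg a) = Leg a"
| "nform (Vert ts) = Vert (sort_key low (map nform ts))"

definition trees :: "enat \<Rightarrow> nat \<Rightarrow> nat tree set" where
  "trees m n = {t. mset (labels t) = mset [0..<n] \<and> vals_le m t \<and> nform t = t}"

definition Adm :: "enat \<Rightarrow> nat \<Rightarrow> nat tree set" where
  "Adm m n = {t \<in> trees m n. admissible t}"


section \<open>The operads $\mathcal F_m$ and $\mathcal L_m$\<close>

text \<open>The arity \<open>n\<close> component of \<open>\<F>\<^sub>m\<close> is the span of \<open>trees m n\<close>. A planar tree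
  \<open>Vert [t\<^sub>1, \<dots>, t\<^sub>k]\<close> stands for the operadic composite of the generator \<open>\<zeta>\<^sub>k\<close> (of degree \<open>k - 2\<close>) with
  \<open>t\<^sub>1, \<dots>, t\<^sub>k\<close>, relabelled. Since \<open>\<zeta>\<^sub>k\<close> spans the signum representation, exchanging two of the \<open>t\<^sub>i\<close>
  costs the sign of the exchange times its Koszul sign, so sorting the children produces a factor
  for each inversion.\<close>

fun nform_sign :: "nat tree \<Rightarrow> int" where
  "nform_sign (Leg a) = 1"
| "nform_sign (Vert ts) = prod_list (map nform_sign ts) *
    (\<Prod>(p, q) \<in> {(p, q). p < q \<and> q < length ts \<and> low (ts ! q) < low (ts ! p)}.
      - psign (tdeg (ts ! p) * tdeg (ts ! q)))"

definition planar :: "nat tree \<Rightarrow> (nat tree \<Rightarrow>\<^sub>0 'k::field)" where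
  "planar t = fscale (of_int (nform_sign t)) (gen (nform t))"

definition relabel :: "(nat \<Rightarrow> nat) \<Rightarrow> (nat tree \<Rightarrow>\<^sub>0 'k::field) \<Rightarrow> (nat tree \<Rightarrow>\<^sub>0 'k)" where
  "relabel \<sigma> = lin_ext (\<lambda>t. planar (map_tree \<sigma> t))"

fun graft :: "('a \<Rightarrow> 'b tree) \<Rightarrow> 'a tree \<Rightarrow> 'b tree" where
  "graft g (Leg a) = g a"
| "graft g (Vert ts) = Vert (map (graft g) ts)"

definition tree_comp :: "nat \<Rightarrow> nat tree \<Rightarrow> nat tree \<Rightarrow> nat tree" where
  "tree_comp i t s = graft (\<lambda>a. if a < i then Leg a
     else if a = i then map_tree (\<lambda>b. b + i) s else Leg (a + arity s - 1)) t"

text \<open>The total degree of the vertices to the right of the leg \<open>i\<close>. In the partial composite of \<open>t\<close>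
  with \<open>s\<close> at \<open>i\<close> the tree \<open>s\<close> is moved from the right of \<open>t\<close> past these vertices into the place of
  the leg.\<close>

fun right_deg :: "'a \<Rightarrow> 'a tree \<Rightarrow> int" and right_degs :: "'a \<Rightarrow> 'a tree list \<Rightarrow> int" where
  "right_deg i (Leg a) = 0"
| "right_deg i (Vert ts) = right_degs i ts"
| "right_degs i [] = 0"
| "right_degs i (t # ts) =
    (if i \<in> set_tree t then right_deg i t + sum_list (map tdeg ts) else right_degs i ts)"

definition pcomp :: "nat \<Rightarrow> (nat tree \<Rightarrow>\<^sub>0 'k::field) \<Rightarrow> (nat tree \<Rightarrow>\<^sub>0 'k) \<Rightarrow> (nat tree \<Rightarrow>\<^sub>0 'k)" where
  "pcomp i x y = lin_ext (\<lambda>t. lin_ext (\<lambda>s.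
     fscale (of_int (psign (tdeg s * right_deg i t))) (planar (tree_comp i t s))) y) x"

definition zeta_comp :: "nat tree list \<Rightarrow> (nat tree \<Rightarrow>\<^sub>0 'k::field)" where
  "zeta_comp ts = planar (Vert (map (\<lambda>p.
     map_tree (\<lambda>a. a + sum_list (map arity (take p ts))) (ts ! p)) [0..<length ts]))"

definition jacobi :: "nat \<Rightarrow> (nat tree \<Rightarrow>\<^sub>0 'k::field)" where
  "jacobi n = (\<Sum>(i, \<sigma>) \<in> (SIGMA i:{1..n}. unshuffles i n).
     fscale (of_int (sign \<sigma> * psign (int (i * (n - i)))))
       (planar (Vert (Vert (map (\<lambda>p. Leg (\<sigma> p)) [0..<i]) # map (\<lambda>p. Leg (\<sigma> p)) [i..<n]))))"

inductive in_ideal :: "enat \<Rightarrow> nat \<Rightarrow> (nat tree \<Rightarrow>\<^sub>0 'k::field) \<Rightarrow> bool" for m :: enat where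
  jacobi: "1 \<le> n \<Longrightarrow> enat n \<le> m \<Longrightarrow> in_ideal m n (jacobi n)"
| zero: "in_ideal m n 0"
| add: "in_ideal m n x \<Longrightarrow> in_ideal m n y \<Longrightarrow> in_ideal m n (x + y)"
| scale: "in_ideal m n x \<Longrightarrow> in_ideal m n (fscale c x)"
| relabel: "in_ideal m n x \<Longrightarrow> \<sigma> permutes {..<n} \<Longrightarrow> in_ideal m n (relabel \<sigma> x)"
| comp_left: "in_ideal m n x \<Longrightarrow> y \<in> span_on (trees m k) \<Longrightarrow> i < n \<Longrightarrow> in_ideal m (n + k - 1) (pcomp i x y)"
| comp_right: "x \<in> span_on (trees m n) \<Longrightarrow> in_ideal m k y \<Longrightarrow> i < n \<Longrightarrow> in_ideal m (n + k - 1) (pcomp i x y)"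

definition op_ideal :: "enat \<Rightarrow> nat \<Rightarrow> (nat tree \<Rightarrow>\<^sub>0 'k::field) set" where
  "op_ideal m n = {x. in_ideal m n x}"

type_synonym 'k opel = "(nat tree \<Rightarrow>\<^sub>0 'k) set"

definition Lop :: "enat \<Rightarrow> nat \<Rightarrow> ('k::field, 'k opel) graded" where
  "Lop m n d = presented {t \<in> trees m n. tdeg t = d} (op_ideal m n)"

definition Lclass :: "enat \<Rightarrow> nat \<Rightarrow> (nat tree \<Rightarrow>\<^sub>0 'k::field) \<Rightarrow> 'k opel" where
  "Lclass m n x = x +o op_ideal m n"

text \<open>As the classes of the admissible trees form a basis of the quotient, the conditions determine
  \<open>Omega m n\<close> on the span of \<open>trees m n\<close>; the choice concerns only its irrelevant values elsewhere.\<close>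

definition Omega :: "enat \<Rightarrow> nat \<Rightarrow> (nat tree \<Rightarrow>\<^sub>0 'k::field) \<Rightarrow> (nat tree \<Rightarrow>\<^sub>0 'k)" where
  "Omega m n = (SOME f. Vector_Spaces.linear fscale fscale f \<and>
     f ` span_on (trees m n) \<subseteq> span_on (Adm m n) \<and>
     (\<forall>t \<in> trees m n. f (gen t) - gen t \<in> op_ideal m n))"


section \<open>Tensor powers and coinvariants\<close>

text \<open>The degree \<open>d\<close> part of the \<open>n\<close>-th tensor power of \<open>Y\<close>, generated by the lists
  \<open>[(d\<^sub>1, y\<^sub>1), \<dots>, (d\<^sub>n, y\<^sub>n)]\<close> with \<open>y\<^sub>i\<close> of degree \<open>d\<^sub>i\<close> and \<open>d\<^sub>1 + \<dots> + d\<^sub>n = d\<close>, modulo multilinearity.\<close>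

definition tensor_rels :: "('k::field, 'y) graded \<Rightarrow> nat \<Rightarrow> ((int \<times> 'y) list \<Rightarrow>\<^sub>0 'k) set" where
  "tensor_rels Y n = free.span
    {gen (w[i := (e, c \<odot>\<^bsub>Y e\<^esub> x \<oplus>\<^bsub>Y e\<^esub> y)]) - fscale c (gen (w[i := (e, x)])) - gen (w[i := (e, y)])
      | w i e c x y. homogeneous_list Y w \<and> length w = n \<and> i < n \<and>
          x \<in> carrier (Y e) \<and> y \<in> carrier (Y e)}"

type_synonym ('k, 'y) tensor = "((int \<times> 'y) list \<Rightarrow>\<^sub>0 'k) set"

definition tensor_power :: "('k::field, 'y) graded \<Rightarrow> nat \<Rightarrow> ('k, ('k, 'y) tensor) graded" where
  "tensor_power Y n d =
    presented {w. homogeneous_list Y w \<and> length w = n \<and> total_degree w = d} (tensor_rels Y n)"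

definition pure_tensor :: "('k::field, 'y) graded \<Rightarrow> (int \<times> 'y) list \<Rightarrow> ('k, 'y) tensor" where
  "pure_tensor Y w = gen w +o tensor_rels Y (length w)"

definition append_tensors ::
    "((int \<times> 'y) list \<Rightarrow>\<^sub>0 'k::field) list \<Rightarrow> ((int \<times> 'y) list \<Rightarrow>\<^sub>0 'k)" where
  "append_tensors xs = foldr (\<lambda>x y. lin_ext (\<lambda>u. lin_ext (\<lambda>w. gen (u @ w)) y) x) xs (gen [])"

definition tensor_concat ::
    "('k::field, 'y) graded \<Rightarrow> nat \<Rightarrow> ('k, 'y) tensor list \<Rightarrow> ('k, 'y) tensor" where
  "tensor_concat Y n vs = coset_map (tensor_rels Y n) append_tensors (listset vs)"

definition relabel_class :: "enat \<Rightarrow> nat \<Rightarrow> (nat \<Rightarrow> nat) \<Rightarrow> 'k::field opel \<Rightarrow> 'k opel" where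
  "relabel_class m n \<sigma> = coset_map (op_ideal m n) (relabel \<sigma>)"

text \<open>The place permutation \<open>y\<^sub>0 \<otimes> \<cdots> \<otimes> y\<^sub>n\<^sub>-\<^sub>1 \<mapsto> \<epsilon> y\<^bsub>\<sigma> 0\<^esub> \<otimes> \<cdots> \<otimes> y\<^bsub>\<sigma> (n-1)\<^esub>\<close>.\<close>

definition permute_tensor ::
    "('k::field, 'y) graded \<Rightarrow> nat \<Rightarrow> (nat \<Rightarrow> nat) \<Rightarrow> ('k, 'y) tensor \<Rightarrow> ('k, 'y) tensor" where
  "permute_tensor Y n \<sigma> = coset_map (tensor_rels Y n)
    (lin_ext (\<lambda>w. fscale (of_int (koszul \<sigma> (map fst w))) (gen (permute_list \<sigma> w))))"

text \<open>The tensor product of the arity \<open>n\<close> component of \<open>\<L>\<^sub>m\<close> with the \<open>n\<close>-th tensor power over the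
  symmetric group, generated by pairs of homogeneous elements tagged with their degrees. The
  leg labelled \<open>a\<close> of a tree takes the \<open>a\<close>-th factor as its input; hence replacing each label \<open>a\<close>
  by \<open>\<sigma> a\<close> amounts to feeding the factor number \<open>\<sigma> a\<close> to the leg labelled \<open>a\<close>.\<close>

type_synonym ('k, 'y) bal_gen = "(int \<times> 'k opel) \<times> (int \<times> ('k, 'y) tensor)"

definition bal_rels :: "enat \<Rightarrow> ('k::field, 'y) graded \<Rightarrow> nat \<Rightarrow> (('k, 'y) bal_gen \<Rightarrow>\<^sub>0 'k) set" where
  "bal_rels m Y n = free.span (
    {gen ((p, c \<odot>\<^bsub>Lop m n p\<^esub> a \<oplus>\<^bsub>Lop m n p\<^esub> b), (q, v)) - fscale c (gen ((p, a), (q, v))) - gen ((p, b), (q, v))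
      | p q c a b v. a \<in> carrier (Lop m n p) \<and> b \<in> carrier (Lop m n p) \<and>
          v \<in> carrier (tensor_power Y n q)} \<union>
    {gen ((p, a), (q, c \<odot>\<^bsub>tensor_power Y n q\<^esub> v \<oplus>\<^bsub>tensor_power Y n q\<^esub> u))
        - fscale c (gen ((p, a), (q, v))) - gen ((p, a), (q, u))
      | p q c a v u. a \<in> carrier (Lop m n p) \<and> v \<in> carrier (tensor_power Y n q) \<and>
          u \<in> carrier (tensor_power Y n q)} \<union>
    {gen ((p, relabel_class m n \<sigma> a), (q, v)) - gen ((p, a), (q, permute_tensor Y n \<sigma> v))
      | p q a v \<sigma>. a \<in> carrier (Lop m n p) \<and> v \<in> carrier (tensor_power Y n q) \<and> \<sigma> permutes {..<n}})"

type_synonym ('k, 'y) bal = "(('k, 'y) bal_gen \<Rightarrow>\<^sub>0 'k) set"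

definition bal_tensor :: "enat \<Rightarrow> ('k::field, 'y) graded \<Rightarrow> nat \<Rightarrow> ('k, ('k, 'y) bal) graded" where
  "bal_tensor m Y n d = presented
    {((p, a), (q, v)) | p a q v.
      a \<in> carrier (Lop m n p) \<and> v \<in> carrier (tensor_power Y n q) \<and> p + q = d} (bal_rels m Y n)"

definition bal_pure ::
    "enat \<Rightarrow> ('k::field, 'y) graded \<Rightarrow> nat \<Rightarrow> int \<times> 'k opel \<Rightarrow> int \<times> ('k, 'y) tensor \<Rightarrow> ('k, 'y) bal" where
  "bal_pure m Y n a v = gen (a, v) +o bal_rels m Y n"


section \<open>The space $\mathfrak L_m(Y)$ and its operations\<close>

definition direct_sum :: "nat set \<Rightarrow> (nat \<Rightarrow> ('k, 'v) module) \<Rightarrow> ('k, nat \<Rightarrow> 'v) module" where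
  "direct_sum I V = \<lparr>
    carrier = {f \<in> (\<Pi>\<^sub>E n\<in>I. carrier (V n)). finite {n \<in> I. f n \<noteq> \<zero>\<^bsub>V n\<^esub>}},
    monoid.mult = undefined, monoid.one = undefined,
    ring.zero = (\<lambda>n\<in>I. \<zero>\<^bsub>V n\<^esub>),
    add = (\<lambda>f g. \<lambda>n\<in>I. f n \<oplus>\<^bsub>V n\<^esub> g n),
    module.smult = (\<lambda>c f. \<lambda>n\<in>I. c \<odot>\<^bsub>V n\<^esub> f n)\<rparr>"

type_synonym ('k, 'y) free_elt = "nat \<Rightarrow> ('k, 'y) bal"

definition free_space :: "enat \<Rightarrow> ('k::field, 'y) graded \<Rightarrow> ('k, ('k, 'y) free_elt) graded" where
  "free_space m Y d = direct_sum {1..} (\<lambda>n. bal_tensor m Y n d)"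

definition in_summand :: "enat \<Rightarrow> ('k::field, 'y) graded \<Rightarrow> nat \<Rightarrow> int \<Rightarrow> ('k, 'y) bal \<Rightarrow> ('k, 'y) free_elt" where
  "in_summand m Y n d x = (\<lambda>i\<in>{1..}. if i = n then x else \<zero>\<^bsub>bal_tensor m Y i d\<^esub>)"

text \<open>The element \<open>x \<otimes> v\<close> of the \<open>n\<close>-th summand, for \<open>x \<in> \<F>\<^sub>m(n)\<close> of degree \<open>p\<close> and \<open>v\<close> of degree \<open>q\<close>.\<close>

definition free_pure ::
    "enat \<Rightarrow> ('k::field, 'y) graded \<Rightarrow> nat \<Rightarrow> int \<Rightarrow> (nat tree \<Rightarrow>\<^sub>0 'k) \<Rightarrow> int \<Rightarrow> ('k, 'y) tensor \<Rightarrow>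
      ('k, 'y) free_elt" where
  "free_pure m Y n p x q v = in_summand m Y n (p + q) (bal_pure m Y n (p, Lclass m n x) (q, v))"

definition free_unit :: "enat \<Rightarrow> ('k::field, 'y) graded \<Rightarrow> int \<Rightarrow> 'y \<Rightarrow> ('k, 'y) free_elt" where
  "free_unit m Y d y = free_pure m Y 1 0 (gen (Leg 0)) d (pure_tensor Y [(d, y)])"

text \<open>The rule for \<open>l\<^sub>k (T\<^sub>1 \<otimes> v\<^sub>1, \<dots>, T\<^sub>k \<otimes> v\<^sub>k)\<close>, where \<open>d\<^sub>j\<close> is the degree of \<open>v\<^sub>j\<close>.\<close>

definition free_rule ::
    "enat \<Rightarrow> ('k::field, 'y) graded \<Rightarrow> ((int \<times> ('k, 'y) free_elt) list \<Rightarrow> ('k, 'y) free_elt) \<Rightarrow> bool" where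
  "free_rule m Y l \<longleftrightarrow> (\<forall>Ts ds vs.
    1 \<le> length Ts \<and> enat (length Ts) \<le> m \<and> length ds = length Ts \<and> length vs = length Ts \<and>
    (\<forall>j < length Ts. Ts ! j \<in> Adm m (arity (Ts ! j)) \<and>
       vs ! j \<in> carrier (tensor_power Y (arity (Ts ! j)) (ds ! j))) \<longrightarrow>
    (let k = length Ts;
         n = sum_list (map arity Ts);
         p = int k - 2 + sum_list (map tdeg Ts);
         q = sum_list ds;
         \<epsilon> = (\<Sum>(i, j) \<in> {(i, j). i < j \<and> j < k}. ds ! i * tdeg (Ts ! j))
     in l (map (\<lambda>j. (tdeg (Ts ! j) + ds ! j,
              free_pure m Y (arity (Ts ! j)) (tdeg (Ts ! j)) (gen (Ts ! j)) (ds ! j) (vs ! j))) [0..<k])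
        = of_int (psign \<epsilon>) \<odot>\<^bsub>free_space m Y (p + q)\<^esub>
            free_pure m Y n p (Omega m n (zeta_comp Ts)) q (tensor_concat Y n vs)))"

end

theory Submission
  imports Defs
begin

text \<open>The operad and the tensor powers are presented by generators and relations, and so is the free
$L(m)$-algebra itself: it is the space of trees whose legs are decorated by homogeneous elements of
\<open>Y\<close>, modulo the linearity of the decorations, the antisymmetry and the generalized Jacobi identity,
the last two applied at any vertex. This quotient has obvious operations, the grafting of decorated
trees into a new vertex (\<open>vert\<close>), it satisfies the axioms by construction, and a linear map from \<open>Y\<close>
to an $L(m)$-algebra extends to it by evaluating trees. The content of the theorem is therefore
that \<open>free_space\<close>, which is assembled from the spaces \<open>\<L>\<^sub>m(n) \<otimes> Y\<^sup>n\<close> over the symmetric groups, is this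
quotient, and that the rule with \<open>Omega\<close> describes the grafting.

The two spaces are compared by mutually inverse maps. From \<open>free_space\<close> to the quotient (\<open>attach\<close>, \<open>unbal\<close>), a
labelled tree and a list of elements of \<open>Y\<close> are sent to the tree with the \<open>a\<close>-th element put on the
leg \<open>a\<close>, with the sign \<open>leg_sign\<close> of moving the elements to their places. This is well defined because
elements of the operadic ideal, when decorated, become relations between decorated trees
(\<open>subst_ideal\<close>); the proof is an induction over the ideal, and \<open>leg_sign_graft\<close> describes the sign of
a composite. In the other direction (\<open>B\<close>), the legs of a decorated tree are numbered. For this to respect the
relations one needs conversely that every relator which does not express the linearity of the
decorations is, up to a sign, the decoration of a relator between labelled trees (\<open>relator_lift\<close>),
and that the latter lies in the operadic ideal (\<open>relator_in_ideal\<close>).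

The admissible trees span, because the Jacobi identity moves unary vertices towards the inputs
(\<open>reducible_valid\<close>). Hence a map \<open>Omega\<close> with the required properties exists, and operations that
satisfy the rule are determined by their values on admissible trees (\<open>ops_agree\<close>).

All signs are products over pairs of entries of lists (\<open>pair_prod\<close>), which reduces the identities
between them to splitting and reordering lists.\<close>

section \<open>Linear extension and subspaces\<close>

abbreviation supp :: "('a \<Rightarrow>\<^sub>0 'k::zero) \<Rightarrow> 'a set" where "supp \<equiv> Poly_Mapping.keys"

abbreviation coord :: "('a \<Rightarrow>\<^sub>0 'k::zero) \<Rightarrow> 'a \<Rightarrow> 'k" where "coord \<equiv> Poly_Mapping.lookup"

type_synonym 'k forest = "nat tree \<Rightarrow>\<^sub>0 'k"

type_synonym ('k, 'y) dforest = "(int \<times> 'y) tree \<Rightarrow>\<^sub>0 'k"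

lemma lin_ext_superset:
 assumes "finite S" "supp x \<subseteq> S"
 shows "lin_ext g x = (\<Sum>t\<in>S. fscale (coord x t) (g t))"
 unfolding lin_ext_def
 by (rule sum.mono_neutral_left) (use assms in \<open>auto simp: in_keys_iff\<close>)

lemma lin_ext_0 [simp]: "lin_ext g 0 = 0"
 by (simp add: lin_ext_def)

lemma lin_ext_add: "lin_ext g (x + y) = lin_ext g x + lin_ext g y"
proof -
 let ?S = "supp x \<union> supp y"
 have "lin_ext g (x + y) = (\<Sum>t\<in>?S. fscale (coord (x + y) t) (g t))"
  by (rule lin_ext_superset) (simp_all add: Poly_Mapping.keys_add)
 also have "\<dots> = lin_ext g x + lin_ext g y"
  by (simp add: lin_ext_superset[of ?S x] lin_ext_superset[of ?S y] lookup_add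
    free.scale_left_distrib sum.distrib)
 finally show ?thesis .
qed

lemma lin_ext_fscale: "lin_ext g (fscale c x) = fscale c (lin_ext g x)"
proof -
 have "supp (fscale c x) \<subseteq> supp x"
  by (auto simp: in_keys_iff)
 then have "lin_ext g (fscale c x) =
   (\<Sum>t\<in>supp x. fscale (coord (fscale c x) t) (g t))"
  by (intro lin_ext_superset) auto
 then show ?thesis
  by (simp add: lin_ext_def free.scale_sum_right)
qed

lemma lin_ext_uminus: "lin_ext g (- x) = - lin_ext g x"
 using lin_ext_fscale[of g "-1" x] by simp

lemma lin_ext_diff: "lin_ext g (x - y) = lin_ext g x - lin_ext g y"
 using lin_ext_add[of g x "- y"] by (simp add: lin_ext_uminus)

lemma lin_ext_sum: "lin_ext g (\<Sum>i\<in>I. h i) = (\<Sum>i\<in>I. lin_ext g (h i))"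
 by (induction I rule: infinite_finite_induct) (simp_all add: lin_ext_add)

lemma lin_ext_gen [simp]: "lin_ext g (gen t) = g t"
 by (simp add: lin_ext_def)

lemma lin_ext_cong:
 "(\<And>t. t \<in> supp x \<Longrightarrow> g t = h t) \<Longrightarrow> lin_ext g x = lin_ext h x"
 by (simp add: lin_ext_def)

lemma lin_ext_comp: "lin_ext g (lin_ext h x) = lin_ext (\<lambda>t. lin_ext g (h t)) x"
 by (simp add: lin_ext_def[of h x] lin_ext_def[of "\<lambda>t. lin_ext g (h t)"] lin_ext_sum lin_ext_fscale)

lemma lin_ext_fun_add: "lin_ext (\<lambda>t. g t + h t) x = lin_ext g x + lin_ext h x"
 by (simp add: lin_ext_def free.scale_right_distrib sum.distrib)

lemma lin_ext_fun_diff: "lin_ext (\<lambda>t. g t - h t) x = lin_ext g x - lin_ext h x"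
 by (simp add: lin_ext_def free.scale_right_diff_distrib sum_subtractf)

lemma lin_ext_fun_fscale: "lin_ext (\<lambda>t. fscale c (g t)) x = fscale c (lin_ext g x)"
 by (simp add: lin_ext_def free.scale_sum_right mult.commute)

lemma lin_ext_fun_sum: "lin_ext (\<lambda>t. \<Sum>i\<in>I. g i t) x = (\<Sum>i\<in>I. lin_ext (g i) x)"
 by (induction I rule: infinite_finite_induct)
  (simp_all add: lin_ext_fun_add, simp_all add: lin_ext_def)

lemma lin_ext_fun_0 [simp]: "lin_ext (\<lambda>t. 0) x = 0"
 by (simp add: lin_ext_def)

lemma lin_ext_id: "lin_ext gen x = x"
proof (rule poly_mapping_eqI)
 fix t
 have "coord (lin_ext gen x) t =
   (\<Sum>s\<in>supp x. coord x s * (1 when s = t))"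
  by (simp add: lin_ext_def lookup_sum lookup_single)
 also have "\<dots> = (\<Sum>s\<in>supp x. if s = t then coord x s else 0)"
  by (rule sum.cong) (auto simp: when_def)
 also have "\<dots> = coord x t"
  by (simp add: in_keys_iff)
 finally show "coord (lin_ext gen x) t = coord x t" .
qed

lemma lin_ext_swap:
 "lin_ext (\<lambda>t. lin_ext (\<lambda>s. g t s) y) x = lin_ext (\<lambda>s. lin_ext (\<lambda>t. g t s) x) y"
 unfolding lin_ext_def by (simp add: free.scale_sum_right mult.commute) (rule sum.swap)

lemma subspace_lin_ext:
 assumes "free.subspace M" "\<And>t. t \<in> supp x \<Longrightarrow> g t \<in> M"
 shows "lin_ext g x \<in> M"
 unfolding lin_ext_def using assms by (intro free.subspace_sum free.subspace_scale) auto

lemma subspace_lin_ext_diff: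
 assumes "free.subspace M" "\<And>t. t \<in> supp x \<Longrightarrow> g t - h t \<in> M"
 shows "lin_ext g x - lin_ext h x \<in> M"
 using subspace_lin_ext[of M x "\<lambda>t. g t - h t"] assms by (simp add: lin_ext_fun_diff)

lemma subspace_diff_trans:
 assumes "free.subspace M" "x - y \<in> M" "y - z \<in> M"
 shows "x - z \<in> M"
 using free.subspace_add[OF assms] by simp

lemma subspace_diff_sym:
 assumes "free.subspace M" "x - y \<in> M"
 shows "y - x \<in> M"
 using free.subspace_neg[OF assms] by simp

lemma subspace_diff_mem_iff:
 assumes "free.subspace M" "x - y \<in> M"
 shows "x \<in> M \<longleftrightarrow> y \<in> M"
 using free.subspace_diff[of M x "x - y"] free.subspace_add[of M y "x - y"] assms by auto

lemma subspace_scale_diff: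
 assumes "free.subspace M" "x - y \<in> M"
 shows "fscale c x - fscale c y \<in> M"
 using free.subspace_scale[OF assms, of c] by (simp add: free.scale_right_diff_distrib)

lemma span_lin_ext:
 assumes "x \<in> free.span R" "free.subspace M" "\<And>r. r \<in> R \<Longrightarrow> lin_ext g r \<in> M"
 shows "lin_ext g x \<in> M"
 using assms(1)
proof (induction rule: free.span_induct)
 case base
 then show ?case
  using assms(2) by (auto simp: free.subspace_def lin_ext_add lin_ext_fscale)
next
 case (step x)
 then show ?case by (rule assms(3))
qed

lemma subspace_span_on: "free.subspace (span_on S :: ('a \<Rightarrow>\<^sub>0 'b::field) set)"
proof (rule free.subspaceI)
 show "0 \<in> span_on S" by (simp add: span_on_def)
 show "x + y \<in> span_on S" if "x \<in> span_on S" "y \<in> span_on S" for x y :: "'a \<Rightarrow>\<^sub>0 'b"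
  using that Poly_Mapping.keys_add[of x y] by (auto simp: span_on_def)
 show "fscale c x \<in> span_on S" if "x \<in> span_on S" for c and x :: "'a \<Rightarrow>\<^sub>0 'b"
  using that by (auto simp: span_on_def in_keys_iff)
qed

lemma span_on_gen [simp]: "gen t \<in> span_on S \<longleftrightarrow> t \<in> S"
 by (simp add: span_on_def)

lemma span_on_mono: "S \<subseteq> T \<Longrightarrow> x \<in> span_on S \<Longrightarrow> x \<in> span_on T"
 by (auto simp: span_on_def)

lemma span_on_keysD: "x \<in> span_on S \<Longrightarrow> t \<in> supp x \<Longrightarrow> t \<in> S"
 by (auto simp: span_on_def)

lemmas span_on_add = free.subspace_add[OF subspace_span_on]
lemmas span_on_diff = free.subspace_diff[OF subspace_span_on]
lemmas span_on_fscale = free.subspace_scale[OF subspace_span_on]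
lemmas span_on_sum = free.subspace_sum[OF subspace_span_on]
lemmas span_on_0 [simp] = free.subspace_0[OF subspace_span_on]
lemmas lin_ext_span_on = subspace_lin_ext[OF subspace_span_on]

lemma span_on_induct [consumes 1, case_names zero step]:
 assumes "x \<in> span_on S" "P 0"
  and "\<And>c t y. t \<in> S \<Longrightarrow> y \<in> span_on S \<Longrightarrow> P y \<Longrightarrow> P (fscale c (gen t) + y)"
 shows "P x"
proof -
 have "P (\<Sum>t\<in>K. fscale (coord x t) (gen t))" if "finite K" "K \<subseteq> S" for K
  using that
 proof (induction K rule: finite_induct)
  case (insert t K)
  have "(\<Sum>t\<in>K. fscale (coord x t) (gen t)) \<in> span_on S"
   using insert by (intro span_on_sum span_on_fscale) auto
  then show ?case
   using insert by (simp add: assms(3))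
 qed (simp add: assms(2))
 from this[of "supp x"] assms(1) have "P (lin_ext gen x)"
  by (simp add: lin_ext_def span_on_def)
 then show ?thesis
  by (simp add: lin_ext_id)
qed

lemma coset_eq_iff:
 fixes N :: "('a \<Rightarrow>\<^sub>0 'k::field) set"
 assumes "free.subspace N"
 shows "x +o N = y +o N \<longleftrightarrow> x - y \<in> N"
proof
 assume "x +o N = y +o N"
 then have "x \<in> y +o N"
  using free.subspace_0[OF assms] by (force simp: elt_set_plus_def)
 then show "x - y \<in> N"
  by (auto simp: elt_set_plus_def)
next
 assume *: "x - y \<in> N"
 have sub: "x +o N \<subseteq> y +o N" if "x - y \<in> N" for x y :: "'a \<Rightarrow>\<^sub>0 'k"
 proof
  fix z assume "z \<in> x +o N"
  then have "z - x \<in> N" by (auto simp: elt_set_plus_def)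
  from free.subspace_add[OF assms this that] show "z \<in> y +o N"
   by (auto simp: set_minus_plus[symmetric])
 qed
 show "x +o N = y +o N"
  using sub[OF *] sub[OF subspace_diff_sym[OF assms *]] by blast
qed

lemma mem_coset_iff: "z \<in> x +o (N :: ('a \<Rightarrow>\<^sub>0 'k::field) set) \<longleftrightarrow> z - x \<in> N"
 by (simp add: set_minus_plus)

lemma coset_add:
 fixes N :: "('a \<Rightarrow>\<^sub>0 'k::field) set"
 assumes "free.subspace N"
 shows "(x +o N) + (y +o N) = (x + y) +o N"
proof -
 have "N + N = N"
 proof
  show "N + N \<subseteq> N"
   using free.subspace_add[OF assms] by (auto simp: set_plus_def)
  show "N \<subseteq> N + N"
   using free.subspace_0[OF assms] by (force simp: set_plus_def)
 qed
 then show ?thesis by (simp add: set_plus_rearrange)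
qed

lemma coset_map_coset:
 assumes N: "free.subspace N" and "x0 \<in> A"
  and "\<And>x. x \<in> A \<Longrightarrow> g x - g x0 \<in> N"
 shows "coset_map N g A = g x0 +o N"
proof -
 have "g x +o N = g x0 +o N" if "x \<in> A" for x
  using assms(3)[OF that] by (simp add: coset_eq_iff[OF N])
 then have "coset_map N g A = (\<Union>x\<in>A. g x0 +o N)"
  unfolding coset_map_def by (intro SUP_cong) auto
 then show ?thesis
  using \<open>x0 \<in> A\<close> by auto
qed

lemma coset_map_fscale:
 assumes N: "free.subspace N"
 shows "coset_map N (fscale c) (x +o N) = fscale c x +o N"
proof (rule coset_map_coset[OF N])
 show "x \<in> x +o N" using free.subspace_0[OF N] by (simp add: mem_coset_iff)
 show "fscale c z - fscale c x \<in> N" if "z \<in> x +o N" for z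
  using that by (intro subspace_scale_diff[OF N]) (simp add: mem_coset_iff)
qed

section \<open>Signs as products over pairs\<close>

lemma psign_0 [simp]: "psign 0 = 1"
 and psign_1 [simp]: "psign 1 = - 1"
 by (simp_all add: psign_def)

lemma psign_add: "psign (a + b) = psign a * psign b"
 by (simp add: psign_def)

lemma psign_even [simp]: "even a \<Longrightarrow> psign a = 1"
 by (simp add: psign_def)

lemma psign_square [simp]: "psign a * psign a = 1"
 by (simp add: psign_def)

lemma psign_square_left [simp]: "psign a * (psign a * b) = b"
 by (simp add: psign_def)

lemma psign_sum_list: "psign (sum_list (map f xs)) = prod_list (map (\<lambda>x. psign (f x)) xs)"
 by (induction xs) (simp_all add: psign_add)

lemma psign_cong: "even (a - b) \<Longrightarrow> psign a = psign b"
 by (auto simp: psign_def)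

text \<open>All signs below are products over the pairs of entries of a list, in the order of the list: of the
vertices and legs met when reading a tree, or of the positions moved by a permutation.\<close>

fun pair_prod :: "('a \<Rightarrow> 'a \<Rightarrow> int) \<Rightarrow> 'a list \<Rightarrow> int" where
 "pair_prod f [] = 1"
| "pair_prod f (x # xs) = prod_list (map (f x) xs) * pair_prod f xs"

text \<open>The contribution to \<open>pair_prod\<close> of the pairs with one entry in each of two adjacent lists.\<close>

definition cross :: "('a \<Rightarrow> 'b \<Rightarrow> int) \<Rightarrow> 'a list \<Rightarrow> 'b list \<Rightarrow> int" where
 "cross f xs ys = prod_list (map (\<lambda>x. prod_list (map (f x) ys)) xs)"

lemma cross_simps [simp]:
 "cross f [] ys = 1" "cross f (x # xs) ys = prod_list (map (f x) ys) * cross f xs ys"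
 by (simp_all add: cross_def)

lemma prod_list_map_mult:
 "prod_list (map (\<lambda>x. f x * g x) xs) = prod_list (map f xs) * (prod_list (map g xs) :: 'b::comm_monoid_mult)"
 by (induction xs) (simp_all add: ac_simps)

lemma cross_Nil_right [simp]: "cross f xs [] = 1"
 by (induction xs) simp_all

lemma cross_append_left: "cross f (xs @ xs') ys = cross f xs ys * cross f xs' ys"
 by (simp add: cross_def)

lemma cross_append_right: "cross f xs (ys @ ys') = cross f xs ys * cross f xs ys'"
 by (induction xs) (simp_all add: ac_simps)

lemma cross_mult: "cross (\<lambda>x y. f x y * g x y) xs ys = cross f xs ys * cross g xs ys"
 by (induction xs) (simp_all add: prod_list_map_mult ac_simps)

lemma cross_flip: "cross f xs ys = cross (\<lambda>y x. f x y) ys xs"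
proof (induction xs)
 case (Cons x xs)
 have "cross (\<lambda>y x. f x y) ys (x # xs) = prod_list (map (f x) ys) * cross (\<lambda>y x. f x y) ys xs"
  by (induction ys) (simp_all add: ac_simps)
 then show ?case using Cons by simp
qed simp

lemma cross_cong:
 "(\<And>x y. x \<in> set xs \<Longrightarrow> y \<in> set ys \<Longrightarrow> f x y = g x y) \<Longrightarrow> cross f xs ys = cross g xs ys"
 unfolding cross_def by (intro arg_cong[of _ _ prod_list] map_cong) auto

lemma prod_list_mset_cong:
 fixes f :: "'a \<Rightarrow> int"
 assumes "mset xs = mset ys" shows "prod_list (map f xs) = prod_list (map f ys)"
 using arg_cong[OF assms, of "\<lambda>M. prod_mset (image_mset f M)"]
 by (metis mset_map prod_mset_prod_list)

lemma cross_mset_cong: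
 assumes "mset xs = mset xs'" "mset ys = mset ys'"
 shows "cross f xs ys = cross f xs' ys'"
proof -
 have "cross f xs ys = cross f xs' ys"
  unfolding cross_def by (rule prod_list_mset_cong[OF assms(1)])
 also have "\<dots> = cross f xs' ys'"
  by (subst (1 2) cross_flip) (auto simp: cross_def intro!: prod_list_mset_cong[OF assms(2)])
 finally show ?thesis .
qed

lemma cross_psign: "cross (\<lambda>x y. psign (f x * g y)) xs ys = psign (sum_list (map f xs) * sum_list (map g ys))"
proof (induction xs)
 case (Cons x xs)
 have "prod_list (map (\<lambda>y. psign (f x * g y)) ys) = psign (f x * sum_list (map g ys))"
  by (simp add: psign_sum_list[symmetric] sum_list_const_mult)
 with Cons show ?case by (simp add: psign_add distrib_right)
qed simp

lemma pair_prod_append: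
 "pair_prod f (xs @ ys) = pair_prod f xs * pair_prod f ys * cross f xs ys"
 by (induction xs) (simp_all add: ac_simps)

lemma pair_prod_mult: "pair_prod (\<lambda>x y. f x y * g x y) xs = pair_prod f xs * pair_prod g xs"
 by (induction xs) (simp_all add: prod_list_map_mult ac_simps)

lemma pair_prod_map: "pair_prod f (map g xs) = pair_prod (\<lambda>x y. f (g x) (g y)) xs"
 by (induction xs) (simp_all add: comp_def)

lemma pair_prod_cong:
 assumes "sorted_wrt R xs" "\<And>x y. x \<in> set xs \<Longrightarrow> y \<in> set xs \<Longrightarrow> R x y \<Longrightarrow> f x y = g x y"
 shows "pair_prod f xs = pair_prod g xs"
 using assms
proof (induction xs)
 case (Cons x xs)
 then have "map (f x) xs = map (g x) xs"
  by (intro map_cong) auto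
 moreover have "pair_prod f xs = pair_prod g xs"
  using Cons by auto
 ultimately show ?case by (simp del: map_eq_conv)
qed simp

lemma pair_prod_1: 
 assumes "sorted_wrt R xs" "\<And>x y. x \<in> set xs \<Longrightarrow> y \<in> set xs \<Longrightarrow> R x y \<Longrightarrow> f x y = 1"
 shows "pair_prod f xs = 1"
proof -
 have "pair_prod f xs = pair_prod (\<lambda>x y. 1) xs"
  by (rule pair_prod_cong[OF assms(1)]) (use assms(2) in auto)
 also have "\<dots> = 1" by (induction xs) (simp_all add: map_replicate_const)
 finally show ?thesis .
qed

lemma pair_prod_concat:
 "pair_prod f (concat xss) = prod_list (map (pair_prod f) xss) * pair_prod (cross f) xss"
proof (induction xss)
 case (Cons xs xss)
 have "cross f xs (concat xss) = prod_list (map (cross f xs) xss)"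
  by (induction xss) (simp_all add: cross_append_right)
 with Cons show ?case by (simp add: pair_prod_append ac_simps)
qed simp

text \<open>If the factor of a pair does not depend on its order, the product does not depend on the
 order of the list.\<close>

lemma pair_prod_perm:
 assumes "mset xs = mset ys" "\<And>x y. x \<in> set xs \<Longrightarrow> y \<in> set xs \<Longrightarrow> f x y = f y x"
 shows "pair_prod f xs = pair_prod f ys"
 using assms
proof (induction xs arbitrary: ys)
 case (Cons x xs)
 then have "x \<in> set ys" by (metis list.set_intros(1) mset_eq_setD)
 then obtain us vs where ys: "ys = us @ x # vs" by (meson split_list)
 have m: "mset xs = mset (us @ vs)" using Cons.prems(1) by (simp add: ys)
 have IH: "pair_prod f xs = pair_prod f (us @ vs)"
  using Cons.IH[OF m] Cons.prems(2) by simp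
 have "map (\<lambda>u. f u x) us = map (f x) us"
 proof (rule map_cong[OF refl])
  fix u assume "u \<in> set us"
  then have "u \<in> set (x # xs)" using mset_eq_setD[OF m] by auto
  then show "f u x = f x u" by (intro Cons.prems(2)) auto
 qed
 moreover have "cross f us [x] = prod_list (map (\<lambda>u. f u x) us)"
  by (induction us) simp_all
 moreover have "prod_list (map (f x) xs) = prod_list (map (f x) (us @ vs))"
  by (rule prod_list_mset_cong[OF m])
 ultimately show ?case
  using IH cross_append_right[of f us "[x]" vs]
  by (simp add: ys pair_prod_append ac_simps del: map_eq_conv)
qed simp

lemma pair_prod_nth:
 "pair_prod f xs = (\<Prod>(p, q) \<in> {(p, q). p < q \<and> q < length xs}. f (xs ! p) (xs ! q))"
proof (induction xs)
 case Nil
 have "{(p, q). p < q \<and> q < length ([]::'a list)} = {}" by auto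
 then show ?case by simp
next
 case (Cons x xs)
 let ?A = "(\<lambda>q. (0::nat, Suc q)) ` {..<length xs}"
 let ?P = "{(p, q). p < q \<and> q < length xs}"
 let ?B = "(\<lambda>(p, q). (Suc p, Suc q)) ` ?P"
 have fin: "finite ?P" by (rule finite_subset[of _ "{..<length xs} \<times> {..<length xs}"]) auto
 have split: "{(p, q). p < q \<and> q < length (x # xs)} = ?A \<union> ?B"
 proof (intro Set.set_eqI iffI)
  fix z assume "z \<in> {(p, q). p < q \<and> q < length (x # xs)}"
  then obtain p q where z: "z = (p, q)" "p < q" "q < Suc (length xs)" by auto
  then obtain q' where "q = Suc q'" by (cases q) auto
  with z show "z \<in> ?A \<union> ?B" by (cases p) force+
 qed auto
 have "(\<Prod>(p, q) \<in> {(p, q). p < q \<and> q < length (x # xs)}. f ((x # xs) ! p) ((x # xs) ! q)) =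
   (\<Prod>(p, q) \<in> ?A. f ((x # xs) ! p) ((x # xs) ! q)) *
   (\<Prod>(p, q) \<in> ?B. f ((x # xs) ! p) ((x # xs) ! q))"
  unfolding split by (rule prod.union_disjoint) (use fin in auto)
 moreover have "(\<Prod>(p, q) \<in> ?A. f ((x # xs) ! p) ((x # xs) ! q)) = (\<Prod>q<length xs. f x (xs ! q))"
  by (subst prod.reindex) (auto simp: inj_on_def)
 moreover have "(\<Prod>q<length xs. f x (xs ! q)) = prod_list (map (f x) xs)"
 proof -
  have "(\<Prod>q<length xs. f x (xs ! q)) = prod_list (map (\<lambda>q. f x (xs ! q)) [0..<length xs])"
   by (simp add: prod.distinct_set_conv_list[symmetric] lessThan_atLeast0)
  also have "map (\<lambda>q. f x (xs ! q)) [0..<length xs] = map (f x) xs"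
   by (rule nth_equalityI) auto
  finally show ?thesis .
 qed
 moreover have "(\<Prod>(p, q) \<in> ?B. f ((x # xs) ! p) ((x # xs) ! q)) = (\<Prod>(p, q) \<in> ?P. f (xs ! p) (xs ! q))"
  by (subst prod.reindex) (auto simp: inj_on_def split_beta)
 ultimately show ?case using Cons by simp
qed

lemma prod_pairs_if:
 fixes n :: nat and g :: "nat \<Rightarrow> nat \<Rightarrow> int"
 shows "(\<Prod>(p, q) \<in> {(p, q). p < q \<and> q < n \<and> P p q}. g p q) =
  (\<Prod>(p, q) \<in> {(p, q). p < q \<and> q < n}. if P p q then g p q else 1)"
proof -
 have fin: "finite {(p, q). p < q \<and> q < n}"
  by (rule finite_subset[of _ "{..<n} \<times> {..<n}"]) auto
 have "(\<Prod>(p, q) \<in> {(p, q). p < q \<and> q < n \<and> P p q}. g p q) =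
   (\<Prod>(p, q) \<in> {z \<in> {(p, q). p < q \<and> q < n}. case z of (p, q) \<Rightarrow> P p q}. g p q)"
  by (rule arg_cong2[of _ _ _ _ prod]) auto
 also have "\<dots> = (\<Prod>(p, q) \<in> {(p, q). p < q \<and> q < n}. if P p q then g p q else 1)"
  unfolding prod.inter_filter[OF fin] by (rule prod.cong) auto
 finally show ?thesis .
qed

lemma koszul_pair_prod:
 "koszul \<sigma> ds =
  pair_prod (\<lambda>p q. if \<sigma> q < \<sigma> p then psign (ds ! \<sigma> p * ds ! \<sigma> q) else 1) [0..<length ds]"
 unfolding koszul_def pair_prod_nth prod_pairs_if
 by (rule prod.cong) auto

lemma pair_prod_square:
 assumes "\<And>x y. f x y * f x y = 1"
 shows "pair_prod f xs * pair_prod f xs = (1::int)"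
 unfolding pair_prod_mult[symmetric] assms
 by (rule pair_prod_1[of "\<lambda>_ _. True"]) (auto simp: sorted_wrt_iff_nth_less)

definition inv_sign :: "nat \<Rightarrow> (nat \<Rightarrow> nat) \<Rightarrow> int" where
 "inv_sign n \<sigma> = pair_prod (\<lambda>p q. if \<sigma> q < \<sigma> p then - 1 else 1) [0..<n]"

lemma mset_map_permutes_upt:
 assumes "\<tau> permutes {..<n}"
 shows "mset (map \<tau> [0..<n]) = mset [0..<n]"
proof -
 have "mset (map \<tau> [0..<n]) = image_mset \<tau> (mset_set {..<n})"
  by (simp add: lessThan_atLeast0)
 also have "\<dots> = mset_set (\<tau> ` {..<n})"
  by (rule image_mset_mset_set) (rule permutes_inj_on[OF assms])
 also have "\<dots> = mset [0..<n]"
  by (simp add: permutes_image[OF assms, unfolded lessThan_atLeast0] lessThan_atLeast0)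
 finally show ?thesis .
qed

lemma enumerating_permutation:
 assumes "mset xs = mset [0..<n]"
 obtains \<sigma> where "\<sigma> permutes {..<n}" "map \<sigma> [0..<n] = xs"
proof -
 from mset_eq_permutation[OF assms] obtain \<sigma> where \<sigma>: "\<sigma> permutes {..<n}" "permute_list \<sigma> [0..<n] = xs"
  by auto
 moreover have "permute_list \<sigma> [0..<n] = map \<sigma> [0..<n]"
  using permutes_in_image[OF \<sigma>(1)] by (auto simp: permute_list_def)
 ultimately show thesis by (intro that) simp_all
qed

text \<open>Used to bring the labels of one subtree into an initial segment, so that the whole tree becomes a
partial composite at the leg \<open>0\<close>.\<close>

lemma split_relabelling:
 assumes "mset (ls @ ms) = mset [0..<n]"
 obtains \<pi> where "\<pi> permutes {..<n}" "map \<pi> ls = [0..<length ls]" "map \<pi> ms = [length ls..<n]"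
proof -
 from enumerating_permutation[OF assms] obtain \<sigma> where \<sigma>: "\<sigma> permutes {..<n}" "map \<sigma> [0..<n] = ls @ ms" .
 let ?\<pi> = "inv_into UNIV \<sigma>"
 have n: "length ls + length ms = n" using mset_eq_length[OF assms] by simp
 have "map ?\<pi> ls @ map ?\<pi> ms = map ?\<pi> (map \<sigma> [0..<n])" unfolding \<sigma>(2) by simp
 also have "\<dots> = [0..<n]" by (simp add: comp_def permutes_inverses[OF \<sigma>(1)])
 also have "\<dots> = [0..<length ls] @ [length ls..<n]"
  using n upt_add_eq_append[of 0 "length ls" "length ms"] by simp
 finally have "map ?\<pi> ls = [0..<length ls] \<and> map ?\<pi> ms = [length ls..<n]" using n by simp
 then show thesis by (elim conjE) (rule that[OF permutes_inv[OF \<sigma>(1)]])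
qed

lemma inv_sign_comp:
 assumes "\<sigma> permutes {..<n}" "\<tau> permutes {..<n}"
 shows "inv_sign n (\<sigma> \<circ> \<tau>) = inv_sign n \<sigma> * inv_sign n \<tau>"
proof -
 let ?f = "\<lambda>\<sigma> p q. (if \<sigma> q < \<sigma> p then - 1 else 1) :: int"
 let ?F = "\<lambda>p q. ?f \<sigma> p q * ?f id p q"
 have m: "mset (map \<tau> [0..<n]) = mset [0..<n]"
  by (rule mset_map_permutes_upt[OF assms(2)])
 have sym: "?F p q = ?F q p" for p q
  using permutes_inj[OF assms(1)] by (auto dest: injD)
 have "pair_prod ?F (map \<tau> [0..<n]) = pair_prod ?F [0..<n]"
  by (rule pair_prod_perm[OF m]) (rule sym)
 moreover have "pair_prod (?f id) [0..<n] = 1"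
  by (rule pair_prod_1[of "(<)"]) auto
 ultimately have *: "inv_sign n (\<sigma> \<circ> \<tau>) * inv_sign n \<tau> = inv_sign n \<sigma>"
  by (simp add: pair_prod_mult pair_prod_map inv_sign_def)
 have "inv_sign n \<tau> * inv_sign n \<tau> = 1"
  unfolding inv_sign_def by (rule pair_prod_square) auto
 with * show ?thesis by (metis mult.assoc mult.right_neutral)
qed

lemma inv_sign_transpose:
 "a < b \<Longrightarrow> b < n \<Longrightarrow> inv_sign n (transpose a b) = - 1"
proof (induction b)
 case (Suc b)
 let ?t = "transpose b (Suc b)"
 have "{(p, q). p < q \<and> q < n \<and> ?t q < ?t p} = {(b, Suc b)}"
  using Suc.prems by (auto simp: transpose_def split: if_splits)
 moreover have "inv_sign n ?t = (\<Prod>(p, q) \<in> {(p, q). p < q \<and> q < n \<and> ?t q < ?t p}. - 1)"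
  unfolding inv_sign_def pair_prod_nth prod_pairs_if by (rule prod.cong) auto
 ultimately have adj: "inv_sign n ?t = - 1" by simp
 show ?case
 proof (cases "a = b")
  case False
  have p: "?t permutes {..<n}" "transpose a b permutes {..<n}"
   using Suc.prems by (auto intro: permutes_swap_id)
  have "transpose a (Suc b) = ?t \<circ> (transpose a b \<circ> ?t)"
   using Suc.prems False by (auto simp: transpose_def fun_eq_iff)
  then have "inv_sign n (transpose a (Suc b)) = inv_sign n ?t * (inv_sign n (transpose a b) * inv_sign n ?t)"
   using p by (simp only: inv_sign_comp permutes_compose)
  then show ?thesis using Suc False by (simp add: adj)
 qed (simp add: adj)
qed simp

text \<open>The signature is the parity of the number of inversions, as both are homomorphisms with value
\<open>- 1\<close> at transpositions. This makes \<^const>\<open>chi\<close> a product over inverted pairs.\<close>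

lemma sign_eq_inv_sign:
 assumes "\<sigma> permutes {..<n}"
 shows "sign \<sigma> = inv_sign n \<sigma>"
proof -
 have "finite {..<n}" by simp
 from this assms show ?thesis
 proof (induction rule: permutes_rev_induct)
  case id
  have "inv_sign n id = 1"
   unfolding inv_sign_def by (rule pair_prod_1[of "(<)"]) auto
  then show ?case by (simp add: sign_id id_def)
 next
  case (swap a b p)
  have tr: "transpose a b permutes {..<n}" using swap by (simp add: permutes_swap_id)
  have "sign (p \<circ> transpose a b) = sign p * sign (transpose a b)"
   using swap tr by (intro sign_compose) (auto intro: permutation_permutes[THEN iffD2] permutation_swap_id)
  moreover have "inv_sign n (transpose a b) = - 1" if "a \<noteq> b"
   using that swap inv_sign_transpose[of a b n] inv_sign_transpose[of b a n] transpose_commute[of a b]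
   by (cases "a < b") auto
  ultimately show ?case
   using swap tr
   by (cases "a = b") (auto simp: inv_sign_comp sign_swap_id simp del: comp_apply o_apply)
 qed
qed

lemma chi_pair_prod:
 assumes "\<sigma> permutes {..<length ds}"
 shows "chi \<sigma> ds =
  pair_prod (\<lambda>p q. if \<sigma> q < \<sigma> p then - psign (ds ! \<sigma> p * ds ! \<sigma> q) else 1) [0..<length ds]"
proof -
 have "chi \<sigma> ds = pair_prod (\<lambda>p q. (if \<sigma> q < \<sigma> p then - 1 else 1) *
   (if \<sigma> q < \<sigma> p then psign (ds ! \<sigma> p * ds ! \<sigma> q) else 1)) [0..<length ds]"
  by (simp only: chi_def koszul_pair_prod sign_eq_inv_sign[OF assms] inv_sign_def pair_prod_mult)
 also have "(\<lambda>p q. (if \<sigma> q < \<sigma> p then - 1 else 1) * (if \<sigma> q < \<sigma> p then psign (ds ! \<sigma> p * ds ! \<sigma> q) else 1))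
   = (\<lambda>p q. if \<sigma> q < \<sigma> p then - psign (ds ! \<sigma> p * ds ! \<sigma> q) else 1)"
  by (intro ext) simp
 finally show ?thesis .
qed

section \<open>Trees and their reading words\<close>

text \<open>Koszul signs depend only on the order in which vertices and legs are met when a tree is read from
the root; a vertex is recorded by its degree.\<close>

fun word :: "'a tree \<Rightarrow> (int + 'a) list" where
 "word (Leg a) = [Inr a]"
| "word (Vert ts) = Inl (int (length ts) - 2) # concat (map word ts)"

definition rights :: "('b + 'a) list \<Rightarrow> 'a list" where
 "rights xs = concat (map (case_sum (\<lambda>_. []) (\<lambda>a. [a])) xs)"

lemma rights_simps [simp]:
 "rights [] = []" "rights (Inl d # xs) = rights xs" "rights (Inr a # xs) = a # rights xs"
 "rights (xs @ ys) = rights xs @ rights ys"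
 by (simp_all add: rights_def)

lemma set_rights: "a \<in> set (rights xs) \<longleftrightarrow> Inr a \<in> set xs"
 by (induction xs) (auto simp: rights_def split: sum.splits)

lemma rights_concat: "rights (concat xss) = concat (map rights xss)"
 by (induction xss) simp_all

lemma rights_word: "rights (word t) = labels t"
 by (induction t) (simp_all add: rights_concat comp_def cong: map_cong)

lemma Inr_word_iff: "Inr a \<in> set (word t) \<longleftrightarrow> a \<in> set (labels t)"
 by (simp add: set_rights[symmetric] rights_word)

definition vdeg :: "int + 'a \<Rightarrow> int" where
 "vdeg = case_sum (\<lambda>d. d) (\<lambda>_. 0)"

definition lfdeg :: "('a \<Rightarrow> int) \<Rightarrow> int + 'a \<Rightarrow> int" where
 "lfdeg D = case_sum (\<lambda>_. 0) D"

lemma vdeg_simps [simp]: "vdeg (Inl d) = d" "vdeg (Inr a) = 0"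
 and lfdeg_simps [simp]: "lfdeg D (Inl d) = 0" "lfdeg D (Inr a) = D a"
 by (simp_all add: vdeg_def lfdeg_def)

lemma sum_list_map_concat: "sum_list (map f (concat xss)) = sum_list (map (\<lambda>xs. sum_list (map f xs)) xss)"
 by (induction xss) simp_all

lemma tdeg_word: "tdeg t = sum_list (map vdeg (word t))"
proof (induction t)
 case (Vert ts)
 then have "map tdeg ts = map (\<lambda>t. sum_list (map vdeg (word t))) ts" by simp
 then show ?case by (simp add: sum_list_map_concat comp_def del: map_eq_conv)
qed simp

definition ldeg :: "('a \<Rightarrow> int) \<Rightarrow> 'a tree \<Rightarrow> int" where
 "ldeg D t = sum_list (map D (labels t))"

text \<open>The degree of a tree with decorated legs, where the decoration \<open>a\<close> has degree \<open>D a\<close>.\<close>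

definition dg :: "('a \<Rightarrow> int) \<Rightarrow> 'a tree \<Rightarrow> int" where
 "dg D t = tdeg t + ldeg D t"

lemma ldeg_word: "ldeg D t = sum_list (map (lfdeg D) (word t))"
proof -
 have "sum_list (map D (rights xs)) = sum_list (map (lfdeg D) xs)" for xs :: "(int + 'a) list"
  by (induction xs) (auto simp: rights_def lfdeg_def split: sum.splits)
 then show ?thesis by (simp add: ldeg_def rights_word[symmetric])
qed

lemma dg_simps [simp]:
 "dg D (Leg a) = D a"
 "dg D (Vert ts) = int (length ts) - 2 + sum_list (map (dg D) ts)"
proof -
 show "dg D (Leg a) = D a" by (simp add: dg_def ldeg_def)
 have "sum_list (map (dg D) ts) = sum_list (map tdeg ts) + sum_list (map (ldeg D) ts)"
  by (induction ts) (simp_all add: dg_def)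
 moreover have "ldeg D (Vert ts) = sum_list (map (ldeg D) ts)"
  by (simp add: ldeg_def sum_list_map_concat comp_def fun_eq_iff cong: map_cong)
 ultimately show "dg D (Vert ts) = int (length ts) - 2 + sum_list (map (dg D) ts)"
  by (simp add: dg_def)
qed

lemma dg_0 [simp]: "dg (\<lambda>_. 0) t = tdeg t"
 by (simp add: dg_def ldeg_def)

lemma set_tree_labels: "set_tree t = set (labels t)"
 by (induction t) auto

lemma labels_map_tree [simp]: "labels (map_tree f t) = map f (labels t)"
 by (induction t) (simp_all add: map_concat comp_def cong: map_cong)

lemma word_map_tree: "word (map_tree f t) = map (map_sum id f) (word t)"
 by (induction t) (simp_all add: map_concat comp_def cong: map_cong)

lemma tdeg_map_tree [simp]: "tdeg (map_tree f t) = tdeg t"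
 by (induction t) (simp_all add: comp_def cong: map_cong)

lemma arity_map_tree [simp]: "arity (map_tree f t) = arity t"
 by (simp add: arity_def)

lemma vals_le_map_tree [simp]: "vals_le m (map_tree f t) = vals_le m t"
 by (induction t) auto

lemma ldeg_map_tree [simp]: "ldeg D (map_tree f t) = ldeg (\<lambda>a. D (f a)) t"
 by (simp add: ldeg_def comp_def)

lemma dg_map_tree [simp]: "dg D (map_tree f t) = dg (\<lambda>a. D (f a)) t"
 by (simp add: dg_def)

lemma map_tree_cong': "(\<And>a. a \<in> set (labels t) \<Longrightarrow> f a = g a) \<Longrightarrow> map_tree f t = map_tree g t"
 by (intro tree.map_cong) (auto simp: set_tree_labels)

lemma ldeg_cong: "(\<And>a. a \<in> set (labels t) \<Longrightarrow> D a = D' a) \<Longrightarrow> ldeg D t = ldeg D' t"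
 unfolding ldeg_def by (intro arg_cong[of _ _ sum_list] map_cong) auto

lemma labels_nonempty: "vals_le m t \<Longrightarrow> labels t \<noteq> []"
proof (induction t)
 case (Vert ts)
 then obtain s where s: "s \<in> set ts" by (cases ts) auto
 with Vert have "labels s \<noteq> []" by auto
 with s show ?case by auto
qed simp

lemma labels_graft: "labels (graft S t) = concat (map (\<lambda>a. labels (S a)) (labels t))"
proof (induction t)
 case (Vert ts)
 have "concat (map (\<lambda>t. concat (map (\<lambda>a. labels (S a)) (labels t))) ts) =
   concat (map (\<lambda>a. labels (S a)) (concat (map labels ts)))"
  by (induction ts) simp_all
 with Vert show ?case by (simp add: comp_def cong: map_cong)
qed simp

lemma word_graft:
 "word (graft S t) = concat (map (case_sum (\<lambda>d. [Inl d]) (\<lambda>a. word (S a))) (word t))"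
proof (induction t)
 case (Vert ts)
 let ?g = "case_sum (\<lambda>d. [Inl d]) (\<lambda>a. word (S a))"
 have "concat (map (\<lambda>t. concat (map ?g (word t))) ts) = concat (map ?g (concat (map word ts)))"
  by (induction ts) simp_all
 with Vert show ?case by (simp add: comp_def cong: map_cong)
qed simp

lemma graft_cong: "(\<And>a. a \<in> set (labels t) \<Longrightarrow> S a = S' a) \<Longrightarrow> graft S t = graft S' t"
 by (induction t) auto

lemma graft_graft: "graft S (graft S' t) = graft (\<lambda>a. graft S (S' a)) t"
 by (induction t) simp_all

lemma graft_map_tree: "graft S (map_tree f t) = graft (\<lambda>a. S (f a)) t"
 by (induction t) simp_all

lemma graft_Leg: "graft (\<lambda>a. Leg (f a)) t = map_tree f t"
 by (induction t) simp_all

lemma tdeg_graft: "tdeg (graft S t) = tdeg t + sum_list (map (\<lambda>a. tdeg (S a)) (labels t))"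
proof (induction t)
 case (Vert ts)
 have "sum_list (map (\<lambda>t. tdeg t + sum_list (map (\<lambda>a. tdeg (S a)) (labels t))) ts) =
   sum_list (map tdeg ts) + sum_list (map (\<lambda>a. tdeg (S a)) (concat (map labels ts)))"
  by (induction ts) simp_all
 with Vert show ?case by (simp add: comp_def cong: map_cong)
qed simp

lemma ldeg_graft: "ldeg D (graft S t) = ldeg (\<lambda>a. ldeg D (S a)) t"
 unfolding ldeg_def labels_graft sum_list_map_concat by (simp add: comp_def)

lemma dg_graft: "dg D (graft S t) = dg (\<lambda>a. dg D (S a)) t"
 by (simp add: dg_def tdeg_graft ldeg_graft) (simp add: ldeg_def sum_list_addf)

lemma vals_le_graft:
 "vals_le m t \<Longrightarrow> (\<And>a. a \<in> set (labels t) \<Longrightarrow> vals_le m (S a)) \<Longrightarrow> vals_le m (graft S t)"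
 by (induction t) auto

lemma mset_concat_map_cong:
 "mset xs = mset ys \<Longrightarrow> mset (concat (map f xs)) = mset (concat (map f ys))"
 by (metis (no_types) mset_concat mset_map sum_mset_sum_list map_map)

section \<open>The sign of moving the inputs of a tree into their places\<close>

fun iv :: "(nat \<Rightarrow> int) \<Rightarrow> int + nat \<Rightarrow> int + nat \<Rightarrow> int" where
 "iv D (Inl d) y = 1"
| "iv D (Inr a) (Inl d) = psign (D a * d)"
| "iv D (Inr a) (Inr b) = (if b < a then psign (D a * D b) else 1)"

text \<open>Decorations of the legs stand to the right of the tree, in the order of the labels. To reach its
leg, a decoration of degree \<open>D a\<close> passes the vertices that are read after this leg and the
decorations of smaller label of the legs read after it. \<open>leg_sign\<close> is the resulting Koszul sign.\<close>

definition leg_sign :: "(nat \<Rightarrow> int) \<Rightarrow> nat tree \<Rightarrow> int" where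
 "leg_sign D t = pair_prod (iv D) (word t)"

lemma iv_square: "iv D x y * iv D x y = 1"
 by (cases "(D, x, y)" rule: iv.cases) auto

lemma leg_sign_square [simp]: "leg_sign D t * leg_sign D t = 1"
 unfolding leg_sign_def by (rule pair_prod_square) (rule iv_square)

lemma leg_sign_square_left [simp]: "leg_sign D t * (leg_sign D t * x) = x"
 by (simp add: mult.assoc[symmetric])

lemma leg_sign_Leg [simp]: "leg_sign D (Leg a) = 1"
 by (simp add: leg_sign_def)

lemma leg_sign_cong:
 assumes "\<And>a. a \<in> set (labels t) \<Longrightarrow> D a = D' a"
 shows "leg_sign D t = leg_sign D' t"
 unfolding leg_sign_def
proof (rule pair_prod_cong[of "\<lambda>_ _. True"])
 fix x y assume "x \<in> set (word t)" "y \<in> set (word t)"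
 then show "iv D x y = iv D' x y"
  using assms by (cases "(D, x, y)" rule: iv.cases) (auto simp: Inr_word_iff)
qed (simp add: sorted_wrt_iff_nth_less)

lemma cross_iv_less:
 assumes "\<And>a b. a \<in> set (labels s) \<Longrightarrow> b \<in> set (labels t) \<Longrightarrow> a < b \<or> D a * D b = 0"
 shows "cross (iv D) (word s) (word t) = psign (ldeg D s * tdeg t)"
proof -
 have "cross (iv D) (word s) (word t) = cross (\<lambda>x y. psign (lfdeg D x * vdeg y)) (word s) (word t)"
 proof (rule cross_cong)
  fix x y assume "x \<in> set (word s)" "y \<in> set (word t)"
  then show "iv D x y = psign (lfdeg D x * vdeg y)"
   using assms by (cases "(D, x, y)" rule: iv.cases) (force simp: Inr_word_iff)+
 qed
 then show ?thesis by (simp only: cross_psign ldeg_word tdeg_word)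
qed

lemma cross_iv_greater:
 assumes "\<And>a b. a \<in> set (labels s) \<Longrightarrow> b \<in> set (labels t) \<Longrightarrow> b < a \<or> D a * D b = 0"
 shows "cross (iv D) (word s) (word t) = psign (ldeg D s * dg D t)"
proof -
 have "cross (iv D) (word s) (word t) =
   cross (\<lambda>x y. psign (lfdeg D x * (vdeg y + lfdeg D y))) (word s) (word t)"
 proof (rule cross_cong)
  fix x y assume "x \<in> set (word s)" "y \<in> set (word t)"
  then show "iv D x y = psign (lfdeg D x * (vdeg y + lfdeg D y))"
   using assms by (cases "(D, x, y)" rule: iv.cases) (force simp: Inr_word_iff)+
 qed
 then show ?thesis by (simp only: cross_psign ldeg_word tdeg_word dg_def sum_list_addf)
qed

lemma pair_prod_rights:
 assumes "\<And>d y. f (Inl d) y = 1" "\<And>d x. f x (Inl d) = 1"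
 shows "pair_prod f xs = pair_prod (\<lambda>a b. f (Inr a) (Inr b)) (rights xs)"
proof (induction xs)
 case (Cons x xs)
 have "prod_list (map (f (Inr a)) xs) = prod_list (map (\<lambda>b. f (Inr a) (Inr b)) (rights xs))" for a
 proof (induction xs)
  case (Cons x xs)
  then show ?case by (cases x) (simp_all add: assms)
 qed simp
 moreover have "prod_list (map (f (Inl d)) xs) = 1" for d
  by (induction xs) (simp_all add: assms)
 ultimately show ?case using Cons by (cases x) simp_all
qed simp

lemma sorted_wrt_word:
 assumes "distinct (labels t)"
 shows "sorted_wrt (\<lambda>x y. \<forall>a. x = Inr a \<longrightarrow> y \<noteq> Inr a) (word t)"
proof -
 have "sorted_wrt (\<lambda>x y. \<forall>a. x = Inr a \<longrightarrow> y \<noteq> Inr a) xs" if "distinct (rights xs)" for xs :: "(int + 'a) list"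
  using that
 proof (induction xs)
  case (Cons x xs)
  then show ?case by (cases x) (auto simp: set_rights)
 qed simp
 then show ?thesis using assms by (simp add: rights_word)
qed

lemma prod_list_word:
 fixes h :: "'a \<Rightarrow> int"
 shows "prod_list (map (case_sum (\<lambda>_. 1) h) (word t)) = prod_list (map h (labels t))"
proof -
 have "prod_list (map (case_sum (\<lambda>_. 1) h) xs) = prod_list (map h (rights xs))" for xs :: "(int + 'a) list"
  by (induction xs) (auto simp: rights_def split: sum.splits)
 then show ?thesis by (simp add: rights_word)
qed

text \<open>The sign of a composite. The inner trees have vertices as well, so that each of them acts on the
outer tree as a decoration whose degree \<^const>\<open>dg\<close> counts its vertices and its legs.\<close>

lemma leg_sign_graft:
 assumes dist: "distinct (labels t)"
  and sep: "\<And>a b x y. a \<in> set (labels t) \<Longrightarrow> b \<in> set (labels t) \<Longrightarrow> a < b \<Longrightarrow>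
   x \<in> set (labels (S a)) \<Longrightarrow> y \<in> set (labels (S b)) \<Longrightarrow> x < y \<or> D x * D y = 0"
 shows "leg_sign D (graft S t) =
  leg_sign (\<lambda>a. dg D (S a)) t * leg_sign (\<lambda>a. tdeg (S a)) t *
  prod_list (map (\<lambda>a. leg_sign D (S a)) (labels t)) *
  pair_prod (\<lambda>a b. psign (ldeg D (S a) * tdeg (S b))) (sort (labels t))"
proof -
 let ?g = "case_sum (\<lambda>d. [Inl d]) (\<lambda>a. word (S a)) :: int + nat \<Rightarrow> (int + nat) list"
 let ?h = "\<lambda>a b. if a < b then psign (ldeg D (S a) * tdeg (S b)) else psign (ldeg D (S b) * tdeg (S a))"
 let ?G = "\<lambda>x y. case x of Inl d \<Rightarrow> 1 | Inr a \<Rightarrow> (case y of Inl d \<Rightarrow> 1 | Inr b \<Rightarrow> ?h a b)"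
 let ?F1 = "iv (\<lambda>a. dg D (S a))"
 let ?F2 = "iv (\<lambda>a. tdeg (S a))"
 have "leg_sign D (graft S t) = prod_list (map (\<lambda>x. pair_prod (iv D) (?g x)) (word t)) *
   pair_prod (\<lambda>x y. cross (iv D) (?g x) (?g y)) (word t)"
  by (simp add: leg_sign_def word_graft pair_prod_concat pair_prod_map comp_def)
 also have "(\<lambda>x. pair_prod (iv D) (?g x)) = case_sum (\<lambda>_. 1) (\<lambda>a. leg_sign D (S a))"
  by (rule ext) (simp add: leg_sign_def split: sum.splits)
 also have "pair_prod (\<lambda>x y. cross (iv D) (?g x) (?g y)) (word t) =
   pair_prod (\<lambda>x y. ?F1 x y * ?F2 x y * ?G x y) (word t)"
 proof (rule pair_prod_cong[OF sorted_wrt_word[OF dist]])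
  fix x y :: "int + nat"
  assume xy: "x \<in> set (word t)" "y \<in> set (word t)" "\<forall>a. x = Inr a \<longrightarrow> y \<noteq> Inr a"
  show "cross (iv D) (?g x) (?g y) = ?F1 x y * ?F2 x y * ?G x y"
  proof (cases x)
   case (Inl d)
   have "prod_list (map (iv D (Inl d)) ys) = 1" for ys by (induction ys) simp_all
   then show ?thesis by (simp add: Inl)
  next
   case x: (Inr a)
   show ?thesis
   proof (cases y)
    case (Inl d)
    have "cross (iv D) (word (S a)) [Inl d] = cross (\<lambda>x y. psign (lfdeg D x * vdeg y)) (word (S a)) [Inl d :: int + nat]"
     proof (rule cross_cong)
     fix u v assume "v \<in> set [Inl d :: int + nat]"
     then show "iv D u v = psign (lfdeg D u * vdeg v)" by (cases u) auto
    qed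
    then have "cross (iv D) (word (S a)) [Inl d] = psign (ldeg D (S a) * d)"
     by (simp add: cross_psign ldeg_word)
    then show ?thesis
     by (simp add: x Inl dg_def psign_add[symmetric]) (simp add: algebra_simps psign_def)
   next
    case y: (Inr b)
    have ab: "a \<in> set (labels t)" "b \<in> set (labels t)" "a \<noteq> b"
     using xy by (auto simp: x y Inr_word_iff)
    show ?thesis
    proof (cases "a < b")
     case True
     have "cross (iv D) (word (S a)) (word (S b)) = psign (ldeg D (S a) * tdeg (S b))"
      by (rule cross_iv_less) (use sep ab True in blast)
     then show ?thesis using True by (simp add: x y)
    next
     case False
     have "cross (iv D) (word (S a)) (word (S b)) = psign (ldeg D (S a) * dg D (S b))"
      by (rule cross_iv_greater) (use sep[of b a] ab False in \<open>force simp: mult.commute\<close>)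
     then show ?thesis using False ab
      by (simp add: x y psign_add[symmetric]) (rule psign_cong, simp add: dg_def algebra_simps)
    qed
   qed
  qed
 qed
 also have "\<dots> = pair_prod ?F1 (word t) * pair_prod ?F2 (word t) * pair_prod ?G (word t)"
  by (simp only: pair_prod_mult)
 also have "pair_prod ?G (word t) = pair_prod ?h (labels t)"
  by (subst pair_prod_rights) (simp_all add: rights_word split: sum.splits)
 also have "pair_prod ?h (labels t) = pair_prod ?h (sort (labels t))"
  by (rule pair_prod_perm) (auto simp: not_less dest: order_antisym)
 also have "\<dots> = pair_prod (\<lambda>a b. psign (ldeg D (S a) * tdeg (S b))) (sort (labels t))"
  by (rule pair_prod_cong[of "(<)"]) (simp_all add: strict_sorted_iff dist)
 finally show ?thesis
  by (simp add: prod_list_word leg_sign_def ac_simps)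
qed

text \<open>Relabelling permutes the decorations before they are moved to their legs.\<close>

lemma leg_sign_map_tree:
 assumes t: "mset (labels t) = mset [0..<n]" and \<sigma>: "\<sigma> permutes {..<n}"
 shows "leg_sign D (map_tree \<sigma> t) = koszul \<sigma> (map D [0..<n]) * leg_sign (\<lambda>a. D (\<sigma> a)) t"
proof -
 let ?m = "map_sum id \<sigma> :: int + nat \<Rightarrow> int + nat"
 let ?F = "\<lambda>x y. iv D (?m x) (?m y) * iv (\<lambda>a. D (\<sigma> a)) x y"
 let ?f = "\<lambda>a b. ?F (Inr a) (Inr b)"
 have sym: "?f a b = ?f b a" for a b
  using permutes_inj[OF \<sigma>] by (auto simp: mult.commute dest: injD)
 have "leg_sign D (map_tree \<sigma> t) * leg_sign (\<lambda>a. D (\<sigma> a)) t = pair_prod ?F (word t)"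
  by (simp add: leg_sign_def word_map_tree pair_prod_map pair_prod_mult)
 also have "\<dots> = pair_prod ?f (labels t)"
  by (subst pair_prod_rights) (auto simp: rights_word split: sum.splits, case_tac x, auto)
 also have "\<dots> = pair_prod ?f [0..<n]"
  by (rule pair_prod_perm[OF t]) (rule sym)
 also have "\<dots> = koszul \<sigma> (map D [0..<n])"
  unfolding koszul_pair_prod length_map length_upt minus_nat.diff_0
 proof (rule pair_prod_cong[of "(<)"])
  fix a b assume "a \<in> set [0..<n]" "b \<in> set [0..<n]" "a < b"
  moreover from this have "\<sigma> a < n" "\<sigma> b < n" using permutes_in_image[OF \<sigma>] by auto
  ultimately show "?f a b = (if \<sigma> b < \<sigma> a
    then psign (map D [0..<n] ! \<sigma> a * map D [0..<n] ! \<sigma> b) else 1)"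
   by simp
 qed simp
 finally show ?thesis
  by (metis leg_sign_square mult.assoc mult.right_neutral)
qed

lemma pair_prod_single:
 fixes e :: int
 defines "f \<equiv> \<lambda>i x y. psign (lfdeg (\<lambda>a. if a = i then e else 0) x * vdeg y)"
 shows "i \<in> set (labels t) \<Longrightarrow> distinct (labels t) \<Longrightarrow>
   pair_prod (f i) (word t) = psign (e * right_deg i t)"
  and "i \<in> set (concat (map labels ts)) \<Longrightarrow> distinct (concat (map labels ts)) \<Longrightarrow>
   pair_prod (f i) (concat (map word ts)) = psign (e * right_degs i ts)"
proof (induction i t and i ts rule: right_deg_right_degs.induct)
 case (2 i ts)
 have "prod_list (map (f i (Inl d)) ys) = 1" for d ys
  by (induction ys) (simp_all add: f_def)
 with 2 show ?case by simp
next
 case (4 i t ts)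
 have sums: "sum_list (map (lfdeg (\<lambda>a. if a = i then e else 0)) (word t)) =
   (if i \<in> set (labels t) then e else 0)"
 proof -
  have "sum_list (map (\<lambda>a. if a = i then e else 0) xs) = (if i \<in> set xs then e else 0)"
   if "distinct xs" for xs
   using that by (induction xs) auto
  with 4 show ?thesis by (simp add: ldeg_word[symmetric] ldeg_def)
 qed
 have cr: "cross (f i) (word t) (concat (map word ts)) =
   psign ((if i \<in> set (labels t) then e else 0) * sum_list (map tdeg ts))"
  unfolding f_def cross_psign sums
  by (simp add: sum_list_map_concat comp_def tdeg_word[abs_def, symmetric])
 have none: "pair_prod (f i) xs = 1" if "i \<notin> set (rights xs)" for xs
  using that
 proof (induction xs)
  case (Cons x xs)
  have "prod_list (map (f i x) ys) = 1" for ys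
   using Cons.prems by (cases x; induction ys) (auto simp: f_def)
  with Cons show ?case by (cases x) auto
 qed simp
 show ?case
 proof (cases "i \<in> set (labels t)")
  case True
  with 4 have "i \<notin> set (rights (concat (map word ts)))"
   by (auto simp: rights_concat rights_word)
  with True 4 show ?thesis
   by (simp add: pair_prod_append cr none set_tree_labels psign_add[symmetric] distrib_left)
 next
  case False
  with 4 show ?thesis
   by (simp add: pair_prod_append cr none rights_word set_tree_labels)
 qed
qed (simp_all add: f_def)

lemma leg_sign_single:
 assumes "distinct (labels t)" "i \<in> set (labels t)"
 shows "leg_sign (\<lambda>a. if a = i then e else 0) t = psign (e * right_deg i t)"
proof -
 let ?D = "\<lambda>a. if a = i then e else 0"
 have "leg_sign ?D t = pair_prod (\<lambda>x y. psign (lfdeg ?D x * vdeg y)) (word t)"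
  unfolding leg_sign_def
 proof (rule pair_prod_cong[OF sorted_wrt_word[OF assms(1)]])
  fix x y :: "int + nat"
  assume "\<forall>a. x = Inr a \<longrightarrow> y \<noteq> Inr a"
  then show "iv ?D x y = psign (lfdeg ?D x * vdeg y)"
   by (cases "(?D, x, y)" rule: iv.cases) auto
 qed
 also have "\<dots> = psign (e * right_deg i t)"
  by (rule pair_prod_single(1)[OF assms(2,1)])
 finally show ?thesis .
qed

section \<open>Exchanging the children of vertices\<close>

text \<open>\<open>swaps \<delta> e t t'\<close> says that \<open>t'\<close> arises from \<open>t\<close> by exchanging adjacent children of vertices, and
 that \<open>e\<close> is the product of the signs that these exchanges cost when an input \<open>a\<close> has degree \<open>\<delta> a\<close>.\<close>

inductive swaps :: "('a \<Rightarrow> int) \<Rightarrow> int \<Rightarrow> 'a tree \<Rightarrow> 'a tree \<Rightarrow> bool" for \<delta> where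
 none: "swaps \<delta> 1 t t"
| swap: "swaps \<delta> (- psign (dg \<delta> x * dg \<delta> y)) (Vert (us @ x # y # vs)) (Vert (us @ y # x # vs))"
| ctx: "swaps \<delta> e s s' \<Longrightarrow> swaps \<delta> e (Vert (us @ s # vs)) (Vert (us @ s' # vs))"
| comp: "swaps \<delta> e s s' \<Longrightarrow> swaps \<delta> e' s' s'' \<Longrightarrow> swaps \<delta> (e * e') s s''"

lemma swaps_trans':
 "swaps \<delta> e s s' \<Longrightarrow> swaps \<delta> e' s' s'' \<Longrightarrow> e'' = e * e' \<Longrightarrow> swaps \<delta> e'' s s''"
 by (simp add: swaps.comp)

lemma swaps_word: "swaps \<delta> e s s' \<Longrightarrow> mset (word s) = mset (word s')"
 by (induction rule: swaps.induct) auto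

lemma mset_rights_cong: "mset xs = mset ys \<Longrightarrow> mset (rights xs) = mset (rights ys)"
 unfolding rights_def by (rule mset_concat_map_cong)

lemma sum_list_map_mset_cong:
 fixes f :: "'a \<Rightarrow> int"
 shows "mset xs = mset ys \<Longrightarrow> sum_list (map f xs) = sum_list (map f ys)"
 by (metis mset_map sum_mset_sum_list)

lemma swaps_labels: "swaps \<delta> e s s' \<Longrightarrow> mset (labels s) = mset (labels s')"
 using mset_rights_cong[OF swaps_word[of \<delta> e s s']] by (simp add: rights_word)

lemma swaps_degs:
 assumes "swaps \<delta> e s s'"
 shows "tdeg s = tdeg s'" "ldeg D s = ldeg D s'" "dg D s = dg D s'" "arity s = arity s'"
proof -
 show t: "tdeg s = tdeg s'"
  by (simp add: tdeg_word sum_list_map_mset_cong[OF swaps_word[OF assms]])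
 show l: "ldeg D s = ldeg D s'"
  by (simp add: ldeg_word sum_list_map_mset_cong[OF swaps_word[OF assms]])
 show "dg D s = dg D s'" by (simp add: dg_def t l)
 show "arity s = arity s'"
  using swaps_labels[OF assms, THEN mset_eq_length] by (simp add: arity_def)
qed

lemma swaps_vals_le: "swaps \<delta> e s s' \<Longrightarrow> vals_le m s = vals_le m s'"
 by (induction rule: swaps.induct) auto

lemma swaps_square: "swaps \<delta> e s s' \<Longrightarrow> e * e = 1"
proof (induction rule: swaps.induct)
 case (comp e s s' e' s'')
 have "e * e' * (e * e') = (e * e) * (e' * e')" by (simp only: ac_simps)
 with comp.IH show ?case by simp
qed simp_all

definition swap_factor :: "('a \<Rightarrow> int) \<Rightarrow> ('z \<Rightarrow> nat) \<Rightarrow> ('z \<Rightarrow> 'a tree) \<Rightarrow> 'z \<Rightarrow> 'z \<Rightarrow> int" where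
 "swap_factor \<delta> key f x y = (if key y < key x then - psign (dg \<delta> (f x) * dg \<delta> (f y)) else 1)"

lemma swaps_insort:
 assumes "sorted (map key zs)"
 shows "swaps \<delta> (prod_list (map (swap_factor \<delta> key f z) zs)) (Vert (us @ f z # map f zs))
  (Vert (us @ map f (insort_key key z zs)))"
 using assms
proof (induction zs arbitrary: us)
 case (Cons y zs)
 show ?case
 proof (cases "key z \<le> key y")
  case True
  then have "map (swap_factor \<delta> key f z) (y # zs) = map (\<lambda>_. 1) (y # zs)"
   using Cons.prems by (intro map_cong) (auto simp: swap_factor_def)
  then have "prod_list (map (swap_factor \<delta> key f z) (y # zs)) = 1"
   by (simp only: map_replicate_const) simp
  then show ?thesis using True by (simp add: swaps.none)
 next
  case False
  have "swaps \<delta> (swap_factor \<delta> key f z y) (Vert (us @ f z # f y # map f zs))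
    (Vert (us @ f y # f z # map f zs))"
   using False by (simp add: swap_factor_def swaps.swap)
  moreover have "swaps \<delta> (prod_list (map (swap_factor \<delta> key f z) zs))
    (Vert ((us @ [f y]) @ f z # map f zs)) (Vert ((us @ [f y]) @ map f (insort_key key z zs)))"
   by (rule Cons.IH) (use Cons.prems in simp)
  ultimately show ?thesis
   using False by (auto intro: swaps.comp)
 qed
qed (simp add: swaps.none)

lemma swaps_sort:
 "swaps \<delta> (pair_prod (swap_factor \<delta> key f) zs) (Vert (us @ map f zs))
  (Vert (us @ map f (sort_key key zs)))"
proof (induction zs arbitrary: us)
 case (Cons z zs)
 have "swaps \<delta> (pair_prod (swap_factor \<delta> key f) zs) (Vert ((us @ [f z]) @ map f zs))
  (Vert ((us @ [f z]) @ map f (sort_key key zs)))"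
  by (rule Cons.IH)
 moreover have "swaps \<delta> (prod_list (map (swap_factor \<delta> key f z) (sort_key key zs)))
  (Vert (us @ f z # map f (sort_key key zs)))
  (Vert (us @ map f (insort_key key z (sort_key key zs))))"
  by (rule swaps_insort) simp
 moreover have "prod_list (map (swap_factor \<delta> key f z) (sort_key key zs)) =
   prod_list (map (swap_factor \<delta> key f z) zs)"
  by (rule prod_list_mset_cong) simp
 ultimately show ?case
  by (auto intro: swaps_trans' simp: mult.commute)
qed (simp add: swaps.none)

lemma nform_sign_Vert:
 "nform_sign (Vert ts) = prod_list (map nform_sign ts) * pair_prod (swap_factor (\<lambda>_. 0) low id) ts"
 unfolding nform_sign.simps pair_prod_nth prod_pairs_if swap_factor_def dg_0 id_apply ..

declare nform_sign.simps(2) [simp del]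

lemma swaps_ctx_list:
 assumes "\<And>z. z \<in> set zs \<Longrightarrow> swaps \<delta> (e z) (f z) (g z)"
 shows "swaps \<delta> (prod_list (map e zs)) (Vert (us @ map f zs @ vs)) (Vert (us @ map g zs @ vs))"
 using assms
proof (induction zs arbitrary: us)
 case (Cons z zs)
 have "swaps \<delta> (e z) (Vert (us @ f z # map f zs @ vs)) (Vert (us @ g z # map f zs @ vs))"
  using Cons by (intro swaps.ctx) auto
 moreover have "swaps \<delta> (prod_list (map e zs)) (Vert ((us @ [g z]) @ map f zs @ vs))
   (Vert ((us @ [g z]) @ map g zs @ vs))"
  by (rule Cons.IH) (use Cons.prems in auto)
 ultimately show ?case
  by (auto intro: swaps.comp)
qed (simp add: swaps.none)

lemma swaps_nform_aux: "swaps (\<lambda>_. 0) (nform_sign t) t (nform t) \<and> low (nform t) = low t"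
proof (induction t)
 case (Leg a)
 then show ?case by (simp add: swaps.none)
next
 case (Vert ts)
 have IH: "swaps (\<lambda>_. 0) (nform_sign t) t (nform t)" "low (nform t) = low t" if "t \<in> set ts" for t
  using Vert that by auto
 have 1: "swaps (\<lambda>_. 0) (prod_list (map nform_sign ts)) (Vert ts) (Vert (map nform ts))"
  using swaps_ctx_list[of ts "\<lambda>_. 0" nform_sign "\<lambda>t. t" nform "[]" "[]"] IH by simp
 have 2: "swaps (\<lambda>_. 0) (pair_prod (swap_factor (\<lambda>_. 0) low id) (map nform ts))
   (Vert (map nform ts)) (Vert (sort_key low (map nform ts)))"
  using swaps_sort[of "\<lambda>_. 0" low id "map nform ts" "[]"] by simp
 have "pair_prod (swap_factor (\<lambda>_. 0) low id) (map nform ts) = pair_prod (swap_factor (\<lambda>_. 0) low id) ts"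
  unfolding pair_prod_map
  by (rule pair_prod_cong[of "\<lambda>_ _. True"])
   (auto simp: swap_factor_def IH(2) swaps_degs(1)[OF IH(1), symmetric] sorted_wrt_iff_nth_less)
 with 1 2 have *: "swaps (\<lambda>_. 0) (nform_sign (Vert ts)) (Vert ts) (nform (Vert ts))"
  by (auto intro: swaps.comp simp: nform_sign_Vert)
 have "set_tree (Vert ts) = set_tree (nform (Vert ts))"
  using mset_eq_setD[OF swaps_labels[OF *]] by (simp only: set_tree_labels)
 with * show ?case by (simp add: low_def)
qed

lemmas swaps_nform = swaps_nform_aux[THEN conjunct1]
lemmas low_nform = swaps_nform_aux[THEN conjunct2]

lemma inj_on_distinct_concat:
 "distinct (concat (map f ts)) \<Longrightarrow> u \<in> set ts \<Longrightarrow> v \<in> set ts \<Longrightarrow> x \<in> set (f u) \<Longrightarrow> x \<in> set (f v) \<Longrightarrow> u = v"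
 by (induction ts) auto

lemma low_in_labels: "labels t \<noteq> [] \<Longrightarrow> low t \<in> set (labels t)"
 unfolding low_def set_tree_labels by (rule Min_in) auto

lemma pair_prod_blocks:
 assumes "\<And>x y. f x y * f x y = (1::int)"
 obtains K where "pair_prod f (us @ xs @ ys @ vs) = K * cross f xs ys"
  "pair_prod f (us @ ys @ xs @ vs) = K * cross f ys xs" "K * K = 1"
proof -
 define K where "K = pair_prod f us * pair_prod f xs * pair_prod f ys * pair_prod f vs *
  cross f us xs * cross f us ys * cross f us vs * cross f xs vs * cross f ys vs"
 have cr: "cross f us vs * cross f us vs = 1" for us vs
  unfolding cross_mult[symmetric] assms by (induction us) (simp_all add: map_replicate_const)
 have a: "pair_prod f (us @ xs @ ys @ vs) = K * cross f xs ys"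
  by (simp add: pair_prod_append cross_append_left cross_append_right K_def ac_simps)
 have b: "pair_prod f (us @ ys @ xs @ vs) = K * cross f ys xs"
  by (simp add: pair_prod_append cross_append_left cross_append_right K_def ac_simps)
 have "K * cross f xs ys * (K * cross f xs ys) = 1"
  unfolding a[symmetric] by (rule pair_prod_square[OF assms])
 then have "K * K = 1"
  using cr[of xs ys] by (metis mult.assoc mult.commute mult.right_neutral)
 then show ?thesis using that a b by blast
qed

lemma swaps_nform_eq:
 assumes "swaps (\<lambda>_. 0) e t t'" "vals_le m t" "distinct (labels t)"
 shows "nform t = nform t' \<and> nform_sign t = e * nform_sign t'"
 using assms
proof (induction rule: swaps.induct)
 case (none t)
 then show ?case by simp
next
 case (swap x y us vs)
 let ?ts = "us @ x # y # vs" and ?ts' = "us @ y # x # vs"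
 have ne: "labels u \<noteq> []" if "u \<in> set ?ts" for u
  using swap.prems(1) that labels_nonempty[of m u] by auto
 have inj: "u = v" if "u \<in> set ?ts" "v \<in> set ?ts" "low u = low v" for u v
  using inj_on_distinct_concat[of labels ?ts u v "low u"] swap.prems(2) that
   low_in_labels[OF ne, of u] low_in_labels[OF ne, of v] by simp
 have inj': "inj_on low (set (map nform ?ts))"
 proof (rule inj_onI)
  fix u' v' assume "u' \<in> set (map nform ?ts)" "v' \<in> set (map nform ?ts)" "low u' = low v'"
  then obtain u v where "u' = nform u" "v' = nform v" "u \<in> set ?ts" "v \<in> set ?ts" "low u = low v"
   by (auto simp only: set_map low_nform image_iff)
  then show "u' = v'" using inj[of u v] by simp
 qed
 have "sort_key low (map nform ?ts) = sort_key low (map nform ?ts')"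
  by (rule sort_key_eq_sort_key[OF _ inj']) simp
 moreover have "pair_prod (swap_factor (\<lambda>_. 0) low id) ?ts =
   - psign (tdeg x * tdeg y) * pair_prod (swap_factor (\<lambda>_. 0) low id) ?ts'"
 proof -
  have "low x \<noteq> low y"
  proof
   assume l: "low x = low y"
   then have "x = y" using inj[of x y] by simp
   then show False using swap.prems(2) ne[of x] by auto
  qed
  then have "swap_factor (\<lambda>_. 0) low id x y = - psign (tdeg x * tdeg y) * swap_factor (\<lambda>_. 0) low id y x"
   by (auto simp: swap_factor_def mult.commute)
  moreover have "swap_factor (\<lambda>_. 0) low id u v * swap_factor (\<lambda>_. 0) low id u v = 1" for u v
   by (simp add: swap_factor_def)
  then obtain K where "pair_prod (swap_factor (\<lambda>_. 0) low id) (us @ [x] @ [y] @ vs) =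
    K * cross (swap_factor (\<lambda>_. 0) low id) [x] [y]"
   "pair_prod (swap_factor (\<lambda>_. 0) low id) (us @ [y] @ [x] @ vs) =
    K * cross (swap_factor (\<lambda>_. 0) low id) [y] [x]"
   by (rule pair_prod_blocks)
  ultimately show ?thesis by simp
 qed
 ultimately show ?case
  by (simp add: nform_sign_Vert ac_simps)
next
 case (ctx e s s' us vs)
 then have IH: "nform s = nform s'" "nform_sign s = e * nform_sign s'"
  by auto
 have l: "low s = low s'" using IH(1) low_nform by metis
 have "pair_prod (swap_factor (\<lambda>_. 0) low id) (us @ s # vs) =
   pair_prod (swap_factor (\<lambda>_. 0) low id) (us @ s' # vs)"
 proof -
  have "swap_factor (\<lambda>_. 0) low id s = swap_factor (\<lambda>_. 0) low id s'"
   "swap_factor (\<lambda>_. 0) low id u s = swap_factor (\<lambda>_. 0) low id u s'" for u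
   using l swaps_degs(1)[OF ctx(1)] by (auto simp: swap_factor_def fun_eq_iff)
  then show ?thesis by (simp add: pair_prod_append cross_flip[of _ us])
 qed
 with IH show ?case by (simp add: nform_sign_Vert ac_simps)
next
 case (comp e s s' e' s'')
 have "vals_le m s'" "distinct (labels s')"
  using comp.prems swaps_vals_le[OF comp(1)] mset_eq_imp_distinct_iff[OF swaps_labels[OF comp(1)]]
  by simp_all
 with comp show ?case by simp
qed

lemma planar_swaps:
 assumes "swaps (\<lambda>_. 0) e t t'" "vals_le m t" "distinct (labels t)"
 shows "planar t = fscale (of_int e) (planar t')"
 using swaps_nform_eq[OF assms] by (simp add: planar_def)

lemma planar_nform_id:
 assumes "nform t = t" "vals_le m t" "distinct (labels t)"
 shows "planar t = gen t"
proof -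
 have "nform_sign t = nform_sign t * nform_sign t"
  using swaps_nform_eq[OF swaps_nform assms(2,3)] assms(1) by simp
 with swaps_square[OF swaps_nform[of t]] have "nform_sign t = 1" by simp
 with assms(1) show ?thesis by (simp add: planar_def)
qed

lemma nform_nform:
 assumes "vals_le m t" "distinct (labels t)"
 shows "nform (nform t) = nform t"
 using swaps_nform_eq[OF swaps_nform assms] by simp

lemma swaps_leg_sign:
 assumes "swaps \<delta> e s s'"
 shows "leg_sign D (Vert (us @ s # vs)) * leg_sign D (Vert (us @ s' # vs)) = leg_sign D s * leg_sign D s'"
proof -
 let ?f = "iv D" and ?A = "Inl (int (length us + Suc (length vs)) - 2) # concat (map word us)"
  and ?B = "concat (map word vs)"
 define K where "K = pair_prod ?f ?A * pair_prod ?f ?B * cross ?f ?A ?B *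
  cross ?f ?A (word s) * cross ?f (word s) ?B"
 have cr: "cross ?f ?A (word s) = cross ?f ?A (word s')" "cross ?f (word s) ?B = cross ?f (word s') ?B"
  using swaps_word[OF assms] by (auto intro!: cross_mset_cong simp del: cross_simps)
 have a: "leg_sign D (Vert (us @ s # vs)) = K * leg_sign D s"
  using pair_prod_append[of ?f ?A "word s @ ?B"]
  by (simp add: leg_sign_def pair_prod_append[of ?f "word s"] cross_append_right K_def ac_simps)
 have b: "leg_sign D (Vert (us @ s' # vs)) = K * leg_sign D s'"
  using pair_prod_append[of ?f ?A "word s' @ ?B"] unfolding K_def cr
  by (simp add: leg_sign_def pair_prod_append[of ?f "word s'"] cross_append_right ac_simps)
 have "K * leg_sign D s * (K * leg_sign D s) = 1"
  unfolding a[symmetric] by simp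
 then have "K * K = 1"
  by (metis leg_sign_square mult.assoc mult.commute mult.right_neutral)
 then have "K * leg_sign D s * (K * leg_sign D s') = leg_sign D s * leg_sign D s'"
  by (metis mult.assoc mult.commute mult.left_neutral)
 then show ?thesis by (simp add: a b)
qed

lemma cross_iv_twice:
 assumes "set (labels x) \<inter> set (labels y) = {}"
 shows "cross (iv D) (word x) (word y) * cross (iv D) (word y) (word x) =
  psign (dg D x * dg D y) * psign (tdeg x * tdeg y)"
proof -
 let ?d = "\<lambda>z. vdeg z + lfdeg D z"
 have "cross (iv D) (word x) (word y) * cross (iv D) (word y) (word x) =
   cross (\<lambda>u v. iv D u v * iv D v u) (word x) (word y)"
  by (simp add: cross_mult cross_flip[of "iv D" "word y"])
 also have "\<dots> = cross (\<lambda>u v. psign (?d u * ?d v) * psign (vdeg u * vdeg v)) (word x) (word y)"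
 proof (rule cross_cong)
  fix u v assume uv: "u \<in> set (word x)" "v \<in> set (word y)"
  show "iv D u v * iv D v u = psign (?d u * ?d v) * psign (vdeg u * vdeg v)"
  proof (cases "\<exists>a b. u = Inr a \<and> v = Inr b")
   case True
   then obtain a b where "u = Inr a" "v = Inr b" by blast
   moreover from this uv assms have "a \<noteq> b" by (auto simp: Inr_word_iff)
   ultimately show ?thesis by (auto simp: mult.commute)
  next
   case False
   then show ?thesis by (cases u; cases v) (auto simp: mult.commute)
  qed
 qed
 also have "\<dots> = psign (dg D x * dg D y) * psign (tdeg x * tdeg y)"
  by (simp only: cross_mult cross_psign sum_list_addf tdeg_word ldeg_word dg_def)
 finally show ?thesis .
qed

lemma leg_sign_swap:
 assumes "distinct (labels (Vert (us @ x # y # vs)))"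
 shows "leg_sign D (Vert (us @ x # y # vs)) * leg_sign D (Vert (us @ y # x # vs)) =
  psign (dg D x * dg D y) * psign (tdeg x * tdeg y)"
proof -
 let ?A = "Inl (int (Suc (Suc (length us + length vs))) - 2) # concat (map word us)"
 obtain K where K: "pair_prod (iv D) (?A @ word x @ word y @ concat (map word vs)) =
    K * cross (iv D) (word x) (word y)"
   "pair_prod (iv D) (?A @ word y @ word x @ concat (map word vs)) =
    K * cross (iv D) (word y) (word x)" "K * K = 1"
  using pair_prod_blocks[of "iv D" ?A "word x" "word y" "concat (map word vs)"] iv_square by blast
 have "leg_sign D (Vert (us @ x # y # vs)) * leg_sign D (Vert (us @ y # x # vs)) =
   (K * K) * (cross (iv D) (word x) (word y) * cross (iv D) (word y) (word x))"
  using K(1,2) by (simp add: leg_sign_def ac_simps)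
 also have "\<dots> = psign (dg D x * dg D y) * psign (tdeg x * tdeg y)"
  unfolding K(3) by (subst cross_iv_twice) (use assms in auto)
 finally show ?thesis .
qed

text \<open>Grafting trees onto the legs turns exchanges of abstract subtrees into exchanges of the grafted
 ones; the change of the signs is accounted for by \<^const>\<open>leg_sign\<close>.\<close>

lemma swaps_graft:
 assumes "swaps (\<lambda>_. 0) e t t'" "distinct (labels t)"
 shows "swaps \<delta> (e * leg_sign (\<lambda>a. dg \<delta> (S a)) t * leg_sign (\<lambda>a. dg \<delta> (S a)) t')
  (graft S t) (graft S t')"
 using assms
proof (induction rule: swaps.induct)
 case (none t)
 then show ?case by (simp add: swaps.none)
next
 case (swap x y us vs)
 let ?D = "\<lambda>a. dg \<delta> (S a)"
 note leg_sign_swap[OF swap.prems, of ?D]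
 then have "- psign (dg (\<lambda>_. 0) x * dg (\<lambda>_. 0) y) * leg_sign ?D (Vert (us @ x # y # vs)) *
   leg_sign ?D (Vert (us @ y # x # vs)) = - psign (dg \<delta> (graft S x) * dg \<delta> (graft S y))"
  by (simp add: mult.assoc dg_graft)
 then show ?case using swaps.swap[of \<delta> "graft S x" "graft S y" "map (graft S) us" "map (graft S) vs"]
  by simp
next
 case (ctx e s s' us vs)
 then have "swaps \<delta> (e * leg_sign (\<lambda>a. dg \<delta> (S a)) s * leg_sign (\<lambda>a. dg \<delta> (S a)) s')
  (graft S s) (graft S s')" by auto
 then show ?case
  using swaps.ctx[of \<delta> _ _ _ "map (graft S) us" "map (graft S) vs"]
  by (simp add: mult.assoc swaps_leg_sign[OF ctx(1)])
next
 case (comp e s s' e' s'')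
 have "distinct (labels s')"
  using comp.prems mset_eq_imp_distinct_iff[OF swaps_labels[OF comp(1)]] by simp
 with comp show ?case
  by (auto intro!: swaps_trans'[OF comp.IH(1) comp.IH(2)] simp: ac_simps)
qed

lemma swaps_map_tree:
 "swaps (\<lambda>_. 0) e t t' \<Longrightarrow> swaps (\<lambda>_. 0) e (map_tree f t) (map_tree f t')"
proof (induction rule: swaps.induct)
 case (swap x y us vs)
 show ?case
  using swaps.swap[of "\<lambda>_. 0" "map_tree f x" "map_tree f y" "map (map_tree f) us" "map (map_tree f) vs"]
  by simp
qed (auto intro: swaps.intros)

lemma swaps_graft_slot:
 assumes "swaps \<delta> e (S i) (S' i)" "\<And>a. a \<noteq> i \<Longrightarrow> S a = S' a" "distinct (labels t)" "i \<in> set (labels t)"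
 shows "swaps \<delta> e (graft S t) (graft S' t)"
 using assms(3,4)
proof (induction t)
 case (Leg a)
 then show ?case using assms(1) by simp
next
 case (Vert ts)
 then obtain s where s: "s \<in> set ts" "i \<in> set (labels s)" by auto
 then obtain us vs where ts: "ts = us @ s # vs" by (meson split_list)
 have "swaps \<delta> e (graft S s) (graft S' s)"
  using Vert s ts by auto
 moreover have "graft S u = graft S' u" if "u \<in> set us \<union> set vs" for u
  using that Vert.prems s ts by (intro graft_cong assms(2)) auto
 then have "map (graft S) us = map (graft S') us" "map (graft S) vs = map (graft S') vs" by auto
 ultimately show ?case by (simp add: ts swaps.ctx del: map_eq_conv)
qed

text \<open>Conversely, exchanges of decorated subtrees lift to exchanges of labelled ones.\<close>

lemma swaps_lift:
 assumes "swaps \<delta> e s s'" "map_tree f t = s" "distinct (labels t)"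
 shows "\<exists>e' t'. swaps (\<lambda>_. 0) e' t t' \<and> map_tree f t' = s' \<and>
  e = e' * leg_sign (\<lambda>a. \<delta> (f a)) t * leg_sign (\<lambda>a. \<delta> (f a)) t'"
 using assms
proof (induction arbitrary: t rule: swaps.induct)
 case (none s)
 then show ?case by (intro exI[of _ 1] exI[of _ t]) (simp add: swaps.none)
next
 case (swap x y us vs)
 from swap.prems(1) obtain us' x' y' vs' where t: "t = Vert (us' @ x' # y' # vs')"
  "map (map_tree f) us' = us" "map_tree f x' = x" "map_tree f y' = y" "map (map_tree f) vs' = vs"
  by (cases t) (auto simp: map_eq_append_conv map_eq_Cons_conv)
 let ?D = "\<lambda>a. \<delta> (f a)"
 have dg: "dg \<delta> x = dg ?D x'" "dg \<delta> y = dg ?D y'" using t by auto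
 have "- psign (tdeg x' * tdeg y') * (leg_sign ?D (Vert (us' @ x' # y' # vs')) *
   leg_sign ?D (Vert (us' @ y' # x' # vs'))) = - psign (dg \<delta> x * dg \<delta> y)"
  unfolding leg_sign_swap[OF swap.prems(2)[unfolded t(1)]] dg by (simp add: ac_simps)
 then show ?case
  using swaps.swap[of "\<lambda>_. 0" x' y' us' vs'] t
  by (intro exI[of _ "- psign (tdeg x' * tdeg y')"] exI[of _ "Vert (us' @ y' # x' # vs')"])
   (simp add: mult.assoc)
next
 case (ctx e s s' us vs)
 from ctx.prems(1) obtain us' u vs' where t: "t = Vert (us' @ u # vs')"
  "map (map_tree f) us' = us" "map_tree f u = s" "map (map_tree f) vs' = vs"
  by (cases t) (auto simp: map_eq_append_conv map_eq_Cons_conv)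
 have "distinct (labels u)" using ctx.prems(2) by (simp add: t(1))
 from ctx.IH[OF t(3) this] obtain e' u' where u': "swaps (\<lambda>_. 0) e' u u'" "map_tree f u' = s'"
  "e = e' * leg_sign (\<lambda>a. \<delta> (f a)) u * leg_sign (\<lambda>a. \<delta> (f a)) u'" by blast
 then show ?case
  using swaps.ctx[OF u'(1), of us' vs'] t swaps_leg_sign[OF u'(1), of "\<lambda>a. \<delta> (f a)" us' vs']
  by (intro exI[of _ e'] exI[of _ "Vert (us' @ u' # vs')"]) (simp add: mult.assoc)
next
 case (comp e s s' e' s'')
 from comp.IH(1)[OF comp.prems] obtain e1 t1 where 1: "swaps (\<lambda>_. 0) e1 t t1" "map_tree f t1 = s'"
  "e = e1 * leg_sign (\<lambda>a. \<delta> (f a)) t * leg_sign (\<lambda>a. \<delta> (f a)) t1" by blast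
 have "distinct (labels t1)"
  using comp.prems mset_eq_imp_distinct_iff[OF swaps_labels[OF 1(1)]] by simp
 from comp.IH(2)[OF 1(2) this] obtain e2 t2 where 2: "swaps (\<lambda>_. 0) e2 t1 t2" "map_tree f t2 = s''"
  "e' = e2 * leg_sign (\<lambda>a. \<delta> (f a)) t1 * leg_sign (\<lambda>a. \<delta> (f a)) t2" by blast
 have "e * e' = e1 * e2 * leg_sign (\<lambda>a. \<delta> (f a)) t * leg_sign (\<lambda>a. \<delta> (f a)) t2"
  unfolding 1(3) 2(3) by (simp add: ac_simps)
 then show ?case using swaps.comp[OF 1(1) 2(1)] 2(2) by blast
qed

section \<open>Numbering the legs of a tree\<close>

text \<open>Numbering the legs in the order of reading splits a decorated tree into a labelled tree and the
list of its decorations. The numbers start at \<open>k\<close>, so that the numbered children of a vertex have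
disjoint sets of labels.\<close>

fun num :: "nat \<Rightarrow> 'a tree \<Rightarrow> nat tree" and nums :: "nat \<Rightarrow> 'a tree list \<Rightarrow> nat tree list" where
 "num k (Leg a) = Leg k"
| "num k (Vert ts) = Vert (nums k ts)"
| "nums k [] = []"
| "nums k (t # ts) = num k t # nums (k + arity t) ts"

abbreviation leg_count :: "'a tree list \<Rightarrow> nat" where
 "leg_count ts \<equiv> length (concat (map labels ts))"

lemma labels_num:
 fixes t :: "'a tree" and ts :: "'a tree list"
 shows "labels (num k t) = [k..<k + arity t]"
  and "concat (map labels (nums k ts)) = [k..<k + leg_count ts]"
proof (induction k t and k ts rule: num_nums.induct)
 case (4 k t ts)
 then show ?case
  using upt_add_eq_append[of k "k + arity t" "leg_count ts"] by (simp add: arity_def add.assoc)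
qed (simp_all add: arity_def)

lemma map_tree_num:
 fixes t :: "'a tree" and ts :: "'a tree list"
 shows "(\<And>j. j < arity t \<Longrightarrow> f (k + j) = labels t ! j) \<Longrightarrow> map_tree f (num k t) = t"
  and "(\<And>j. j < leg_count ts \<Longrightarrow> f (k + j) = concat (map labels ts) ! j) \<Longrightarrow>
  map (map_tree f) (nums k ts) = ts"
proof (induction k t and k ts rule: num_nums.induct)
 case (1 k a)
 from "1.prems"[of 0] show ?case by (simp add: arity_def)
next
 case (2 k ts)
 then show ?case by (simp add: arity_def)
next
 case (4 k t ts)
 have "map_tree f (num k t) = t"
 proof (rule "4.IH"(1))
  fix j assume "j < arity t"
  then show "f (k + j) = labels t ! j" using "4.prems"[of j] by (simp add: nth_append arity_def)
 qed
 moreover have "map (map_tree f) (nums (k + arity t) ts) = ts"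
 proof (rule "4.IH"(2))
  fix j assume "j < leg_count ts"
  then show "f (k + arity t + j) = concat (map labels ts) ! j"
   using "4.prems"[of "arity t + j"] by (simp add: nth_append arity_def add.assoc)
 qed
 ultimately show ?case by simp
qed simp

lemma num_map_tree:
 fixes t :: "'a tree" and ts :: "'a tree list"
 shows "num k (map_tree f t) = num k t" and "nums k (map (map_tree f) ts) = nums k ts"
 by (induction k t and k ts rule: num_nums.induct) simp_all

lemma map_tree_num_nth: "map_tree (\<lambda>a. labels t ! (a - k)) (num k t) = t"
 by (rule map_tree_num) simp

lemma tdeg_num [simp]: "tdeg (num k t) = tdeg t"
 using tdeg_map_tree[of "\<lambda>a. labels t ! (a - k)" "num k t"] by (simp only: map_tree_num_nth)

lemma vals_le_num [simp]: "vals_le m (num k t) = vals_le m t"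
 using vals_le_map_tree[of m "\<lambda>a. labels t ! (a - k)" "num k t"] by (simp only: map_tree_num_nth)

lemma length_nums [simp]: "length (nums k ts) = length ts"
 by (induction ts arbitrary: k) simp_all

section \<open>Partial composites of planar trees\<close>

text \<open>Partial composition grafts these trees onto all legs at once, which makes the lemmas on
\<^const>\<open>graft\<close> applicable.\<close>

definition slot :: "nat \<Rightarrow> nat tree \<Rightarrow> nat \<Rightarrow> nat tree" where
 "slot i s a = (if a < i then Leg a else if a = i then map_tree (\<lambda>b. b + i) s else Leg (a + arity s - 1))"

lemma tree_comp_eq: "tree_comp i t s = graft (slot i s) t"
 by (simp add: tree_comp_def slot_def[abs_def])

lemma mset_labels_tree_comp:
 assumes "mset (labels t) = mset [0..<n]" "mset (labels s) = mset [0..<k]" "i < n" "1 \<le> k"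
 shows "mset (labels (tree_comp i t s)) = mset [0..<n + k - 1]"
proof -
 have k: "arity s = k" using arg_cong[OF assms(2), of size] by (simp add: arity_def)
 have n: "[0..<n] = [0..<i] @ i # [Suc i..<n]"
  using assms(3) by (metis append_Cons append_Nil le_add_same_cancel1 less_imp_le_nat upt_add_eq_append upt_conv_Cons
    le_iff_add zero_le)
 have "mset (labels (tree_comp i t s)) = mset (concat (map (\<lambda>a. labels (slot i s a)) [0..<n]))"
  unfolding tree_comp_eq labels_graft by (rule mset_concat_map_cong[OF assms(1)])
 also have "concat (map (\<lambda>a. labels (slot i s a)) [0..<n]) =
   [0..<i] @ map (\<lambda>b. b + i) (labels s) @ map (\<lambda>a. a + (k - 1)) [Suc i..<n]"
 proof -
  have "concat (map (\<lambda>a. labels (slot i s a)) [0..<i]) = [0..<i]"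
   by (rule trans[OF arg_cong[of _ "map (\<lambda>a. [a]) [0..<i]" concat]]) (auto simp: slot_def)
  moreover have "concat (map (\<lambda>a. labels (slot i s a)) [Suc i..<n]) = map (\<lambda>a. a + (k - 1)) [Suc i..<n]"
   by (rule trans[OF arg_cong[of _ "map (\<lambda>a. [a + (k - 1)]) [Suc i..<n]" concat]])
    (use assms(4) in \<open>auto simp: slot_def k concat_map_singleton\<close>)
  ultimately show ?thesis by (simp add: n slot_def)
 qed
 also have "mset \<dots> = mset ([0..<i] @ map (\<lambda>b. b + i) [0..<k] @ map (\<lambda>a. a + (k - 1)) [Suc i..<n])"
  using assms(2) by simp
 also have "[0..<i] @ map (\<lambda>b. b + i) [0..<k] @ map (\<lambda>a. a + (k - 1)) [Suc i..<n] = [0..<n + k - 1]"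
  using assms(3,4) by (intro nth_equalityI) (auto simp: nth_append)
 finally show ?thesis .
qed

lemma vals_le_tree_comp: "vals_le m t \<Longrightarrow> vals_le m s \<Longrightarrow> vals_le m (tree_comp i t s)"
 unfolding tree_comp_eq by (rule vals_le_graft) (auto simp: slot_def)

lemma distinct_mset_upt: "mset xs = mset [0..<n] \<Longrightarrow> distinct xs"
 by (metis distinct_upt mset_eq_imp_distinct_iff)

lemma pcomp_planar:
 fixes n k :: nat
 assumes t: "mset (labels t) = mset [0..<n]" "vals_le m t"
  and s: "mset (labels s) = mset [0..<k]" "vals_le m s" and i: "i < n"
 shows "pcomp i (planar t) (planar s) =
  (fscale (of_int (leg_sign (\<lambda>a. if a = i then tdeg s else 0) t)) (planar (tree_comp i t s)) :: 'k::field forest)"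
proof -
 let ?D = "\<lambda>a. if a = i then tdeg s else 0"
 let ?t = "nform t" and ?s = "nform s"
 have k: "1 \<le> k" using labels_nonempty[OF s(2)] s(1) by (cases k) auto
 have t': "mset (labels ?t) = mset [0..<n]" "vals_le m ?t"
  using t swaps_labels[OF swaps_nform] swaps_vals_le[OF swaps_nform] by auto
 have s': "mset (labels ?s) = mset [0..<k]" "vals_le m ?s" "tdeg ?s = tdeg s" "arity ?s = arity s"
  using s swaps_labels[OF swaps_nform] swaps_vals_le[OF swaps_nform] swaps_degs[OF swaps_nform] by auto
 have i': "i \<in> set (labels ?t)"
  using i mset_eq_setD[OF t'(1)] by simp
 have D: "(\<lambda>a. dg (\<lambda>_. 0) (slot i s a)) = ?D"
  by (auto simp: slot_def fun_eq_iff)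
 have "swaps (\<lambda>_. 0) (nform_sign t * leg_sign ?D t * leg_sign ?D ?t) (tree_comp i t s) (tree_comp i ?t s)"
  using swaps_graft[OF swaps_nform[of t] distinct_mset_upt[OF t(1)], of "\<lambda>_. 0" "slot i s"]
  by (simp only: D tree_comp_eq)
 then have 1: "planar (tree_comp i t s) =
   (fscale (of_int (nform_sign t * leg_sign ?D t * leg_sign ?D ?t)) (planar (tree_comp i ?t s)) :: 'k forest)"
  by (rule planar_swaps[OF _ vals_le_tree_comp[OF t(2) s(2)]])
   (rule distinct_mset_upt[OF mset_labels_tree_comp[OF t(1) s(1) i k]])
 have "swaps (\<lambda>_. 0) (nform_sign s) (tree_comp i ?t s) (tree_comp i ?t ?s)"
  unfolding tree_comp_eq
  by (rule swaps_graft_slot[OF _ _ distinct_mset_upt[OF t'(1)] i'])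
   (auto simp: slot_def s'(4) intro!: swaps_map_tree swaps_nform)
 then have 2: "planar (tree_comp i ?t s) =
   (fscale (of_int (nform_sign s)) (planar (tree_comp i ?t ?s)) :: 'k forest)"
  by (rule planar_swaps[OF _ vals_le_tree_comp[OF t'(2) s(2)]])
   (rule distinct_mset_upt[OF mset_labels_tree_comp[OF t'(1) s(1) i k]])
 have "pcomp i (planar t) (planar s) = (fscale (of_int (nform_sign t * nform_sign s * leg_sign ?D ?t))
   (planar (tree_comp i ?t ?s)) :: 'k forest)"
  unfolding pcomp_def planar_def[of t] planar_def[of s]
  by (simp add: lin_ext_fscale s'(3) leg_sign_single[OF distinct_mset_upt[OF t'(1)] i'] mult.assoc)
 also have "\<dots> = fscale (of_int (leg_sign ?D t)) (planar (tree_comp i t s))"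
  unfolding 1 2 by (simp add: ac_simps of_int_mult[symmetric] del: of_int_mult)
 finally show ?thesis .
qed

lemma relabel_planar:
 assumes "vals_le m t" "mset (labels t) = mset [0..<n]" "\<sigma> permutes {..<n}"
 shows "relabel \<sigma> (planar t) = (planar (map_tree \<sigma> t) :: 'k::field forest)"
proof -
 have "distinct (labels (map_tree \<sigma> t))"
  using distinct_mset_upt[OF assms(2)] permutes_inj_on[OF assms(3)] by (simp add: distinct_map)
 then have "planar (map_tree \<sigma> t) = (fscale (of_int (nform_sign t)) (planar (map_tree \<sigma> (nform t))) :: 'k forest)"
  by (intro planar_swaps[OF swaps_map_tree[OF swaps_nform], of m]) (auto simp: assms)
 then show ?thesis
  by (simp add: relabel_def planar_def[of t] lin_ext_fscale)
qed

lemma planar_in_trees: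
 assumes "vals_le m t" "mset (labels t) = mset [0..<n]"
 shows "planar t \<in> span_on {s \<in> trees m n. tdeg s = tdeg t}"
proof -
 note sw = swaps_nform[of t]
 have "nform t \<in> {s \<in> trees m n. tdeg s = tdeg t}"
  using assms swaps_labels[OF sw] swaps_vals_le[OF sw, of m] swaps_degs(1)[OF sw]
   nform_nform[OF assms(1) distinct_mset_upt[OF assms(2)]]
  by (simp add: trees_def)
 then show ?thesis
  unfolding planar_def by (intro span_on_fscale) simp
qed

section \<open>Relations between decorated trees\<close>

text \<open>Trees whose legs are decorated by elements of a graded set \<open>V\<close> are the terms of an algebra with
 operations of every arity up to \<open>m\<close>. The relators are the axioms of an $L(m)$-algebra, applied at
 any place of a term, together with the relations \<open>LR\<close> between the decorations.\<close>

definition valid :: "enat \<Rightarrow> 'b set \<Rightarrow> 'b tree \<Rightarrow> bool" where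
 "valid m V t \<longleftrightarrow> vals_le m t \<and> set (labels t) \<subseteq> V"

definition jtree :: "nat \<Rightarrow> 'b tree list \<Rightarrow> 'b tree" where
 "jtree i xs = Vert (Vert (take i xs) # drop i xs)"

abbreviation unsh :: "nat \<Rightarrow> (nat \<times> (nat \<Rightarrow> nat)) set" where
 "unsh n \<equiv> SIGMA i:{1..n}. unshuffles i n"

definition jac :: "('b \<Rightarrow> int) \<Rightarrow> 'b tree list \<Rightarrow> ('b tree \<Rightarrow>\<^sub>0 'k::field)" where
 "jac \<delta> ts = (\<Sum>(i, \<sigma>) \<in> unsh (length ts).
   fscale (of_int (chi \<sigma> (map (dg \<delta>) ts) * psign (int (i * (length ts - i)))))
    (gen (jtree i (permute_list \<sigma> ts))))"

inductive relator :: "enat \<Rightarrow> 'b set \<Rightarrow> ('b \<Rightarrow> int) \<Rightarrow> ('b \<Rightarrow>\<^sub>0 'k::field) set \<Rightarrow> ('b tree \<Rightarrow>\<^sub>0 'k) \<Rightarrow> bool"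
 for m V \<delta> LR where
 leaf: "r \<in> LR \<Longrightarrow> relator m V \<delta> LR (lin_ext (\<lambda>b. gen (Leg b)) r)"
| swap: "valid m V s \<Longrightarrow> swaps \<delta> e s s' \<Longrightarrow> relator m V \<delta> LR (gen s - fscale (of_int e) (gen s'))"
| jac: "1 \<le> length ts \<Longrightarrow> enat (length ts) \<le> m \<Longrightarrow> (\<And>t. t \<in> set ts \<Longrightarrow> valid m V t) \<Longrightarrow>
  relator m V \<delta> LR (jac \<delta> ts)"
| ctx: "relator m V \<delta> LR r \<Longrightarrow> enat (length us + length vs + 1) \<le> m \<Longrightarrow>
  (\<And>t. t \<in> set us \<union> set vs \<Longrightarrow> valid m V t) \<Longrightarrow>
  relator m V \<delta> LR (lin_ext (\<lambda>t. gen (Vert (us @ t # vs))) r)"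

definition relations :: "enat \<Rightarrow> 'b set \<Rightarrow> ('b \<Rightarrow> int) \<Rightarrow> ('b \<Rightarrow>\<^sub>0 'k::field) set \<Rightarrow> ('b tree \<Rightarrow>\<^sub>0 'k) set" where
 "relations m V \<delta> LR = free.span (Collect (relator m V \<delta> LR))"

lemma subspace_relations: "free.subspace (relations m V \<delta> LR)"
 by (simp add: relations_def)

lemma relator_in_relations: "relator m V \<delta> LR r \<Longrightarrow> r \<in> relations m V \<delta> LR"
 by (simp add: relations_def free.span_base)

lemma relations_ctx:
 assumes "x \<in> relations m V \<delta> LR" "enat (length us + length vs + 1) \<le> m"
  "\<And>t. t \<in> set us \<union> set vs \<Longrightarrow> valid m V t"
 shows "lin_ext (\<lambda>t. gen (Vert (us @ t # vs))) x \<in> relations m V \<delta> LR"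
 using assms(1)[unfolded relations_def] subspace_relations
proof (rule span_lin_ext)
 fix r assume "r \<in> Collect (relator m V \<delta> LR)"
 then show "lin_ext (\<lambda>t. gen (Vert (us @ t # vs))) r \<in> relations m V \<delta> LR"
  using assms(2,3) by (auto intro!: relator_in_relations relator.ctx)
qed

text \<open>A relation may be grafted into a leg of a tree: the vertices on the path from that leg to the root
are added one by one.\<close>

lemma relations_graft_slot:
 assumes x: "x \<in> relations m V \<delta> LR" and "distinct (labels t)" "i \<in> set (labels t)" "vals_le m t"
  and S: "\<And>a. a \<in> set (labels t) \<Longrightarrow> a \<noteq> i \<Longrightarrow> valid m V (S a)"
 shows "lin_ext (\<lambda>s. gen (graft (S(i := s)) t)) x \<in> relations m V \<delta> LR"
 using assms(2-)
proof (induction t)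
 case (Leg a)
 then show ?case using x by (simp add: lin_ext_id)
next
 case (Vert ts)
 then obtain s where s: "s \<in> set ts" "i \<in> set (labels s)" by auto
 then obtain us vs where ts: "ts = us @ s # vs" by (meson split_list)
 have IH: "lin_ext (\<lambda>u. gen (graft (S(i := u)) s)) x \<in> relations m V \<delta> LR"
  by (rule Vert.IH[OF s(1)]) (use Vert.prems s ts in auto)
 have "graft (S(i := w)) u = graft S u" if "u \<in> set us \<union> set vs" for u w
  using that Vert.prems s ts by (intro graft_cong) auto
 then have m: "map (graft (S(i := w))) us = map (graft S) us" "map (graft (S(i := w))) vs = map (graft S) vs" for w
  by auto
 have "lin_ext (\<lambda>u. gen (Vert (map (graft S) us @ u # map (graft S) vs)))
   (lin_ext (\<lambda>u. gen (graft (S(i := u)) s)) x) \<in> relations m V \<delta> LR"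
 proof (rule relations_ctx[OF IH])
  show "enat (length (map (graft S) us) + length (map (graft S) vs) + 1) \<le> m"
   using Vert.prems(3) by (simp add: ts)
  fix u assume "u \<in> set (map (graft S) us) \<union> set (map (graft S) vs)"
  then obtain v where v: "v \<in> set us \<union> set vs" "u = graft S v" by auto
  have val: "valid m V (S a)" if "a \<in> set (labels v)" for a
  proof (rule Vert.prems(4))
   show "a \<in> set (labels (Vert ts))" using that v(1) by (auto simp: ts)
   have "a \<notin> set (labels s)" using that v(1) Vert.prems(1) by (auto simp: ts)
   with s(2) show "a \<noteq> i" by auto
  qed
  moreover have "vals_le m v" using v(1) Vert.prems(3) by (auto simp: ts)
  ultimately show "valid m V u"
   by (auto simp: v(2) valid_def labels_graft intro!: vals_le_graft)
 qed
 then show ?case by (simp add: lin_ext_comp ts m del: map_eq_conv fun_upd_apply)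
qed

lemma valid_Vert [simp]:
 "valid m V (Vert ts) \<longleftrightarrow> 1 \<le> length ts \<and> enat (length ts) \<le> m \<and> (\<forall>t\<in>set ts. valid m V t)"
 by (auto simp: valid_def)

lemma valid_Leg [simp]: "valid m V (Leg a) \<longleftrightarrow> a \<in> V"
 by (auto simp: valid_def)

lemma valid_swaps: "swaps \<delta> e s s' \<Longrightarrow> valid m V s = valid m V s'"
 using swaps_vals_le[of \<delta> e s s' m] mset_eq_setD[OF swaps_labels[of \<delta> e s s']] by (auto simp: valid_def)

lemma valid_graft:
 "vals_le m t \<Longrightarrow> (\<And>a. a \<in> set (labels t) \<Longrightarrow> valid m V (S a)) \<Longrightarrow> valid m V (graft S t)"
 by (auto simp: valid_def labels_graft intro!: vals_le_graft)

lemma unshD: "(i, \<sigma>) \<in> unsh n \<Longrightarrow> 1 \<le> i \<and> i \<le> n \<and> \<sigma> permutes {..<n}"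
 by (auto simp: unshuffles_def)

lemma finite_unsh: "finite (unsh n)"
 by (rule finite_subset[of _ "{1..n} \<times> {\<sigma>. \<sigma> permutes {..<n}}"])
  (auto simp: unshuffles_def intro: finite_permutations)

lemma jtree_facts:
 assumes "1 \<le> i" "i \<le> length xs"
 shows "tdeg (jtree i xs) = int (length xs) - 3 + sum_list (map tdeg xs)"
  and "dg \<delta> (jtree i xs) = int (length xs) - 3 + sum_list (map (dg \<delta>) xs)"
  and "labels (jtree i xs) = concat (map labels xs)"
proof -
 have s: "sum_list (map f (take i xs)) + sum_list (map f (drop i xs)) = sum_list (map f xs)" for f :: "_ \<Rightarrow> int"
  by (metis append_take_drop_id map_append sum_list_append)
 show "tdeg (jtree i xs) = int (length xs) - 3 + sum_list (map tdeg xs)"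
  using s[of tdeg] assms by (simp add: jtree_def of_nat_diff)
 show "dg \<delta> (jtree i xs) = int (length xs) - 3 + sum_list (map (dg \<delta>) xs)"
  using s[of "dg \<delta>"] assms by (simp add: jtree_def of_nat_diff)
 show "labels (jtree i xs) = concat (map labels xs)"
  by (simp add: jtree_def) (metis append_take_drop_id concat_append map_append)
qed

lemma valid_jtree:
 assumes "1 \<le> i" "i \<le> length xs" "enat (length xs) \<le> m" "\<And>t. t \<in> set xs \<Longrightarrow> valid m V t"
 shows "valid m V (jtree i xs)"
proof -
 have "enat i \<le> m" "enat (Suc (length xs - i)) \<le> m"
  using assms(1-3) by (auto intro: order_trans[OF _ assms(3)])
 then show ?thesis
  using assms(1,2) assms(4)[OF in_set_takeD] assms(4)[OF in_set_dropD]
  by (auto simp: jtree_def min_def)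
qed

lemma map_jtree:
 "map_tree f (jtree i xs) = jtree i (map (map_tree f) xs)"
 "graft S (jtree i ys) = jtree i (map (graft S) ys)"
 by (simp_all add: jtree_def take_map drop_map)

lemma mset_permute_list_map: "\<sigma> permutes {..<length xs} \<Longrightarrow> mset (map f (permute_list \<sigma> xs)) = mset (map f xs)"
 by (simp add: mset_permute_list)

definition leaf_homogeneous :: "'b set \<Rightarrow> ('b \<Rightarrow> int) \<Rightarrow> ('b \<Rightarrow>\<^sub>0 'k::field) set \<Rightarrow> bool" where
 "leaf_homogeneous V \<delta> LR \<longleftrightarrow> (\<forall>r\<in>LR. \<exists>d. r \<in> span_on {b \<in> V. \<delta> b = d})"

lemma relator_homogeneous:
 assumes "relator m V \<delta> LR r" "leaf_homogeneous V \<delta> LR"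
 shows "\<exists>e d n. r \<in> span_on {t. valid m V t \<and> tdeg t = e \<and> dg \<delta> t = d \<and> arity t = n}"
 using assms(1)
proof (induction rule: relator.induct)
 case (leaf r)
 then obtain d where "r \<in> span_on {b \<in> V. \<delta> b = d}"
  using assms(2) by (auto simp: leaf_homogeneous_def)
 then have "lin_ext (\<lambda>b. gen (Leg b)) r \<in>
   span_on {t. valid m V t \<and> tdeg t = 0 \<and> dg \<delta> t = d \<and> arity t = 1}"
  by (intro lin_ext_span_on) (auto dest!: span_on_keysD simp: arity_def)
 then show ?case by blast
next
 case (swap s e s')
 then have "gen s - fscale (of_int e) (gen s') \<in>
   span_on {t. valid m V t \<and> tdeg t = tdeg s \<and> dg \<delta> t = dg \<delta> s \<and> arity t = arity s}"
  using swaps_degs[OF swap(2)] valid_swaps[OF swap(2), of m V]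
  by (intro span_on_diff span_on_fscale) auto
 then show ?case by blast
next
 case (jac ts)
 have "jac \<delta> ts \<in> span_on {t. valid m V t \<and> tdeg t = int (length ts) - 3 + sum_list (map tdeg ts) \<and>
   dg \<delta> t = int (length ts) - 3 + sum_list (map (dg \<delta>) ts) \<and> arity t = length (concat (map labels ts))}"
  unfolding jac_def
 proof (intro span_on_sum, unfold split_beta, intro span_on_fscale)
  fix p assume p: "p \<in> unsh (length ts)"
  obtain i \<sigma> where i\<sigma>: "p = (i, \<sigma>)" by (cases p)
  with p unshD[of i \<sigma> "length ts"] have i: "1 \<le> i" "i \<le> length (permute_list \<sigma> ts)"
   and \<sigma>: "\<sigma> permutes {..<length ts}" by auto
  note mp = mset_permute_list_map[OF \<sigma>]
  have "length (concat (map labels (permute_list \<sigma> ts))) = length (concat (map labels ts))"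
   using mset_eq_length[OF mset_concat_map_cong[of "permute_list \<sigma> ts" ts labels]] \<sigma> by simp
  moreover have "valid m V (jtree i (permute_list \<sigma> ts))"
   using i jac \<sigma> by (intro valid_jtree) auto
  ultimately show "gen (jtree (fst p) (permute_list (snd p) ts)) \<in> span_on {t. valid m V t \<and>
   tdeg t = int (length ts) - 3 + sum_list (map tdeg ts) \<and>
   dg \<delta> t = int (length ts) - 3 + sum_list (map (dg \<delta>) ts) \<and> arity t = length (concat (map labels ts))}"
   using sum_list_map_mset_cong[OF mset_permute_list[OF \<sigma>], of tdeg]
    sum_list_map_mset_cong[OF mset_permute_list[OF \<sigma>], of "dg \<delta>"]
   by (simp add: i\<sigma> jtree_facts[OF i] arity_def)
 qed
 then show ?case by blast
next
 case (ctx r us vs)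
 then obtain e d n where r: "r \<in> span_on {t. valid m V t \<and> tdeg t = e \<and> dg \<delta> t = d \<and> arity t = n}"
  by blast
 let ?c = "int (length us + length vs + 1) - 2"
 have "lin_ext (\<lambda>t. gen (Vert (us @ t # vs))) r \<in> span_on {t. valid m V t \<and>
   tdeg t = ?c + sum_list (map tdeg us) + e + sum_list (map tdeg vs) \<and>
   dg \<delta> t = ?c + sum_list (map (dg \<delta>) us) + d + sum_list (map (dg \<delta>) vs) \<and>
   arity t = length (concat (map labels us)) + n + length (concat (map labels vs))}"
  using ctx.hyps(2,3) r by (intro lin_ext_span_on) (auto dest!: span_on_keysD simp: arity_def)
 then show ?case by blast
qed

lemma relations_diff_memI:
 "y \<in> relations m V \<delta> LR \<Longrightarrow> x - y \<in> relations m V \<delta> LR \<Longrightarrow> x \<in> relations m V \<delta> LR"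
 using subspace_diff_mem_iff[OF subspace_relations] by blast

section \<open>Substitution into elements of the operad\<close>

text \<open>The action of a labelled tree on decorated trees.\<close>

definition subst :: "('b \<Rightarrow> int) \<Rightarrow> 'b tree list \<Rightarrow> nat tree \<Rightarrow> ('b tree \<Rightarrow>\<^sub>0 'k::field)" where
 "subst \<delta> ss t = fscale (of_int (leg_sign (\<lambda>a. dg \<delta> (ss ! a)) t)) (gen (graft ((!) ss) t))"

lemma of_int_psign_square_left [simp]:
 "of_int (psign a) * (of_int (psign a) * b) = (b :: 'k::ring_1)"
 by (simp add: mult.assoc[symmetric] of_int_mult[symmetric] del: of_int_mult)

lemma of_int_leg_sign_square_left [simp]:
 "of_int (leg_sign D t) * (of_int (leg_sign D t) * b) = (b :: 'k::ring_1)"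
 by (simp add: mult.assoc[symmetric] of_int_mult[symmetric] del: of_int_mult)

lemma subst_swaps:
 assumes sw: "swaps (\<lambda>_. 0) e t t'" and t: "vals_le m t" "mset (labels t) = mset [0..<n]"
  and ss: "length ss = n" "\<And>s. s \<in> set ss \<Longrightarrow> valid m V s"
 shows "subst \<delta> ss t - fscale (of_int e) (subst \<delta> ss t') \<in> relations m V \<delta> LR"
proof -
 let ?L = "leg_sign (\<lambda>a. dg \<delta> (ss ! a)) t" and ?L' = "leg_sign (\<lambda>a. dg \<delta> (ss ! a)) t'"
 have "valid m V (graft ((!) ss) t)"
  using t(1) mset_eq_setD[OF t(2)] ss by (intro valid_graft) auto
 then have "gen (graft ((!) ss) t) - fscale (of_int (e * ?L * ?L')) (gen (graft ((!) ss) t')) \<in> relations m V \<delta> LR"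
  using swaps_graft[OF sw distinct_mset_upt[OF t(2)], of \<delta> "(!) ss"]
  by (intro relator_in_relations relator.swap) simp_all
 from free.subspace_scale[OF subspace_relations this, of "of_int ?L"]
 have "fscale (of_int ?L) (gen (graft ((!) ss) t)) - fscale (of_int (?L * (e * ?L * ?L'))) (gen (graft ((!) ss) t')) \<in> relations m V \<delta> LR"
  by (simp only: free.scale_right_diff_distrib free.scale_scale of_int_mult)
 moreover have "?L * (e * ?L * ?L') = e * ?L'" by (simp add: ac_simps)
 ultimately show ?thesis by (simp add: subst_def)
qed

lemma subst_planar:
 assumes t: "vals_le m t" "mset (labels t) = mset [0..<n]"
  and ss: "length ss = n" "\<And>s. s \<in> set ss \<Longrightarrow> valid m V s"
 shows "lin_ext (\<lambda>t. fscale (c (tdeg t)) (subst \<delta> ss t)) (planar t) - fscale (c (tdeg t)) (subst \<delta> ss t)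
  \<in> relations m V \<delta> LR"
proof -
 have "subst \<delta> ss t - fscale (of_int (nform_sign t)) (subst \<delta> ss (nform t)) \<in> relations m V \<delta> LR"
  by (rule subst_swaps[OF swaps_nform t ss])
 from free.subspace_scale[OF subspace_relations subspace_diff_sym[OF subspace_relations this], of "c (tdeg t)"]
 show ?thesis
  by (simp add: planar_def lin_ext_fscale free.scale_right_diff_distrib mult.commute
    swaps_degs(1)[OF swaps_nform, symmetric])
qed

lemma leg_sign_map_mono:
 assumes "distinct (labels t)"
  and "\<And>a b. a \<in> set (labels t) \<Longrightarrow> b \<in> set (labels t) \<Longrightarrow> a < b \<Longrightarrow> f a < f b"
 shows "leg_sign D (map_tree f t) = leg_sign (\<lambda>a. D (f a)) t"
 unfolding leg_sign_def word_map_tree pair_prod_map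
proof (rule pair_prod_cong[OF sorted_wrt_word[OF assms(1)]])
 fix x y assume xy: "x \<in> set (word t)" "y \<in> set (word t)" "\<forall>a. x = Inr a \<longrightarrow> y \<noteq> Inr a"
 show "iv D (map_sum id f x) (map_sum id f y) = iv (\<lambda>a. D (f a)) x y"
 proof (cases "\<exists>a b. x = Inr a \<and> y = Inr b")
  case True
  then obtain a b where ab: "x = Inr a" "y = Inr b" by blast
  with xy have "a \<in> set (labels t)" "b \<in> set (labels t)" "a \<noteq> b" by (auto simp: Inr_word_iff)
  then have "f b < f a \<longleftrightarrow> b < a" using assms(2)[of a b] assms(2)[of b a] by (auto simp: neq_iff)
  then show ?thesis by (simp add: ab)
 next
  case False
  then show ?thesis by (cases x; cases y) auto
 qed
qed

lemma leg_sign_jtree_Leg: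
 assumes "1 \<le> i" "i \<le> n" "\<sigma> permutes {..<n}"
 shows "leg_sign D (jtree i (map (\<lambda>p. Leg (\<sigma> p)) [0..<n])) = koszul \<sigma> (map D [0..<n])"
proof -
 let ?t = "jtree i (map Leg [0..<n])"
 have l: "labels ?t = [0..<n]"
  using assms by (subst jtree_facts) (simp_all add: comp_def)
 have "leg_sign E ?t = 1" for E
 proof -
  have w: "word ?t = [Inl (int (Suc (n - i)) - 2), Inl (int i - 2)] @ map Inr [0..<n]"
  proof -
   have "concat (map (word \<circ> Leg) xs) = map Inr xs" for xs :: "nat list" by (induction xs) auto
   moreover have "map Inr (take i [0..<n]) @ map Inr (drop i [0..<n]) = (map Inr [0..<n] :: (int + nat) list)"
    by (metis append_take_drop_id map_append)
   ultimately show ?thesis using assms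
    by (simp add: jtree_def take_map drop_map min_def del: take_upt drop_upt)
  qed
  have "prod_list (map (iv E (Inl d)) xs) = 1" for d xs by (induction xs) simp_all
  then have "leg_sign E ?t = pair_prod (iv E) (map Inr [0..<n])"
   unfolding leg_sign_def w by (simp del: map_map)
  also have "\<dots> = 1"
   unfolding pair_prod_map by (rule pair_prod_1[of "(<)"]) auto
  finally show ?thesis .
 qed
 then show ?thesis
  using leg_sign_map_tree[of ?t n \<sigma> D] l assms(3) by (simp add: map_jtree comp_def)
qed

lemma jacobi_eq:
 "jacobi n = (\<Sum>(i, \<sigma>) \<in> unsh n. fscale (of_int (sign \<sigma> * psign (int (i * (n - i)))))
   (planar (jtree i (map (\<lambda>p. Leg (\<sigma> p)) [0..<n]))))"
 unfolding jacobi_def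
 by (rule sum.cong) (auto simp: jtree_def take_map drop_map min_def)

lemma pcomp_span_on:
 assumes "x \<in> span_on (trees m n)" "y \<in> span_on (trees m k)" "i < n"
 shows "pcomp i x y \<in> span_on (trees m (n + k - 1))"
 unfolding pcomp_def
proof (intro lin_ext_span_on span_on_fscale)
 fix t s assume "t \<in> supp x" "s \<in> supp y"
 then have t: "vals_le m t" "mset (labels t) = mset [0..<n]" and s: "vals_le m s" "mset (labels s) = mset [0..<k]"
  using assms(1,2) by (auto simp: trees_def dest!: span_on_keysD)
 have "1 \<le> k" using labels_nonempty[OF s(1)] s(2) by (cases k) auto
 then show "planar (tree_comp i t s) \<in> span_on (trees m (n + k - 1))"
  using mset_labels_tree_comp[OF t(2) s(2) assms(3)] vals_le_tree_comp[OF t(1) s(1)]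
  by (intro span_on_mono[OF _ planar_in_trees[of m]]) auto
qed

lemma in_ideal_span_on: "in_ideal m n x \<Longrightarrow> x \<in> span_on (trees m n)"
proof (induction rule: in_ideal.induct)
 case (jacobi n)
 show ?case
  unfolding jacobi_eq
 proof (intro span_on_sum, unfold split_beta, intro span_on_fscale)
  fix p assume p: "p \<in> unsh n"
  obtain i \<sigma> where i\<sigma>: "p = (i, \<sigma>)" by (cases p)
  with p unshD[of i \<sigma> n] have i: "1 \<le> i" "i \<le> n" and \<sigma>: "\<sigma> permutes {..<n}" by auto
  have "valid m UNIV (jtree i (map (\<lambda>p. Leg (\<sigma> p)) [0..<n]))"
   using i jacobi by (intro valid_jtree) auto
  moreover have "labels (jtree i (map (\<lambda>p. Leg (\<sigma> p)) [0..<n])) = map \<sigma> [0..<n]"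
   using i by (subst jtree_facts) (simp_all add: comp_def)
  ultimately show "planar (jtree (fst p) (map (\<lambda>q. Leg (snd p q)) [0..<n])) \<in> span_on (trees m n)"
   using mset_map_permutes_upt[OF \<sigma>] unfolding i\<sigma> fst_conv snd_conv
   by (intro span_on_mono[OF _ planar_in_trees]) (auto simp: valid_def)
 qed
next
 case (relabel n x \<sigma>)
 have "planar (map_tree \<sigma> t) \<in> span_on (trees m n)" if "t \<in> supp x" for t
 proof -
  have t: "vals_le m t" "mset (labels t) = mset [0..<n]"
   using span_on_keysD[OF relabel.IH that] by (auto simp: trees_def)
  have "mset (map \<sigma> (labels t)) = mset (map \<sigma> [0..<n])" using t(2) by simp
  also have "\<dots> = mset [0..<n]" by (rule mset_map_permutes_upt[OF relabel.hyps(2)])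
  finally show ?thesis
   using t(1) by (intro span_on_mono[OF _ planar_in_trees[of m]]) auto
 qed
 then show ?case unfolding relabel_def by (rule lin_ext_span_on)
next
 case (comp_left n x y k i)
 show ?case by (rule pcomp_span_on[OF comp_left.IH comp_left.hyps(2,3)])
next
 case (comp_right x n k y i)
 show ?case by (rule pcomp_span_on[OF comp_right.hyps(1) comp_right.IH comp_right.hyps(3)])
qed (auto intro: span_on_add span_on_fscale)

lemma upt_split: "i < n \<Longrightarrow> [0..<n] = [0..<i] @ i # [Suc i..<n]"
 by (metis append_Cons append_Nil le_add_same_cancel1 less_imp_le_nat upt_add_eq_append upt_conv_Cons
   le_iff_add zero_le)

lemma tdeg_tree_comp:
 assumes "mset (labels t) = mset [0..<n]" "i < n"
 shows "tdeg (tree_comp i t s) = tdeg t + tdeg s"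
proof -
 have "sum_list (map (\<lambda>a. tdeg (slot i s a)) (labels t)) = sum_list (map (\<lambda>a. tdeg (slot i s a)) [0..<n])"
  by (rule sum_list_map_mset_cong[OF assms(1)])
 also have "\<dots> = tdeg s"
 proof -
  have "sum_list (map (\<lambda>a. tdeg (slot i s a)) xs) = 0" if "i \<notin> set xs" for xs
   using that by (induction xs) (auto simp: slot_def)
  then show ?thesis by (simp add: upt_split[OF assms(2)] slot_def[of i s i])
 qed
 finally show ?thesis by (simp add: tree_comp_eq tdeg_graft)
qed

text \<open>Substituting into a partial composite amounts to substituting first into the inner tree and
 then the result into the outer one.\<close>

lemma subst_tree_comp:
 fixes \<delta> :: "'b \<Rightarrow> int"
 assumes t: "mset (labels t) = mset [0..<n]" and s: "mset (labels s) = mset [0..<k]" and i: "i < n" and k: "1 \<le> k"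
  and ss: "length ss = n + k - 1"
 defines "ss' \<equiv> take i ss @ graft (\<lambda>b. ss ! (b + i)) s # drop (i + k) ss"
 shows "leg_sign (\<lambda>a. dg \<delta> (ss ! a)) (tree_comp i t s) =
   psign (tdeg s * right_deg i t) * leg_sign (\<lambda>b. dg \<delta> (ss ! (b + i))) s *
   psign (sum_list (map (\<lambda>a. dg \<delta> (ss ! a)) [0..<i]) * tdeg s) *
   leg_sign (\<lambda>a. dg \<delta> (ss' ! a)) t"
  and "graft ((!) ss) (tree_comp i t s) = graft ((!) ss') t"
proof -
 let ?D = "\<lambda>a. dg \<delta> (ss ! a)"
 let ?S = "slot i s"
 have ar: "arity s = k" using arg_cong[OF s, of size] by (simp add: arity_def)
 have lt: "distinct (labels t)" "set (labels t) = {..<n}"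
  using distinct_mset_upt[OF t] mset_eq_setD[OF t] by (auto simp: lessThan_atLeast0)
 have ls: "distinct (labels s)" "set (labels s) = {..<k}"
  using distinct_mset_upt[OF s] mset_eq_setD[OF s] by (auto simp: lessThan_atLeast0)
 have nth: "ss' ! a = (if a < i then ss ! a else if a = i then graft (\<lambda>b. ss ! (b + i)) s else ss ! (a + k - 1))"
  if "a < n" for a
  using that i k ss by (auto simp: ss'_def nth_append nth_Cons' min_def not_less) (simp add: algebra_simps)?
 have srt: "sort (labels t) = [0..<n]"
  by (metis properties_for_sort sorted_upt t)
 have "leg_sign ?D (tree_comp i t s) =
  leg_sign (\<lambda>a. dg ?D (?S a)) t * leg_sign (\<lambda>a. tdeg (?S a)) t *
  prod_list (map (\<lambda>a. leg_sign ?D (?S a)) (labels t)) *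
  pair_prod (\<lambda>a b. psign (ldeg ?D (?S a) * tdeg (?S b))) (sort (labels t))"
  unfolding tree_comp_eq
 proof (rule leg_sign_graft[OF lt(1)])
  fix a b x y assume ab: "a < b" "x \<in> set (labels (?S a))" "y \<in> set (labels (?S b))"
  have rng: "c < i \<and> z = c \<or> c = i \<and> i \<le> z \<and> z < i + k \<or> i < c \<and> z = c + k - 1"
   if "z \<in> set (labels (?S c))" for c z
  proof (cases "c = i")
   case True
   then have "z \<in> (\<lambda>b. b + i) ` {..<k}" using that ls(2) by (simp add: slot_def)
   then show ?thesis using True by auto
  next
   case False
   then show ?thesis using that by (cases "c < i") (simp_all add: slot_def ar)
  qed
  from rng[OF ab(2)] rng[OF ab(3)] have "x < y" using k ab(1) by linarith
  then show "x < y \<or> ?D x * ?D y = 0" ..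
 qed
 also have "leg_sign (\<lambda>a. dg ?D (?S a)) t = leg_sign (\<lambda>a. dg \<delta> (ss' ! a)) t"
 proof (rule leg_sign_cong)
  fix a assume "a \<in> set (labels t)"
  then have "a < n" using lt by simp
  then show "dg ?D (?S a) = dg \<delta> (ss' ! a)"
   by (simp add: nth slot_def ar dg_graft)
 qed
 also have "leg_sign (\<lambda>a. tdeg (?S a)) t = psign (tdeg s * right_deg i t)"
 proof -
  have "(\<lambda>a. tdeg (?S a)) = (\<lambda>a. if a = i then tdeg s else 0)"
   by (auto simp: slot_def fun_eq_iff)
  then show ?thesis using leg_sign_single[OF lt(1), of i "tdeg s"] i lt(2) by simp
 qed
 also have "prod_list (map (\<lambda>a. leg_sign ?D (?S a)) (labels t)) = leg_sign (\<lambda>b. dg \<delta> (ss ! (b + i))) s"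
 proof -
  have one: "prod_list (map (\<lambda>a. leg_sign ?D (?S a)) xs) = 1" if "i \<notin> set xs" for xs
   using that by (induction xs) (auto simp: slot_def)
  have "prod_list (map (\<lambda>a. leg_sign ?D (?S a)) (labels t)) = prod_list (map (\<lambda>a. leg_sign ?D (?S a)) [0..<n])"
   by (rule prod_list_mset_cong[OF t])
  also have "\<dots> = leg_sign ?D (map_tree (\<lambda>b. b + i) s)"
   by (simp add: upt_split[OF i] one slot_def[of i s i])
  also have "\<dots> = leg_sign (\<lambda>b. dg \<delta> (ss ! (b + i))) s"
   by (rule leg_sign_map_mono[OF ls(1)]) simp
  finally show ?thesis .
 qed
 also have "pair_prod (\<lambda>a b. psign (ldeg ?D (?S a) * tdeg (?S b))) (sort (labels t)) =
   psign (sum_list (map ?D [0..<i]) * tdeg s)"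
 proof -
  let ?f = "\<lambda>a b. psign (ldeg ?D (?S a) * tdeg (?S b))"
  have td: "tdeg (?S b) = 0" if "b \<noteq> i" for b using that by (simp add: slot_def)
  have one: "prod_list (map (?f a) xs) = 1" if "i \<notin> set xs" for a xs
   using that by (induction xs) (auto simp: td)
  have pp: "pair_prod ?f xs = 1" if "i \<notin> set xs" for xs
   using that by (induction xs) (auto simp: one)
  have "cross ?f xs (i # ys) = psign (sum_list (map ?D xs) * tdeg s)" if "\<forall>x\<in>set xs. x < i" "i \<notin> set ys" for xs ys
   using that
  proof (induction xs)
   case (Cons x xs)
   then have "?f x i = psign (?D x * tdeg s)" by (simp add: slot_def ldeg_def)
   with Cons show ?case by (simp add: one psign_add distrib_right)
  qed simp
  then show ?thesis
   unfolding srt upt_split[OF i] by (simp add: pair_prod_append pp one)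
 qed
 finally show "leg_sign ?D (tree_comp i t s) =
   psign (tdeg s * right_deg i t) * leg_sign (\<lambda>b. dg \<delta> (ss ! (b + i))) s *
   psign (sum_list (map ?D [0..<i]) * tdeg s) * leg_sign (\<lambda>a. dg \<delta> (ss' ! a)) t"
  by (simp only: ac_simps)
 show "graft ((!) ss) (tree_comp i t s) = graft ((!) ss') t"
  unfolding tree_comp_eq graft_graft
 proof (rule graft_cong)
  fix a assume "a \<in> set (labels t)"
  then have "a < n" using lt by simp
  then show "graft ((!) ss) (?S a) = ss' ! a"
   by (simp add: nth slot_def ar graft_map_tree)
 qed
qed

lemma subst_map_tree:
 assumes t: "mset (labels t) = mset [0..<n]" and \<sigma>: "\<sigma> permutes {..<n}" and ss: "length ss = n"
 shows "(subst \<delta> ss (map_tree \<sigma> t) :: 'b tree \<Rightarrow>\<^sub>0 'k::field) =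
  fscale (of_int (koszul \<sigma> (map (\<lambda>a. dg \<delta> (ss ! a)) [0..<n]))) (subst \<delta> (permute_list \<sigma> ss) t)"
proof -
 have nth: "permute_list \<sigma> ss ! a = ss ! \<sigma> a" if "a \<in> set (labels t)" for a
  using that mset_eq_setD[OF t] \<sigma> ss by (intro permute_list_nth) auto
 have "graft ((!) ss) (map_tree \<sigma> t) = graft ((!) (permute_list \<sigma> ss)) t"
  unfolding graft_map_tree by (rule graft_cong) (simp add: nth)
 moreover have "leg_sign (\<lambda>a. dg \<delta> (ss ! \<sigma> a)) t = leg_sign (\<lambda>a. dg \<delta> (permute_list \<sigma> ss ! a)) t"
  by (rule leg_sign_cong) (simp add: nth)
 ultimately show ?thesis
  by (simp add: subst_def leg_sign_map_tree[OF t \<sigma>])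
qed

text \<open>Elements of the operadic ideal act trivially on decorated trees. The weight \<open>c\<close> by the degree of the
tree is needed in the induction: in a composite, the sign of an inner tree depends on its degree.\<close>

lemma subst_ideal:
 fixes x :: "'k::field forest"
 assumes "in_ideal m n x" "length ss = n" "\<And>s. s \<in> set ss \<Longrightarrow> valid m V s"
 shows "lin_ext (\<lambda>t. fscale (c (tdeg t)) (subst \<delta> ss t)) x \<in> relations m V \<delta> LR"
 using assms
proof (induction arbitrary: ss c rule: in_ideal.induct)
 case (jacobi n)
 let ?N = "relations m V \<delta> LR"
 let ?F = "\<lambda>t. fscale (c (tdeg t)) (subst \<delta> ss t)"
 let ?j = "\<lambda>i \<sigma>. jtree i (map (\<lambda>p. Leg (\<sigma> p)) [0..<n])"
 let ?c = "\<lambda>i \<sigma>. of_int (sign \<sigma> * psign (int (i * (n - i)))) :: 'k"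
 have "lin_ext ?F (jacobi n) = (\<Sum>p \<in> unsh n. fscale (?c (fst p) (snd p)) (lin_ext ?F (planar (?j (fst p) (snd p)))))"
  unfolding jacobi_eq split_beta by (simp add: lin_ext_sum lin_ext_fscale)
 moreover have "fscale (c (int n - 3)) (jac \<delta> ss) =
   (\<Sum>p \<in> unsh n. fscale (?c (fst p) (snd p)) (?F (?j (fst p) (snd p))))"
  unfolding jac_def split_beta free.scale_sum_right jacobi.prems(1)
 proof (rule sum.cong[OF refl])
  fix p assume p: "p \<in> unsh n"
  obtain i \<sigma> where i\<sigma>: "p = (i, \<sigma>)" by (cases p)
  with p unshD[of i \<sigma> n] have i: "1 \<le> i" "i \<le> n" and \<sigma>: "\<sigma> permutes {..<n}" by auto
  have td: "tdeg (?j i \<sigma>) = int n - 3"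
   using i by (subst jtree_facts) (simp_all add: comp_def)
  have g: "graft ((!) ss) (?j i \<sigma>) = jtree i (permute_list \<sigma> ss)"
   by (simp add: map_jtree permute_list_def comp_def jacobi.prems(1))
  have "map (dg \<delta>) ss = map (\<lambda>a. dg \<delta> (ss ! a)) [0..<n]"
   using jacobi.prems(1) by (intro nth_equalityI) auto
  then show "fscale (c (int n - 3)) (fscale (of_int (chi (snd p) (map (dg \<delta>) ss) * psign (int (fst p * (n - fst p)))))
     (gen (jtree (fst p) (permute_list (snd p) ss)))) = fscale (?c (fst p) (snd p)) (?F (?j (fst p) (snd p)))"
   by (simp add: i\<sigma> subst_def td g leg_sign_jtree_Leg[OF i \<sigma>] chi_def mult_ac)
 qed
 moreover have D: "(\<Sum>p \<in> unsh n. fscale (?c (fst p) (snd p)) (lin_ext ?F (planar (?j (fst p) (snd p))))) -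
   (\<Sum>p \<in> unsh n. fscale (?c (fst p) (snd p)) (?F (?j (fst p) (snd p)))) \<in> ?N"
  unfolding sum_subtractf[symmetric]
 proof (intro free.subspace_sum subspace_relations subspace_scale_diff)
  fix p assume p: "p \<in> unsh n"
  obtain i \<sigma> where i\<sigma>: "p = (i, \<sigma>)" by (cases p)
  with p unshD[of i \<sigma> n] have i: "1 \<le> i" "i \<le> n" and \<sigma>: "\<sigma> permutes {..<n}" by auto
  have "valid m UNIV (?j i \<sigma>)"
   using i jacobi.hyps by (intro valid_jtree) auto
  moreover have "labels (?j i \<sigma>) = map \<sigma> [0..<n]"
   using i by (subst jtree_facts) (simp_all add: comp_def)
  ultimately show "lin_ext ?F (planar (?j (fst p) (snd p))) - ?F (?j (fst p) (snd p)) \<in> ?N"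
   unfolding i\<sigma> fst_conv snd_conv using mset_map_permutes_upt[OF \<sigma>] jacobi.prems
   by (intro subst_planar[of m _ n]) (auto simp: valid_def)
 qed
 moreover have J: "fscale (c (int n - 3)) (jac \<delta> ss) \<in> ?N"
  using jacobi by (intro free.subspace_scale subspace_relations relator_in_relations relator.jac) auto
 ultimately show ?case
  by (auto intro: relations_diff_memI[OF J] simp only:)
next
 case (zero n)
 then show ?case by (simp add: free.subspace_0 subspace_relations)
next
 case (add n x y)
 then show ?case by (simp add: lin_ext_add free.subspace_add subspace_relations)
next
 case (scale n x a)
 then show ?case by (simp add: lin_ext_fscale free.subspace_scale subspace_relations)
next
 case (relabel n x \<sigma>)
 let ?N = "relations m V \<delta> LR"
 let ?F = "\<lambda>ss t. fscale (c (tdeg t)) (subst \<delta> ss t)"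
 let ?k = "of_int (koszul \<sigma> (map (\<lambda>a. dg \<delta> (ss ! a)) [0..<n])) :: 'k"
 note \<sigma> = relabel.hyps(2)
 have ss': "length (permute_list \<sigma> ss) = n" "\<And>s. s \<in> set (permute_list \<sigma> ss) \<Longrightarrow> valid m V s"
  using relabel.prems \<sigma> by simp_all
 have "fscale ?k (lin_ext (?F (permute_list \<sigma> ss)) x) \<in> ?N"
  by (intro free.subspace_scale subspace_relations relabel.IH ss')
 moreover have "lin_ext (?F ss) (relabel \<sigma> x) - fscale ?k (lin_ext (?F (permute_list \<sigma> ss)) x) \<in> ?N"
  unfolding relabel_def lin_ext_comp lin_ext_fun_fscale[symmetric]
 proof (rule subspace_lin_ext_diff[OF subspace_relations])
  fix t assume "t \<in> supp x"
  then have t: "vals_le m t" "mset (labels t) = mset [0..<n]"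
   using span_on_keysD[OF in_ideal_span_on[OF relabel.hyps(1)]] by (auto simp: trees_def)
  have st: "mset (labels (map_tree \<sigma> t)) = mset [0..<n]"
   using t(2) mset_map_permutes_upt[OF \<sigma>] by simp
  have "lin_ext (?F ss) (planar (map_tree \<sigma> t)) - fscale (c (tdeg (map_tree \<sigma> t))) (subst \<delta> ss (map_tree \<sigma> t)) \<in> ?N"
   using t(1) by (intro subst_planar[OF _ st] relabel.prems) simp
  moreover have "subst \<delta> ss (map_tree \<sigma> t) = fscale ?k (subst \<delta> (permute_list \<sigma> ss) t)"
   by (rule subst_map_tree[OF t(2) \<sigma> relabel.prems(1)])
  ultimately show "lin_ext (?F ss) (planar (map_tree \<sigma> t)) - fscale ?k (?F (permute_list \<sigma> ss) t) \<in> ?N"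
   by (simp add: mult.commute)
 qed
 ultimately show ?case by (rule relations_diff_memI)
next
 case (comp_left n x y k i)
 let ?N = "relations m V \<delta> LR"
 let ?F = "\<lambda>ss t. fscale (c (tdeg t)) (subst \<delta> ss t)"
 let ?p = "\<lambda>t s. of_int (psign (tdeg s * right_deg i t)) :: 'k"
 have "lin_ext (?F ss) (pcomp i x y) =
   lin_ext (\<lambda>s. lin_ext (\<lambda>t. fscale (?p t s) (lin_ext (?F ss) (planar (tree_comp i t s)))) x) y"
  unfolding pcomp_def lin_ext_comp lin_ext_fscale
  by (rule lin_ext_swap[of "\<lambda>t s. fscale (?p t s) (lin_ext (?F ss) (planar (tree_comp i t s)))"])
 also have "\<dots> \<in> ?N"
 proof (rule subspace_lin_ext[OF subspace_relations])
  fix s assume "s \<in> supp y"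
  then have s: "vals_le m s" "mset (labels s) = mset [0..<k]"
   using span_on_keysD[OF comp_left.hyps(2)] by (auto simp: trees_def)
  have k: "1 \<le> k" using labels_nonempty[OF s(1)] s(2) by (cases k) auto
  let ?ss = "take i ss @ graft (\<lambda>b. ss ! (b + i)) s # drop (i + k) ss"
  let ?q = "of_int (leg_sign (\<lambda>b. dg \<delta> (ss ! (b + i))) s *
   psign (sum_list (map (\<lambda>a. dg \<delta> (ss ! a)) [0..<i]) * tdeg s)) :: 'k"
  have ss': "length ?ss = n" using comp_left.prems(1) comp_left.hyps(3) k by simp
  have vs: "valid m V (graft (\<lambda>b. ss ! (b + i)) s)"
  proof (rule valid_graft[OF s(1)])
   fix a assume "a \<in> set (labels s)"
   then have "a < k" using mset_eq_setD[OF s(2)] by simp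
   then have "a + i < length ss" using comp_left.hyps(3) comp_left.prems(1) by simp
   then show "valid m V (ss ! (a + i))" by (intro comp_left.prems(2)) simp
  qed
  have vss: "valid m V u" if "u \<in> set ?ss" for u
   using that vs comp_left.prems(2) by (auto dest: in_set_takeD in_set_dropD)
  have "lin_ext (\<lambda>t. fscale (?q * c (tdeg t + tdeg s)) (subst \<delta> ?ss t)) x \<in> ?N"
   by (rule comp_left.IH[OF ss' vss])
  moreover have "lin_ext (\<lambda>t. fscale (?p t s) (lin_ext (?F ss) (planar (tree_comp i t s)))) x -
    lin_ext (\<lambda>t. fscale (?q * c (tdeg t + tdeg s)) (subst \<delta> ?ss t)) x \<in> ?N"
  proof (rule subspace_lin_ext_diff[OF subspace_relations])
   fix t assume "t \<in> supp x"
   then have t: "vals_le m t" "mset (labels t) = mset [0..<n]"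
    using span_on_keysD[OF in_ideal_span_on[OF comp_left.hyps(1)]] by (auto simp: trees_def)
   note st = subst_tree_comp[OF t(2) s(2) comp_left.hyps(3) k comp_left.prems(1)]
   have td: "tdeg (tree_comp i t s) = tdeg t + tdeg s"
    by (rule tdeg_tree_comp[OF t(2) comp_left.hyps(3)])
   have "lin_ext (?F ss) (planar (tree_comp i t s)) - ?F ss (tree_comp i t s) \<in> ?N"
    using mset_labels_tree_comp[OF t(2) s(2) comp_left.hyps(3) k] comp_left.prems
    by (intro subst_planar vals_le_tree_comp t s) auto
   from subspace_scale_diff[OF subspace_relations this, of "?p t s"]
   show "fscale (?p t s) (lin_ext (?F ss) (planar (tree_comp i t s))) -
    fscale (?q * c (tdeg t + tdeg s)) (subst \<delta> ?ss t) \<in> ?N"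
    unfolding td by (simp add: subst_def st mult_ac)
  qed
  ultimately show "lin_ext (\<lambda>t. fscale (?p t s) (lin_ext (?F ss) (planar (tree_comp i t s)))) x \<in> ?N"
   by (rule relations_diff_memI)
 qed
 finally show ?case .
next
 case (comp_right x n k y i)
 let ?N = "relations m V \<delta> LR"
 let ?F = "\<lambda>ss t. fscale (c (tdeg t)) (subst \<delta> ss t)"
 let ?p = "\<lambda>t s. of_int (psign (tdeg s * right_deg i t)) :: 'k"
 have "lin_ext (?F ss) (pcomp i x y) =
   lin_ext (\<lambda>t. lin_ext (\<lambda>s. fscale (?p t s) (lin_ext (?F ss) (planar (tree_comp i t s)))) y) x"
  unfolding pcomp_def lin_ext_comp lin_ext_fscale ..
 also have "\<dots> \<in> ?N"
 proof (rule subspace_lin_ext[OF subspace_relations])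
  fix t assume "t \<in> supp x"
  then have t: "vals_le m t" "mset (labels t) = mset [0..<n]"
   using span_on_keysD[OF comp_right.hyps(1)] by (auto simp: trees_def)
  let ?z = "\<lambda>s. lin_ext (\<lambda>s. fscale (?p t s) (lin_ext (?F ss) (planar (tree_comp i t s)))) y"
  show "lin_ext (\<lambda>s. fscale (?p t s) (lin_ext (?F ss) (planar (tree_comp i t s)))) y \<in> ?N"
  proof (cases "k = 0")
   case True
   \<comment> \<open>Every vertex has an input, so there are no trees without legs.\<close>
   have "trees m 0 = {}"
    using labels_nonempty by (auto simp: trees_def)
   then have "supp y = {}"
    using in_ideal_span_on[OF comp_right.hyps(2)] True by (simp add: span_on_def)
   then show ?thesis by (simp add: free.subspace_0 subspace_relations)
  next
   case False
   then have k: "1 \<le> k" by simp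
   define ms where "ms = take k (drop i ss)"
   define S where "S = (\<lambda>a. if a < i then ss ! a else ss ! (a + k - 1))"
   define E where "E = sum_list (map (dg \<delta>) ms)"
   define L where "L = (\<lambda>e. leg_sign (\<lambda>a. if a = i then e + E else dg \<delta> (S a)) t)"
   \<comment> \<open>The sign of the inner tree in the composite depends on its degree only, and becomes a weight.\<close>
   define c' where "c' = (\<lambda>e. c (tdeg t + e) * of_int (L e) *
    of_int (psign (sum_list (map (\<lambda>a. dg \<delta> (ss ! a)) [0..<i]) * e)))"
   have ms: "length ms = k" "\<And>b. b < k \<Longrightarrow> ms ! b = ss ! (b + i)" "\<And>s. s \<in> set ms \<Longrightarrow> valid m V s"
    using comp_right.prems comp_right.hyps(3)
    by (auto simp: ms_def add.commute dest: in_set_takeD in_set_dropD)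
   have "lin_ext (\<lambda>s. fscale (c' (tdeg s)) (subst \<delta> ms s)) y \<in> ?N"
    using ms by (intro comp_right.IH) auto
   then have "lin_ext (\<lambda>s. gen (graft (S(i := s)) t)) (lin_ext (\<lambda>s. fscale (c' (tdeg s)) (subst \<delta> ms s)) y) \<in> ?N"
   proof (rule relations_graft_slot)
    show "distinct (labels t)" "vals_le m t" using t distinct_mset_upt by auto
    show "i \<in> set (labels t)" using comp_right.hyps(3) mset_eq_setD[OF t(2)] by simp
    fix a assume "a \<in> set (labels t)" "a \<noteq> i"
    then have "a < n" using mset_eq_setD[OF t(2)] by simp
    then show "valid m V (S a)"
     unfolding S_def using k comp_right.prems(1) comp_right.hyps(3)
     by (auto intro!: comp_right.prems(2) nth_mem)
   qed
   moreover have "lin_ext (\<lambda>s. fscale (?p t s) (lin_ext (?F ss) (planar (tree_comp i t s)))) y -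
     lin_ext (\<lambda>s. gen (graft (S(i := s)) t)) (lin_ext (\<lambda>s. fscale (c' (tdeg s)) (subst \<delta> ms s)) y) \<in> ?N"
    unfolding lin_ext_comp
   proof (rule subspace_lin_ext_diff[OF subspace_relations])
    fix s assume "s \<in> supp y"
    then have s: "vals_le m s" "mset (labels s) = mset [0..<k]"
     using span_on_keysD[OF in_ideal_span_on[OF comp_right.hyps(2)]] by (auto simp: trees_def)
    let ?ss = "take i ss @ graft (\<lambda>b. ss ! (b + i)) s # drop (i + k) ss"
    note st = subst_tree_comp[OF t(2) s(2) comp_right.hyps(3) k comp_right.prems(1)]
    have td: "tdeg (tree_comp i t s) = tdeg t + tdeg s"
     by (rule tdeg_tree_comp[OF t(2) comp_right.hyps(3)])
    have nth: "?ss ! a = (S(i := graft ((!) ms) s)) a" if "a \<in> set (labels t)" for a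
    proof -
     have "a < n" using that mset_eq_setD[OF t(2)] by simp
     moreover have "graft (\<lambda>b. ss ! (b + i)) s = graft ((!) ms) s"
      using mset_eq_setD[OF s(2)] by (intro graft_cong) (simp add: ms(2))
     ultimately show ?thesis
      using comp_right.prems(1) comp_right.hyps(3) k
      by (auto simp: S_def nth_append nth_Cons' min_def) (simp add: algebra_simps)?
    qed
    have g: "graft ((!) ?ss) t = graft (S(i := graft ((!) ms) s)) t"
     by (rule graft_cong) (rule nth)
    have dgs: "dg \<delta> (graft ((!) ms) s) = tdeg s + E"
    proof -
     have "ldeg (\<lambda>a. dg \<delta> (ms ! a)) s = sum_list (map (\<lambda>a. dg \<delta> (ms ! a)) [0..<k])"
      unfolding ldeg_def by (rule sum_list_map_mset_cong[OF s(2)])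
     also have "map (\<lambda>a. dg \<delta> (ms ! a)) [0..<k] = map (dg \<delta>) ms"
      using ms(1) by (intro nth_equalityI) auto
     finally show ?thesis by (simp add: dg_graft dg_def[of _ s] E_def)
    qed
    have l1: "leg_sign (\<lambda>a. dg \<delta> (?ss ! a)) t = L (tdeg s)"
     unfolding L_def by (rule leg_sign_cong) (simp add: nth dgs)
    have l2: "leg_sign (\<lambda>b. dg \<delta> (ss ! (b + i))) s = leg_sign (\<lambda>b. dg \<delta> (ms ! b)) s"
     using mset_eq_setD[OF s(2)] by (intro leg_sign_cong) (simp add: ms(2))
    have "lin_ext (?F ss) (planar (tree_comp i t s)) - ?F ss (tree_comp i t s) \<in> ?N"
     using mset_labels_tree_comp[OF t(2) s(2) comp_right.hyps(3) k] comp_right.prems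
     by (intro subst_planar vals_le_tree_comp t s) auto
    from subspace_scale_diff[OF subspace_relations this, of "?p t s"]
    show "fscale (?p t s) (lin_ext (?F ss) (planar (tree_comp i t s))) -
     lin_ext (\<lambda>s. gen (graft (S(i := s)) t)) (fscale (c' (tdeg s)) (subst \<delta> ms s)) \<in> ?N"
     unfolding td
     by (simp add: subst_def st(1) st(2)[unfolded g] l1 l2 c'_def lin_ext_fscale mult_ac)
   qed
   ultimately show ?thesis by (rule relations_diff_memI)
  qed
 qed
 finally show ?case .
qed

section \<open>Multilinear extension of vertices\<close>

text \<open>The elementary tensor of a list of vectors, as a combination of lists of basis elements.\<close>

fun tuples :: "('a \<Rightarrow>\<^sub>0 'k::field) list \<Rightarrow> ('a list \<Rightarrow>\<^sub>0 'k)" where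
 "tuples [] = gen []"
| "tuples (x # xs) = lin_ext (\<lambda>a. lin_ext (\<lambda>as. gen (a # as)) (tuples xs)) x"

lemma tuples_append:
 "tuples (xs @ ys) = lin_ext (\<lambda>as. lin_ext (\<lambda>bs. gen (as @ bs)) (tuples ys)) (tuples xs)"
 by (induction xs) (simp_all add: lin_ext_comp lin_ext_id)

lemma tuples_gens: "tuples (map gen ts) = gen ts"
 by (induction ts) simp_all

lemma append_tensors_tuples: "append_tensors xs = lin_ext (\<lambda>as. gen (concat as)) (tuples xs)"
proof (induction xs)
 case (Cons x xs)
 have "append_tensors (x # xs) = lin_ext (\<lambda>u. lin_ext (\<lambda>w. gen (u @ w)) (append_tensors xs)) x"
  by (simp add: append_tensors_def)
 also have "\<dots> = lin_ext (\<lambda>as. gen (concat as)) (tuples (x # xs))"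
  by (simp add: Cons lin_ext_comp)
 finally show ?case .
qed (simp add: append_tensors_def)

lemma lookup_lin_ext: "coord (lin_ext g x) b =
  (\<Sum>a\<in>supp x. coord x a * coord (g a) b)"
 by (simp add: lin_ext_def lookup_sum)

lemma lookup_lin_ext_inj:
 assumes "f a0 = b" "\<And>a. a \<in> supp x \<Longrightarrow> f a = b \<Longrightarrow> a = a0"
 shows "coord (lin_ext (\<lambda>a. gen (f a)) x) b = coord x a0"
proof -
 have "coord (lin_ext (\<lambda>a. gen (f a)) x) b =
   (\<Sum>a\<in>supp x. if a = a0 then coord x a else 0)"
  unfolding lookup_lin_ext
 proof (rule sum.cong[OF refl])
  fix a assume "a \<in> supp x"
  with assms have "f a = b \<longleftrightarrow> a = a0" by blast
  then show "coord x a * coord (gen (f a)) b =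
    (if a = a0 then coord x a else 0)"
   by (simp add: lookup_single)
 qed
 then show ?thesis by (simp add: in_keys_iff)
qed

lemma lookup_lin_ext_outside:
 assumes "\<And>a. a \<in> supp x \<Longrightarrow> f a \<noteq> b"
 shows "coord (lin_ext (\<lambda>a. gen (f a)) x) b = 0"
 unfolding lookup_lin_ext
proof (intro sum.neutral ballI)
 fix a assume "a \<in> supp x"
 from assms[OF this] show "coord x a * coord (gen (f a)) b = 0"
  by (simp add: lookup_single)
qed

lemma keys_tuples:
 assumes "as \<in> supp (tuples xs)"
 shows "list_all2 (\<lambda>a x. a \<in> supp x) as xs"
 using assms
proof (induction xs arbitrary: as)
 case (Cons x xs)
 have "tuples (x # xs) \<in> span_on {b # bs | b bs. b \<in> supp x \<and> bs \<in> supp (tuples xs)}"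
  unfolding tuples.simps by (intro lin_ext_span_on) auto
 from span_on_keysD[OF this Cons.prems] show ?case using Cons.IH by auto
qed simp

lemma length_keys_tuples: "as \<in> supp (tuples xs) \<Longrightarrow> length as = length xs"
 by (auto dest: keys_tuples list_all2_lengthD)

lemma lookup_tuples:
 assumes "length as = length xs"
 shows "coord (tuples xs) as = (\<Prod>i<length xs. coord (xs ! i) (as ! i))"
 using assms
proof (induction xs arbitrary: as)
 case (Cons x xs)
 then obtain b bs where as: "as = b # bs" "length bs = length xs" by (cases as) auto
 have "coord (lin_ext (\<lambda>as. gen (a # as)) (tuples xs)) (b # bs) =
   (if a = b then coord (tuples xs) bs else 0)" for a
  by (auto intro!: lookup_lin_ext_inj lookup_lin_ext_outside)
 then have "coord (tuples (x # xs)) as =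
   (\<Sum>a\<in>supp x. if a = b then coord x a * coord (tuples xs) bs else 0)"
  unfolding as tuples.simps lookup_lin_ext[of _ x] by (intro sum.cong) auto
 also have "\<dots> = coord x b * coord (tuples xs) bs"
  by (simp add: in_keys_iff)
 finally show ?case
  unfolding length_Cons prod.lessThan_Suc_shift by (simp add: Cons.IH[OF as(2)] as(1))
qed simp

lemma tuples_permute:
 assumes \<sigma>: "\<sigma> permutes {..<length xs}"
 shows "tuples (permute_list \<sigma> xs) = lin_ext (\<lambda>as. gen (permute_list \<sigma> as)) (tuples xs)"
proof (rule poly_mapping_eqI)
 fix bs :: "'a list"
 let ?n = "length xs"
 show "coord (tuples (permute_list \<sigma> xs)) bs =
   coord (lin_ext (\<lambda>as. gen (permute_list \<sigma> as)) (tuples xs)) bs"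
 proof (cases "length bs = ?n")
  case False
  then have "bs \<notin> supp (tuples (permute_list \<sigma> xs))"
   by (auto dest: length_keys_tuples)
  moreover have "coord (lin_ext (\<lambda>as. gen (permute_list \<sigma> as)) (tuples xs)) bs = 0"
   by (rule lookup_lin_ext_outside) (use False in \<open>auto dest: length_keys_tuples\<close>)
  ultimately show ?thesis by (simp add: in_keys_iff)
 next
  case True
  let ?i = "inv_into UNIV \<sigma>"
  let ?as = "permute_list ?i bs"
  have i: "?i permutes {..<?n}" by (rule permutes_inv[OF \<sigma>])
  have "permute_list \<sigma> ?as = bs"
   using permute_list_compose[of \<sigma> bs ?i] \<sigma> by (simp add: True permutes_inv_o)
  moreover have "as = ?as" if "as \<in> supp (tuples xs)" "permute_list \<sigma> as = bs" for as
   using permute_list_compose[of ?i as \<sigma>] i length_keys_tuples[OF that(1)]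
   by (simp add: permutes_inv_o[OF \<sigma>] that(2)[symmetric])
  ultimately have "coord (lin_ext (\<lambda>as. gen (permute_list \<sigma> as)) (tuples xs)) bs =
    coord (tuples xs) ?as"
   by (rule lookup_lin_ext_inj)
  also have "\<dots> = (\<Prod>j<?n. coord (xs ! j) (bs ! ?i j))"
   by (simp add: lookup_tuples True) (rule prod.cong, use i True in \<open>auto simp: permute_list_nth\<close>)
  also have "\<dots> = (\<Prod>j<?n. coord (xs ! \<sigma> j) (bs ! ?i (\<sigma> j)))"
   by (rule prod.permute[OF \<sigma>, unfolded comp_def])
  also have "\<dots> = coord (tuples (permute_list \<sigma> xs)) bs"
   by (simp add: lookup_tuples True permutes_inverses[OF \<sigma>])
    (rule prod.cong, use \<sigma> in \<open>auto simp: permute_list_nth\<close>)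
  finally show ?thesis ..
 qed
qed

definition vert :: "('b tree \<Rightarrow>\<^sub>0 'k::field) list \<Rightarrow> ('b tree \<Rightarrow>\<^sub>0 'k)" where
 "vert xs = lin_ext (\<lambda>ts. gen (Vert ts)) (tuples xs)"

lemma vert_gens: "vert (map gen ts) = gen (Vert ts)"
 by (simp add: vert_def tuples_gens)

lemma vert_slot:
 "vert (us @ x # vs) =
  lin_ext (\<lambda>as. lin_ext (\<lambda>bs. lin_ext (\<lambda>t. gen (Vert (as @ t # bs))) x) (tuples vs)) (tuples us)"
proof -
 have "vert (us @ x # vs) =
   lin_ext (\<lambda>as. lin_ext (\<lambda>t. lin_ext (\<lambda>bs. gen (Vert (as @ t # bs))) (tuples vs)) x) (tuples us)"
  by (simp add: vert_def tuples_append lin_ext_comp)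
 also have "\<dots> = lin_ext (\<lambda>as. lin_ext (\<lambda>bs. lin_ext (\<lambda>t. gen (Vert (as @ t # bs))) x) (tuples vs)) (tuples us)"
 proof (rule lin_ext_cong)
  fix as
  show "lin_ext (\<lambda>t. lin_ext (\<lambda>bs. gen (Vert (as @ t # bs))) (tuples vs)) x =
    lin_ext (\<lambda>bs. lin_ext (\<lambda>t. gen (Vert (as @ t # bs))) x) (tuples vs)"
   by (rule lin_ext_swap[of "\<lambda>t bs. gen (Vert (as @ t # bs))"])
 qed
 finally show ?thesis .
qed

lemma vert_linear:
 "vert (us @ (fscale c x + y) # vs) = fscale c (vert (us @ x # vs)) + vert (us @ y # vs)"
 by (simp add: vert_slot lin_ext_add lin_ext_fscale lin_ext_fun_add lin_ext_fun_fscale)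

lemma vert_diff: "vert (us @ (x - y) # vs) = vert (us @ x # vs) - vert (us @ y # vs)"
 using vert_linear[of us "-1" y x vs] by simp

lemma keys_tuples_valid:
 assumes "as \<in> supp (tuples xs)" "\<And>x. x \<in> set xs \<Longrightarrow> x \<in> span_on {t. P t}" "t \<in> set as"
 shows "P t"
proof -
 obtain i where i: "i < length as" "t = as ! i" using assms(3) by (auto simp: in_set_conv_nth)
 with keys_tuples[OF assms(1)] have "t \<in> supp (xs ! i)" "i < length xs"
  by (auto simp: list_all2_conv_all_nth)
 then show ?thesis using assms(2)[of "xs ! i"] by (auto dest: span_on_keysD)
qed

lemma vert_slot_relations:
 assumes "x \<in> relations m V \<delta> LR" "enat (length us + length vs + 1) \<le> m"
  "\<And>u. u \<in> set us \<union> set vs \<Longrightarrow> u \<in> span_on {t. valid m V t}"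
 shows "vert (us @ x # vs) \<in> relations m V \<delta> LR"
 unfolding vert_slot
proof (rule subspace_lin_ext[OF subspace_relations], rule subspace_lin_ext[OF subspace_relations])
 fix as bs assume *: "as \<in> supp (tuples us)" "bs \<in> supp (tuples vs)"
 show "lin_ext (\<lambda>t. gen (Vert (as @ t # bs))) x \<in> relations m V \<delta> LR"
 proof (rule relations_ctx[OF assms(1)])
  show "enat (length as + length bs + 1) \<le> m"
   using assms(2) * by (simp add: length_keys_tuples)
  show "valid m V t" if "t \<in> set as \<union> set bs" for t
   using that keys_tuples_valid[OF *(1), of "valid m V" t] keys_tuples_valid[OF *(2), of "valid m V" t] assms(3)
   by auto
 qed
qed

lemma vert_relations_cong_append:
 assumes "list_all2 (\<lambda>x y. x - y \<in> relations m V \<delta> LR) xs ys" "enat (length us + length xs) \<le> m"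
  "\<And>u. u \<in> set us \<union> set xs \<union> set ys \<Longrightarrow> u \<in> span_on {t. valid m V t}"
 shows "vert (us @ xs) - vert (us @ ys) \<in> relations m V \<delta> LR"
 using assms
proof (induction xs arbitrary: us ys)
 case Nil
 then show ?case by (simp add: free.subspace_0 subspace_relations)
next
 case (Cons x xs us yys)
 then obtain y ys where yys: "yys = y # ys" and hyps: "x - y \<in> relations m V \<delta> LR"
  "list_all2 (\<lambda>x y. x - y \<in> relations m V \<delta> LR) xs ys"
  by (auto simp: list_all2_Cons1)
 have "vert (us @ (x - y) # xs) \<in> relations m V \<delta> LR"
  by (rule vert_slot_relations[OF hyps(1)]) (use Cons.prems yys in auto)
 moreover have "vert ((us @ [y]) @ xs) - vert ((us @ [y]) @ ys) \<in> relations m V \<delta> LR"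
  by (rule Cons.IH[OF hyps(2)]) (use Cons.prems yys in auto)
 ultimately show ?case
  using subspace_diff_trans[OF subspace_relations, of "vert (us @ x # xs)" "vert (us @ y # xs)"]
  by (simp add: vert_diff yys)
qed

lemma vert_relations_cong:
 assumes "list_all2 (\<lambda>x y. x - y \<in> relations m V \<delta> LR) xs ys" "enat (length xs) \<le> m"
  "\<And>u. u \<in> set xs \<union> set ys \<Longrightarrow> u \<in> span_on {t. valid m V t}"
 shows "vert xs - vert ys \<in> relations m V \<delta> LR"
 using vert_relations_cong_append[of m V \<delta> LR xs ys "[]"] assms by simp

lemma lin_ext_relations:
 assumes "\<And>a. a \<in> supp x \<Longrightarrow> g a \<in> relations m V \<delta> LR"
 shows "lin_ext g x \<in> relations m V \<delta> LR"
 by (rule subspace_lin_ext[OF subspace_relations assms])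

lemma sort_key_permutation:
 assumes \<sigma>: "\<sigma> permutes {..<n}"
 shows "sort_key \<sigma> [0..<n] = map (inv_into UNIV \<sigma>) [0..<n]"
proof (rule sort_key_inj_key_eq)
 show "mset [0..<n] = mset (map (inv_into UNIV \<sigma>) [0..<n])"
  by (simp only: mset_map_permutes_upt[OF permutes_inv[OF \<sigma>]])
 show "inj_on \<sigma> (set [0..<n])" by (rule permutes_inj_on[OF \<sigma>])
 have "map \<sigma> (map (inv_into UNIV \<sigma>) [0..<n]) = [0..<n]"
  by (simp add: comp_def permutes_inverses[OF \<sigma>])
 then show "sorted (map \<sigma> (map (inv_into UNIV \<sigma>) [0..<n]))" by simp
qed

text \<open>A permutation of the children is a sequence of adjacent exchanges; sorting the positions by \<open>\<sigma>\<close>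
performs one exchange for each inversion of \<open>\<sigma>\<close>.\<close>

lemma swaps_permute:
 assumes \<sigma>: "\<sigma> permutes {..<length ts}"
 shows "swaps \<delta> (chi \<sigma> (map (dg \<delta>) ts)) (Vert (permute_list \<sigma> ts)) (Vert ts)"
proof -
 let ?n = "length ts" and ?f = "\<lambda>p. ts ! \<sigma> p"
 have "swaps \<delta> (pair_prod (swap_factor \<delta> \<sigma> ?f) [0..<?n]) (Vert (map ?f [0..<?n]))
   (Vert (map ?f (sort_key \<sigma> [0..<?n])))"
  using swaps_sort[of \<delta> \<sigma> ?f "[0..<?n]" "[]"] by simp
 moreover have "map ?f [0..<?n] = permute_list \<sigma> ts" by (simp add: permute_list_def)
 moreover have "map ?f (sort_key \<sigma> [0..<?n]) = ts"
  by (rule nth_equalityI) (simp_all add: sort_key_permutation[OF \<sigma>] permutes_inverses[OF \<sigma>])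
 moreover have "pair_prod (swap_factor \<delta> \<sigma> ?f) [0..<?n] = chi \<sigma> (map (dg \<delta>) ts)"
 proof -
  have "chi \<sigma> (map (dg \<delta>) ts) = pair_prod (\<lambda>p q. if \<sigma> q < \<sigma> p
    then - psign (map (dg \<delta>) ts ! \<sigma> p * map (dg \<delta>) ts ! \<sigma> q) else 1) [0..<?n]"
   using chi_pair_prod[of \<sigma> "map (dg \<delta>) ts"] \<sigma> by simp
  also have "\<dots> = pair_prod (swap_factor \<delta> \<sigma> ?f) [0..<?n]"
  proof (rule pair_prod_cong[of "(<)"])
   fix p q assume "p \<in> set [0..<?n]" "q \<in> set [0..<?n]"
   then have "\<sigma> p < ?n" "\<sigma> q < ?n" using permutes_in_image[OF \<sigma>] by auto
   then show "(if \<sigma> q < \<sigma> p then - psign (map (dg \<delta>) ts ! \<sigma> p * map (dg \<delta>) ts ! \<sigma> q) else 1) =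
     swap_factor \<delta> \<sigma> ?f p q"
    by (simp add: swap_factor_def)
  qed simp
  finally show ?thesis ..
 qed
 ultimately show ?thesis by simp
qed

lemma map_keys_tuples:
 assumes "as \<in> supp (tuples xs)"
  "list_all2 (\<lambda>x d. x \<in> span_on {t. valid m V t \<and> dg \<delta> t = d}) xs ds"
 shows "map (dg \<delta>) as = ds" "\<And>t. t \<in> set as \<Longrightarrow> valid m V t" "length as = length xs" "length ds = length xs"
proof -
 note k = keys_tuples[OF assms(1)]
 show l: "length as = length xs" "length ds = length xs"
  using k assms(2) by (simp_all add: list_all2_lengthD)
 have *: "valid m V (as ! i) \<and> dg \<delta> (as ! i) = ds ! i" if "i < length as" for i
  using that k assms(2) l by (auto simp: list_all2_conv_all_nth dest!: span_on_keysD)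
 show "map (dg \<delta>) as = ds"
  using l * by (intro nth_equalityI) auto
 show "valid m V t" if "t \<in> set as" for t
  using that * by (auto simp: in_set_conv_nth)
qed

lemma vert_permute:
 assumes xs: "list_all2 (\<lambda>x d. x \<in> span_on {t. valid m V t \<and> dg \<delta> t = d}) xs ds"
  and "1 \<le> length xs" "enat (length xs) \<le> m" and \<sigma>: "\<sigma> permutes {..<length xs}"
 shows "vert (permute_list \<sigma> xs) - fscale (of_int (chi \<sigma> ds)) (vert xs) \<in> relations m V \<delta> LR"
 unfolding vert_def tuples_permute[OF \<sigma>] lin_ext_comp lin_ext_gen lin_ext_fun_fscale[symmetric] lin_ext_fun_diff[symmetric]
proof (rule lin_ext_relations)
 fix as assume as: "as \<in> supp (tuples xs)"
 note k = map_keys_tuples[OF as xs]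
 have "swaps \<delta> (chi \<sigma> (map (dg \<delta>) as)) (Vert (permute_list \<sigma> as)) (Vert as)"
  using \<sigma> k(3) by (intro swaps_permute) simp
 then show "gen (Vert (permute_list \<sigma> as)) - fscale (of_int (chi \<sigma> ds)) (gen (Vert as)) \<in> relations m V \<delta> LR"
  unfolding k(1) using k \<sigma> assms(2,3) by (intro relator_in_relations relator.swap) auto
qed

lemma vert_vert: "vert (vert us # vs) = lin_ext (\<lambda>ts. gen (jtree (length us) ts)) (tuples (us @ vs))"
proof -
 have "vert (vert us # vs) = lin_ext (\<lambda>as. lin_ext (\<lambda>bs. gen (Vert (Vert as # bs))) (tuples vs)) (tuples us)"
  by (simp add: vert_def lin_ext_comp)
 also have "\<dots> = lin_ext (\<lambda>as. lin_ext (\<lambda>bs. gen (jtree (length us) (as @ bs))) (tuples vs)) (tuples us)"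
  by (intro lin_ext_cong) (simp add: jtree_def length_keys_tuples)
 finally show ?thesis by (simp add: tuples_append lin_ext_comp)
qed

lemma vert_jacobi:
 assumes xs: "list_all2 (\<lambda>x d. x \<in> span_on {t. valid m V t \<and> dg \<delta> t = d}) xs ds"
  and "1 \<le> length xs" "enat (length xs) \<le> m"
 shows "(\<Sum>(i, \<sigma>) \<in> unsh (length xs). fscale (of_int (chi \<sigma> ds * psign (int (i * (length xs - i)))))
  (vert (vert (take i (permute_list \<sigma> xs)) # drop i (permute_list \<sigma> xs)))) \<in> relations m V \<delta> LR"
proof -
 have "(\<Sum>(i, \<sigma>) \<in> unsh (length xs). fscale (of_int (chi \<sigma> ds * psign (int (i * (length xs - i)))))
   (vert (vert (take i (permute_list \<sigma> xs)) # drop i (permute_list \<sigma> xs)))) =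
  lin_ext (jac \<delta>) (tuples xs)"
 proof -
  have "(\<Sum>(i, \<sigma>) \<in> unsh (length xs). fscale (of_int (chi \<sigma> ds * psign (int (i * (length xs - i)))))
    (vert (vert (take i (permute_list \<sigma> xs)) # drop i (permute_list \<sigma> xs)))) =
   (\<Sum>p \<in> unsh (length xs). lin_ext (\<lambda>ts. fscale (of_int (chi (snd p) ds * psign (int (fst p * (length xs - fst p)))))
     (gen (jtree (fst p) (permute_list (snd p) ts)))) (tuples xs))"
  proof (rule sum.cong[OF refl], clarify)
   fix i \<sigma> assume "i \<in> {1..length xs}" "\<sigma> \<in> unshuffles i (length xs)"
   with unshD[of i \<sigma> "length xs"] have i: "1 \<le> i" "i \<le> length xs" and \<sigma>: "\<sigma> permutes {..<length xs}" by auto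
   have "vert (vert (take i (permute_list \<sigma> xs)) # drop i (permute_list \<sigma> xs)) =
     lin_ext (\<lambda>ts. gen (jtree i ts)) (tuples (permute_list \<sigma> xs))"
    using i by (simp add: vert_vert min_def)
   then show "fscale (of_int (chi \<sigma> ds * psign (int (i * (length xs - i)))))
     (vert (vert (take i (permute_list \<sigma> xs)) # drop i (permute_list \<sigma> xs))) =
    lin_ext (\<lambda>ts. fscale (of_int (chi (snd (i, \<sigma>)) ds * psign (int (fst (i, \<sigma>) * (length xs - fst (i, \<sigma>))))))
     (gen (jtree (fst (i, \<sigma>)) (permute_list (snd (i, \<sigma>)) ts)))) (tuples xs)"
    by (simp only: tuples_permute[OF \<sigma>] lin_ext_comp lin_ext_gen lin_ext_fun_fscale fst_conv snd_conv)
  qed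
  also have "\<dots> = lin_ext (jac \<delta>) (tuples xs)"
   unfolding lin_ext_fun_sum[symmetric]
   by (rule lin_ext_cong) (simp add: jac_def map_keys_tuples[OF _ xs] split_beta)
  finally show ?thesis .
 qed
 moreover have "lin_ext (jac \<delta>) (tuples xs) \<in> relations m V \<delta> LR"
  by (rule lin_ext_relations) (use assms map_keys_tuples[OF _ xs] in \<open>auto intro!: relator_in_relations relator.jac\<close>)
 ultimately show ?thesis by simp
qed

section \<open>Reduction to admissible trees\<close>

lemma unshuffles_full:
 assumes "\<sigma> \<in> unshuffles n n"
 shows "\<sigma> = id"
proof -
 have \<sigma>: "\<sigma> permutes {..<n}" "strict_mono_on {..<n} \<sigma>" using assms by (auto simp: unshuffles_def)
 have "sorted (map \<sigma> [0..<n])"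
  using \<sigma>(2) by (auto simp: sorted_iff_nth_mono strict_mono_on_def le_less)
 then have "map \<sigma> [0..<n] = [0..<n]"
  using mset_map_permutes_upt[OF \<sigma>(1)] by (metis properties_for_sort sorted_upt)
 then have "\<sigma> i = i" if "i < n" for i
  using that by (metis add_0 diff_zero length_upt nth_map nth_upt)
 then show ?thesis
  using permutes_not_in[OF \<sigma>(1)] by (metis eq_id_iff lessThan_iff)
qed

abbreviation reducible :: "enat \<Rightarrow> 'b set \<Rightarrow> ('b \<Rightarrow> int) \<Rightarrow> ('b \<Rightarrow>\<^sub>0 'k::field) set \<Rightarrow> 'b tree \<Rightarrow> bool" where
 "reducible m V \<delta> LR t \<equiv>
  \<exists>x \<in> span_on {s. valid m V s \<and> admissible s \<and> mset (labels s) = mset (labels t)}.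
   gen t - x \<in> relations m V \<delta> LR"

lemma reducible_refl: "valid m V t \<Longrightarrow> admissible t \<Longrightarrow> reducible m V \<delta> LR t"
 by (rule bexI[of _ "gen t"]) (auto simp: free.subspace_0 subspace_relations)

text \<open>The Jacobi identity moves a unary vertex towards the inputs: all other summands either have no
 unary vertex at this place or have it one level further up, and at an input vertex it may stay.\<close>

lemma reducible_unary:
 fixes LR :: "('b \<Rightarrow>\<^sub>0 'k::field) set"
 assumes "1 \<le> m" "valid m V t" "admissible t"
 shows "reducible m V \<delta> LR (Vert [t])"
 using assms(2,3)
proof (induction t)
 case (Leg a)
 then show ?case using assms(1) by (intro reducible_refl) (auto simp: one_enat_def)
next
 case (Vert ts)
 let ?n = "length ts" and ?N = "relations m V \<delta> LR"
 let ?A = "{s. valid m V s \<and> admissible s \<and> mset (labels s) = mset (labels (Vert [Vert ts]))}"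
 have n: "1 \<le> ?n" "enat ?n \<le> m" and val: "\<And>t. t \<in> set ts \<Longrightarrow> valid m V t"
  using Vert.prems by auto
 have red: "\<exists>x \<in> span_on ?A. gen (jtree (fst p) (permute_list (snd p) ts)) - x \<in> ?N"
  if p: "p \<in> unsh ?n - {(?n, id)}" for p
 proof -
  obtain i \<sigma> where i\<sigma>: "p = (i, \<sigma>)" by (cases p)
  with p have i: "1 \<le> i" "i \<le> ?n" "i \<noteq> ?n" and \<sigma>: "\<sigma> permutes {..<?n}"
   using unshD[of i \<sigma> ?n] unshuffles_full[of \<sigma> ?n] by auto
  let ?ys = "permute_list \<sigma> ts"
  have ys: "set ?ys = set ts" "length ?ys = ?n" using \<sigma> by auto
  have lab: "mset (labels (jtree i ?ys)) = mset (labels (Vert [Vert ts]))"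
   using i mset_concat_map_cong[of ?ys ts labels] \<sigma> by (simp add: jtree_facts)
  have vj: "valid m V (jtree i ?ys)"
   using i n val ys by (intro valid_jtree) auto
  have adm: "admissible u" if "u \<in> set ts" for u using Vert.prems that by auto
  show ?thesis
  proof (cases "i = 1")
   case False
   have "admissible (jtree i ?ys)"
    using i False adm ys by (auto simp: jtree_def dest!: in_set_takeD in_set_dropD)
   then show ?thesis using lab vj
    by (intro bexI[of _ "gen (jtree i ?ys)"]) (auto simp: i\<sigma> free.subspace_0 subspace_relations)
  next
   case True
   obtain y zs where yz: "?ys = y # zs" using ys i by (cases ?ys) auto
   have y: "y \<in> set ts" "\<And>z. z \<in> set zs \<Longrightarrow> z \<in> set ts" using ys(1) yz by auto
   obtain x where x: "x \<in> span_on {s. valid m V s \<and> admissible s \<and> mset (labels s) = mset (labels (Vert [y]))}"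
    "gen (Vert [y]) - x \<in> ?N"
    using Vert.IH[OF y(1) val[OF y(1)] adm[OF y(1)]] by blast
   have len: "Suc (length zs) = ?n" using arg_cong[OF yz, of length] ys(2) by simp
   let ?g = "\<lambda>s. gen (Vert (s # zs))"
   have "lin_ext ?g (gen (Vert [y]) - x) \<in> ?N"
    using relations_ctx[OF x(2), of "[]" zs] n(2) val y(2) by (simp add: len)
   then have "gen (jtree i ?ys) - lin_ext ?g x \<in> ?N"
    by (simp add: lin_ext_diff jtree_def True yz)
   moreover have "lin_ext ?g x \<in> span_on ?A"
   proof (rule lin_ext_span_on)
    fix s assume "s \<in> supp x"
    then have s: "valid m V s" "admissible s" "mset (labels s) = mset (labels y)"
     using span_on_keysD[OF x(1)] by auto
    have "mset (labels (Vert (s # zs))) = mset (labels (jtree i ?ys))"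
     using s(3) by (simp add: jtree_def True yz)
    then show "?g s \<in> span_on ?A"
     using s y val adm len i n lab by auto
   qed
   ultimately show ?thesis by (auto simp: i\<sigma>)
  qed
 qed
 then have "\<exists>h. \<forall>p \<in> unsh ?n - {(?n, id)}. h p \<in> span_on ?A \<and>
   gen (jtree (fst p) (permute_list (snd p) ts)) - h p \<in> ?N"
  by (intro bchoice) blast
 then obtain h where hh: "\<forall>p \<in> unsh ?n - {(?n, id)}. h p \<in> span_on ?A \<and>
   gen (jtree (fst p) (permute_list (snd p) ts)) - h p \<in> ?N"
  by (rule exE)
 note h = bspec[OF hh]
 let ?c = "\<lambda>p. of_int (chi (snd p) (map (dg \<delta>) ts) * psign (int (fst p * (?n - fst p)))) :: 'k"
 let ?j = "\<lambda>p. gen (jtree (fst p) (permute_list (snd p) ts)) :: 'b tree \<Rightarrow>\<^sub>0 'k"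
 have top: "(?n, id) \<in> unsh ?n"
  using n by (auto simp: unshuffles_def permutes_id strict_mono_on_def)
 have chi_id: "chi id (map (dg \<delta>) ts) = 1"
  unfolding chi_pair_prod[of id "map (dg \<delta>) ts", OF permutes_id] by (rule pair_prod_1[of "(<)"]) auto
 have "jac \<delta> ts = (\<Sum>p\<in>unsh ?n. fscale (?c p) (?j p))"
  by (simp add: jac_def split_beta)
 also have "\<dots> = gen (Vert [Vert ts]) + (\<Sum>p\<in>unsh ?n - {(?n, id)}. fscale (?c p) (?j p))"
  unfolding sum.remove[OF finite_unsh top] by (simp add: chi_id jtree_def)
 finally have J: "jac \<delta> ts = gen (Vert [Vert ts]) + (\<Sum>p\<in>unsh ?n - {(?n, id)}. fscale (?c p) (?j p))" .
 have "jac \<delta> ts \<in> ?N"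
  using n val by (intro relator_in_relations relator.jac) auto
 moreover have "(\<Sum>p\<in>unsh ?n - {(?n, id)}. fscale (?c p) (?j p)) -
   (\<Sum>p\<in>unsh ?n - {(?n, id)}. fscale (?c p) (h p)) \<in> ?N"
  unfolding sum_subtractf[symmetric]
  by (intro free.subspace_sum subspace_relations subspace_scale_diff) (rule conjunct2[OF h])
 ultimately have "jac \<delta> ts - ((\<Sum>p\<in>unsh ?n - {(?n, id)}. fscale (?c p) (?j p)) -
   (\<Sum>p\<in>unsh ?n - {(?n, id)}. fscale (?c p) (h p))) \<in> ?N"
  by (rule free.subspace_diff[OF subspace_relations])
 then have "gen (Vert [Vert ts]) - (- (\<Sum>p\<in>unsh ?n - {(?n, id)}. fscale (?c p) (h p))) \<in> ?N"
  by (simp add: J)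
 moreover have "- (\<Sum>p\<in>unsh ?n - {(?n, id)}. fscale (?c p) (h p)) \<in> span_on ?A"
  by (intro free.subspace_neg subspace_span_on span_on_sum span_on_fscale) (rule conjunct1[OF h])
 ultimately show ?case by (intro bexI)
qed

text \<open>Induction from the inputs to the root: once the children of a vertex are admissible, the vertex is
either not unary, or it is moved towards the inputs.\<close>

lemma reducible_valid:
 fixes LR :: "('b \<Rightarrow>\<^sub>0 'k::field) set"
 assumes "1 \<le> m" "valid m V t"
 shows "reducible m V \<delta> LR t"
 using assms(2)
proof (induction t)
 case (Leg a)
 then show ?case by (intro reducible_refl) auto
next
 case (Vert ts)
 let ?N = "relations m V \<delta> LR"
 have "\<exists>h. \<forall>t\<in>set ts. h t \<in> span_on {s. valid m V s \<and> admissible s \<and> mset (labels s) = mset (labels t)} \<and>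
   gen t - h t \<in> ?N"
  using Vert by (intro bchoice) auto
 then obtain h where h: "\<And>t. t \<in> set ts \<Longrightarrow>
   h t \<in> span_on {s. valid m V s \<and> admissible s \<and> mset (labels s) = mset (labels t)}"
  "\<And>t. t \<in> set ts \<Longrightarrow> gen t - h t \<in> ?N"
  by blast
 have h': "h t \<in> span_on {s. valid m V s}" if "t \<in> set ts" for t
  by (rule span_on_mono[OF _ h(1)[OF that]]) auto
 have "vert (map gen ts) - vert (map h ts) \<in> ?N"
  by (rule vert_relations_cong) (use h h' Vert.prems in \<open>auto simp: list_all2_conv_all_nth\<close>)
 then have 1: "gen (Vert ts) - lin_ext (\<lambda>ss. gen (Vert ss)) (tuples (map h ts)) \<in> ?N"
  by (simp only: vert_gens) (simp add: vert_def)
 have "\<exists>x \<in> span_on {s. valid m V s \<and> admissible s \<and> mset (labels s) = mset (labels (Vert ts))}.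
   gen (Vert ss) - x \<in> ?N" if ss: "ss \<in> supp (tuples (map h ts))" for ss
 proof -
  note k = keys_tuples[OF ss]
  have len: "length ss = length ts" using list_all2_lengthD[OF k] by simp
  have s: "valid m V (ss ! i) \<and> admissible (ss ! i) \<and> mset (labels (ss ! i)) = mset (labels (ts ! i))"
   if "i < length ts" for i
   using that k h(1)[of "ts ! i"] len by (auto simp: list_all2_conv_all_nth dest!: span_on_keysD)
  have all: "valid m V u \<and> admissible u" if "u \<in> set ss" for u
   using that s len by (auto simp: in_set_conv_nth)
  have "map (\<lambda>t. mset (labels t)) ss = map (\<lambda>t. mset (labels t)) ts"
   using s len by (intro nth_equalityI) auto
  then have lab: "mset (labels (Vert ss)) = mset (labels (Vert ts))"
   by (simp add: mset_concat comp_def)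
  have v: "valid m V (Vert ss)" using all len Vert.prems by auto
  show ?thesis
  proof (cases "length ts = 1")
   case True
   then obtain u where u: "ss = [u]" using len by (cases ss) auto
   then show ?thesis using reducible_unary[OF assms(1), of V u \<delta> LR] all[of u] lab by simp
  next
   case False
   then have "admissible (Vert ss)" using all len by auto
   then show ?thesis using reducible_refl[OF v, of \<delta> LR] lab by simp
  qed
 qed
 then have "\<exists>g. \<forall>ss \<in> supp (tuples (map h ts)).
   g ss \<in> span_on {s. valid m V s \<and> admissible s \<and> mset (labels s) = mset (labels (Vert ts))} \<and>
   gen (Vert ss) - g ss \<in> ?N"
  by (intro bchoice) blast
 then obtain g where g: "\<And>ss. ss \<in> supp (tuples (map h ts)) \<Longrightarrow>
   g ss \<in> span_on {s. valid m V s \<and> admissible s \<and> mset (labels s) = mset (labels (Vert ts))} \<and>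
   gen (Vert ss) - g ss \<in> ?N" by blast
 have "lin_ext (\<lambda>ss. gen (Vert ss)) (tuples (map h ts)) - lin_ext g (tuples (map h ts)) \<in> ?N"
  by (rule subspace_lin_ext_diff[OF subspace_relations]) (use g in blast)
 with 1 have "gen (Vert ts) - lin_ext g (tuples (map h ts)) \<in> ?N"
  by (rule subspace_diff_trans[OF subspace_relations])
 moreover have "lin_ext g (tuples (map h ts)) \<in>
   span_on {s. valid m V s \<and> admissible s \<and> mset (labels s) = mset (labels (Vert ts))}"
  by (rule lin_ext_span_on) (use g in blast)
 ultimately show ?case by blast
qed

section \<open>Relations between labelled trees generate the operadic ideal\<close>

abbreviation label_relations :: "enat \<Rightarrow> ('k::field forest) set" where
 "label_relations m \<equiv> relations m UNIV (\<lambda>_. 0) {}"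

lemma leaf_homogeneous_empty: "leaf_homogeneous V \<delta> {}"
 by (simp add: leaf_homogeneous_def)

lemma subspace_op_ideal: "free.subspace (op_ideal m n)"
 by (rule free.subspaceI) (auto simp: op_ideal_def intro: in_ideal.intros)

lemma koszul_square: "koszul \<sigma> ds * koszul \<sigma> ds = 1"
 unfolding koszul_pair_prod by (rule pair_prod_square) auto

lemma koszul_0: "(\<And>d. d \<in> set ds \<Longrightarrow> d = 0) \<Longrightarrow> \<sigma> permutes {..<length ds} \<Longrightarrow> koszul \<sigma> ds = 1"
 unfolding koszul_pair_prod
proof (rule pair_prod_1[of "(<)"])
 fix p q
 assume *: "\<And>d. d \<in> set ds \<Longrightarrow> d = 0" "\<sigma> permutes {..<length ds}" "p \<in> set [0..<length ds]"
 then have "\<sigma> p < length ds" using permutes_in_image[of \<sigma> "{..<length ds}" p] by simp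
 then show "(if \<sigma> q < \<sigma> p then psign (ds ! \<sigma> p * ds ! \<sigma> q) else 1) = 1"
  using *(1)[of "ds ! \<sigma> p"] by simp
qed simp

text \<open>Permuting the arguments of the composites in the Jacobi identity changes the sign of the inputs
 by two Koszul signs: that of the total degrees of the arguments and that of their vertices alone.\<close>

lemma leg_sign_jtree:
 assumes i: "1 \<le> i" "i \<le> length us" and \<sigma>: "\<sigma> permutes {..<length us}"
  and sep: "\<And>a b x y. a < b \<Longrightarrow> b < length us \<Longrightarrow> x \<in> set (labels (us ! a)) \<Longrightarrow>
   y \<in> set (labels (us ! b)) \<Longrightarrow> x < y \<or> D x * D y = 0"
 shows "leg_sign D (jtree i (permute_list \<sigma> us)) =
  koszul \<sigma> (map (dg D) us) * koszul \<sigma> (map tdeg us) *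
  (prod_list (map (leg_sign D) us) * pair_prod (\<lambda>u v. psign (ldeg D u * tdeg v)) us)"
proof -
 let ?n = "length us"
 let ?t = "jtree i (map (\<lambda>p. Leg (\<sigma> p)) [0..<?n])"
 have l: "labels ?t = map \<sigma> [0..<?n]"
  using i by (subst jtree_facts) (simp_all add: comp_def)
 have m: "mset (labels ?t) = mset [0..<?n]"
  unfolding l by (rule mset_map_permutes_upt[OF \<sigma>])
 have n1: "map f us = map (\<lambda>a. f (us ! a)) [0..<?n]" for f :: "nat tree \<Rightarrow> int"
  by (rule nth_equalityI) auto
 have g: "graft ((!) us) ?t = jtree i (permute_list \<sigma> us)"
  by (simp add: map_jtree permute_list_def comp_def)
 have "leg_sign D (graft ((!) us) ?t) =
  leg_sign (\<lambda>a. dg D (us ! a)) ?t * leg_sign (\<lambda>a. tdeg (us ! a)) ?t *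
  prod_list (map (\<lambda>a. leg_sign D (us ! a)) (labels ?t)) *
  pair_prod (\<lambda>a b. psign (ldeg D (us ! a) * tdeg (us ! b))) (sort (labels ?t))"
 proof (rule leg_sign_graft)
  show "distinct (labels ?t)" by (rule distinct_mset_upt[OF m])
  fix a b x y assume "a \<in> set (labels ?t)" "b \<in> set (labels ?t)" "a < b"
   "x \<in> set (labels (us ! a))" "y \<in> set (labels (us ! b))"
  then show "x < y \<or> D x * D y = 0"
   using mset_eq_setD[OF m] by (intro sep) auto
 qed
 also have "sort (labels ?t) = [0..<?n]"
  by (metis properties_for_sort sorted_upt m)
 also have "pair_prod (\<lambda>a b. psign (ldeg D (us ! a) * tdeg (us ! b))) [0..<?n] =
   pair_prod (\<lambda>u v. psign (ldeg D u * tdeg v)) us"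
  using pair_prod_map[of "\<lambda>u v. psign (ldeg D u * tdeg v)" "(!) us" "[0..<?n]"] by (simp add: map_nth)
 also have "prod_list (map (\<lambda>a. leg_sign D (us ! a)) (labels ?t)) = prod_list (map (leg_sign D) us)"
  unfolding n1 by (rule prod_list_mset_cong[OF m])
 finally show ?thesis
  unfolding g by (simp add: leg_sign_jtree_Leg[OF i \<sigma>] n1[symmetric] mult.assoc)
qed

lemma sign_products_square:
 fixes C :: int
 assumes "C = prod_list (map (leg_sign D) xs) * pair_prod (\<lambda>u v. psign (f u * g v)) ys"
 shows "C * C = 1"
proof -
 have 1: "prod_list (map (leg_sign D) xs) * prod_list (map (leg_sign D) xs) = 1"
  by (induction xs) (simp_all add: mult.assoc mult.left_commute[of "leg_sign D _"] mult.left_commute[of _ "leg_sign D _"])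
 have 2: "pair_prod (\<lambda>u v. psign (f u * g v)) ys * pair_prod (\<lambda>u v. psign (f u * g v)) ys = 1"
  by (rule pair_prod_square) (rule psign_square)
 have "C * C = (prod_list (map (leg_sign D) xs) * prod_list (map (leg_sign D) xs)) *
   (pair_prod (\<lambda>u v. psign (f u * g v)) ys * pair_prod (\<lambda>u v. psign (f u * g v)) ys)"
  unfolding assms by (simp only: ac_simps)
 then show ?thesis unfolding 1 2 by simp
qed

lemma mset_shifted:
 assumes "1 \<le> k" "k \<le> n"
 shows "mset (0 # map (\<lambda>b. b - (k - 1)) [k..<n]) = mset [0..<n - k + 1]"
proof -
 have "map (\<lambda>b. b - (k - 1)) [k..<n] = [1..<n - k + 1]"
  using assms by (intro nth_equalityI) (auto simp del: upt_Suc)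
 then show ?thesis by (simp add: upt_conv_Cons del: upt_Suc)
qed

lemma chi_0:
 "\<sigma> permutes {..<length ds} \<Longrightarrow> (\<And>d. d \<in> set ds \<Longrightarrow> d = 0) \<Longrightarrow> chi \<sigma> ds = sign \<sigma>"
 by (simp add: chi_def koszul_0)

lemma graft_slot_0:
 assumes "\<And>a. a \<in> set (labels u) \<Longrightarrow> k \<le> f a" "1 \<le> k" "arity s = k"
 shows "graft (slot 0 s) (map_tree (\<lambda>a. f a - (k - 1)) u) = map_tree f u"
proof -
 have "graft (slot 0 s) (map_tree (\<lambda>a. f a - (k - 1)) u) = graft (\<lambda>a. Leg (f a)) u"
  unfolding graft_map_tree
 proof (rule graft_cong)
  fix a assume "a \<in> set (labels u)"
  from assms(1)[OF this] have "k \<le> f a" .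
  with assms(2,3) show "slot 0 s (f a - (k - 1)) = Leg (f a)"
   by (auto simp: slot_def)
 qed
 then show ?thesis by (simp add: graft_Leg)
qed

lemma slot_0_self: "slot 0 s 0 = s"
 by (simp add: slot_def tree.map_ident)

lemma relabel_lin_ext: "relabel \<sigma> (lin_ext g x) = lin_ext (\<lambda>t. relabel \<sigma> (g t)) x"
 by (simp add: relabel_def lin_ext_comp)

lemma pcomp_lin_ext_left: "pcomp i (lin_ext g x) y = lin_ext (\<lambda>t. pcomp i (g t) y) x"
 by (simp add: pcomp_def lin_ext_comp)

lemma pcomp_lin_ext_right: "pcomp i y (lin_ext g x) = lin_ext (\<lambda>t. pcomp i y (g t)) x"
proof -
 have "pcomp i y (lin_ext g x) = lin_ext (\<lambda>t. lin_ext (\<lambda>u. lin_ext (\<lambda>s.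
   fscale (of_int (psign (tdeg s * right_deg i t))) (planar (tree_comp i t s))) (g u)) x) y"
  by (simp add: pcomp_def lin_ext_comp)
 also have "\<dots> = lin_ext (\<lambda>u. lin_ext (\<lambda>t. lin_ext (\<lambda>s.
   fscale (of_int (psign (tdeg s * right_deg i t))) (planar (tree_comp i t s))) (g u)) y) x"
  by (rule lin_ext_swap[of "\<lambda>t u. lin_ext (\<lambda>s.
   fscale (of_int (psign (tdeg s * right_deg i t))) (planar (tree_comp i t s))) (g u)"])
 finally show ?thesis by (simp add: pcomp_def)
qed

text \<open>The ideal is invariant under relabelling, so an element may be relabelled before it is shown to
be in the ideal.\<close>

lemma in_ideal_relabel_cancel:
 assumes "in_ideal m n (relabel \<pi> x)" "\<pi> permutes {..<n}" "x \<in> span_on (trees m n)"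
 shows "in_ideal m n x"
proof -
 let ?i = "inv_into UNIV \<pi>"
 have i: "?i permutes {..<n}" by (rule permutes_inv[OF assms(2)])
 have "relabel ?i (relabel \<pi> x) = lin_ext (\<lambda>t. relabel ?i (planar (map_tree \<pi> t))) x"
  unfolding relabel_def[of \<pi>] by (rule relabel_lin_ext)
 also have "\<dots> = lin_ext gen x"
 proof (rule lin_ext_cong)
  fix t assume "t \<in> supp x"
  then have t: "vals_le m t" "mset (labels t) = mset [0..<n]" "nform t = t"
   using span_on_keysD[OF assms(3)] by (auto simp: trees_def)
  have "mset (labels (map_tree \<pi> t)) = mset [0..<n]"
   using t(2) mset_map_permutes_upt[OF assms(2)] by simp
  then have "relabel ?i (planar (map_tree \<pi> t)) = planar (map_tree ?i (map_tree \<pi> t))"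
   using t(1) i by (intro relabel_planar[of m _ n]) auto
  also have "map_tree ?i (map_tree \<pi> t) = t"
   by (simp add: tree.map_comp comp_def permutes_inverses[OF assms(2)] tree.map_ident)
  also have "planar t = gen t"
   using planar_nform_id[OF t(3,1) distinct_mset_upt[OF t(2)]] .
  finally show "relabel ?i (planar (map_tree \<pi> t)) = gen t" .
 qed
 finally show ?thesis
  using in_ideal.relabel[OF assms(1) i] by (simp add: lin_ext_id)
qed

lemma lin_ext_jac:
 "lin_ext g (jac \<delta> ts) = (\<Sum>p \<in> unsh (length ts).
   fscale (of_int (chi (snd p) (map (dg \<delta>) ts) * psign (int (fst p * (length ts - fst p)))))
    (g (jtree (fst p) (permute_list (snd p) ts))))"
 by (simp add: jac_def split_beta lin_ext_sum lin_ext_fscale)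

lemma labels_jtree_permute:
 assumes "(i, \<sigma>) \<in> unsh (length ts)"
 shows "mset (labels (jtree i (permute_list \<sigma> ts))) = mset (concat (map labels ts))"
proof -
 from unshD[OF assms] have "1 \<le> i" "i \<le> length ts" and \<sigma>: "\<sigma> permutes {..<length ts}" by auto
 then show ?thesis
  using mset_concat_map_cong[of "permute_list \<sigma> ts" ts labels] by (simp add: jtree_facts)
qed

lemma vals_le_jtree_permute:
 assumes "(i, \<sigma>) \<in> unsh (length ts)" "enat (length ts) \<le> m" "\<And>t. t \<in> set ts \<Longrightarrow> vals_le m t"
 shows "vals_le m (jtree i (permute_list \<sigma> ts))"
proof -
 from unshD[OF assms(1)] have "1 \<le> i" "i \<le> length ts" and \<sigma>: "\<sigma> permutes {..<length ts}" by auto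
 then have "valid m UNIV (jtree i (permute_list \<sigma> ts))"
  using assms(2,3) by (intro valid_jtree) (auto simp: valid_def)
 then show ?thesis by (simp add: valid_def)
qed

lemma jac_span:
 assumes "enat (length ts) \<le> m" "\<And>t. t \<in> set ts \<Longrightarrow> vals_le m t"
 shows "jac \<delta> ts \<in> span_on {t. vals_le m t \<and> mset (labels t) = mset (concat (map labels ts))}"
 unfolding jac_def
proof (intro span_on_sum, unfold split_beta, intro span_on_fscale)
 fix p assume "p \<in> unsh (length ts)"
 then show "gen (jtree (fst p) (permute_list (snd p) ts)) \<in>
   span_on {t. vals_le m t \<and> mset (labels t) = mset (concat (map labels ts))}"
  using labels_jtree_permute[of "fst p" "snd p" ts] vals_le_jtree_permute[of "fst p" "snd p" ts m] assms by simp
qed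

lemma jac_map_tree:
 "lin_ext g (jac (\<lambda>_. 0) (map (map_tree f) ts)) = lin_ext (\<lambda>t. g (map_tree f t)) (jac (\<lambda>_. 0) ts)"
 unfolding lin_ext_jac length_map
proof (rule sum.cong[OF refl])
 fix p assume "p \<in> unsh (length ts)"
 then have \<sigma>: "snd p permutes {..<length ts}" using unshD[of "fst p" "snd p" "length ts"] by simp
 have "map (dg (\<lambda>_. 0)) (map (map_tree f) ts) = map (dg (\<lambda>_. 0)) ts" by simp
 then show "fscale (of_int (chi (snd p) (map (dg (\<lambda>_. 0)) (map (map_tree f) ts)) * psign (int (fst p * (length ts - fst p)))))
   (g (jtree (fst p) (permute_list (snd p) (map (map_tree f) ts)))) =
  fscale (of_int (chi (snd p) (map (dg (\<lambda>_. 0)) ts) * psign (int (fst p * (length ts - fst p)))))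
   (g (map_tree f (jtree (fst p) (permute_list (snd p) ts))))"
  by (simp only: map_jtree permute_list_map[OF \<sigma>])
qed

lemma relabel_jac:
 assumes "enat (length ts) \<le> m" "\<And>t. t \<in> set ts \<Longrightarrow> vals_le m t"
  "mset (concat (map labels ts)) = mset [0..<n]" "\<pi> permutes {..<n}"
 shows "relabel \<pi> (lin_ext planar (jac (\<lambda>_. 0) ts)) = lin_ext planar (jac (\<lambda>_. 0) (map (map_tree \<pi>) ts))"
 unfolding relabel_lin_ext jac_map_tree
proof (rule lin_ext_cong)
 fix t assume "t \<in> supp (jac (\<lambda>_. 0) ts :: nat tree \<Rightarrow>\<^sub>0 'a)"
 from span_on_keysD[OF jac_span[OF assms(1,2)] this]
 show "relabel \<pi> (planar t) = (planar (map_tree \<pi> t) :: nat tree \<Rightarrow>\<^sub>0 'a)"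
  using assms(3,4) by (intro relabel_planar[of m _ n]) auto
qed

lemma jacobi_jac: "jacobi n = lin_ext planar (jac (\<lambda>_. 0) (map Leg [0..<n]))"
 unfolding jacobi_eq lin_ext_jac split_beta
proof (rule sum.cong, goal_cases)
 case (2 p)
 then have \<sigma>: "snd p permutes {..<n}" using unshD[of "fst p" "snd p" n] by simp
 then have "permute_list (snd p) (map Leg [0..<n]) = map (\<lambda>q. Leg (snd p q)) [0..<n]"
  using permutes_in_image[OF \<sigma>] by (auto simp: permute_list_def)
 moreover have "chi (snd p) (map (dg (\<lambda>_. 0)) (map Leg [0..<n])) = sign (snd p)"
  using \<sigma> by (intro chi_0) auto
 ultimately show ?case by (simp only: length_map length_upt diff_zero)
qed simp

lemma mult_rearrange: "a * b = c * d \<Longrightarrow> a * p * b = c * (d * p)" for a :: int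
 by (metis mult.assoc mult.commute)

text \<open>The Jacobi identity for arbitrary trees in place of the inputs lies in the ideal: the trees are
 grafted one by one, each onto the leg with label \<open>0\<close>.\<close>

lemma jac_in_ideal:
 fixes ts :: "nat tree list"
 assumes "1 \<le> length ts" "enat (length ts) \<le> m" "\<And>t. t \<in> set ts \<Longrightarrow> vals_le m t"
  "mset (concat (map labels ts)) = mset [0..<N]"
 shows "in_ideal m N (lin_ext planar (jac (\<lambda>_. 0) ts) :: 'k::field forest)"
 using assms
proof (induction "length (filter (\<lambda>t. \<nexists>a. t = Leg a) ts)" arbitrary: ts N)
 case 0
 let ?n = "length ts"
 have leg: "map Leg (concat (map labels ts)) = ts"
  using 0(1) by (induction ts) (auto split: if_splits)
 from enumerating_permutation[OF 0(5)] obtain \<tau>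
  where \<tau>: "\<tau> permutes {..<N}" "map \<tau> [0..<N] = concat (map labels ts)" .
 have "map (map_tree \<tau>) (map Leg [0..<N]) = map Leg (map \<tau> [0..<N])" by simp
 then have ts: "map (map_tree \<tau>) (map Leg [0..<N]) = ts" unfolding \<tau>(2) leg .
 have N: "length ts = N" using arg_cong[OF ts, of length] by simp
 have "relabel \<tau> (lin_ext planar (jac (\<lambda>_. 0) (map Leg [0..<N]))) =
   (lin_ext planar (jac (\<lambda>_. 0) (map (map_tree \<tau>) (map Leg [0..<N]))) :: 'k forest)"
  by (rule relabel_jac[of _ m N]) (use 0(3) N \<tau>(1) in \<open>auto simp: comp_def\<close>)
 moreover have "in_ideal m N (relabel \<tau> (jacobi N) :: 'k forest)"
  using 0(2,3) N by (intro in_ideal.relabel in_ideal.jacobi \<tau>(1)) auto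
 ultimately show ?case unfolding ts jacobi_jac by (simp only:)
next
 case (Suc c)
 let ?n = "length ts"
 from Suc(2) have "filter (\<lambda>t. \<nexists>a. t = Leg a) ts \<noteq> []" by auto
 then obtain s where "s \<in> set ts" and s: "\<nexists>a. s = Leg a"
  by (auto simp: filter_empty_conv)
 then obtain us vs where ts: "ts = us @ s # vs" by (meson split_list)
 define k where "k = arity s"
 let ?l = "concat (map labels us) @ concat (map labels vs)"
 have vs': "vals_le m s" using Suc.prems ts by auto
 then have k: "1 \<le> k" using labels_nonempty[of m s] by (cases "labels s") (auto simp: k_def arity_def)
 have "mset (labels s @ ?l) = mset [0..<N]" using Suc.prems(4) by (simp add: ts ac_simps)
 from split_relabelling[OF this] obtain \<pi> where \<pi>: "\<pi> permutes {..<N}"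
   "map \<pi> (labels s) = [0..<k]" "map \<pi> ?l = [k..<N]"
  unfolding arity_def[symmetric] k_def[symmetric] .
 \<comment> \<open>The subtree \<open>s\<close>, relabelled by \<open>0, \<dots>, k - 1\<close>, shrinks to the leg \<open>0\<close>; the other labels move down.\<close>
 let ?\<rho> = "\<lambda>a. \<pi> a - (k - 1)"
 let ?s = "map_tree \<pi> s"
 let ?ts1 = "map (map_tree \<pi>) ts"
 let ?ts0 = "map (map_tree ?\<rho>) us @ Leg 0 # map (map_tree ?\<rho>) vs"
 have other: "k \<le> \<pi> a" if "u \<in> set us \<union> set vs" "a \<in> set (labels u)" for u a
 proof -
  have "\<pi> a \<in> set (map \<pi> ?l)" using that by auto
  then show ?thesis unfolding \<pi>(3) by simp
 qed
 have labs1: "mset (labels ?s) = mset [0..<k]" by (simp add: \<pi>(2))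
 have N': "k \<le> N" using mset_eq_length[OF Suc.prems(4)] by (simp add: ts k_def arity_def)
 have lab0: "mset (concat (map labels ?ts0)) = mset [0..<N - k + 1]"
 proof -
  have "map ?\<rho> ?l = map (\<lambda>b. b - (k - 1)) [k..<N]" unfolding \<pi>(3)[symmetric] by simp
  then have "mset (0 # map ?\<rho> ?l) = mset [0..<N - k + 1]" using mset_shifted[OF k N'] by (simp only:)
  then show ?thesis by (simp add: map_concat comp_def)
 qed
 have len0: "length ?ts0 = ?n" by (simp add: ts)
 have "c = length (filter (\<lambda>t. \<nexists>a. t = Leg a) ?ts0)"
 proof -
  have "(\<nexists>a. map_tree f t = Leg a) \<longleftrightarrow> (\<nexists>a. t = Leg a)" for f :: "nat \<Rightarrow> nat" and t by (cases t) auto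
  then have "length (filter (\<lambda>t. \<nexists>a. t = Leg a) (map (map_tree f) ws)) = length (filter (\<lambda>t. \<nexists>a. t = Leg a) ws)"
   for f :: "nat \<Rightarrow> nat" and ws by (induction ws) simp_all
  then show ?thesis using Suc(2) s by (simp add: ts)
 qed
 then have I0: "in_ideal m (N - k + 1) (lin_ext planar (jac (\<lambda>_. 0) ?ts0) :: 'k forest)"
  by (rule Suc(1)) (use Suc.prems lab0 in \<open>auto simp: ts\<close>)
 \<comment> \<open>The leg \<open>0\<close> stands for the subtree \<open>s\<close> and has its degree.\<close>
 let ?D = "\<lambda>a. if a = 0 then tdeg s else 0"
 define C where "C = prod_list (map (leg_sign ?D) ?ts0) * pair_prod (\<lambda>u v. psign (ldeg ?D u * tdeg v)) ?ts0"
 have planar_s: "planar ?s \<in> (span_on (trees m k) :: 'k opel)"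
  by (rule span_on_mono[OF _ planar_in_trees[OF _ labs1]]) (use vs' in auto)
 have "pcomp 0 (lin_ext planar (jac (\<lambda>_. 0) ?ts0)) (planar ?s) =
   (fscale (of_int C) (lin_ext planar (jac (\<lambda>_. 0) ?ts1)) :: 'k forest)"
  unfolding pcomp_lin_ext_left
  unfolding lin_ext_jac len0 length_map free.scale_sum_right
 proof (rule sum.cong[OF refl])
  fix p assume p: "p \<in> unsh ?n"
  obtain i \<sigma> where i\<sigma>: "p = (i, \<sigma>)" by (cases p)
  with p unshD[of i \<sigma> ?n] have i: "1 \<le> i" "i \<le> ?n" and \<sigma>: "\<sigma> permutes {..<?n}" by auto
  let ?c = "jtree i (permute_list \<sigma> ?ts0)"
  have pc: "(i, \<sigma>) \<in> unsh (length ?ts0)" using p i\<sigma> len0 by simp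
  have lc: "mset (labels ?c) = mset [0..<N - k + 1]"
   using labels_jtree_permute[OF pc] lab0 by simp
  have vc: "vals_le m ?c"
   by (rule vals_le_jtree_permute[OF pc]) (use Suc.prems in \<open>auto simp: ts\<close>)
  have 1: "pcomp 0 (planar ?c) (planar ?s) =
    (fscale (of_int (leg_sign ?D ?c)) (planar (tree_comp 0 ?c ?s)) :: 'k forest)"
   using pcomp_planar[OF lc vc labs1, of 0, where ?'k = 'k, unfolded tdeg_map_tree] vs'
   by (simp only: vals_le_map_tree)
  have 2: "tree_comp 0 ?c ?s = jtree i (permute_list \<sigma> ?ts1)"
  proof -
   have "map (graft (slot 0 ?s)) ?ts0 = ?ts1"
   proof -
    have "graft (slot 0 ?s) (map_tree ?\<rho> u) = map_tree \<pi> u" if "u \<in> set us \<union> set vs" for u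
     by (rule graft_slot_0[OF _ k]) (use other[OF that] in \<open>simp_all add: k_def\<close>)
    then show ?thesis by (simp add: ts slot_0_self)
   qed
   then have "map (graft (slot 0 ?s)) (permute_list \<sigma> ?ts0) = permute_list \<sigma> ?ts1"
    using permute_list_map[of \<sigma> ?ts0 "graft (slot 0 ?s)"] \<sigma> len0 by metis
   then show ?thesis by (simp only: tree_comp_eq map_jtree)
  qed
  have dD: "map (dg ?D) ?ts0 = map tdeg ?ts1"
  proof -
   have "dg ?D (map_tree ?\<rho> u) = tdeg u" if "u \<in> set us \<union> set vs" for u
   proof -
    have "ldeg (\<lambda>a. ?D (?\<rho> a)) u = ldeg (\<lambda>_. 0) u"
    proof (rule ldeg_cong)
     fix a assume "a \<in> set (labels u)"
     from other[OF that this] k have "?\<rho> a \<noteq> 0" by linarith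
     then show "?D (?\<rho> a) = 0" by (simp only: if_False)
    qed
    then show ?thesis by (simp add: dg_def) (simp add: ldeg_def)
   qed
   then show ?thesis by (simp add: ts)
  qed
  have 3: "leg_sign ?D ?c = koszul \<sigma> (map tdeg ?ts1) * koszul \<sigma> (map tdeg ?ts0) * C"
   unfolding C_def dD[symmetric]
  proof (rule leg_sign_jtree)
   show "1 \<le> i" "i \<le> length ?ts0" "\<sigma> permutes {..<length ?ts0}" using i \<sigma> len0 by simp_all
   fix a b x y assume ab: "a < b" "b < length ?ts0" "x \<in> set (labels (?ts0 ! a))" "y \<in> set (labels (?ts0 ! b))"
   have "sorted_wrt (\<lambda>u v. set (labels u) \<inter> set (labels v) = {}) ts" if "distinct (concat (map labels ts))"
    for ts :: "nat tree list"
    using that by (induction ts) auto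
   from this[OF distinct_mset_upt[OF lab0], unfolded sorted_wrt_iff_nth_less, rule_format, OF ab(1,2)]
   have "x \<noteq> y" using ab(3,4) by blast
   then show "x < y \<or> ?D x * ?D y = 0" by auto
  qed
  have 4: "chi \<sigma> (map tdeg ?ts0) * (koszul \<sigma> (map tdeg ?ts1) * koszul \<sigma> (map tdeg ?ts0) * C) =
    C * chi \<sigma> (map tdeg ?ts1)"
   using koszul_square[of \<sigma> "map tdeg ?ts0"] by (simp add: chi_def)
  have "dg (\<lambda>_. 0) = (tdeg :: nat tree \<Rightarrow> int)" by (rule ext) simp
  then show "fscale (of_int (chi (snd p) (map (dg (\<lambda>_. 0)) ?ts0) * psign (int (fst p * (?n - fst p)))))
     (pcomp 0 (planar (jtree (fst p) (permute_list (snd p) ?ts0))) (planar ?s)) =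
    (fscale (of_int C) (fscale (of_int (chi (snd p) (map (dg (\<lambda>_. 0)) ?ts1) * psign (int (fst p * (?n - fst p)))))
     (planar (jtree (fst p) (permute_list (snd p) ?ts1)))) :: 'k forest)"
   unfolding i\<sigma> fst_conv snd_conv 1 2 3 free.scale_scale of_int_mult[symmetric]
   by (intro arg_cong2[of _ _ _ _ fscale] arg_cong[of _ _ of_int] mult_rearrange refl)
    (use 4 in \<open>simp only:\<close>)
 qed
 moreover have "in_ideal m (N - k + 1 + k - 1) (pcomp 0 (lin_ext planar (jac (\<lambda>_. 0) ?ts0)) (planar ?s) :: 'k forest)"
  by (rule in_ideal.comp_left[OF I0 planar_s]) simp
 moreover have "N - k + 1 + k - 1 = N" using N' by simp
 ultimately have "in_ideal m N (fscale (of_int C) (lin_ext planar (jac (\<lambda>_. 0) ?ts1)) :: 'k forest)"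
  by simp
 then have "in_ideal m N (fscale (of_int C) (fscale (of_int C) (lin_ext planar (jac (\<lambda>_. 0) ?ts1))) :: 'k forest)"
  by (rule in_ideal.scale)
 moreover have "C * C = 1" by (rule sign_products_square[OF C_def])
 ultimately have I1: "in_ideal m N (lin_ext planar (jac (\<lambda>_. 0) ?ts1) :: 'k forest)"
  by (simp add: of_int_mult[symmetric] del: of_int_mult)
 have "relabel \<pi> (lin_ext planar (jac (\<lambda>_. 0) ts)) = (lin_ext planar (jac (\<lambda>_. 0) ?ts1) :: 'k forest)"
  by (rule relabel_jac[OF Suc.prems(2-4) \<pi>(1)])
 with I1 have "in_ideal m N (relabel \<pi> (lin_ext planar (jac (\<lambda>_. 0) ts)) :: 'k forest)" by simp
 moreover have "lin_ext planar (jac (\<lambda>_. 0) ts) \<in> (span_on (trees m N) :: 'k opel)"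
 proof (rule lin_ext_span_on)
  fix t assume "t \<in> supp (jac (\<lambda>_. 0) ts :: 'k forest)"
  from span_on_keysD[OF jac_span[OF Suc.prems(2,3)] this] Suc.prems(4)
  show "planar t \<in> (span_on (trees m N) :: 'k opel)"
   by (intro span_on_mono[OF _ planar_in_trees[of m]]) auto
 qed
 ultimately show ?case by (rule in_ideal_relabel_cancel[OF _ \<pi>(1)])
qed

text \<open>Only the trees whose labels are mapped bijectively onto \<open>0, \<dots>, n - 1\<close> by \<open>f\<close> contribute.\<close>

definition relabelled :: "(nat \<Rightarrow> nat) \<Rightarrow> nat \<Rightarrow> nat tree \<Rightarrow> ('k::field forest)" where
 "relabelled f n t = (if mset (map f (labels t)) = mset [0..<n] then planar (map_tree f t) else 0)"

text \<open>A relation in the context of a vertex is a partial composite of that vertex with a relation whose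
labels form an initial segment; a relabelling brings it into this form. Hence the generality in \<open>f\<close>.\<close>

lemma relator_in_ideal:
 fixes r :: "'k::field forest"
 assumes "relator m UNIV (\<lambda>_. 0) {} r"
 shows "in_ideal m n (lin_ext (relabelled f n) r)"
 using assms
proof (induction arbitrary: f n rule: relator.induct)
 case (leaf r)
 then show ?case by simp
next
 case (swap s e s')
 have m: "mset (map f (labels s)) = mset (map f (labels s'))"
  using swaps_labels[OF swap(2)] by simp
 show ?case
 proof (cases "mset (map f (labels s)) = mset [0..<n]")
  case True
  have "planar (map_tree f s) = (fscale (of_int e) (planar (map_tree f s')) :: 'k forest)"
   using swap(1) True
   by (intro planar_swaps[OF swaps_map_tree[OF swap(2)], of m]) (auto simp: valid_def intro: distinct_mset_upt)
  then show ?thesis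
   using True m by (simp add: lin_ext_diff lin_ext_fscale relabelled_def in_ideal.zero)
 next
  case False
  then show ?thesis
   using m by (simp add: lin_ext_diff lin_ext_fscale relabelled_def in_ideal.zero)
 qed
next
 case (jac ts)
 let ?J = "jac (\<lambda>_. 0) ts :: 'k forest"
 have lab: "mset (map f (labels t)) = mset (map f (concat (map labels ts)))" if "t \<in> supp ?J" for t
  using span_on_keysD[OF jac_span[of ts m] that] jac by (auto simp: valid_def)
 show ?case
 proof (cases "mset (map f (concat (map labels ts))) = mset [0..<n]")
  case True
  have "lin_ext (relabelled f n) ?J = lin_ext (\<lambda>t. planar (map_tree f t)) ?J"
   by (rule lin_ext_cong) (use lab True in \<open>simp add: relabelled_def del: mset_map\<close>)
  moreover have "in_ideal m n (lin_ext planar (jac (\<lambda>_. 0) (map (map_tree f) ts)) :: 'k forest)"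
   by (rule jac_in_ideal) (use jac True in \<open>auto simp: valid_def map_concat comp_def\<close>)
  ultimately show ?thesis by (simp add: jac_map_tree)
 next
  case False
  have "lin_ext (relabelled f n) ?J = lin_ext (\<lambda>_. 0) ?J"
   by (rule lin_ext_cong) (use lab False in \<open>simp add: relabelled_def del: mset_map\<close>)
  then show ?thesis by (simp add: in_ideal.zero)
 qed
next
 case (ctx r us vs)
 let ?t = "\<lambda>t. Vert (us @ t # vs)"
 let ?P = "\<lambda>t. mset (map f (labels (?t t))) = mset [0..<n]"
 let ?ls = "concat (map labels us) @ concat (map labels vs)"
 have eq: "lin_ext (relabelled f n) (lin_ext (\<lambda>t. gen (?t t)) r) = lin_ext (\<lambda>t. relabelled f n (?t t)) r"
  by (simp add: lin_ext_comp)
 show ?case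
 proof (cases "\<exists>t \<in> supp r. ?P t")
  case False
  then have "lin_ext (\<lambda>t. relabelled f n (?t t)) r = lin_ext (\<lambda>t. 0) r"
   by (intro lin_ext_cong) (auto simp: relabelled_def)
  then show ?thesis by (simp add: eq in_ideal.zero)
 next
  case True
  then obtain t0 where t0: "t0 \<in> supp r" "?P t0" by blast
  obtain e d l where "r \<in> span_on {t. valid m UNIV t \<and> tdeg t = e \<and> dg (\<lambda>_. 0) t = d \<and> arity t = l}"
   using relator_homogeneous[OF ctx.hyps(1) leaf_homogeneous_empty] by blast
  then have r: "r \<in> span_on {t. valid m UNIV t \<and> tdeg t = e}"
   by (rule span_on_mono[rotated]) auto
  define k where "k = length (labels t0)"
  have "valid m UNIV t0" using span_on_keysD[OF r t0(1)] by simp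
  then have k: "1 \<le> k" using labels_nonempty[of m t0] by (cases "labels t0") (auto simp: k_def valid_def)
  have "mset (map f (labels t0) @ map f ?ls) = mset [0..<n]" using t0(2) by (simp add: ac_simps)
  from split_relabelling[OF this] obtain \<pi> where \<pi>: "\<pi> permutes {..<n}"
    "map \<pi> (map f (labels t0)) = [0..<k]" "map \<pi> (map f ?ls) = [k..<n]"
   unfolding length_map k_def[symmetric] .
  let ?\<rho> = "\<lambda>a. \<pi> (f a) - (k - 1)"
  let ?c = "Vert (map (map_tree ?\<rho>) us @ Leg 0 # map (map_tree ?\<rho>) vs)"
  have P\<pi>: "?P t \<longleftrightarrow> mset (map (\<pi> \<circ> f) (labels t)) = mset [0..<k]" for t
  proof -
   have P: "mset (map f (labels (?t t))) = mset (map f (labels t)) + mset (map f ?ls)" for t by simp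
   have "?P t \<longleftrightarrow> mset (map f (labels t)) = mset (map f (labels t0))"
    using t0(2) P[of t] P[of t0] by (metis add_right_cancel)
   also have "\<dots> \<longleftrightarrow> mset (map \<pi> (map f (labels t))) = mset (map \<pi> (map f (labels t0)))"
    unfolding mset_map[of \<pi>] inj_eq[OF multiset.inj_map[OF permutes_inj[OF \<pi>(1)]]] ..
   finally show ?thesis unfolding map_map \<pi>(2)[unfolded map_map] .
  qed
  have other: "k \<le> \<pi> (f a)" if "a \<in> set ?ls" for a
  proof -
   have "\<pi> (f a) \<in> set (map \<pi> (map f ?ls))" unfolding set_map by (intro imageI that)
   then show ?thesis unfolding \<pi>(3) by simp
  qed
  have lenn: "k \<le> n" using mset_eq_length[OF t0(2)] by (simp add: k_def)
  have lc: "mset (labels ?c) = mset [0..<n - k + 1]"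
  proof -
   have "map ?\<rho> ?ls = map (\<lambda>b. b - (k - 1)) [k..<n]" unfolding \<pi>(3)[symmetric] by simp
   then have "mset (0 # map ?\<rho> ?ls) = mset [0..<n - k + 1]" using mset_shifted[OF k lenn] by (simp only:)
   then show ?thesis by (simp add: map_concat comp_def)
  qed
  have vc: "vals_le m ?c"
   using ctx.hyps(2,3) by (auto simp: valid_def)
  let ?sg = "of_int (leg_sign (\<lambda>a. if a = 0 then e else 0) ?c) :: 'k"
  have "in_ideal m (n - k + 1 + k - 1) (pcomp 0 (planar ?c) (lin_ext (relabelled (\<pi> \<circ> f) k) r))"
  proof (rule in_ideal.comp_right)
   show "planar ?c \<in> span_on (trees m (n - k + 1))"
    by (rule span_on_mono[OF _ planar_in_trees[OF vc lc]]) auto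
   show "in_ideal m k (lin_ext (relabelled (\<pi> \<circ> f) k) r)" by (rule ctx.IH)
  qed simp
  moreover have "n - k + 1 + k - 1 = n" using lenn by simp
  ultimately have I: "in_ideal m n (fscale ?sg (pcomp 0 (planar ?c) (lin_ext (relabelled (\<pi> \<circ> f) k) r)))"
   by (simp add: in_ideal.scale)
  have "fscale ?sg (pcomp 0 (planar ?c) (lin_ext (relabelled (\<pi> \<circ> f) k) r)) =
    relabel \<pi> (lin_ext (\<lambda>t. relabelled f n (?t t)) r)"
   unfolding pcomp_lin_ext_right relabel_lin_ext lin_ext_fun_fscale[symmetric]
  proof (rule lin_ext_cong)
   fix t assume "t \<in> supp r"
   then have t: "vals_le m t" "tdeg t = e"
    using span_on_keysD[OF r] by (auto simp: valid_def)
   show "fscale ?sg (pcomp 0 (planar ?c) (relabelled (\<pi> \<circ> f) k t)) =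
     relabel \<pi> (relabelled f n (?t t) :: 'k forest)"
   proof (cases "?P t")
    case False
    then show ?thesis using P\<pi>[of t]
     by (simp add: relabelled_def pcomp_def relabel_def del: mset_map)
   next
    case True
    let ?s = "map_tree (\<pi> \<circ> f) t"
    have ls: "mset (labels ?s) = mset [0..<k]" using True P\<pi>[of t] by simp
    have ar: "arity ?s = k" using mset_eq_length[OF ls] by (simp add: arity_def)
    have "pcomp 0 (planar ?c) (planar ?s) = (fscale ?sg (planar (tree_comp 0 ?c ?s)) :: 'k forest)"
     using pcomp_planar[OF lc vc ls, of 0, where ?'k = 'k, unfolded tdeg_map_tree] t
     by (simp only: vals_le_map_tree)
    moreover have "tree_comp 0 ?c ?s = map_tree \<pi> (map_tree f (?t t))"
    proof -
     have "graft (slot 0 ?s) (map_tree ?\<rho> u) = map_tree (\<lambda>a. \<pi> (f a)) u" if "u \<in> set us \<union> set vs" for u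
      by (rule graft_slot_0[OF _ k ar]) (use that in \<open>auto intro!: other\<close>)
     then show ?thesis
      by (auto simp: tree_comp_eq slot_0_self tree.map_comp comp_def)
    qed
    moreover have "relabel \<pi> (planar (map_tree f (?t t))) = (planar (map_tree \<pi> (map_tree f (?t t))) :: 'k forest)"
    proof (rule relabel_planar[of m _ n, OF _ _ \<pi>(1)])
     show "vals_le m (map_tree f (?t t))" using t ctx.hyps(2,3) by (auto simp: valid_def)
     show "mset (labels (map_tree f (?t t))) = mset [0..<n]" using True by (simp only: labels_map_tree)
    qed
    moreover have "relabelled (\<pi> \<circ> f) k t = (planar ?s :: 'k forest)"
     unfolding relabelled_def using True P\<pi>[of t] by (intro if_P) blast
    moreover have "relabelled f n (?t t) = (planar (map_tree f (?t t)) :: 'k forest)"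
     unfolding relabelled_def using True by (rule if_P)
    moreover have "?sg * ?sg = 1"
     unfolding of_int_mult[symmetric] leg_sign_square by simp
    ultimately show ?thesis
     by (simp only: free.scale_scale free.scale_one)
   qed
  qed
  with I have "in_ideal m n (relabel \<pi> (lin_ext (\<lambda>t. relabelled f n (?t t)) r))" by simp
  moreover have "lin_ext (\<lambda>t. relabelled f n (?t t)) r \<in> span_on (trees m n)"
  proof (rule lin_ext_span_on)
   fix t assume "t \<in> supp r"
   then have t: "vals_le m t" using span_on_keysD[OF r] by (auto simp: valid_def)
   then have v: "vals_le m (map_tree f (?t t))"
    using ctx.hyps(2,3) by (auto simp: valid_def)
   show "relabelled f n (?t t) \<in> (span_on (trees m n) :: 'k opel)"
    unfolding relabelled_def
   proof (split if_split, intro conjI impI)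
    assume "mset (map f (labels (?t t))) = mset [0..<n]"
    then have "mset (labels (map_tree f (?t t))) = mset [0..<n]" by (simp only: labels_map_tree)
    from planar_in_trees[OF v this] show "planar (map_tree f (?t t)) \<in> (span_on (trees m n) :: 'k opel)"
     by (rule span_on_mono[rotated]) auto
   qed simp
  qed
  ultimately show ?thesis
   unfolding eq by (rule in_ideal_relabel_cancel[OF _ \<pi>(1)])
 qed
qed

lemma label_relations_in_ideal:
 "x \<in> label_relations m \<Longrightarrow> lin_ext (relabelled f n) x \<in> op_ideal m n"
 unfolding relations_def
 by (rule span_lin_ext[OF _ subspace_op_ideal]) (auto simp: op_ideal_def relator_in_ideal)

lemma admissible_swaps: "swaps \<delta> e t t' \<Longrightarrow> admissible t \<longleftrightarrow> admissible t'"
proof (induction rule: swaps.induct)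
 case (ctx e s s' us vs)
 have "(\<exists>a. s = Leg a) \<longleftrightarrow> (\<exists>a. s' = Leg a)"
  using ctx(1) by (induction rule: swaps.induct) auto
 with ctx show ?case by auto
qed auto

lemma Omega_exists:
 assumes "1 \<le> m"
 shows "\<exists>g. \<forall>t \<in> trees m n. g t \<in> (span_on (Adm m n) :: ('k::field forest) set) \<and> g t - gen t \<in> op_ideal m n"
proof (rule bchoice, rule ballI)
 fix t assume "t \<in> trees m n"
 then have t: "vals_le m t" "mset (labels t) = mset [0..<n]" "nform t = t"
  by (auto simp: trees_def)
 have "reducible m UNIV (\<lambda>_. 0) ({} :: (nat \<Rightarrow>\<^sub>0 'k) set) t"
  by (rule reducible_valid[OF assms]) (simp add: valid_def t)
 then obtain x :: "'k forest" where x: "x \<in> span_on {s. valid m UNIV s \<and> admissible s \<and> mset (labels s) = mset (labels t)}"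
  "gen t - x \<in> label_relations m" by blast
 let ?P = "relabelled id n :: nat tree \<Rightarrow> 'k forest"
 have "lin_ext ?P (gen t - x) \<in> op_ideal m n"
  by (rule label_relations_in_ideal[OF x(2)])
 moreover have "lin_ext ?P (gen t - x) = gen t - lin_ext ?P x"
  using planar_nform_id[OF t(3,1) distinct_mset_upt[OF t(2)]] t(2)
  by (simp add: lin_ext_diff relabelled_def tree.map_id)
 moreover have "lin_ext ?P x \<in> span_on (Adm m n)"
 proof (rule lin_ext_span_on)
  fix s assume "s \<in> supp x"
  then have s: "vals_le m s" "admissible s" "mset (labels s) = mset [0..<n]"
   using span_on_keysD[OF x(1)] t(2) by (auto simp: valid_def)
  have "nform s \<in> trees m n"
   using s swaps_labels[OF swaps_nform, of s] swaps_vals_le[OF swaps_nform, of m s]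
    nform_nform[OF s(1) distinct_mset_upt[OF s(3)]] by (simp add: trees_def)
  then have "nform s \<in> Adm m n"
   using s(2) admissible_swaps[OF swaps_nform, of s] by (simp add: Adm_def)
  then show "?P s \<in> span_on (Adm m n)"
   using s(3) unfolding relabelled_def
   by (simp add: tree.map_id planar_def span_on_fscale)
 qed
 ultimately show "\<exists>y. y \<in> (span_on (Adm m n) :: 'k opel) \<and> y - gen t \<in> op_ideal m n"
  using subspace_diff_sym[OF subspace_op_ideal, of "gen t" "lin_ext ?P x" m n]
  by (intro exI[of _ "lin_ext ?P x"]) simp
qed

lemma linear_lin_ext: "Vector_Spaces.linear fscale fscale (lin_ext g)"
 by unfold_locales (simp_all add: lin_ext_add lin_ext_fscale)

lemma Omega_spec:
 assumes "1 \<le> m"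
 shows "Vector_Spaces.linear fscale fscale (Omega m n :: ('k::field forest) \<Rightarrow> _)"
  and "Omega m n ` span_on (trees m n) \<subseteq> (span_on (Adm m n) :: 'k opel)"
  and "t \<in> trees m n \<Longrightarrow> Omega m n (gen t) - gen t \<in> (op_ideal m n :: 'k opel)"
proof -
 obtain g :: "nat tree \<Rightarrow> 'k forest" where g: "\<forall>t \<in> trees m n. g t \<in> span_on (Adm m n) \<and> g t - gen t \<in> op_ideal m n"
  using Omega_exists[OF assms] by blast
 have "\<exists>f. Vector_Spaces.linear fscale fscale f \<and> f ` span_on (trees m n) \<subseteq> (span_on (Adm m n) :: 'k opel) \<and>
   (\<forall>t \<in> trees m n. f (gen t) - gen t \<in> op_ideal m n)"
  by (rule exI[of _ "lin_ext g"])
   (use g linear_lin_ext[of g] in \<open>auto intro!: lin_ext_span_on dest: span_on_keysD\<close>)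
 from someI_ex[OF this]
 show "Vector_Spaces.linear fscale fscale (Omega m n :: ('k::field forest) \<Rightarrow> _)"
  and "Omega m n ` span_on (trees m n) \<subseteq> (span_on (Adm m n) :: 'k opel)"
  and "t \<in> trees m n \<Longrightarrow> Omega m n (gen t) - gen t \<in> (op_ideal m n :: 'k opel)"
  unfolding Omega_def[symmetric] by blast+
qed

section \<open>Numbered copies of relators\<close>

definition decorate :: "nat \<Rightarrow> (int \<times> 'y) list \<Rightarrow> nat tree \<Rightarrow> (('k::field, 'y) dforest)" where
 "decorate k w t = fscale (of_int (leg_sign (\<lambda>a. fst (w ! (a - k))) t)) (gen (map_tree (\<lambda>a. w ! (a - k)) t))"

definition carrier_pairs :: "('k, 'y) graded \<Rightarrow> (int \<times> 'y) set" where
 "carrier_pairs Y = {(d, y). y \<in> carrier (Y d)}"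

definition linear_relators :: "('k::field, 'y) graded \<Rightarrow> ((int \<times> 'y) \<Rightarrow>\<^sub>0 'k) set" where
 "linear_relators Y = {gen (e, c \<odot>\<^bsub>Y e\<^esub> x \<oplus>\<^bsub>Y e\<^esub> y) - fscale c (gen (e, x)) - gen (e, y)
  | e c x y. x \<in> carrier (Y e) \<and> y \<in> carrier (Y e)}"

lemma carrier_pairs_iff [simp]: "(d, y) \<in> carrier_pairs Y \<longleftrightarrow> y \<in> carrier (Y d)"
 by (simp add: carrier_pairs_def)

lemma homogeneous_list_iff: "homogeneous_list Y w \<longleftrightarrow> set w \<subseteq> carrier_pairs Y"
 by (auto simp: homogeneous_list_def carrier_pairs_def)

lemma leg_sign_Vert:
 assumes "\<And>i j a b. i < j \<Longrightarrow> j < length us \<Longrightarrow> a \<in> set (labels (us ! i)) \<Longrightarrow> b \<in> set (labels (us ! j)) \<Longrightarrow> a < b"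
 shows "leg_sign D (Vert us) =
  prod_list (map (leg_sign D) us) * pair_prod (\<lambda>u v. psign (ldeg D u * tdeg v)) us"
proof -
 have one: "prod_list (map (iv D (Inl d)) xs) = 1" for d xs by (induction xs) simp_all
 have "leg_sign D (Vert us) = prod_list (map (leg_sign D) us) * pair_prod (\<lambda>u v. cross (iv D) (word u) (word v)) us"
  by (simp add: leg_sign_def one pair_prod_concat pair_prod_map comp_def leg_sign_def[abs_def])
 also have "pair_prod (\<lambda>u v. cross (iv D) (word u) (word v)) us = pair_prod (\<lambda>u v. psign (ldeg D u * tdeg v)) us"
 proof (rule pair_prod_cong)
  show "sorted_wrt (\<lambda>u v. \<forall>a \<in> set (labels u). \<forall>b \<in> set (labels v). a < b) us"
   unfolding sorted_wrt_iff_nth_less by (intro allI impI ballI) (rule assms)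
  fix u v :: "nat tree" assume "\<forall>a \<in> set (labels u). \<forall>b \<in> set (labels v). a < b"
  then show "cross (iv D) (word u) (word v) = psign (ldeg D u * tdeg v)"
   by (intro cross_iv_less disjI1) blast
 qed
 finally show ?thesis .
qed

text \<open>Up to a sign, a relator is the decoration of a relator between labelled trees, or it expresses the
linearity in one of the decorations. The labels start at an arbitrary \<open>k\<close>, because under a vertex
the legs of the children to the left are numbered first.\<close>

definition lifted_relator :: "enat \<Rightarrow> ('k::field, 'y) graded \<Rightarrow> nat \<Rightarrow> nat \<Rightarrow> ('k, 'y) dforest \<Rightarrow> bool" where
 "lifted_relator m Y l k r \<longleftrightarrow> (\<exists>w r' c. length w = l \<and> set w \<subseteq> carrier_pairs Y \<and>
   relator m UNIV (\<lambda>_. 0) {} (r' :: 'k forest) \<and>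
   (\<forall>t \<in> supp r'. mset (labels t) = mset [k..<k + l]) \<and>
   r = fscale (of_int c) (lin_ext (decorate k w) r'))"

definition linearity_relator :: "enat \<Rightarrow> ('k::field, 'y) graded \<Rightarrow> nat \<Rightarrow> nat \<Rightarrow> ('k, 'y) dforest \<Rightarrow> bool" where
 "linearity_relator m Y l k r \<longleftrightarrow> (\<exists>t w i e c x y. mset (labels t) = mset [k..<k + l] \<and> vals_le m t \<and>
   length w = l \<and> set w \<subseteq> carrier_pairs Y \<and> i < l \<and> x \<in> carrier (Y e) \<and> y \<in> carrier (Y e) \<and>
   r = gen (map_tree (\<lambda>a. w[i := (e, c \<odot>\<^bsub>Y e\<^esub> x \<oplus>\<^bsub>Y e\<^esub> y)] ! (a - k)) t)
    - fscale c (gen (map_tree (\<lambda>a. w[i := (e, x)] ! (a - k)) t))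
    - gen (map_tree (\<lambda>a. w[i := (e, y)] ! (a - k)) t))"

lemma lifted_relatorI:
 fixes r' :: "'k::field forest"
 assumes "length w = l" "set w \<subseteq> carrier_pairs Y" "relator m UNIV (\<lambda>_. 0) {} r'"
  "\<And>t. t \<in> supp r' \<Longrightarrow> mset (labels t) = mset [k..<k + l]"
  "r = fscale (of_int c) (lin_ext (decorate k w) r')"
 shows "lifted_relator m Y l k r"
 unfolding lifted_relator_def
 by (rule exI[of _ w], rule exI[of _ r'], rule exI[of _ c], intro conjI ballI) (fact assms)+

lemma linearity_relatorI:
 assumes "mset (labels t) = mset [k..<k + l]" "vals_le m t"
   "length w = l" "set w \<subseteq> carrier_pairs Y" "i < l" "x \<in> carrier (Y e)" "y \<in> carrier (Y e)"
   "r = gen (map_tree (\<lambda>a. w[i := (e, c \<odot>\<^bsub>Y e\<^esub> x \<oplus>\<^bsub>Y e\<^esub> y)] ! (a - k)) t)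
    - fscale c (gen (map_tree (\<lambda>a. w[i := (e, x)] ! (a - k)) t))
    - gen (map_tree (\<lambda>a. w[i := (e, y)] ! (a - k)) t)"
 shows "linearity_relator m Y l k r"
 unfolding linearity_relator_def
 by (rule exI[of _ t], rule exI[of _ w], rule exI[of _ i], rule exI[of _ e], rule exI[of _ c],
   rule exI[of _ x], rule exI[of _ y], intro conjI) (fact assms)+

lemma carrier_pairs_valid: "valid m (carrier_pairs Y) t \<Longrightarrow> set (labels t) \<subseteq> carrier_pairs Y"
 by (simp add: valid_def)

lemma sorted_wrt_nums:
 fixes ws :: "'a tree list"
 shows "sorted_wrt (\<lambda>u v. \<forall>a \<in> set (labels u). \<forall>b \<in> set (labels v). a < b) (nums q ws)"
proof (induction ws arbitrary: q)
 case (Cons u ws)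
 have "a < b" if "a \<in> set (labels (num q u))" "v \<in> set (nums (q + arity u) ws)" "b \<in> set (labels v)" for a b v
 proof -
  have "b \<in> set (concat (map labels (nums (q + arity u) ws)))" using that by auto
  then show ?thesis using that(1) by (simp add: labels_num)
 qed
 then show ?case using Cons by auto
qed simp

lemma upt_join: "a \<le> b \<Longrightarrow> b \<le> c \<Longrightarrow> [a..<b] @ [b..<c] = [a..<c]"
 by (metis le_iff_add upt_add_eq_append)

text \<open>The sign splits into that of the tree and a factor depending only on the context and the degrees of
the tree, hence common to all trees of a homogeneous relator.\<close>

lemma numbered_ctx:
 fixes us vs :: "(int \<times> 'y) tree list"
 defines "L \<equiv> concat (map labels us)" and "R \<equiv> concat (map labels vs)"
 assumes w: "length w = l" and t: "mset (labels t) = mset [k + length L..<k + length L + l]"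
 defines "w' \<equiv> L @ w @ R" and "t' \<equiv> Vert (nums k us @ t # nums (k + length L + l) vs)"
 shows "mset (labels t') = mset [k..<k + length w']"
  and "map_tree (\<lambda>a. w' ! (a - k)) t' = Vert (us @ map_tree (\<lambda>a. w ! (a - (k + length L))) t # vs)"
  and "leg_sign (\<lambda>a. fst (w' ! (a - k))) t' =
   leg_sign (\<lambda>a. fst (w ! (a - (k + length L)))) t *
   (prod_list (map (leg_sign (\<lambda>a. fst (w' ! (a - k)))) (nums k us @ nums (k + length L + l) vs)) *
    pair_prod (\<lambda>u v. psign (fst u * snd v))
    (map (\<lambda>u. (ldeg (\<lambda>a. fst (w' ! (a - k))) u, tdeg u)) (nums k us) @
     (sum_list (map fst w), tdeg t) #
     map (\<lambda>u. (ldeg (\<lambda>a. fst (w' ! (a - k))) u, tdeg u)) (nums (k + length L + l) vs)))"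
proof -
 let ?D = "\<lambda>a. fst (w' ! (a - k))"
 let ?us = "nums k us" and ?vs = "nums (k + length L + l) vs"
 let ?ts = "?us @ t # ?vs"
 have lu: "concat (map labels ?us) = [k..<k + length L]"
  and lv: "concat (map labels ?vs) = [k + length L + l..<k + length L + l + length R]"
  by (simp_all add: labels_num L_def R_def)
 have st: "set (labels t) = {k + length L..<k + length L + l}"
  using mset_eq_setD[OF t] by simp
 have j: "[k..<k + length L] @ [k + length L..<k + length L + l] @ [k + length L + l..<k + length L + l + length R]
   = [k..<k + length w']"
  by (simp only: upt_join le_add1 w'_def w length_append add.assoc order_trans[OF le_add1 le_add1])
 have "mset (labels t') = mset (concat (map labels ?us)) + (mset (labels t) + mset (concat (map labels ?vs)))"
  by (simp add: t'_def)
 also have "\<dots> = mset ([k..<k + length L] @ [k + length L..<k + length L + l] @ [k + length L + l..<k + length L + l + length R])"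
  by (simp only: lu lv t mset_append)
 finally show "mset (labels t') = mset [k..<k + length w']" by (simp only: j)
 have nt: "w' ! (a - k) = w ! (a - (k + length L))" if "a \<in> set (labels t)" for a
 proof -
  have "k + length L \<le> a" "a < k + length L + l" using that st by auto
  then obtain j where "a = k + length L + j" "j < l" by (metis le_iff_add add_less_cancel_left)
  then show ?thesis by (simp add: w'_def nth_append w)
 qed
 have mu: "map (map_tree (\<lambda>a. w' ! (a - k))) ?us = us"
  by (rule map_tree_num(2)) (simp add: w'_def nth_append L_def)
 have mv: "map (map_tree (\<lambda>a. w' ! (a - k))) ?vs = vs"
  by (rule map_tree_num(2)) (simp add: w'_def nth_append R_def w)
 show "map_tree (\<lambda>a. w' ! (a - k)) t' = Vert (us @ map_tree (\<lambda>a. w ! (a - (k + length L))) t # vs)"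
  using mu mv map_tree_cong'[of t, OF nt] by (simp add: t'_def)
 have lt: "leg_sign ?D t = leg_sign (\<lambda>a. fst (w ! (a - (k + length L)))) t"
  by (rule leg_sign_cong) (simp add: nt)
 have ld: "ldeg ?D t = sum_list (map fst w)"
 proof -
  have "ldeg ?D t = ldeg (\<lambda>a. fst (w ! (a - (k + length L)))) t"
   by (rule ldeg_cong) (simp add: nt)
  also have "\<dots> = sum_list (map (\<lambda>a. fst (w ! (a - (k + length L)))) [k + length L..<k + length L + l])"
   unfolding ldeg_def by (rule sum_list_map_mset_cong[OF t])
  also have "map (\<lambda>a. fst (w ! (a - (k + length L)))) [k + length L..<k + length L + l] = map fst w"
   using w by (intro nth_equalityI) auto
  finally show ?thesis .
 qed
 have ord: "a < b" if ij: "i < j" "j < length ?ts" and a: "a \<in> set (labels (?ts ! i))" and b: "b \<in> set (labels (?ts ! j))" for i j a b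
 proof -
  have "a < k + length L" if "u \<in> set ?us" "a \<in> set (labels u)" for u a
  proof -
   have "a \<in> set (concat (map labels ?us))" using that by auto
   then show ?thesis unfolding lu by simp
  qed
  moreover have "k + length L + l \<le> a" if "u \<in> set ?vs" "a \<in> set (labels u)" for u a
  proof -
   have "a \<in> set (concat (map labels ?vs))" using that by auto
   then show ?thesis unfolding lv by simp
  qed
  moreover have "k + length L \<le> a \<and> a < k + length L + l" if "a \<in> set (labels t)" for a
   using that st by simp
  ultimately have "sorted_wrt (\<lambda>u v. \<forall>a \<in> set (labels u). \<forall>b \<in> set (labels v). a < b) ?ts"
   unfolding sorted_wrt_append sorted_wrt.simps
   by (intro conjI sorted_wrt_nums ballI) (simp_all, force+)
  from this[unfolded sorted_wrt_iff_nth_less, rule_format, OF ij a b] show ?thesis .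
 qed
 let ?p = "\<lambda>u. (ldeg ?D u, tdeg u)"
 have "leg_sign ?D t' = prod_list (map (leg_sign ?D) ?ts) * pair_prod (\<lambda>u v. psign (ldeg ?D u * tdeg v)) ?ts"
  unfolding t'_def by (rule leg_sign_Vert) (rule ord)
 also have "pair_prod (\<lambda>u v. psign (ldeg ?D u * tdeg v)) ?ts = pair_prod (\<lambda>u v. psign (fst u * snd v)) (map ?p ?ts)"
  by (simp only: pair_prod_map fst_conv snd_conv)
 also have "map ?p ?ts = map ?p ?us @ (sum_list (map fst w), tdeg t) # map ?p ?vs"
  by (simp add: ld)
 also have "prod_list (map (leg_sign ?D) ?ts) =
   leg_sign (\<lambda>a. fst (w ! (a - (k + length L)))) t * prod_list (map (leg_sign ?D) (?us @ ?vs))"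
  by (simp add: lt)
 finally show "leg_sign ?D t' =
   leg_sign (\<lambda>a. fst (w ! (a - (k + length L)))) t *
   (prod_list (map (leg_sign ?D) (?us @ ?vs)) *
    pair_prod (\<lambda>u v. psign (fst u * snd v))
    (map ?p ?us @ (sum_list (map fst w), tdeg t) # map ?p ?vs))"
  by (simp only: mult.assoc)
qed

lemma relator_lift:
 fixes r :: "('k::field, 'y) dforest"
 assumes "relator m (carrier_pairs Y) fst (linear_relators Y) r"
 shows "(\<exists>l. \<forall>k. lifted_relator m Y l k r) \<or> (\<exists>l. \<forall>k. linearity_relator m Y l k r)"
 using assms
proof (induction rule: relator.induct)
 case (leaf r)
 then obtain e c x y where r: "r = gen (e, c \<odot>\<^bsub>Y e\<^esub> x \<oplus>\<^bsub>Y e\<^esub> y) - fscale c (gen (e, x)) - gen (e, y)"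
  "x \<in> carrier (Y e)" "y \<in> carrier (Y e)" by (auto simp: linear_relators_def)
 have "linearity_relator m Y 1 k (lin_ext (\<lambda>b. gen (Leg b)) r)" for k
  unfolding linearity_relator_def
  by (rule exI[of _ "Leg k"], rule exI[of _ "[(e, x)]"], rule exI[of _ 0], rule exI[of _ e], rule exI[of _ c],
    rule exI[of _ x], rule exI[of _ y]) (use r in \<open>simp add: lin_ext_diff lin_ext_fscale\<close>)
 then show ?case by blast
next
 case (swap s e s')
 have "lifted_relator m Y (arity s) k (gen s - fscale (of_int e) (gen s'))" for k
 proof -
  let ?w = "labels s" and ?t = "num k s"
  let ?D = "\<lambda>a. fst (?w ! (a - k))"
  have l: "labels ?t = [k..<k + arity s]" by (rule labels_num)
  obtain e' t' where t': "swaps (\<lambda>_. 0) e' ?t t'" "map_tree (\<lambda>a. ?w ! (a - k)) t' = s'"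
   "e = e' * leg_sign ?D ?t * leg_sign ?D t'"
  proof -
   have "distinct (labels ?t)" unfolding l by (rule distinct_upt)
   from swaps_lift[OF swap(2) map_tree_num_nth[of s k] this] that show ?thesis by blast
  qed
  have "relator m UNIV (\<lambda>_. 0) {} (gen ?t - fscale (of_int e') (gen t') :: 'k forest)"
   using swap(1) by (intro relator.swap t'(1)) (simp add: valid_def)
  moreover have "mset (labels t) = mset [k..<k + arity s]"
   if "t \<in> supp (gen ?t - fscale (of_int e') (gen t') :: 'k forest)" for t
  proof -
   have "gen ?t - fscale (of_int e') (gen t') \<in> (span_on {?t, t'} :: 'k opel)"
    by (intro span_on_diff span_on_fscale) auto
   from span_on_keysD[OF this that] show ?thesis
    using swaps_labels[OF t'(1)] by (elim insertE emptyE) (simp_all add: l)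
  qed
  moreover have "gen s - fscale (of_int e) (gen s') = fscale (of_int (leg_sign ?D ?t))
    (lin_ext (decorate k ?w) (gen ?t - fscale (of_int e') (gen t') :: 'k forest))"
  proof -
   have "leg_sign ?D ?t * (e' * leg_sign ?D t') = e" unfolding t'(3) by (simp only: ac_simps)
   then show ?thesis
    unfolding lin_ext_diff lin_ext_fscale lin_ext_gen decorate_def map_tree_num_nth t'(2)
     free.scale_right_diff_distrib free.scale_scale of_int_mult[symmetric] leg_sign_square
    by (simp only: of_int_1 free.scale_one)
  qed
  ultimately show ?thesis
   by (intro lifted_relatorI[OF _ carrier_pairs_valid[OF swap(1)]]) (simp_all only: arity_def)
 qed
 then show ?case by blast
next
 case (jac ts)
 let ?n = "length ts"
 have "lifted_relator m Y (leg_count ts) k (jac fst ts)" for k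
 proof -
  let ?w = "concat (map labels ts)" and ?ts = "nums k ts"
  let ?D = "\<lambda>a. fst (?w ! (a - k))"
  define C where "C = prod_list (map (leg_sign ?D) ?ts) * pair_prod (\<lambda>u v. psign (ldeg ?D u * tdeg v)) ?ts"
  have l: "concat (map labels ?ts) = [k..<k + leg_count ts]" by (rule labels_num)
  have m: "map (map_tree (\<lambda>a. ?w ! (a - k))) ?ts = ts" by (rule map_tree_num(2)) simp
  have vt: "valid m UNIV t" if "t \<in> set ?ts" for t
  proof -
   have "map_tree (\<lambda>a. ?w ! (a - k)) t \<in> set (map (map_tree (\<lambda>a. ?w ! (a - k))) ?ts)"
    unfolding set_map by (rule imageI[OF that])
   then have "map_tree (\<lambda>a. ?w ! (a - k)) t \<in> set ts" by (simp only: m)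
   from jac(3)[OF this] show ?thesis by (simp add: valid_def)
  qed
  have "relator m UNIV (\<lambda>_. 0) {} (jac (\<lambda>_. 0) ?ts :: 'k forest)"
   using jac(1,2) vt by (intro relator.jac) auto
  moreover have "mset (labels t) = mset [k..<k + leg_count ts]"
   if "t \<in> supp (jac (\<lambda>_. 0) ?ts :: 'k forest)" for t
  proof -
   have "jac (\<lambda>_. 0) ?ts \<in> (span_on {t. vals_le m t \<and> mset (labels t) = mset (concat (map labels ?ts))} :: 'k opel)"
    using jac(2) vt by (intro jac_span) (auto simp: valid_def)
   from span_on_keysD[OF this that] show ?thesis unfolding l by blast
  qed
  moreover have "jac fst ts = fscale (of_int C) (lin_ext (decorate k ?w) (jac (\<lambda>_. 0) ?ts :: 'k forest))"
   unfolding lin_ext_jac unfolding jac_def split_beta free.scale_sum_right length_nums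
  proof (rule sum.cong[OF refl])
   fix p assume p: "p \<in> unsh ?n"
   obtain i \<sigma> where i\<sigma>: "p = (i, \<sigma>)" by (cases p)
   with p unshD[of i \<sigma> ?n] have i: "1 \<le> i" "i \<le> ?n" and \<sigma>: "\<sigma> permutes {..<?n}" by auto
   have srt: "a < b" if "a' < b'" "b' < length ?ts" "a \<in> set (labels (?ts ! a'))" "b \<in> set (labels (?ts ! b'))"
    for a b a' b'
    using sorted_wrt_nums[of k ts, unfolded sorted_wrt_iff_nth_less, rule_format, OF that] .
   have ls: "leg_sign ?D (jtree i (permute_list \<sigma> ?ts)) =
     koszul \<sigma> (map (dg ?D) ?ts) * koszul \<sigma> (map tdeg ?ts) * C"
    unfolding C_def
   proof (rule leg_sign_jtree)
    show "1 \<le> i" "i \<le> length ?ts" "\<sigma> permutes {..<length ?ts}" using i \<sigma> by simp_all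
    fix a b x y assume "a < b" "b < length ?ts" "x \<in> set (labels (?ts ! a))" "y \<in> set (labels (?ts ! b))"
    from srt[OF this] show "x < y \<or> ?D x * ?D y = 0" ..
   qed
   have dgs: "map (dg ?D) ?ts = map (dg fst) ts"
    using arg_cong[OF m, of "map (dg fst)"] by (simp add: comp_def)
   have mt: "map_tree (\<lambda>a. ?w ! (a - k)) (jtree i (permute_list \<sigma> ?ts)) = jtree i (permute_list \<sigma> ts)"
    using m permute_list_map[of \<sigma> ?ts "map_tree (\<lambda>a. ?w ! (a - k))"] \<sigma> by (simp add: map_jtree)
   have CC: "C * C = 1" by (rule sign_products_square[OF C_def])
   have eqq: "chi \<sigma> (map (dg fst) ts) * q = C * (chi \<sigma> (map tdeg ?ts) * q *
     (koszul \<sigma> (map (dg fst) ts) * koszul \<sigma> (map tdeg ?ts) * C))" for q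
   proof -
    have "C * (chi \<sigma> (map tdeg ?ts) * q * (koszul \<sigma> (map (dg fst) ts) * koszul \<sigma> (map tdeg ?ts) * C)) =
      (C * C) * (koszul \<sigma> (map tdeg ?ts) * koszul \<sigma> (map tdeg ?ts)) * (sign \<sigma> * koszul \<sigma> (map (dg fst) ts) * q)"
     unfolding chi_def by (simp only: ac_simps)
    also have "\<dots> = chi \<sigma> (map (dg fst) ts) * q"
     unfolding CC koszul_square by (simp add: chi_def)
    finally show ?thesis ..
   qed
   have d0: "map (dg (\<lambda>_. 0)) ?ts = map tdeg ?ts" by simp
   show "fscale (of_int (chi (snd p) (map (dg fst) ts) * psign (int (fst p * (?n - fst p)))))
      (gen (jtree (fst p) (permute_list (snd p) ts))) =
     (fscale (of_int C) (fscale (of_int (chi (snd p) (map (dg (\<lambda>_. 0)) ?ts) * psign (int (fst p * (?n - fst p)))))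
      (decorate k ?w (jtree (fst p) (permute_list (snd p) ?ts)))) :: ('k, 'y) dforest)"
    unfolding i\<sigma> fst_conv snd_conv decorate_def ls dgs mt d0 free.scale_scale of_int_mult[symmetric]
    by (rule arg_cong2[of _ _ _ _ fscale, OF arg_cong[of _ _ of_int, OF eqq] refl])
  qed
  moreover have "set ?w \<subseteq> carrier_pairs Y"
   using jac(3) by (auto simp: valid_def)
  ultimately show ?thesis
   by (rule lifted_relatorI[OF refl, rotated 1])
 qed
 then show ?case by blast
next
 case (ctx r us vs)
 let ?L = "concat (map labels us)" and ?R = "concat (map labels vs)"
 let ?K = "lin_ext (\<lambda>t. gen (Vert (us @ t # vs))) :: ('k, 'y) dforest \<Rightarrow> _"
 have LR: "set ?L \<subseteq> carrier_pairs Y" "set ?R \<subseteq> carrier_pairs Y"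
  using ctx.hyps(3) by (auto simp: valid_def)
 have vus: "valid m UNIV u" if "u \<in> set (nums q ws)" "\<forall>u\<in>set ws. valid m (carrier_pairs Y) u" for u q and ws :: "(int \<times> 'y) tree list"
  using that
 proof (induction ws arbitrary: q)
  case (Cons v ws)
  then show ?case by (auto simp: valid_def)
 qed simp
 from ctx.IH show ?case
 proof
  assume "\<exists>l. \<forall>k. lifted_relator m Y l k r"
  then obtain l where l: "\<And>k. lifted_relator m Y l k r" by blast
  have "lifted_relator m Y (length ?L + l + length ?R) k (?K r)" for k
  proof -
   let ?k = "k + length ?L"
   obtain w r' c where w: "length w = l" "set w \<subseteq> carrier_pairs Y"
    and r': "relator m UNIV (\<lambda>_. 0) {} (r' :: 'k forest)"
    and lab: "\<And>t. t \<in> supp r' \<Longrightarrow> mset (labels t) = mset [?k..<?k + l]"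
    and r: "r = fscale (of_int c) (lin_ext (decorate ?k w) r')"
    using l[of ?k] unfolding lifted_relator_def by blast
   obtain e d a where "r' \<in> span_on {t. valid m UNIV t \<and> tdeg t = e \<and> dg (\<lambda>_. 0) t = d \<and> arity t = a}"
    using relator_homogeneous[OF r' leaf_homogeneous_empty] by blast
   from span_on_keysD[OF this] have e: "tdeg t = e" if "t \<in> supp r'" for t
    using that by simp
   let ?us = "nums k us" and ?vs = "nums (?k + l) vs"
   let ?w = "?L @ w @ ?R"
   let ?t = "\<lambda>t. Vert (?us @ t # ?vs)"
   let ?r = "lin_ext (\<lambda>t. gen (?t t)) r' :: 'k forest"
   let ?D = "\<lambda>a. fst (?w ! (a - k))"
   define K where "K = prod_list (map (leg_sign ?D) (?us @ ?vs)) *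
    pair_prod (\<lambda>u v. psign (fst u * snd v)) (map (\<lambda>u. (ldeg ?D u, tdeg u)) ?us @
     (sum_list (map fst w), e) # map (\<lambda>u. (ldeg ?D u, tdeg u)) ?vs)"
   have KK: "K * K = 1" by (rule sign_products_square[OF K_def])
   have rr: "relator m UNIV (\<lambda>_. 0) {} ?r"
    using ctx.hyps(2,3) by (intro relator.ctx r') (auto intro: vus)
   have labr: "mset (labels t) = mset [k..<k + (length ?L + l + length ?R)]" if t: "t \<in> supp ?r" for t
   proof -
    have "?r \<in> span_on {t. mset (labels t) = mset [k..<k + (length ?L + l + length ?R)]}"
    proof (rule lin_ext_span_on)
     fix t assume "t \<in> supp r'"
     from numbered_ctx(1)[OF w(1) lab[OF this]]
     have "mset (labels (?t t)) = mset [k..<k + (length ?L + l + length ?R)]"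
      by (simp only: length_append w(1) add.assoc)
     then show "gen (?t t) \<in> (span_on {t. mset (labels t) = mset [k..<k + (length ?L + l + length ?R)]} :: 'k opel)"
      unfolding span_on_gen by (rule CollectI)
    qed
    from span_on_keysD[OF this t] show ?thesis by (rule CollectD)
   qed
   have "?K r =
     fscale (of_int c) (lin_ext (\<lambda>t. ?K (decorate ?k w t)) r')"
    by (simp only: r lin_ext_fscale lin_ext_comp)
   also have "lin_ext (\<lambda>t. ?K (decorate ?k w t)) r' =
     lin_ext (\<lambda>t. fscale (of_int K) (decorate k ?w (?t t))) r'"
   proof (rule lin_ext_cong)
    fix t assume t: "t \<in> supp r'"
    note n2 = numbered_ctx(2)[OF w(1) lab[OF t]] and n3 = numbered_ctx(3)[OF w(1) lab[OF t]]
    have ls: "leg_sign ?D (?t t) = leg_sign (\<lambda>a. fst (w ! (a - ?k))) t * K"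
     unfolding n3 K_def e[OF t] ..
    let ?L' = "leg_sign (\<lambda>a. fst (w ! (a - ?k))) t"
    have "K * (?L' * K) = (K * K) * ?L'" by (simp only: ac_simps)
    then have KL: "K * (?L' * K) = ?L'" unfolding KK by simp
    have 1: "?K (decorate ?k w t) =
      (fscale (of_int ?L') (gen (Vert (us @ map_tree (\<lambda>a. w ! (a - ?k)) t # vs))) :: ('k, 'y) dforest)"
     by (simp only: decorate_def lin_ext_fscale lin_ext_gen)
    have 2: "decorate k ?w (?t t) =
      (fscale (of_int (?L' * K)) (gen (Vert (us @ map_tree (\<lambda>a. w ! (a - ?k)) t # vs))) :: ('k, 'y) dforest)"
     unfolding decorate_def n2 ls ..
    show "?K (decorate ?k w t) =
      (fscale (of_int K) (decorate k ?w (?t t)) :: ('k, 'y) dforest)"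
     unfolding 1 2 free.scale_scale of_int_mult[symmetric] KL ..
   qed
   also have "fscale (of_int c) (lin_ext (\<lambda>t. fscale (of_int K) (decorate k ?w (?t t))) r') =
     fscale (of_int (c * K)) (lin_ext (decorate k ?w) ?r)"
    by (simp only: lin_ext_fun_fscale lin_ext_comp lin_ext_gen free.scale_scale of_int_mult)
   finally have "?K r = fscale (of_int (c * K)) (lin_ext (decorate k ?w) ?r)" .
   moreover have "length ?w = length ?L + l + length ?R" "set ?w \<subseteq> carrier_pairs Y"
    using w LR by simp_all
   ultimately show ?thesis
    by (intro lifted_relatorI[of ?w "length ?L + l + length ?R" Y m ?r k "?K r" "c * K", OF _ _ rr labr])
  qed
  then show ?thesis by blast
 next
  assume "\<exists>l. \<forall>k. linearity_relator m Y l k r"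
  then obtain l where l: "\<And>k. linearity_relator m Y l k r" by blast
  have "linearity_relator m Y (length ?L + l + length ?R) k (?K r)" for k
  proof -
   let ?k = "k + length ?L"
   obtain t w i e c x y where t: "mset (labels t) = mset [?k..<?k + l]" "vals_le m t"
    and w: "length w = l" "set w \<subseteq> carrier_pairs Y" and i: "i < l" and xy: "x \<in> carrier (Y e)" "y \<in> carrier (Y e)"
    and r: "r = gen (map_tree (\<lambda>a. w[i := (e, c \<odot>\<^bsub>Y e\<^esub> x \<oplus>\<^bsub>Y e\<^esub> y)] ! (a - ?k)) t)
    - fscale c (gen (map_tree (\<lambda>a. w[i := (e, x)] ! (a - ?k)) t))
    - gen (map_tree (\<lambda>a. w[i := (e, y)] ! (a - ?k)) t)"
    using l[of ?k] unfolding linearity_relator_def by blast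
   let ?t = "Vert (nums k us @ t # nums (?k + l) vs)"
   let ?w = "?L @ w @ ?R" and ?i = "length ?L + i"
   have up: "?w[?i := z] = ?L @ w[i := z] @ ?R" for z
    using i w(1) by (simp add: list_update_append)
   have mt: "map_tree (\<lambda>a. ?w[?i := z] ! (a - k)) ?t = Vert (us @ map_tree (\<lambda>a. w[i := z] ! (a - ?k)) t # vs)" for z
    unfolding up by (rule numbered_ctx(2)[OF _ t(1)]) (simp add: w)
   have "mset (labels ?t) = mset [k..<k + (length ?L + l + length ?R)]"
    using numbered_ctx(1)[OF w(1) t(1)] by (simp only: length_append w(1) add.assoc)
   moreover have "vals_le m ?t"
    using ctx.hyps(2) t(2) vus[of _ k us] vus[of _ "?k + l" vs] ctx.hyps(3)
    by (auto simp: valid_def)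
   moreover have "?K r =
     gen (map_tree (\<lambda>a. ?w[?i := (e, c \<odot>\<^bsub>Y e\<^esub> x \<oplus>\<^bsub>Y e\<^esub> y)] ! (a - k)) ?t)
    - fscale c (gen (map_tree (\<lambda>a. ?w[?i := (e, x)] ! (a - k)) ?t))
    - gen (map_tree (\<lambda>a. ?w[?i := (e, y)] ! (a - k)) ?t)"
    unfolding mt r by (simp only: lin_ext_diff lin_ext_fscale lin_ext_gen)
   moreover have "length ?w = length ?L + l + length ?R" "set ?w \<subseteq> carrier_pairs Y" "?i < length ?L + l + length ?R"
    using w LR i by simp_all
   ultimately show ?thesis
    by (intro linearity_relatorI[of ?t k _ m ?w Y ?i x e y _ c] xy)
  qed
  then show ?thesis by blast
 qed
qed

section \<open>Decorated trees and the summands of the free algebra\<close>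

text \<open>The letters stand for: \<open>V\<close> the decorations; \<open>N\<close> the relations between decorated trees; \<open>I\<close>, \<open>TR\<close> and
\<open>BR\<close> the relations that define the operad, the tensor powers and the tensor products over the
symmetric groups; \<open>T\<close>, \<open>W\<close> and \<open>H\<close> the generating trees and lists of given arity and degree.\<close>

locale free_setting =
 fixes m :: enat and Y :: "('k::field_char_0, 'y) graded"
 assumes m1: "1 \<le> m" and Y: "graded_vector_space Y"
begin

abbreviation V :: "(int \<times> 'y) set" where "V \<equiv> carrier_pairs Y"
abbreviation N :: "('k, 'y) dforest set" where "N \<equiv> relations m V fst (linear_relators Y)"
abbreviation I :: "nat \<Rightarrow> 'k opel" where "I n \<equiv> op_ideal m n"
abbreviation TR :: "nat \<Rightarrow> ((int \<times> 'y) list \<Rightarrow>\<^sub>0 'k) set" where "TR n \<equiv> tensor_rels Y n"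
abbreviation BR :: "nat \<Rightarrow> (('k, 'y) bal_gen \<Rightarrow>\<^sub>0 'k) set" where "BR n \<equiv> bal_rels m Y n"
abbreviation T :: "nat \<Rightarrow> int \<Rightarrow> nat tree set" where "T n p \<equiv> {t \<in> trees m n. tdeg t = p}"
abbreviation W :: "nat \<Rightarrow> int \<Rightarrow> (int \<times> 'y) list set" where
 "W n q \<equiv> {w. homogeneous_list Y w \<and> length w = n \<and> total_degree w = q}"
abbreviation H :: "nat \<Rightarrow> (int \<times> 'y) list set" where "H n \<equiv> {w. homogeneous_list Y w \<and> length w = n}"

lemma Y_closed: "x \<in> carrier (Y d) \<Longrightarrow> y \<in> carrier (Y d) \<Longrightarrow> c \<odot>\<^bsub>Y d\<^esub> x \<oplus>\<^bsub>Y d\<^esub> y \<in> carrier (Y d)"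
proof -
 assume xy: "x \<in> carrier (Y d)" "y \<in> carrier (Y d)"
 interpret M: Module.module "ring_of_type_algebra :: 'k ring" "Y d"
  using Y by (simp add: graded_vector_space_def)
 have "c \<in> carrier (ring_of_type_algebra :: 'k ring)" by (simp add: ring_of_type_algebra_def)
 with xy show ?thesis by simp
qed

lemma leaf_homogeneous_linear: "leaf_homogeneous V fst (linear_relators Y)"
proof -
 have "gen (e, c \<odot>\<^bsub>Y e\<^esub> x \<oplus>\<^bsub>Y e\<^esub> y) - fscale c (gen (e, x)) - gen (e, y) \<in> span_on {b \<in> V. fst b = e}"
  if "x \<in> carrier (Y e)" "y \<in> carrier (Y e)" for e c x y
  using that by (intro span_on_diff span_on_fscale) (auto intro: Y_closed)
 then show ?thesis
  unfolding leaf_homogeneous_def linear_relators_def by blast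
qed

lemma subspace_TR: "free.subspace (TR n)"
 by (simp add: tensor_rels_def)

lemma subspace_BR: "free.subspace (BR n)"
 by (simp add: bal_rels_def)

lemma subspace_I: "free.subspace (I n)"
 by (rule subspace_op_ideal)

lemma subspace_N: "free.subspace N"
 by (rule subspace_relations)

lemma homogeneous_update:
 "homogeneous_list Y w \<Longrightarrow> z \<in> carrier (Y e) \<Longrightarrow> homogeneous_list Y (w[i := (e, z)])"
 using set_update_subset_insert[of w i "(e, z)"] by (auto simp: homogeneous_list_iff)

lemma TR_subset: "TR n \<subseteq> span_on (H n)"
 unfolding tensor_rels_def
proof (rule free.span_minimal[OF _ subspace_span_on], clarify)
 fix w i e c x y assume *: "homogeneous_list Y w" "x \<in> carrier (Y e)" "y \<in> carrier (Y e)" "n = length w"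
 show "gen (w[i := (e, c \<odot>\<^bsub>Y e\<^esub> x \<oplus>\<^bsub>Y e\<^esub> y)]) - fscale c (gen (w[i := (e, x)])) - gen (w[i := (e, y)])
   \<in> span_on {wa. homogeneous_list Y wa \<and> length wa = length w}"
  using * by (intro span_on_diff span_on_fscale) (auto intro: homogeneous_update Y_closed)
qed

lemma tensor_relI:
 assumes "homogeneous_list Y w" "length w = n" "i < n" "x \<in> carrier (Y e)" "y \<in> carrier (Y e)"
 shows "gen (w[i := (e, c \<odot>\<^bsub>Y e\<^esub> x \<oplus>\<^bsub>Y e\<^esub> y)]) - fscale c (gen (w[i := (e, x)])) - gen (w[i := (e, y)]) \<in> TR n"
 unfolding tensor_rels_def by (rule free.span_base) (use assms in blast)

lemma TR_induct:
 assumes "y \<in> TR n" "free.subspace M"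
  "\<And>w i e c x z. homogeneous_list Y w \<Longrightarrow> length w = n \<Longrightarrow> i < n \<Longrightarrow> x \<in> carrier (Y e) \<Longrightarrow> z \<in> carrier (Y e) \<Longrightarrow>
   g (w[i := (e, c \<odot>\<^bsub>Y e\<^esub> x \<oplus>\<^bsub>Y e\<^esub> z)]) - fscale c (g (w[i := (e, x)])) - g (w[i := (e, z)]) \<in> M"
 shows "lin_ext g y \<in> M"
 using assms(1)[unfolded tensor_rels_def] assms(2)
proof (rule span_lin_ext)
 fix r assume "r \<in> {gen (w[i := (e, c \<odot>\<^bsub>Y e\<^esub> x \<oplus>\<^bsub>Y e\<^esub> y)]) - fscale c (gen (w[i := (e, x)])) - gen (w[i := (e, y)])
   | w i e c x y. homogeneous_list Y w \<and> length w = n \<and> i < n \<and>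
     x \<in> carrier (Y e) \<and> y \<in> carrier (Y e)}"
 then show "lin_ext g r \<in> M"
  using assms(3) by (auto simp: lin_ext_diff lin_ext_fscale)
qed

subsection \<open>Decorating the legs of labelled trees\<close>

lemma labelled:
 assumes "t \<in> trees m n"
 shows "vals_le m t" "mset (labels t) = mset [0..<n]" "nform t = t" "set (labels t) = {..<n}" "distinct (labels t)"
  "arity t = n"
proof -
 show *: "vals_le m t" "mset (labels t) = mset [0..<n]" "nform t = t"
  using assms by (auto simp: trees_def)
 show "set (labels t) = {..<n}" "distinct (labels t)"
  using mset_eq_setD[OF *(2)] distinct_mset_upt[OF *(2)] by (simp_all add: lessThan_atLeast0)
 show "arity t = n" using mset_eq_length[OF *(2)] by (simp add: arity_def)
qed

lemma subst_Leg:
 assumes "set (labels t) \<subseteq> {..<length w}"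
 shows "subst fst (map Leg w) t = decorate 0 w t"
proof -
 have nth: "map Leg w ! a = Leg (w ! a)" if "a \<in> set (labels t)" for a
  using that assms by auto
 have "graft ((!) (map Leg w)) t = map_tree (\<lambda>a. w ! a) t"
  unfolding graft_Leg[symmetric] by (rule graft_cong) (rule nth)
 moreover have "leg_sign (\<lambda>a. dg fst (map Leg w ! a)) t = leg_sign (\<lambda>a. fst (w ! a)) t"
  by (rule leg_sign_cong) (simp add: nth)
 ultimately show ?thesis by (simp add: subst_def decorate_def)
qed

lemma ldeg_nth:
 assumes "mset (labels t) = mset [0..<n]" "length w = n"
 shows "ldeg (\<lambda>a. f (w ! a)) t = sum_list (map f w)"
proof -
 have "ldeg (\<lambda>a. f (w ! a)) t = sum_list (map (\<lambda>a. f (w ! a)) [0..<n])"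
  unfolding ldeg_def by (rule sum_list_map_mset_cong[OF assms(1)])
 also have "map (\<lambda>a. f (w ! a)) [0..<n] = map f w"
  using assms(2) by (intro nth_equalityI) auto
 finally show ?thesis .
qed

text \<open>Puts the factors of a tensor on the legs of the trees.\<close>

definition attach :: "'k forest \<Rightarrow> ((int \<times> 'y) list \<Rightarrow>\<^sub>0 'k) \<Rightarrow> ('k, 'y) dforest" where
 "attach x y = lin_ext (\<lambda>t. lin_ext (\<lambda>w. decorate 0 w t) y) x"

lemma attach_swap: "attach x y = lin_ext (\<lambda>w. lin_ext (\<lambda>t. decorate 0 w t) x) y"
 unfolding attach_def by (rule lin_ext_swap[of "\<lambda>t w. decorate 0 w t"])

lemma attach_diff_left: "attach (x - x') y = attach x y - attach x' y"
 by (simp add: attach_def lin_ext_diff)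

lemma attach_diff_right: "attach x (y - y') = attach x y - attach x y'"
 by (simp add: attach_swap lin_ext_diff)

lemma attach_add_left: "attach (x + x') y = attach x y + attach x' y"
 by (simp add: attach_def lin_ext_add)

lemma attach_add_right: "attach x (y + y') = attach x y + attach x y'"
 by (simp add: attach_swap lin_ext_add)

lemma attach_scale_left: "attach (fscale c x) y = fscale c (attach x y)"
 by (simp add: attach_def lin_ext_fscale)

lemma attach_scale_right: "attach x (fscale c y) = fscale c (attach x y)"
 by (simp add: attach_swap lin_ext_fscale)

text \<open>Decorating the legs is the action on trivial decorated trees, so this is a case of the triviality of
the action of the ideal.\<close>

lemma attach_ideal:
 assumes "x \<in> I n" "y \<in> span_on (H n)"
 shows "attach x y \<in> N"
 unfolding attach_swap
proof (rule subspace_lin_ext[OF subspace_N])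
 fix w assume "w \<in> supp y"
 then have w: "set w \<subseteq> V" "length w = n"
  using span_on_keysD[OF assms(2)] by (auto simp: homogeneous_list_iff)
 have x: "in_ideal m n x" using assms(1) by (simp add: op_ideal_def)
 have "lin_ext (\<lambda>t. fscale ((\<lambda>_. 1) (tdeg t)) (subst fst (map Leg w) t)) x \<in> N"
  by (rule subst_ideal[OF x]) (use w in auto)
 also have "lin_ext (\<lambda>t. fscale ((\<lambda>_. 1) (tdeg t)) (subst fst (map Leg w) t)) x = lin_ext (\<lambda>t. decorate 0 w t) x"
 proof (rule lin_ext_cong)
  fix t assume "t \<in> supp x"
  then have "t \<in> trees m n" using span_on_keysD[OF in_ideal_span_on[OF x]] by blast
  from labelled(4)[OF this] show "fscale ((\<lambda>_. 1) (tdeg t)) (subst fst (map Leg w) t) = (decorate 0 w t :: _ \<Rightarrow>\<^sub>0 'k)"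
   using w(2) by (simp add: subst_Leg)
 qed
 finally show "lin_ext (\<lambda>t. decorate 0 w t) x \<in> N" .
qed

lemma leaf_linear:
 assumes "x \<in> carrier (Y e)" "z \<in> carrier (Y e)"
 shows "gen (Leg (e, c \<odot>\<^bsub>Y e\<^esub> x \<oplus>\<^bsub>Y e\<^esub> z)) - fscale c (gen (Leg (e, x))) - gen (Leg (e, z)) \<in> N"
proof -
 have "gen (e, c \<odot>\<^bsub>Y e\<^esub> x \<oplus>\<^bsub>Y e\<^esub> z) - fscale c (gen (e, x)) - gen (e, z) \<in> linear_relators Y"
  unfolding linear_relators_def
  by (rule CollectI, intro exI conjI, rule refl) (rule assms)+
 from relator_in_relations[OF relator.leaf[OF this]] show ?thesis
  by (simp add: lin_ext_diff lin_ext_fscale)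
qed

lemma attach_tensor:
 assumes "x \<in> span_on (trees m n)" "y \<in> TR n"
 shows "attach x y \<in> N"
 unfolding attach_def
proof (rule subspace_lin_ext[OF subspace_N])
 fix t assume "t \<in> supp x"
 then have "t \<in> trees m n" using span_on_keysD[OF assms(1)] by blast
 note t = labelled[OF this]
 show "lin_ext (\<lambda>w. decorate 0 w t) y \<in> N"
 proof (rule TR_induct[OF assms(2) subspace_N])
  fix w i e c x z
  assume w: "homogeneous_list Y w" "length w = n" "i < n" and xz: "x \<in> carrier (Y e)" "z \<in> carrier (Y e)"
  let ?L = "of_int (leg_sign (\<lambda>a. if a = i then e else fst (w ! a)) t) :: 'k"
  let ?S = "\<lambda>a. Leg (w ! a)"
  have dec: "decorate 0 (w[i := (e, u)]) t = fscale ?L (gen (graft (?S(i := Leg (e, u))) t))" for u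
  proof -
   have "map_tree (\<lambda>a. w[i := (e, u)] ! a) t = graft (?S(i := Leg (e, u))) t"
    unfolding graft_Leg[symmetric] by (rule graft_cong) (use w t(4) in auto)
   moreover have "leg_sign (\<lambda>a. fst (w[i := (e, u)] ! a)) t = leg_sign (\<lambda>a. if a = i then e else fst (w ! a)) t"
    by (rule leg_sign_cong) (use w t(4) in auto)
   ultimately show ?thesis by (simp add: decorate_def)
  qed
  have "lin_ext (\<lambda>s. gen (graft (?S(i := s)) t))
    (gen (Leg (e, c \<odot>\<^bsub>Y e\<^esub> x \<oplus>\<^bsub>Y e\<^esub> z)) - fscale c (gen (Leg (e, x))) - gen (Leg (e, z))) \<in> N"
  proof (rule relations_graft_slot[OF leaf_linear[OF xz] t(5) _ t(1)])
   show "i \<in> set (labels t)" using t(4) w(3) by simp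
   fix a assume "a \<in> set (labels t)"
   then have "w ! a \<in> set w" using t(4) w(2) by simp
   then show "valid m V (Leg (w ! a))" using w(1) by (auto simp: homogeneous_list_iff)
  qed
  from free.subspace_scale[OF subspace_N this, of ?L]
  show "decorate 0 (w[i := (e, c \<odot>\<^bsub>Y e\<^esub> x \<oplus>\<^bsub>Y e\<^esub> z)]) t -
    fscale c (decorate 0 (w[i := (e, x)]) t) - decorate 0 (w[i := (e, z)]) t \<in> N"
   unfolding dec by (simp add: lin_ext_diff lin_ext_fscale free.scale_right_diff_distrib mult.commute)
 qed
qed

definition perm_tensor :: "(nat \<Rightarrow> nat) \<Rightarrow> ((int \<times> 'y) list \<Rightarrow>\<^sub>0 'k) \<Rightarrow> ((int \<times> 'y) list \<Rightarrow>\<^sub>0 'k)" where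
 "perm_tensor \<sigma> = lin_ext (\<lambda>w. fscale (of_int (koszul \<sigma> (map fst w))) (gen (permute_list \<sigma> w)))"

lemma attach_relabel:
 assumes "x \<in> span_on (trees m n)" "y \<in> span_on (H n)" and \<sigma>: "\<sigma> permutes {..<n}"
 shows "attach (relabel \<sigma> x) y - attach x (perm_tensor \<sigma> y) \<in> N"
proof -
 have "attach (relabel \<sigma> x) y = lin_ext (\<lambda>t. lin_ext (\<lambda>w. lin_ext (decorate 0 w) (planar (map_tree \<sigma> t))) y) x"
 proof -
  have "attach (relabel \<sigma> x) y = lin_ext (\<lambda>t. attach (planar (map_tree \<sigma> t)) y) x"
   unfolding relabel_def attach_def lin_ext_comp ..
  then show ?thesis by (simp only: attach_swap)
 qed
 moreover have "attach x (perm_tensor \<sigma> y) =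
   lin_ext (\<lambda>t. lin_ext (\<lambda>w. fscale (of_int (koszul \<sigma> (map fst w))) (decorate 0 (permute_list \<sigma> w) t)) y) x"
  unfolding perm_tensor_def attach_def lin_ext_comp lin_ext_fscale lin_ext_gen ..
 moreover have "lin_ext (\<lambda>t. lin_ext (\<lambda>w. lin_ext (decorate 0 w) (planar (map_tree \<sigma> t))) y) x -
   lin_ext (\<lambda>t. lin_ext (\<lambda>w. fscale (of_int (koszul \<sigma> (map fst w))) (decorate 0 (permute_list \<sigma> w) t)) y) x \<in> N"
 proof (rule subspace_lin_ext_diff[OF subspace_N], rule subspace_lin_ext_diff[OF subspace_N])
  fix t w assume "t \<in> supp x" "w \<in> supp y"
  then have "t \<in> trees m n" and w: "set w \<subseteq> V" "length w = n"
   using span_on_keysD[OF assms(1)] span_on_keysD[OF assms(2)] by (auto simp: homogeneous_list_iff)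
  note t = labelled[OF this(1)]
  have t': "vals_le m (map_tree \<sigma> t)" "mset (labels (map_tree \<sigma> t)) = mset [0..<n]"
   using t(1,2) mset_map_permutes_upt[OF \<sigma>] by simp_all
  have lt': "set (labels (map_tree \<sigma> t)) \<subseteq> {..<length w}"
   using mset_eq_setD[OF t'(2)] w(2) by auto
  have lp: "set (labels (nform (map_tree \<sigma> t))) \<subseteq> {..<length w}"
   using mset_eq_setD[OF swaps_labels[OF swaps_nform[of "map_tree \<sigma> t"]]] lt' by simp
  have "lin_ext (\<lambda>t. fscale ((\<lambda>_. 1) (tdeg t)) (subst fst (map Leg w) t)) (planar (map_tree \<sigma> t))
    - fscale ((\<lambda>_. 1) (tdeg (map_tree \<sigma> t))) (subst fst (map Leg w) (map_tree \<sigma> t)) \<in> N"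
   by (rule subst_planar[OF t']) (use w in auto)
  moreover have "lin_ext (\<lambda>t. fscale ((\<lambda>_. 1) (tdeg t)) (subst fst (map Leg w) t)) (planar (map_tree \<sigma> t)) =
    (lin_ext (decorate 0 w) (planar (map_tree \<sigma> t)) :: _ \<Rightarrow>\<^sub>0 'k)"
   by (simp add: planar_def lin_ext_fscale subst_Leg[OF lp])
  moreover have "fscale ((\<lambda>_. 1) (tdeg (map_tree \<sigma> t))) (subst fst (map Leg w) (map_tree \<sigma> t)) =
    (fscale (of_int (koszul \<sigma> (map fst w))) (decorate 0 (permute_list \<sigma> w) t) :: _ \<Rightarrow>\<^sub>0 'k)"
  proof -
   have "map (\<lambda>a. dg fst (map Leg w ! a)) [0..<n] = map fst w"
    using w(2) by (intro nth_equalityI) auto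
   moreover have "permute_list \<sigma> (map Leg w) = map Leg (permute_list \<sigma> w)"
    using \<sigma> w(2) by (simp add: permute_list_map)
   moreover have "set (labels t) \<subseteq> {..<length (permute_list \<sigma> w)}" using t(4) w(2) by simp
   ultimately show ?thesis
    using subst_map_tree[OF t(2) \<sigma>, of "map Leg w" fst, where ?'k = 'k] w(2) by (simp add: subst_Leg)
  qed
  ultimately show "lin_ext (decorate 0 w) (planar (map_tree \<sigma> t)) -
    fscale (of_int (koszul \<sigma> (map fst w))) (decorate 0 (permute_list \<sigma> w) t) \<in> N" by simp
 qed
 ultimately show ?thesis by simp
qed

definition D :: "nat \<Rightarrow> int \<Rightarrow> (int \<times> 'y) tree set" where
 "D n d = {s. valid m V s \<and> arity s = n \<and> dg fst s = d}"

lemma decorated: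
 assumes "vals_le m t" "mset (labels t) = mset [0..<n]" "w \<in> H n"
 shows "map_tree (\<lambda>a. w ! a) t \<in> D n (tdeg t + total_degree w)"
proof -
 have w: "set w \<subseteq> V" "length w = n" using assms(3) by (auto simp: homogeneous_list_iff)
 have "a < n" if "a \<in> set (labels t)" for a using that mset_eq_setD[OF assms(2)] by simp
 then have "set (map (\<lambda>a. w ! a) (labels t)) \<subseteq> V" using w by auto
 moreover have "arity t = n" using mset_eq_length[OF assms(2)] by (simp add: arity_def)
 ultimately show ?thesis
  using assms(1) ldeg_nth[OF assms(2) w(2), of fst] by (simp add: D_def valid_def dg_def total_degree_def)
qed

lemma attach_span:
 assumes "x \<in> span_on (T n p)" "y \<in> span_on (W n q)"
 shows "attach x y \<in> span_on (D n (p + q))"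
 unfolding attach_def
proof (intro lin_ext_span_on)
 fix t w assume "t \<in> supp x" "w \<in> supp y"
 then have t: "t \<in> trees m n" "tdeg t = p" and w: "w \<in> H n" "total_degree w = q"
  using span_on_keysD[OF assms(1)] span_on_keysD[OF assms(2)] by auto
 show "decorate 0 w t \<in> span_on (D n (p + q))"
  unfolding decorate_def using decorated[OF labelled(1,2)[OF t(1)] w(1)] t(2) w(2)
  by (intro span_on_fscale) simp
qed

subsection \<open>Generators of the balanced tensor product\<close>

text \<open>The generator of the balanced tensor product given by two classes. As a function of their
representatives it is linear only modulo the relations.\<close>

definition G :: "nat \<Rightarrow> int \<Rightarrow> 'k forest \<Rightarrow> int \<Rightarrow> ((int \<times> 'y) list \<Rightarrow>\<^sub>0 'k) \<Rightarrow> (('k, 'y) bal_gen \<Rightarrow>\<^sub>0 'k)" where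
 "G n p x q y = gen ((p, x +o I n), (q, y +o TR n))"

lemma Lop_carrier: "a \<in> carrier (Lop m n p) \<longleftrightarrow> (\<exists>x \<in> span_on (T n p). a = x +o I n)"
 by (auto simp: Lop_def presented_def)

lemma tensor_carrier: "v \<in> carrier (tensor_power Y n q) \<longleftrightarrow> (\<exists>y \<in> span_on (W n q). v = y +o TR n)"
 by (auto simp: tensor_power_def presented_def)

lemma Lop_ops: "c \<odot>\<^bsub>Lop m n p\<^esub> (x +o I n) \<oplus>\<^bsub>Lop m n p\<^esub> (x' +o I n) = (fscale c x + x') +o I n"
 by (simp add: Lop_def presented_def coset_map_fscale[OF subspace_I] coset_add[OF subspace_I])

lemma tensor_ops:
 "c \<odot>\<^bsub>tensor_power Y n q\<^esub> (y +o TR n) \<oplus>\<^bsub>tensor_power Y n q\<^esub> (y' +o TR n) = (fscale c y + y') +o TR n"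
 by (simp add: tensor_power_def presented_def coset_map_fscale[OF subspace_TR] coset_add[OF subspace_TR])

lemma G_left:
 assumes "x \<in> span_on (T n p)" "x' \<in> span_on (T n p)" "y \<in> span_on (W n q)"
 shows "G n p (fscale c x + x') q y - (fscale c (G n p x q y) + G n p x' q y) \<in> BR n"
proof -
 have "gen ((p, c \<odot>\<^bsub>Lop m n p\<^esub> (x +o I n) \<oplus>\<^bsub>Lop m n p\<^esub> (x' +o I n)), (q, y +o TR n))
   - fscale c (gen ((p, x +o I n), (q, y +o TR n))) - gen ((p, x' +o I n), (q, y +o TR n)) \<in> BR n"
  unfolding bal_rels_def
  by (rule free.span_base, rule UnI1, rule UnI1, rule CollectI, intro exI conjI, rule refl)
   (use assms in \<open>auto simp: Lop_carrier tensor_carrier\<close>)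
 then show ?thesis unfolding Lop_ops G_def by (simp add: algebra_simps)
qed

lemma G_right:
 assumes "x \<in> span_on (T n p)" "y \<in> span_on (W n q)" "y' \<in> span_on (W n q)"
 shows "G n p x q (fscale c y + y') - (fscale c (G n p x q y) + G n p x q y') \<in> BR n"
proof -
 have "gen ((p, x +o I n), (q, c \<odot>\<^bsub>tensor_power Y n q\<^esub> (y +o TR n) \<oplus>\<^bsub>tensor_power Y n q\<^esub> (y' +o TR n)))
   - fscale c (gen ((p, x +o I n), (q, y +o TR n))) - gen ((p, x +o I n), (q, y' +o TR n)) \<in> BR n"
  unfolding bal_rels_def
  by (rule free.span_base, rule UnI1, rule UnI2, rule CollectI, intro exI conjI, rule refl)
   (use assms in \<open>auto simp: Lop_carrier tensor_carrier\<close>)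
 then show ?thesis unfolding tensor_ops G_def by (simp add: algebra_simps)
qed

lemma G_cong_left: "x - x' \<in> I n \<Longrightarrow> G n p x q y = G n p x' q y"
 unfolding G_def coset_eq_iff[OF subspace_I, symmetric] by (simp only:)

lemma G_cong_right: "y - y' \<in> TR n \<Longrightarrow> G n p x q y = G n p x q y'"
 unfolding G_def coset_eq_iff[OF subspace_TR, symmetric] by (simp only:)

lemma G_zero_left: "y \<in> span_on (W n q) \<Longrightarrow> G n p 0 q y \<in> BR n"
 using free.subspace_neg[OF subspace_BR G_left[of 0 n p 0 y q 1]] by simp

lemma G_zero_right: "x \<in> span_on (T n p) \<Longrightarrow> G n p x q 0 \<in> BR n"
 using free.subspace_neg[OF subspace_BR G_right[of x n p 0 q 0 1]] by simp

lemma G_ideal: "x \<in> I n \<Longrightarrow> y \<in> span_on (W n q) \<Longrightarrow> G n p x q y \<in> BR n"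
 using G_cong_left[of x 0 n p q y] G_zero_left[of y n q p] by simp

lemma G_scale_right:
 assumes "x \<in> span_on (T n p)" "y \<in> span_on (W n q)"
 shows "G n p x q (fscale c y) - fscale c (G n p x q y) \<in> BR n"
proof -
 have "G n p x q (fscale c y + 0) - (fscale c (G n p x q y) + G n p x q 0) \<in> BR n"
  by (rule G_right) (use assms in auto)
 from free.subspace_add[OF subspace_BR this G_zero_right[OF assms(1), of q]] show ?thesis by simp
qed

lemma G_lin_ext_left:
 assumes "\<And>t. t \<in> supp r \<Longrightarrow> g t \<in> span_on (T n p)" "y \<in> span_on (W n q)"
 shows "G n p (lin_ext g r) q y - lin_ext (\<lambda>t. G n p (g t) q y) r \<in> BR n"
proof -
 have "r \<in> span_on (supp r)" by (simp add: span_on_def)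
 then show ?thesis
 proof (induction rule: span_on_induct)
  case zero
  then show ?case using G_zero_left[OF assms(2)] by simp
 next
  case (step c t z)
  have "lin_ext g z \<in> span_on (T n p)"
   by (rule lin_ext_span_on) (use assms(1) span_on_keysD[OF step(2)] in blast)
  from free.subspace_add[OF subspace_BR G_left[OF assms(1)[OF step(1)] this assms(2), of c] step.IH] show ?case
   by (simp add: lin_ext_add lin_ext_fscale algebra_simps)
 qed
qed

lemma G_lin_ext_right:
 assumes "x \<in> span_on (T n p)" "\<And>t. t \<in> supp r \<Longrightarrow> g t \<in> span_on (W n q)"
 shows "G n p x q (lin_ext g r) - lin_ext (\<lambda>t. G n p x q (g t)) r \<in> BR n"
proof -
 have "r \<in> span_on (supp r)" by (simp add: span_on_def)
 then show ?thesis
 proof (induction rule: span_on_induct)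
  case zero
  then show ?case using G_zero_right[OF assms(1)] by simp
 next
  case (step c t z)
  have "lin_ext g z \<in> span_on (W n q)"
   by (rule lin_ext_span_on) (use assms(2) span_on_keysD[OF step(2)] in blast)
  from free.subspace_add[OF subspace_BR G_right[OF assms(1) assms(2)[OF step(1)] this, of c] step.IH] show ?case
   by (simp add: lin_ext_add lin_ext_fscale algebra_simps)
 qed
qed

lemma G_expand:
 assumes "x \<in> span_on (T n p)" "y \<in> span_on (W n q)"
 shows "G n p x q y - lin_ext (\<lambda>t. lin_ext (\<lambda>w. G n p (gen t) q (gen w)) y) x \<in> BR n"
proof -
 have 1: "G n p x q y - lin_ext (\<lambda>t. G n p (gen t) q y) x \<in> BR n"
  using G_lin_ext_left[of x gen n p y q] span_on_keysD[OF assms(1)] assms(2) by (simp add: lin_ext_id)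
 have "lin_ext (\<lambda>t. G n p (gen t) q y) x - lin_ext (\<lambda>t. lin_ext (\<lambda>w. G n p (gen t) q (gen w)) y) x \<in> BR n"
 proof (rule subspace_lin_ext_diff[OF subspace_BR])
  fix t assume "t \<in> supp x"
  then have "gen t \<in> (span_on (T n p) :: (_ \<Rightarrow>\<^sub>0 'k) set)" using span_on_keysD[OF assms(1)] by auto
  then show "G n p (gen t) q y - lin_ext (\<lambda>w. G n p (gen t) q (gen w)) y \<in> BR n"
   using G_lin_ext_right[of "gen t" n p y gen q] span_on_keysD[OF assms(2)] by (simp add: lin_ext_id)
 qed
 with 1 show ?thesis by (rule subspace_diff_trans[OF subspace_BR])
qed

lemma perm_tensor_TR:
 assumes "y \<in> TR n" and \<sigma>: "\<sigma> permutes {..<n}"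
 shows "perm_tensor \<sigma> y \<in> TR n"
 unfolding perm_tensor_def
proof (rule TR_induct[OF assms(1) subspace_TR])
 fix w i e c x z
 assume w: "homogeneous_list Y w" "length w = n" "i < n" and xz: "x \<in> carrier (Y e)" "z \<in> carrier (Y e)"
 let ?k = "of_int (koszul \<sigma> (map fst (w[i := (e, x)]))) :: 'k"
 have fst_eq: "map fst (w[i := (e, u)]) = (map fst w)[i := e]" for u by (simp add: map_update)
 obtain j where j: "j < n" "\<sigma> j = i"
 proof
  show "inv_into UNIV \<sigma> i < n" using permutes_in_image[OF permutes_inv[OF \<sigma>], of i] w(3) by simp
  show "\<sigma> (inv_into UNIV \<sigma> i) = i" by (rule permutes_inverses(1)[OF \<sigma>])
 qed
 have up: "permute_list \<sigma> (w[i := u]) = (permute_list \<sigma> w)[j := u]" for u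
 proof (rule nth_equalityI)
  fix l assume l: "l < length (permute_list \<sigma> (w[i := u]))"
  then have "\<sigma> l = i \<longleftrightarrow> l = j" using j(2) permutes_inj[OF \<sigma>] by (auto dest: injD)
  moreover have "\<sigma> l < n" using l w(2) permutes_in_image[OF \<sigma>, of l] by simp
  ultimately show "permute_list \<sigma> (w[i := u]) ! l = (permute_list \<sigma> w)[j := u] ! l"
   using l w(2,3) j \<sigma> by (cases "l = j") (simp_all add: permute_list_nth)
 qed simp
 have "homogeneous_list Y (permute_list \<sigma> w)"
  using w \<sigma> by (simp add: homogeneous_list_iff)
 from free.subspace_scale[OF subspace_TR tensor_relI[OF this _ j(1) xz, of c], of ?k] w(2)
 show "fscale (of_int (koszul \<sigma> (map fst (w[i := (e, c \<odot>\<^bsub>Y e\<^esub> x \<oplus>\<^bsub>Y e\<^esub> z)]))))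
    (gen (permute_list \<sigma> (w[i := (e, c \<odot>\<^bsub>Y e\<^esub> x \<oplus>\<^bsub>Y e\<^esub> z)]))) -
   fscale c (fscale (of_int (koszul \<sigma> (map fst (w[i := (e, x)])))) (gen (permute_list \<sigma> (w[i := (e, x)])))) -
   fscale (of_int (koszul \<sigma> (map fst (w[i := (e, z)])))) (gen (permute_list \<sigma> (w[i := (e, z)]))) \<in> TR n"
  by (simp add: fst_eq up free.scale_right_diff_distrib mult.commute)
qed

lemma perm_tensor_diff: "perm_tensor \<sigma> (x - y) = perm_tensor \<sigma> x - perm_tensor \<sigma> y"
 by (simp add: perm_tensor_def lin_ext_diff)

lemma relabel_diff: "relabel \<sigma> (x - y) = relabel \<sigma> x - relabel \<sigma> y"
 by (simp add: relabel_def lin_ext_diff)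

lemma permute_tensor_coset:
 assumes "\<sigma> permutes {..<n}"
 shows "permute_tensor Y n \<sigma> (y +o TR n) = perm_tensor \<sigma> y +o TR n"
 unfolding permute_tensor_def perm_tensor_def[symmetric]
proof (rule coset_map_coset[OF subspace_TR])
 show "y \<in> y +o TR n" by (simp add: mem_coset_iff free.subspace_0[OF subspace_TR])
 show "perm_tensor \<sigma> z - perm_tensor \<sigma> y \<in> TR n" if "z \<in> y +o TR n" for z
  using perm_tensor_TR[OF _ assms, of "z - y"] that by (simp add: mem_coset_iff perm_tensor_diff)
qed

lemma relabel_class_coset:
 assumes "\<sigma> permutes {..<n}"
 shows "relabel_class m n \<sigma> (x +o I n) = relabel \<sigma> x +o I n"
 unfolding relabel_class_def
proof (rule coset_map_coset[OF subspace_I])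
 show "x \<in> x +o I n" by (simp add: mem_coset_iff free.subspace_0[OF subspace_I])
 show "relabel \<sigma> z - relabel \<sigma> x \<in> I n" if "z \<in> x +o I n" for z
  using in_ideal.relabel[OF _ assms, of m "z - x"] that by (simp add: mem_coset_iff relabel_diff op_ideal_def)
qed

lemma G_relabel:
 assumes "x \<in> span_on (T n p)" "y \<in> span_on (W n q)" and \<sigma>: "\<sigma> permutes {..<n}"
 shows "G n p (relabel \<sigma> x) q y - G n p x q (perm_tensor \<sigma> y) \<in> BR n"
proof -
 have "gen ((p, relabel_class m n \<sigma> (x +o I n)), (q, y +o TR n))
   - gen ((p, x +o I n), (q, permute_tensor Y n \<sigma> (y +o TR n))) \<in> BR n"
  unfolding bal_rels_def
  by (rule free.span_base, rule UnI2, rule CollectI, intro exI conjI, rule refl)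
   (use assms in \<open>auto simp: Lop_carrier tensor_carrier\<close>)
 then show ?thesis unfolding relabel_class_coset[OF \<sigma>] permute_tensor_coset[OF \<sigma>] G_def .
qed

definition E :: "nat \<Rightarrow> nat tree \<Rightarrow> (int \<times> 'y) list \<Rightarrow> (('k, 'y) bal_gen \<Rightarrow>\<^sub>0 'k)" where
 "E n t w = G n (tdeg t) (planar t) (total_degree w) (gen w)"

text \<open>The class of a decorated tree in the summand of arity \<open>n\<close>: its legs are numbered from left to
right. Trees of other arities are sent to \<open>0\<close>, so that \<open>B n\<close> is also the projection to the summand.\<close>

definition B :: "nat \<Rightarrow> (int \<times> 'y) tree \<Rightarrow> (('k, 'y) bal_gen \<Rightarrow>\<^sub>0 'k)" where
 "B n s = (if valid m V s \<and> arity s = n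
   then fscale (of_int (leg_sign (\<lambda>a. fst (labels s ! a)) (num 0 s))) (E n (num 0 s) (labels s)) else 0)"

lemma planar_T: "vals_le m t \<Longrightarrow> mset (labels t) = mset [0..<n] \<Longrightarrow> planar t \<in> span_on (T n (tdeg t))"
 by (rule planar_in_trees)

text \<open>A decorated tree has many representations as a labelled tree with a list of decorations; they all
 give the same element of the balanced tensor product.\<close>

lemma B_rep:
 assumes t: "vals_le m t" "mset (labels t) = mset [0..<n]" and w: "w \<in> H n"
 shows "B n (map_tree (\<lambda>a. w ! a) t) - fscale (of_int (leg_sign (\<lambda>a. fst (w ! a)) t)) (E n t w) \<in> BR n"
proof -
 let ?s = "map_tree (\<lambda>a. w ! a) t"
 let ?t0 = "num 0 t"
 from enumerating_permutation[OF t(2)] obtain \<sigma> where \<sigma>: "\<sigma> permutes {..<n}" and ms: "map \<sigma> [0..<n] = labels t" .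
 have ar: "arity t = n" using mset_eq_length[OF t(2)] by (simp add: arity_def)
 have l0: "labels ?t0 = [0..<n]" using labels_num(1)[of 0 t] ar by simp
 have t0: "map_tree \<sigma> ?t0 = t"
  by (rule map_tree_num(1)) (simp add: ar flip: ms)
 have w': "homogeneous_list Y w" "length w = n" using w by auto
 have ls: "labels ?s = permute_list \<sigma> w"
 proof -
  have "permute_list \<sigma> w = map (\<lambda>a. w ! a) (map \<sigma> [0..<n])"
   using w'(2) by (simp add: permute_list_def)
  also have "\<dots> = labels ?s" by (simp only: ms labels_map_tree)
  finally show ?thesis by (rule sym)
 qed
 have ns: "num 0 ?s = ?t0" by (rule num_map_tree)
 have vs: "valid m V ?s" "arity ?s = n"
  using decorated[OF t w] by (auto simp: D_def)
 have tdw: "total_degree (permute_list \<sigma> w) = total_degree w"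
  unfolding total_degree_def using \<sigma> w'(2)
  by (intro sum_list_map_mset_cong) simp
 let ?k = "koszul \<sigma> (map fst w)"
 let ?p = "tdeg t" and ?q = "total_degree w"
 have td0: "tdeg ?t0 = ?p" by simp
 have P: "planar t = (relabel \<sigma> (planar ?t0) :: _ \<Rightarrow>\<^sub>0 'k)"
  using relabel_planar[of m ?t0 n \<sigma>, where ?'k = 'k] t(1) l0 \<sigma> t0 by simp
 have p0: "planar ?t0 \<in> (span_on (T n ?p) :: (_ \<Rightarrow>\<^sub>0 'k) set)"
  using planar_T[of ?t0 n] t(1) l0 by simp
 have gw: "gen w \<in> span_on (W n ?q)" "gen (permute_list \<sigma> w) \<in> span_on (W n ?q)"
  using w' \<sigma> tdw by (auto simp: homogeneous_list_iff)
 have pw: "perm_tensor \<sigma> (gen w) = fscale (of_int ?k) (gen (permute_list \<sigma> w))"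
  by (simp add: perm_tensor_def)
 have 1: "E n t w - G n ?p (planar ?t0) ?q (fscale (of_int ?k) (gen (permute_list \<sigma> w))) \<in> BR n"
  unfolding E_def P using G_relabel[OF p0 gw(1) \<sigma>] by (simp only: pw)
 have 2: "G n ?p (planar ?t0) ?q (fscale (of_int ?k) (gen (permute_list \<sigma> w))) -
   fscale (of_int ?k) (E n ?t0 (permute_list \<sigma> w)) \<in> BR n"
  unfolding E_def tdw td0 by (rule G_scale_right[OF p0 gw(2)])
 have 3: "E n t w - fscale (of_int ?k) (E n ?t0 (permute_list \<sigma> w)) \<in> BR n"
  by (rule subspace_diff_trans[OF subspace_BR 1 2])
 let ?L = "leg_sign (\<lambda>a. fst (w ! a)) t"
 let ?M = "leg_sign (\<lambda>a. fst (permute_list \<sigma> w ! a)) (num 0 t)"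
 have L: "?L = ?k * ?M"
 proof -
  have a: "leg_sign (\<lambda>a. fst (w ! a)) (map_tree \<sigma> ?t0) =
    koszul \<sigma> (map (\<lambda>a. fst (w ! a)) [0..<n]) * leg_sign (\<lambda>a. fst (w ! \<sigma> a)) ?t0"
   by (rule leg_sign_map_tree) (use l0 \<sigma> in auto)
  have b: "map (\<lambda>a. fst (w ! a)) [0..<n] = map fst w"
   using w'(2) by (intro nth_equalityI) auto
  have c: "leg_sign (\<lambda>a. fst (w ! \<sigma> a)) ?t0 = ?M"
   by (rule leg_sign_cong) (use l0 w'(2) \<sigma> in \<open>simp add: permute_list_nth\<close>)
  from a[unfolded t0 b c] show "?L = ?k * ?M" .
 qed
 have "B n ?s = fscale (of_int ?M) (E n ?t0 (permute_list \<sigma> w))"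
  unfolding B_def if_P[OF conjI[OF vs]] unfolding ls ns by (rule refl)
 moreover have "fscale (of_int ?L) (E n t w) - fscale (of_int ?L) (fscale (of_int ?k) (E n ?t0 (permute_list \<sigma> w))) \<in> BR n"
  by (rule subspace_scale_diff[OF subspace_BR 3])
 moreover have "fscale (of_int ?L) (fscale (of_int ?k) (E n ?t0 (permute_list \<sigma> w))) =
   fscale (of_int ?M) (E n ?t0 (permute_list \<sigma> w))"
 proof -
  have "?L * ?k = (?k * ?k) * ?M" unfolding L by (simp only: ac_simps)
  then have "?L * ?k = ?M" unfolding koszul_square by simp
  then show ?thesis by (simp only: free.scale_scale of_int_mult[symmetric])
 qed
 ultimately have "fscale (of_int ?L) (E n t w) - B n ?s \<in> BR n" by (simp only:)
 then show ?thesis by (rule subspace_diff_sym[OF subspace_BR])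
qed

lemma B_decorate:
 assumes t: "vals_le m t" "mset (labels t) = mset [0..<n]" and w: "w \<in> H n"
 shows "lin_ext (B n) (decorate 0 w t) - E n t w \<in> BR n"
proof -
 let ?L = "leg_sign (\<lambda>a. fst (w ! a)) t"
 have "fscale (of_int ?L) (B n (map_tree (\<lambda>a. w ! a) t)) - fscale (of_int ?L) (fscale (of_int ?L) (E n t w)) \<in> BR n"
  by (rule subspace_scale_diff[OF subspace_BR B_rep[OF assms]])
 moreover have "of_int ?L * of_int ?L = (1 :: 'k)"
  by (simp add: of_int_mult[symmetric] del: of_int_mult)
 ultimately show ?thesis
  by (simp add: decorate_def lin_ext_fscale)
qed

lemma relabelled_id:
 "mset (labels t) = mset [0..<n] \<Longrightarrow> relabelled id n t = planar t"
 by (simp add: relabelled_def tree.map_id)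

text \<open>A relator is, up to a sign, either a decorated relator between labelled trees, which vanishes
because those lie in the operadic ideal, or an instance of the linearity of the tensor power.\<close>

lemma B_relator:
 assumes "relator m V fst (linear_relators Y) r"
 shows "lin_ext (B n) r \<in> BR n"
proof -
 have other: "lin_ext (B n) r = 0" if "r \<in> span_on {s. arity s = l}" "l \<noteq> n" for l
 proof -
  have "lin_ext (B n) r = lin_ext (\<lambda>_. 0) r"
   by (rule lin_ext_cong) (use span_on_keysD[OF that(1)] that(2) in \<open>auto simp: B_def\<close>)
  then show ?thesis by simp
 qed
 from relator_lift[OF assms] consider l where "lifted_relator m Y l 0 r" | l where "linearity_relator m Y l 0 r"
  by blast
 then show ?thesis
 proof cases
  case (1 l)
  then obtain w r' c where w: "length w = l" "set w \<subseteq> V"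
    and r': "relator m UNIV (\<lambda>_. 0) {} (r' :: 'k forest)"
    and lab: "\<And>t. t \<in> supp r' \<Longrightarrow> mset (labels t) = mset [0..<l]"
    and r: "r = fscale (of_int c) (lin_ext (decorate 0 w) r')"
   unfolding lifted_relator_def add_0 by blast
  have wH: "w \<in> H l" using w by (simp add: homogeneous_list_iff)
  obtain p d a where "r' \<in> span_on {t. valid m UNIV t \<and> tdeg t = p \<and> dg (\<lambda>_. 0) t = d \<and> arity t = a}"
   using relator_homogeneous[OF r' leaf_homogeneous_empty] by blast
  from span_on_keysD[OF this] have tp: "vals_le m t" "tdeg t = p" if "t \<in> supp r'" for t
   using that by (auto simp: valid_def)
  show ?thesis
  proof (cases "l = n")
   case False
   have "r \<in> span_on {s. arity s = l}"
    unfolding r decorate_def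
   proof (intro span_on_fscale lin_ext_span_on)
    fix t assume "t \<in> supp r'"
    from mset_eq_length[OF lab[OF this]] show "gen (map_tree (\<lambda>a. w ! (a - 0)) t) \<in> (span_on {s. arity s = l} :: (_ \<Rightarrow>\<^sub>0 'k) set)"
     by (simp add: arity_def)
   qed
   from other[OF this False] show ?thesis by (simp add: free.subspace_0[OF subspace_BR])
  next
   case True
   let ?q = "total_degree w"
   have gw: "gen w \<in> span_on (W n ?q)" using wH True by simp
   have pt: "planar t \<in> (span_on (T n p) :: (_ \<Rightarrow>\<^sub>0 'k) set)" if "t \<in> supp r'" for t
    using planar_T[OF tp(1)[OF that] lab[OF that]] tp(2)[OF that] True by simp
   have "lin_ext planar r' = (lin_ext (relabelled id n) r' :: _ \<Rightarrow>\<^sub>0 'k)"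
   proof (rule lin_ext_cong)
    fix t assume "t \<in> supp r'"
    from lab[OF this] True have "mset (labels t) = mset [0..<n]" by simp
    then show "planar t = (relabelled id n t :: _ \<Rightarrow>\<^sub>0 'k)" by (rule relabelled_id[symmetric])
   qed
   then have "lin_ext planar r' \<in> I n"
    using label_relations_in_ideal[OF relator_in_relations[OF r'], of id n] by simp
   then have "G n p (lin_ext planar r') ?q (gen w) \<in> BR n" by (rule G_ideal[OF _ gw])
   moreover have "G n p (lin_ext planar r') ?q (gen w) - lin_ext (\<lambda>t. G n p (planar t) ?q (gen w)) r' \<in> BR n"
    by (rule G_lin_ext_left[OF pt gw])
   ultimately have 1: "lin_ext (\<lambda>t. G n p (planar t) ?q (gen w)) r' \<in> BR n"
    using subspace_diff_mem_iff[OF subspace_BR] by blast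
   have "lin_ext (\<lambda>t. lin_ext (B n) (decorate 0 w t)) r' - lin_ext (\<lambda>t. G n p (planar t) ?q (gen w)) r' \<in> BR n"
   proof (rule subspace_lin_ext_diff[OF subspace_BR])
    fix t assume t: "t \<in> supp r'"
    show "lin_ext (B n) (decorate 0 w t) - G n p (planar t) ?q (gen w) \<in> BR n"
     using B_decorate[OF tp(1)[OF t] lab[OF t] wH] True tp(2)[OF t] by (simp add: E_def)
   qed
   with 1 have "lin_ext (\<lambda>t. lin_ext (B n) (decorate 0 w t)) r' \<in> BR n"
    using subspace_diff_mem_iff[OF subspace_BR] by blast
   then show ?thesis
    unfolding r by (simp add: lin_ext_fscale lin_ext_comp free.subspace_scale[OF subspace_BR])
  qed
 next
  case (2 l)
  then obtain t w i e c x y where t: "mset (labels t) = mset [0..<l]" "vals_le m t"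
    and w: "length w = l" "set w \<subseteq> V" and i: "i < l" and xy: "x \<in> carrier (Y e)" "y \<in> carrier (Y e)"
    and r: "r = gen (map_tree (\<lambda>a. w[i := (e, c \<odot>\<^bsub>Y e\<^esub> x \<oplus>\<^bsub>Y e\<^esub> y)] ! a) t)
    - fscale c (gen (map_tree (\<lambda>a. w[i := (e, x)] ! a) t))
    - gen (map_tree (\<lambda>a. w[i := (e, y)] ! a) t)"
   unfolding linearity_relator_def add_0 diff_zero by blast
  show ?thesis
  proof (cases "l = n")
   case False
   have "r \<in> span_on {s. arity s = l}"
    using mset_eq_length[OF t(1)] unfolding r by (intro span_on_diff span_on_fscale) (auto simp: arity_def)
   from other[OF this False] show ?thesis by (simp add: free.subspace_0[OF subspace_BR])
  next
   case True
   let ?w = "\<lambda>u. w[i := (e, u)]"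
   let ?L = "leg_sign (\<lambda>a. fst (?w x ! a)) t"
   let ?q = "total_degree (?w x)" and ?p = "tdeg t"
   have hw: "homogeneous_list Y w" using w by (simp add: homogeneous_list_iff)
   have wH: "?w u \<in> H n" if "u \<in> carrier (Y e)" for u
    using homogeneous_update[OF hw that] w(1) True by simp
   have fst_eq: "map fst (?w u) = (map fst w)[i := e]" for u by (simp add: map_update)
   have q: "total_degree (?w u) = ?q" for u by (simp add: total_degree_def fst_eq)
   have L: "leg_sign (\<lambda>a. fst (?w u ! a)) t = ?L" for u
   proof (rule leg_sign_cong)
    fix a assume "a \<in> set (labels t)"
    then have "a < length w" using mset_eq_setD[OF t(1)] w(1) by simp
    then show "fst (?w u ! a) = fst (?w x ! a)" by (cases "a = i") auto
   qed
   have gw: "gen (?w u) \<in> span_on (W n ?q)" if "u \<in> carrier (Y e)" for u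
    using wH[OF that] q[of u] by simp
   have pt: "planar t \<in> (span_on (T n ?p) :: (_ \<Rightarrow>\<^sub>0 'k) set)"
    using planar_T[OF t(2,1)] True by simp
   have E: "E n t (?w u) = G n ?p (planar t) ?q (gen (?w u))" for u
    unfolding E_def q[of u] by (rule refl)
   let ?z = "c \<odot>\<^bsub>Y e\<^esub> x \<oplus>\<^bsub>Y e\<^esub> y"
   have B: "B n (map_tree (\<lambda>a. ?w u ! a) t) - fscale (of_int ?L) (E n t (?w u)) \<in> BR n" if "u \<in> carrier (Y e)" for u
    using B_rep[OF t(2) _ wH[OF that]] t(1) True unfolding L[of u] by simp
   have "gen (?w ?z) - (fscale c (gen (?w x)) + gen (?w y)) \<in> TR n"
    using tensor_relI[OF hw _ _ xy, of n i c] w(1) i True by (simp add: algebra_simps)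
   then have "E n t (?w ?z) = G n ?p (planar t) ?q (fscale c (gen (?w x)) + gen (?w y))"
    unfolding E by (rule G_cong_right)
   then have "E n t (?w ?z) - (fscale c (E n t (?w x)) + E n t (?w y)) \<in> BR n"
    using G_right[OF pt gw[OF xy(1)] gw[OF xy(2)], of c] by (simp only: E)
   from free.subspace_scale[OF subspace_BR this, of "of_int ?L"]
   have e: "fscale (of_int ?L) (E n t (?w ?z)) - fscale c (fscale (of_int ?L) (E n t (?w x))) - fscale (of_int ?L) (E n t (?w y)) \<in> BR n"
    by (simp add: free.scale_right_diff_distrib free.scale_right_distrib algebra_simps)
   have "lin_ext (B n) r - (fscale (of_int ?L) (E n t (?w ?z)) - fscale c (fscale (of_int ?L) (E n t (?w x))) -
     fscale (of_int ?L) (E n t (?w y))) =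
    (B n (map_tree (\<lambda>a. ?w ?z ! a) t) - fscale (of_int ?L) (E n t (?w ?z))) -
    fscale c (B n (map_tree (\<lambda>a. ?w x ! a) t) - fscale (of_int ?L) (E n t (?w x))) -
    (B n (map_tree (\<lambda>a. ?w y ! a) t) - fscale (of_int ?L) (E n t (?w y)))"
    unfolding r by (simp add: lin_ext_diff lin_ext_fscale free.scale_right_diff_distrib)
   also have "\<dots> \<in> BR n"
    by (intro free.subspace_diff free.subspace_scale subspace_BR B xy Y_closed)
   finally show ?thesis using e subspace_diff_mem_iff[OF subspace_BR] by blast
  qed
 qed
qed

lemma B_relations: "x \<in> N \<Longrightarrow> lin_ext (B n) x \<in> BR n"
 unfolding relations_def
 by (rule span_lin_ext[OF _ subspace_BR]) (auto intro: B_relator)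

subsection \<open>From the balanced tensor product to decorated trees\<close>

definition repI :: "nat \<Rightarrow> int \<Rightarrow> 'k opel \<Rightarrow> 'k forest" where
 "repI n p a = (SOME x. x \<in> span_on (T n p) \<and> a = x +o I n)"

definition repT :: "nat \<Rightarrow> int \<Rightarrow> ('k, 'y) tensor \<Rightarrow> ((int \<times> 'y) list \<Rightarrow>\<^sub>0 'k)" where
 "repT n q v = (SOME y. y \<in> span_on (W n q) \<and> v = y +o TR n)"

text \<open>The inverse of \<open>B n\<close>, on chosen representatives of the two classes. It is well defined modulo \<open>N\<close>
because \<open>attach\<close> maps the operadic ideal and the relations of the tensor power to \<open>N\<close>.\<close>

definition unbal :: "nat \<Rightarrow> (('k, 'y) bal_gen \<Rightarrow>\<^sub>0 'k) \<Rightarrow> ('k, 'y) dforest" where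
 "unbal n = lin_ext (\<lambda>((p, a), (q, v)). attach (repI n p a) (repT n q v))"

lemma repI:
 assumes "a \<in> carrier (Lop m n p)"
 shows "repI n p a \<in> span_on (T n p)" "a = repI n p a +o I n"
proof -
 from assms obtain x where "x \<in> span_on (T n p)" "a = x +o I n"
  unfolding Lop_carrier by (rule bexE)
 then have "\<exists>x. x \<in> span_on (T n p) \<and> a = x +o I n" by (intro exI conjI)
 then have "repI n p a \<in> span_on (T n p) \<and> a = repI n p a +o I n"
  unfolding repI_def by (rule someI_ex)
 then show "repI n p a \<in> span_on (T n p)" "a = repI n p a +o I n"
  by (rule conjunct1, rule conjunct2)
qed

lemma repT:
 assumes "v \<in> carrier (tensor_power Y n q)"
 shows "repT n q v \<in> span_on (W n q)" "v = repT n q v +o TR n"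
proof -
 from assms obtain y where "y \<in> span_on (W n q)" "v = y +o TR n"
  unfolding tensor_carrier by (rule bexE)
 then have "\<exists>y. y \<in> span_on (W n q) \<and> v = y +o TR n" by (intro exI conjI)
 then have "repT n q v \<in> span_on (W n q) \<and> v = repT n q v +o TR n"
  unfolding repT_def by (rule someI_ex)
 then show "repT n q v \<in> span_on (W n q)" "v = repT n q v +o TR n"
  by (rule conjunct1, rule conjunct2)
qed

lemma span_T: "x \<in> span_on (T n p) \<Longrightarrow> x \<in> span_on (trees m n)"
 by (rule span_on_mono[rotated]) auto

lemma span_W: "y \<in> span_on (W n q) \<Longrightarrow> y \<in> span_on (H n)"
 by (rule span_on_mono[rotated]) auto

lemma unbal_gen:
 assumes "x \<in> span_on (trees m n)" "y \<in> span_on (H n)" "a \<in> carrier (Lop m n p)" "v \<in> carrier (tensor_power Y n q)"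
  "a = x +o I n" "v = y +o TR n"
 shows "unbal n (gen ((p, a), (q, v))) - attach x y \<in> N"
proof -
 let ?x = "repI n p a" and ?y = "repT n q v"
 have x: "?x - x \<in> I n"
  unfolding coset_eq_iff[OF subspace_I, symmetric]
  by (rule trans[OF repI(2)[OF assms(3), symmetric] assms(5)])
 have y: "?y - y \<in> TR n"
  unfolding coset_eq_iff[OF subspace_TR, symmetric]
  by (rule trans[OF repT(2)[OF assms(4), symmetric] assms(6)])
 have "attach (?x - x) ?y \<in> N"
  by (rule attach_ideal[OF x span_W[OF repT(1)[OF assms(4)]]])
 moreover have "attach x (?y - y) \<in> N"
  by (rule attach_tensor[OF assms(1) y])
 ultimately have "attach (?x - x) ?y + attach x (?y - y) \<in> N"
  by (rule free.subspace_add[OF subspace_N])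
 moreover have "unbal n (gen ((p, a), (q, v))) = attach ?x ?y" by (simp add: unbal_def)
 ultimately show ?thesis by (simp add: attach_diff_left attach_diff_right)
qed

lemma unbal_G:
 assumes "x \<in> span_on (T n p)" "y \<in> span_on (W n q)"
 shows "unbal n (G n p x q y) - attach x y \<in> N"
 unfolding G_def
 by (rule unbal_gen[OF span_T[OF assms(1)] span_W[OF assms(2)]])
  (use assms in \<open>auto simp: Lop_carrier tensor_carrier\<close>)

lemma unbal_diff: "unbal n (x - y) = unbal n x - unbal n y"
 and unbal_scale: "unbal n (fscale c x) = fscale c (unbal n x)"
 by (simp_all add: unbal_def lin_ext_diff lin_ext_fscale)

lemma perm_tensor_W:
 assumes "y \<in> span_on (W n q)" "\<sigma> permutes {..<n}"
 shows "perm_tensor \<sigma> y \<in> span_on (W n q)"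
 unfolding perm_tensor_def
proof (intro lin_ext_span_on span_on_fscale)
 fix w assume "w \<in> supp y"
 then have "homogeneous_list Y w" "length w = n" "total_degree w = q"
  using span_on_keysD[OF assms(1)] by auto
 then show "gen (permute_list \<sigma> w) \<in> span_on (W n q)"
  using assms(2) sum_list_map_mset_cong[OF mset_permute_list[of \<sigma> w], of fst]
  by (simp add: homogeneous_list_iff total_degree_def)
qed

lemma relabel_T:
 assumes "x \<in> span_on (T n p)" "\<sigma> permutes {..<n}"
 shows "relabel \<sigma> x \<in> span_on (T n p)"
 unfolding relabel_def
proof (rule lin_ext_span_on)
 fix t assume "t \<in> supp x"
 then have t: "t \<in> trees m n" "tdeg t = p" using span_on_keysD[OF assms(1)] by auto
 have "mset (labels (map_tree \<sigma> t)) = mset [0..<n]"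
  using labelled(2)[OF t(1)] mset_map_permutes_upt[OF assms(2)] by simp
 then show "planar (map_tree \<sigma> t) \<in> span_on (T n p)"
  using planar_T[of "map_tree \<sigma> t" n] labelled(1)[OF t(1)] t(2) by simp
qed

lemma unbal_relations:
 assumes "z \<in> BR n"
 shows "unbal n z \<in> N"
 unfolding unbal_def
proof (rule span_lin_ext[OF assms[unfolded bal_rels_def] subspace_N], unfold unbal_def[symmetric], elim UnE CollectE exE conjE, goal_cases)
 case (1 r p q c a b v)
 from 1(2-4) obtain x x' y where x: "x \<in> span_on (T n p)" "a = x +o I n" "x' \<in> span_on (T n p)" "b = x' +o I n"
  and y: "y \<in> span_on (W n q)" "v = y +o TR n" by (auto simp: Lop_carrier tensor_carrier)
 have r': "r = G n p (fscale c x + x') q y - fscale c (G n p x q y) - G n p x' q y"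
  by (simp only: 1(1) x y Lop_ops G_def)
 have xx: "fscale c x + x' \<in> span_on (T n p)" using x by (intro span_on_add span_on_fscale)
 have "unbal n r - (attach (fscale c x + x') y - fscale c (attach x y) - attach x' y) =
   (unbal n (G n p (fscale c x + x') q y) - attach (fscale c x + x') y) -
   fscale c (unbal n (G n p x q y) - attach x y) - (unbal n (G n p x' q y) - attach x' y)"
  unfolding r' by (simp add: unbal_diff unbal_scale free.scale_right_diff_distrib)
 also have "\<dots> \<in> N"
  by (intro free.subspace_diff free.subspace_scale subspace_N unbal_G xx x y)
 finally show ?case by (simp add: attach_add_left attach_scale_left)
next
 case (2 r p q c a v u)
 from 2(2-4) obtain x y y' where x: "x \<in> span_on (T n p)" "a = x +o I n"
  and y: "y \<in> span_on (W n q)" "v = y +o TR n" "y' \<in> span_on (W n q)" "u = y' +o TR n"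
  by (auto simp: Lop_carrier tensor_carrier)
 have r': "r = G n p x q (fscale c y + y') - fscale c (G n p x q y) - G n p x q y'"
  by (simp only: 2(1) x y tensor_ops G_def)
 have yy: "fscale c y + y' \<in> span_on (W n q)" using y by (intro span_on_add span_on_fscale)
 have "unbal n r - (attach x (fscale c y + y') - fscale c (attach x y) - attach x y') =
   (unbal n (G n p x q (fscale c y + y')) - attach x (fscale c y + y')) -
   fscale c (unbal n (G n p x q y) - attach x y) - (unbal n (G n p x q y') - attach x y')"
  unfolding r' by (simp add: unbal_diff unbal_scale free.scale_right_diff_distrib)
 also have "\<dots> \<in> N"
  by (intro free.subspace_diff free.subspace_scale subspace_N unbal_G yy x y)
 finally show ?case by (simp add: attach_add_right attach_scale_right)
next
 case (3 r p q a v \<sigma>)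
 note \<sigma> = 3(4)
 from 3(2,3) obtain x y where x: "x \<in> span_on (T n p)" "a = x +o I n" and y: "y \<in> span_on (W n q)" "v = y +o TR n"
  by (auto simp: Lop_carrier tensor_carrier)
 have r': "r = G n p (relabel \<sigma> x) q y - G n p x q (perm_tensor \<sigma> y)"
  by (simp only: 3(1) x y relabel_class_coset[OF \<sigma>] permute_tensor_coset[OF \<sigma>] G_def)
 have "unbal n r - (attach (relabel \<sigma> x) y - attach x (perm_tensor \<sigma> y)) =
   (unbal n (G n p (relabel \<sigma> x) q y) - attach (relabel \<sigma> x) y) -
   (unbal n (G n p x q (perm_tensor \<sigma> y)) - attach x (perm_tensor \<sigma> y))"
  unfolding r' by (simp add: unbal_diff)
 also have "\<dots> \<in> N"
  by (intro free.subspace_diff subspace_N unbal_G relabel_T perm_tensor_W x y \<sigma>)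
 finally show ?case
  using attach_relabel[OF span_T[OF x(1)] span_W[OF y(1)] \<sigma>] subspace_diff_mem_iff[OF subspace_N] by blast
qed

lemma attach_planar:
 assumes t: "vals_le m t" "mset (labels t) = mset [0..<n]" and w: "w \<in> H n"
 shows "attach (planar t) (gen w) - decorate 0 w t \<in> N"
proof -
 have "lin_ext (\<lambda>t. fscale ((\<lambda>_. 1) (tdeg t)) (subst fst (map Leg w) t)) (planar t)
   - fscale ((\<lambda>_. 1) (tdeg t)) (subst fst (map Leg w) t) \<in> N"
  by (rule subst_planar[OF t]) (use w in \<open>auto simp: homogeneous_list_iff\<close>)
 moreover have "set (labels t) \<subseteq> {..<length w}" "set (labels (nform t)) \<subseteq> {..<length w}"
  using mset_eq_setD[OF t(2)] mset_eq_setD[OF swaps_labels[OF swaps_nform[of t]]] w by auto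
 ultimately show ?thesis
  by (simp add: attach_def planar_def lin_ext_fscale subst_Leg)
qed

lemma unbal_B:
 assumes "valid m V s" "arity s = n"
 shows "unbal n (B n s) - gen s \<in> N"
proof -
 let ?t = "num 0 s" and ?w = "labels s"
 let ?L = "leg_sign (\<lambda>a. fst (?w ! a)) ?t"
 have t: "vals_le m ?t" "mset (labels ?t) = mset [0..<n]"
  using assms labels_num(1)[of 0 s] by (auto simp: valid_def)
 have w: "?w \<in> H n" using assms by (auto simp: valid_def homogeneous_list_iff arity_def)
 have "unbal n (E n ?t ?w) - attach (planar ?t) (gen ?w) \<in> N"
  unfolding E_def by (rule unbal_G[OF planar_T[OF t]]) (use w in simp)
 moreover have "attach (planar ?t) (gen ?w) - decorate 0 ?w ?t \<in> N" by (rule attach_planar[OF t w])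
 ultimately have "unbal n (E n ?t ?w) - decorate 0 ?w ?t \<in> N"
  by (rule subspace_diff_trans[OF subspace_N])
 from subspace_scale_diff[OF subspace_N this, of "of_int ?L"]
 have "unbal n (B n s) - fscale (of_int ?L) (decorate 0 ?w ?t) \<in> N"
  using assms by (simp add: B_def unbal_scale)
 moreover have "fscale (of_int ?L) (decorate 0 ?w ?t) = (gen s :: _ \<Rightarrow>\<^sub>0 'k)"
 proof -
  have "of_int ?L * of_int ?L = (1 :: 'k)"
   unfolding of_int_mult[symmetric] leg_sign_square by simp
  then show ?thesis using map_tree_num_nth[of s 0] by (simp add: decorate_def)
 qed
 ultimately show ?thesis by simp
qed

definition bal_gens :: "nat \<Rightarrow> int \<Rightarrow> ('k, 'y) bal_gen set" where
 "bal_gens n d = {((p, a), (q, v)) | p a q v.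
   a \<in> carrier (Lop m n p) \<and> v \<in> carrier (tensor_power Y n q) \<and> p + q = d}"

lemma unbal_span: "z \<in> span_on (bal_gens n d) \<Longrightarrow> unbal n z \<in> span_on (D n d)"
 unfolding unbal_def
proof (rule lin_ext_span_on, goal_cases)
 case (1 g)
 from span_on_keysD[OF 1] have "g \<in> bal_gens n d" .
 then obtain p a q v where g: "g = ((p, a), (q, v))" "a \<in> carrier (Lop m n p)"
  "v \<in> carrier (tensor_power Y n q)" "p + q = d" by (auto simp: bal_gens_def)
 then show ?case
  using attach_span[OF repI(1)[OF g(2)] repT(1)[OF g(3)]] by simp
qed

lemma B_attach:
 assumes "x \<in> span_on (T n p)" "y \<in> span_on (W n q)"
 shows "lin_ext (B n) (attach x y) - G n p x q y \<in> BR n"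
proof -
 have "lin_ext (B n) (decorate 0 w t) - G n p (gen t) q (gen w) \<in> BR n"
  if "t \<in> supp x" "w \<in> supp y" for t w
 proof -
  have t: "t \<in> trees m n" "tdeg t = p" and w: "w \<in> H n" "total_degree w = q"
   using span_on_keysD[OF assms(1) that(1)] span_on_keysD[OF assms(2) that(2)] by auto
  have "planar t = (gen t :: _ \<Rightarrow>\<^sub>0 'k)"
   using planar_nform_id[OF labelled(3,1,5)[OF t(1)]] .
  then show ?thesis
   using B_decorate[OF labelled(1,2)[OF t(1)] w(1)] t(2) w(2) by (simp add: E_def)
 qed
 then have "lin_ext (\<lambda>t. lin_ext (\<lambda>w. lin_ext (B n) (decorate 0 w t)) y) x -
   lin_ext (\<lambda>t. lin_ext (\<lambda>w. G n p (gen t) q (gen w)) y) x \<in> BR n"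
  by (intro subspace_lin_ext_diff[OF subspace_BR])
 then have "lin_ext (B n) (attach x y) - lin_ext (\<lambda>t. lin_ext (\<lambda>w. G n p (gen t) q (gen w)) y) x \<in> BR n"
  unfolding attach_def lin_ext_comp .
 from subspace_diff_trans[OF subspace_BR this subspace_diff_sym[OF subspace_BR G_expand[OF assms]]]
 show ?thesis .
qed

lemma B_unbal:
 assumes "z \<in> span_on (bal_gens n d)"
 shows "lin_ext (B n) (unbal n z) - z \<in> BR n"
proof -
 have "lin_ext (\<lambda>g. lin_ext (B n) (unbal n (gen g))) z - lin_ext gen z \<in> BR n"
 proof (rule subspace_lin_ext_diff[OF subspace_BR])
  fix g assume "g \<in> supp z"
  then have "g \<in> bal_gens n d" by (rule span_on_keysD[OF assms])
  then obtain p a q v where g: "g = ((p, a), (q, v))" "a \<in> carrier (Lop m n p)"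
   "v \<in> carrier (tensor_power Y n q)" by (auto simp: bal_gens_def)
  have "gen g = G n p (repI n p a) q (repT n q v)"
   unfolding G_def g(1) repI(2)[OF g(2), symmetric] repT(2)[OF g(3), symmetric] ..
  moreover have "unbal n (gen g) = attach (repI n p a) (repT n q v)" by (simp add: unbal_def g(1))
  ultimately show "lin_ext (B n) (unbal n (gen g)) - gen g \<in> BR n"
   using B_attach[OF repI(1)[OF g(2)] repT(1)[OF g(3)]] by (simp only:)
 qed
 then show ?thesis by (simp add: unbal_def lin_ext_comp lin_ext_id)
qed

end

section \<open>The free space as a quotient of the space of decorated trees\<close>

text \<open>An additive map that is compatible with the scalars carries the vector space axioms to its image.\<close>

lemma module_of_image:
 fixes M :: "('k::field_char_0, 'v) module" and h :: "('a \<Rightarrow>\<^sub>0 'k) \<Rightarrow> 'v"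
 assumes S: "free.subspace S" and carrier: "carrier M = h ` S" and zero: "\<zero>\<^bsub>M\<^esub> = h 0"
  and add: "\<And>x y. x \<in> S \<Longrightarrow> y \<in> S \<Longrightarrow> h x \<oplus>\<^bsub>M\<^esub> h y = h (x + y)"
  and smult: "\<And>c x. x \<in> S \<Longrightarrow> c \<odot>\<^bsub>M\<^esub> h x = h (fscale c x)"
 shows "Module.module (ring_of_type_algebra :: 'k ring) M"
proof -
 have S0: "0 \<in> S" and Sadd: "\<And>x y. x \<in> S \<Longrightarrow> y \<in> S \<Longrightarrow> x + y \<in> S"
  and Ss: "\<And>c x. x \<in> S \<Longrightarrow> fscale c x \<in> S" and Sm: "\<And>x. x \<in> S \<Longrightarrow> - x \<in> S"
  using S by (auto simp: free.subspace_0 free.subspace_add free.subspace_scale free.subspace_neg)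
 have "abelian_group M"
 proof (rule abelian_groupI)
  fix a assume "a \<in> carrier M"
  then obtain x where x: "x \<in> S" "a = h x" unfolding carrier by blast
  then have "h (- x) \<in> carrier M" unfolding carrier using Sm by blast
  moreover have "h (- x) \<oplus>\<^bsub>M\<^esub> a = \<zero>\<^bsub>M\<^esub>" unfolding x(2) zero using add[OF Sm[OF x(1)] x(1)] by simp
  ultimately show "\<exists>b\<in>carrier M. b \<oplus>\<^bsub>M\<^esub> a = \<zero>\<^bsub>M\<^esub>" by blast
 qed (auto simp: carrier zero add S0 Sadd add_ac)
 then show ?thesis
  by (intro moduleI cring_from_type_algebra)
   (auto simp: carrier smult add Ss Sadd ring_of_type_algebra_def free.scale_right_distrib free.scale_left_distrib)
qed

context free_setting
begin

abbreviation F :: "int \<Rightarrow> ('k, ('k, 'y) free_elt) module" where "F \<equiv> free_space m Y"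

abbreviation TD :: "int \<Rightarrow> (int \<times> 'y) tree set" where "TD d \<equiv> {s. valid m V s \<and> dg fst s = d}"

text \<open>The class of a combination of decorated trees of degree \<open>d\<close> in the free space, component by component.\<close>

definition beta :: "int \<Rightarrow> ('k, 'y) dforest \<Rightarrow> ('k, 'y) free_elt" where
 "beta d x = (\<lambda>n\<in>{1..}. lin_ext (B n) x +o BR n)"

lemma bal_tensor_presented: "bal_tensor m Y n d = presented (bal_gens n d) (BR n)"
 by (simp add: bal_tensor_def bal_gens_def)

lemma bal_simps:
 "carrier (bal_tensor m Y n d) = (\<lambda>z. z +o BR n) ` span_on (bal_gens n d)"
 "\<zero>\<^bsub>bal_tensor m Y n d\<^esub> = BR n"
 "(z +o BR n) \<oplus>\<^bsub>bal_tensor m Y n d\<^esub> (z' +o BR n) = (z + z') +o BR n"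
 "c \<odot>\<^bsub>bal_tensor m Y n d\<^esub> (z +o BR n) = fscale c z +o BR n"
 unfolding bal_tensor_presented presented_def
 by (simp_all add: coset_add[OF subspace_BR] coset_map_fscale[OF subspace_BR])

lemma F_simps:
 "f \<in> carrier (F d) \<longleftrightarrow> f \<in> (\<Pi>\<^sub>E n\<in>{1..}. carrier (bal_tensor m Y n d)) \<and> finite {n \<in> {1..}. f n \<noteq> BR n}"
 "\<zero>\<^bsub>F d\<^esub> = (\<lambda>n\<in>{1..}. BR n)"
 "f \<oplus>\<^bsub>F d\<^esub> g = (\<lambda>n\<in>{1..}. f n \<oplus>\<^bsub>bal_tensor m Y n d\<^esub> g n)"
 "c \<odot>\<^bsub>F d\<^esub> f = (\<lambda>n\<in>{1..}. c \<odot>\<^bsub>bal_tensor m Y n d\<^esub> f n)"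
 by (simp_all add: free_space_def direct_sum_def bal_simps(2))

lemma beta_add: "beta d x \<oplus>\<^bsub>F d\<^esub> beta d y = beta d (x + y)"
 by (simp add: F_simps beta_def bal_simps lin_ext_add cong: restrict_cong)

lemma beta_scale: "c \<odot>\<^bsub>F d\<^esub> beta d x = beta d (fscale c x)"
 by (simp add: F_simps beta_def bal_simps lin_ext_fscale cong: restrict_cong)

lemma beta_0: "beta d 0 = \<zero>\<^bsub>F d\<^esub>"
 by (simp add: F_simps beta_def)

lemma beta_cong: "x - y \<in> N \<Longrightarrow> beta d x = beta d y"
proof -
 assume "x - y \<in> N"
 then have "lin_ext (B n) x +o BR n = lin_ext (B n) y +o BR n" for n
  using B_relations[of "x - y" n] by (simp add: coset_eq_iff[OF subspace_BR] lin_ext_diff)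
 then show ?thesis by (simp add: beta_def)
qed

lemma B_span: "s \<in> TD d \<Longrightarrow> B n s \<in> span_on (bal_gens n d)"
proof (cases "valid m V s \<and> arity s = n")
 case True
 assume s: "s \<in> TD d"
 let ?t = "num 0 s" and ?w = "labels s"
 have t: "vals_le m ?t" "mset (labels ?t) = mset [0..<n]"
  using True labels_num(1)[of 0 s] by (auto simp: valid_def)
 have w: "?w \<in> H n" using True by (auto simp: valid_def homogeneous_list_iff arity_def)
 have s': "map_tree (\<lambda>a. labels s ! a) (num 0 s) = s" using map_tree_num_nth[of s 0] by simp
 have "s \<in> D n (tdeg ?t + total_degree ?w)" using decorated[OF t w] unfolding s' .
 then have "dg fst s = tdeg ?t + total_degree ?w" unfolding D_def by blast
 then have d: "tdeg ?t + total_degree ?w = d" using s by simp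
 have "planar ?t +o I n \<in> carrier (Lop m n (tdeg ?t))" "gen ?w +o TR n \<in> carrier (tensor_power Y n (total_degree ?w))"
  using planar_T[OF t] w by (auto simp: Lop_carrier tensor_carrier)
 then have "((tdeg ?t, planar ?t +o I n), (total_degree ?w, gen ?w +o TR n)) \<in> bal_gens n d"
  unfolding bal_gens_def using d by blast
 then have "E n ?t ?w \<in> span_on (bal_gens n d)"
  unfolding E_def G_def by (simp only: span_on_gen)
 with True show ?thesis unfolding B_def by (simp only: if_True simp_thms span_on_fscale)
next
 case False
 then have "B n s = 0" unfolding B_def by (rule if_not_P)
 then show ?thesis by simp
qed

lemma B_outside: "arity s \<noteq> n \<Longrightarrow> B n s = 0"
 by (simp add: B_def)

lemma lin_ext_B_outside:
 assumes "x \<in> span_on {s. arity s \<noteq> n}" shows "lin_ext (B n) x = 0"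
proof -
 have "lin_ext (B n) x = lin_ext (\<lambda>_. 0) x"
  by (rule lin_ext_cong, rule B_outside) (use span_on_keysD[OF assms] in blast)
 then show ?thesis by simp
qed

lemma beta_carrier:
 assumes "x \<in> span_on (TD d)"
 shows "beta d x \<in> carrier (F d)"
proof -
 have "lin_ext (B n) x \<in> span_on (bal_gens n d)" for n
  by (rule lin_ext_span_on, rule B_span) (rule span_on_keysD[OF assms])
 then have 1: "beta d x \<in> (\<Pi>\<^sub>E n\<in>{1..}. carrier (bal_tensor m Y n d))"
  by (auto simp: beta_def bal_simps)
 have "n \<in> arity ` supp x" if "n \<in> {1..}" "beta d x n \<noteq> BR n" for n
 proof (rule ccontr)
  assume "n \<notin> arity ` supp x"
  then have "lin_ext (B n) x = 0"
   by (intro lin_ext_B_outside) (auto simp: span_on_def)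
  then have "beta d x n = BR n" using that(1) by (simp add: beta_def)
  with that(2) show False by contradiction
 qed
 then have "{n \<in> {1..}. beta d x n \<noteq> BR n} \<subseteq> arity ` supp x" by blast
 then have "finite {n \<in> {1..}. beta d x n \<noteq> BR n}" by (rule finite_subset) simp
 with 1 show ?thesis by (simp add: F_simps)
qed

text \<open>The component of arity \<open>n\<close> of a combination is recovered from its image under \<open>B n\<close>; hence the
relations \<open>N\<close> are the whole kernel.\<close>

lemma vanishing:
 assumes z: "z \<in> span_on {s. valid m V s}" and B: "\<And>n. 1 \<le> n \<Longrightarrow> lin_ext (B n) z \<in> BR n"
 shows "z \<in> N"
proof -
 define A where "A = arity ` supp z"
 have "finite A" by (simp add: A_def)
 have "z = lin_ext gen z" by (rule lin_ext_id[symmetric])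
 also have "\<dots> = lin_ext (\<lambda>s. \<Sum>n\<in>A. if arity s = n then gen s else 0) z"
  by (rule lin_ext_cong) (simp add: A_def)
 also have "\<dots> = (\<Sum>n\<in>A. lin_ext (\<lambda>s. if arity s = n then gen s else 0) z)"
  by (rule lin_ext_fun_sum)
 also have "\<dots> \<in> N"
 proof (rule free.subspace_sum[OF subspace_N])
  fix n assume "n \<in> A"
  then obtain s where "s \<in> supp z" "arity s = n" by (auto simp: A_def)
  then have "valid m V s" "arity s = n" using span_on_keysD[OF z] by auto
  then have "1 \<le> n" using labels_nonempty[of m s] by (auto simp: valid_def arity_def Suc_le_eq)
  from unbal_relations[OF B[OF this]] have "lin_ext (\<lambda>s. unbal n (B n s)) z \<in> N"
   by (simp add: unbal_def lin_ext_comp)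
  moreover have "lin_ext (\<lambda>s. unbal n (B n s)) z - lin_ext (\<lambda>s. if arity s = n then gen s else 0) z \<in> N"
  proof (rule subspace_lin_ext_diff[OF subspace_N])
   fix s assume "s \<in> supp z"
   then have "valid m V s" using span_on_keysD[OF z] by auto
   then show "unbal n (B n s) - (if arity s = n then gen s else 0) \<in> N"
    using unbal_B[of s n] by (cases "arity s = n") (auto simp: B_outside unbal_def free.subspace_0[OF subspace_N])
  qed
  ultimately show "lin_ext (\<lambda>s. if arity s = n then gen s else 0) z \<in> N"
   using subspace_diff_mem_iff[OF subspace_N] by blast
 qed
 finally show ?thesis .
qed

lemma TD_valid: "x \<in> span_on (TD d) \<Longrightarrow> x \<in> span_on {s. valid m V s}"
 by (rule span_on_mono[rotated]) auto

lemma beta_eq_iff: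
 assumes "x \<in> span_on (TD d)" "y \<in> span_on (TD d)"
 shows "beta d x = beta d y \<longleftrightarrow> x - y \<in> N"
proof
 assume eq: "beta d x = beta d y"
 show "x - y \<in> N"
 proof (rule vanishing[OF TD_valid[OF span_on_diff[OF assms]]])
  fix n :: nat assume "1 \<le> n"
  with fun_cong[OF eq, of n] show "lin_ext (B n) (x - y) \<in> BR n"
   by (simp add: beta_def coset_eq_iff[OF subspace_BR] lin_ext_diff)
 qed
qed (rule beta_cong)

lemma D_TD: "x \<in> span_on (D n d) \<Longrightarrow> x \<in> span_on (TD d)"
 by (rule span_on_mono[rotated]) (auto simp: D_def)

lemma lin_ext_B_D: "x \<in> span_on (D n d) \<Longrightarrow> k \<noteq> n \<Longrightarrow> lin_ext (B k) x = 0"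
 by (rule lin_ext_B_outside, rule span_on_mono[rotated]) (auto simp: D_def)

text \<open>Only finitely many components are nonzero, and each of them is the image of its \<open>unbal\<close>.\<close>

lemma beta_surj:
 assumes f: "f \<in> carrier (F d)"
 obtains x where "x \<in> span_on (TD d)" "beta d x = f"
proof -
 define S where "S = {n \<in> {1..}. f n \<noteq> BR n}"
 have fin: "finite S" and fP: "f \<in> (\<Pi>\<^sub>E n\<in>{1..}. carrier (bal_tensor m Y n d))"
  using f by (simp_all add: F_simps S_def)
 have "\<forall>n\<in>{1..}. \<exists>z. z \<in> span_on (bal_gens n d) \<and> f n = z +o BR n"
 proof
  fix n :: nat assume "n \<in> {1..}"
  then have "f n \<in> carrier (bal_tensor m Y n d)" by (rule PiE_mem[OF fP])
  then show "\<exists>z. z \<in> span_on (bal_gens n d) \<and> f n = z +o BR n" unfolding bal_simps by blast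
 qed
 from bchoice[OF this] obtain z where z: "\<And>n. 1 \<le> n \<Longrightarrow> z n \<in> span_on (bal_gens n d)"
  "\<And>n. 1 \<le> n \<Longrightarrow> f n = z n +o BR n" by auto
 define x where "x = (\<Sum>n\<in>S. unbal n (z n))"
 have Sn: "1 \<le> n" if "n \<in> S" for n using that by (simp add: S_def)
 have x: "x \<in> span_on (TD d)"
  unfolding x_def by (rule span_on_sum) (rule D_TD[OF unbal_span[OF z(1)[OF Sn]]])
 have "beta d x n = f n" for n
 proof (cases "1 \<le> n")
  case True
  have "lin_ext (B n) x = (\<Sum>k\<in>S. lin_ext (B n) (unbal k (z k)))"
   unfolding x_def by (rule lin_ext_sum)
  also have "\<dots> = (\<Sum>k\<in>S. if k = n then lin_ext (B n) (unbal n (z n)) else 0)"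
  proof (rule sum.cong[OF refl])
   fix k assume "k \<in> S"
   then show "lin_ext (B n) (unbal k (z k)) = (if k = n then lin_ext (B n) (unbal n (z n)) else 0)"
    using lin_ext_B_D[OF unbal_span[OF z(1)[OF Sn]], of k n] by auto
  qed
  also have "\<dots> = (if n \<in> S then lin_ext (B n) (unbal n (z n)) else 0)"
   using fin by simp
  finally have e: "lin_ext (B n) x = (if n \<in> S then lin_ext (B n) (unbal n (z n)) else 0)" .
  have "lin_ext (B n) x - z n \<in> BR n"
  proof (cases "n \<in> S")
   case True
   then show ?thesis using B_unbal[OF z(1)[OF \<open>1 \<le> n\<close>]] by (simp only: e if_True)
  next
   case False
   then have "z n +o BR n = 0 +o BR n" using z(2)[OF True] True by (simp add: S_def)
   then have "z n - 0 \<in> BR n" by (simp only: coset_eq_iff[OF subspace_BR])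
   from subspace_diff_sym[OF subspace_BR this] show ?thesis using False by (simp only: e if_False)
  qed
  then show ?thesis using True z(2)[OF True] by (simp add: beta_def coset_eq_iff[OF subspace_BR])
 next
  case False
  then show ?thesis using PiE_arb[OF fP, of n] by (simp add: beta_def)
 qed
 then have "beta d x = f" by (rule ext)
 with x show thesis by (rule that)
qed

lemma F_carrier: "carrier (F d) = beta d ` span_on (TD d)"
proof (rule Set.set_eqI, rule iffI)
 fix f assume "f \<in> carrier (F d)"
 then obtain x where "x \<in> span_on (TD d)" "beta d x = f" by (rule beta_surj)
 then show "f \<in> beta d ` span_on (TD d)" by blast
next
 fix f assume "f \<in> beta d ` span_on (TD d)"
 then show "f \<in> carrier (F d)" using beta_carrier by blast
qed

lemma F_module: "Module.module (ring_of_type_algebra :: 'k ring) (F d)"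
 by (rule module_of_image[where h = "beta d", OF subspace_span_on F_carrier])
  (simp_all add: beta_0 beta_add beta_scale)

text \<open>A choice of representatives; it is linear only modulo \<open>N\<close>.\<close>

definition alpha :: "int \<Rightarrow> ('k, 'y) free_elt \<Rightarrow> ('k, 'y) dforest" where
 "alpha d f = (SOME x. x \<in> span_on (TD d) \<and> beta d x = f)"

lemma alpha:
 assumes "f \<in> carrier (F d)"
 shows "alpha d f \<in> span_on (TD d)" "beta d (alpha d f) = f"
proof -
 from assms obtain x where "x \<in> span_on (TD d)" "beta d x = f" by (rule beta_surj)
 then have "\<exists>x. x \<in> span_on (TD d) \<and> beta d x = f" by (intro exI conjI)
 then have "alpha d f \<in> span_on (TD d) \<and> beta d (alpha d f) = f"
  unfolding alpha_def by (rule someI_ex)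
 then show "alpha d f \<in> span_on (TD d)" "beta d (alpha d f) = f" by (rule conjunct1, rule conjunct2)
qed

lemma alpha_beta:
 assumes "x \<in> span_on (TD d)"
 shows "alpha d (beta d x) - x \<in> N"
 using beta_eq_iff[OF alpha(1)[OF beta_carrier[OF assms]] assms] alpha(2)[OF beta_carrier[OF assms]] by simp

lemma finsum_beta:
 assumes "finite A" "\<And>i. i \<in> A \<Longrightarrow> g i \<in> span_on (TD d)"
 shows "finsum (F d) (\<lambda>i. beta d (g i)) A = beta d (\<Sum>i\<in>A. g i)"
proof -
 interpret M: Module.module "ring_of_type_algebra :: 'k ring" "F d" by (rule F_module)
 show ?thesis using assms
 proof (induction A)
  case empty
  show ?case by (simp add: beta_0)
 next
  case (insert a A)
  have "finsum (F d) (\<lambda>i. beta d (g i)) (insert a A) =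
    beta d (g a) \<oplus>\<^bsub>F d\<^esub> finsum (F d) (\<lambda>i. beta d (g i)) A"
   by (rule M.finsum_insert) (use insert in \<open>auto intro!: beta_carrier\<close>)
  then show ?case using insert by (simp add: beta_add)
 qed
qed

text \<open>The link between decorated trees and the elements \<open>x \<otimes> v\<close> that occur in the rule.\<close>

lemma beta_attach:
 assumes x: "x \<in> span_on (T n p)" and y: "y \<in> span_on (W n q)" and "1 \<le> n"
 shows "beta (p + q) (attach x y) = free_pure m Y n p x q (y +o TR n)"
proof
 fix k
 show "beta (p + q) (attach x y) k = free_pure m Y n p x q (y +o TR n) k"
 proof (cases "1 \<le> k")
  case True
  show ?thesis
  proof (cases "k = n")
   case True
   have "lin_ext (B n) (attach x y) +o BR n = G n p x q y +o BR n"
    using B_attach[OF x y] by (simp only: coset_eq_iff[OF subspace_BR])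
   then show ?thesis using \<open>1 \<le> k\<close> True
    by (simp add: beta_def free_pure_def in_summand_def bal_pure_def G_def Lclass_def)
  next
   case False
   from lin_ext_B_D[OF attach_span[OF x y] False] show ?thesis using \<open>1 \<le> k\<close> False
    by (simp add: beta_def free_pure_def in_summand_def bal_simps)
  qed
 next
  case False
  then show ?thesis by (simp add: beta_def free_pure_def in_summand_def)
 qed
qed

lemma free_unit_beta:
 assumes "y \<in> carrier (Y d)"
 shows "free_unit m Y d y = beta d (gen (Leg (d, y)))"
proof -
 have "Leg 0 \<in> trees m 1" by (simp add: trees_def)
 then have "gen (Leg 0) \<in> (span_on (T 1 0) :: (_ \<Rightarrow>\<^sub>0 'k) set)" by simp
 moreover have "gen [(d, y)] \<in> (span_on (W 1 d) :: (_ \<Rightarrow>\<^sub>0 'k) set)"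
  using assms by (simp add: homogeneous_list_def total_degree_def)
 ultimately have "beta (0 + d) (attach (gen (Leg 0)) (gen [(d, y)])) = free_unit m Y d y"
  unfolding free_unit_def pure_tensor_def by (subst beta_attach) simp_all
 moreover have "attach (gen (Leg 0)) (gen [(d, y)]) = gen (Leg (d, y))"
  by (simp add: attach_def decorate_def)
 ultimately show ?thesis by simp
qed

lemma free_unit_linear: "graded_linear Y F (free_unit m Y)"
proof -
 have c: "gen (Leg (d, y)) \<in> (span_on (TD d) :: (_ \<Rightarrow>\<^sub>0 'k) set)" if "y \<in> carrier (Y d)" for d y
  using that by (simp add: dg_def ldeg_def)
 have "free_unit m Y d (a \<odot>\<^bsub>Y d\<^esub> x \<oplus>\<^bsub>Y d\<^esub> y) = a \<odot>\<^bsub>F d\<^esub> free_unit m Y d x \<oplus>\<^bsub>F d\<^esub> free_unit m Y d y"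
  if "x \<in> carrier (Y d)" "y \<in> carrier (Y d)" for d a x y
 proof -
  have "gen (Leg (d, a \<odot>\<^bsub>Y d\<^esub> x \<oplus>\<^bsub>Y d\<^esub> y)) - (fscale a (gen (Leg (d, x))) + gen (Leg (d, y))) \<in> N"
   using leaf_linear[OF that] by (simp add: diff_diff_eq)
  from beta_cong[OF this] show ?thesis
   by (simp add: free_unit_beta that Y_closed beta_add beta_scale)
 qed
 then show ?thesis
  unfolding graded_linear_def using beta_carrier[OF c] free_unit_beta by simp
qed

section \<open>The operations\<close>

text \<open>The operations graft representatives into a new vertex.\<close>

definition free_op :: "(int \<times> ('k, 'y) free_elt) list \<Rightarrow> ('k, 'y) free_elt" where
 "free_op w = beta (op_degree w) (vert (map (\<lambda>(d, f). alpha d f) w))"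

abbreviation homog :: "(int \<times> ('k, 'y) dforest) list \<Rightarrow> bool" where
 "homog zs \<equiv> (\<forall>z \<in> set zs. snd z \<in> span_on (TD (fst z)))"

abbreviation betas :: "(int \<times> ('k, 'y) dforest) list \<Rightarrow> (int \<times> ('k, 'y) free_elt) list" where
 "betas zs \<equiv> map (\<lambda>z. (fst z, beta (fst z) (snd z))) zs"

lemma homog_list_all2: "homog zs \<Longrightarrow> list_all2 (\<lambda>x d. x \<in> span_on {t. valid m V t \<and> dg fst t = d}) (map snd zs) (map fst zs)"
 by (simp add: list_all2_conv_all_nth)

lemma op_degree_betas: "op_degree (betas zs) = op_degree zs"
 by (simp add: op_degree_def total_degree_def comp_def)

lemma vert_TD:
 assumes "homog zs" "1 \<le> length zs" "enat (length zs) \<le> m"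
 shows "vert (map snd zs) \<in> span_on (TD (op_degree zs))"
 unfolding vert_def
proof (rule lin_ext_span_on)
 fix ts assume ts: "ts \<in> supp (tuples (map snd zs))"
 note * = map_keys_tuples[OF ts homog_list_all2[OF assms(1)]]
 have "dg fst (Vert ts) = op_degree zs"
  using *(1,3) by (simp add: op_degree_def total_degree_def)
 then show "gen (Vert ts) \<in> span_on (TD (op_degree zs))"
  using * assms by simp
qed

text \<open>The choice of representatives does not matter, as relations may be grafted into a vertex.\<close>

lemma free_op_betas:
 assumes "homog zs" "1 \<le> length zs" "enat (length zs) \<le> m"
 shows "free_op (betas zs) = beta (op_degree zs) (vert (map snd zs))"
proof -
 have "vert (map (\<lambda>z. alpha (fst z) (beta (fst z) (snd z))) zs) - vert (map snd zs) \<in> N"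
 proof (rule vert_relations_cong)
  show "list_all2 (\<lambda>x y. x - y \<in> N) (map (\<lambda>z. alpha (fst z) (beta (fst z) (snd z))) zs) (map snd zs)"
   using assms(1) alpha_beta by (simp add: list_all2_conv_all_nth)
  show "enat (length (map (\<lambda>z. alpha (fst z) (beta (fst z) (snd z))) zs)) \<le> m" using assms(3) by simp
  fix u assume "u \<in> set (map (\<lambda>z. alpha (fst z) (beta (fst z) (snd z))) zs) \<union> set (map snd zs)"
  then obtain z where z: "z \<in> set zs" "u = snd z \<or> u = alpha (fst z) (beta (fst z) (snd z))" by auto
  then have "snd z \<in> span_on (TD (fst z))" using assms(1) by blast
  then have "u \<in> span_on (TD (fst z))" using z(2) alpha(1)[OF beta_carrier] by auto
  then show "u \<in> span_on {t. valid m V t}" by (rule TD_valid)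
 qed
 moreover have "map (\<lambda>(d, f). alpha d f) (betas zs) = map (\<lambda>z. alpha (fst z) (beta (fst z) (snd z))) zs"
  by simp
 ultimately show ?thesis unfolding free_op_def op_degree_betas by (simp only: beta_cong)
qed

lemma betas_alpha:
 assumes "homogeneous_list F w"
 obtains zs where "homog zs" "w = betas zs"
proof -
 let ?zs = "map (\<lambda>(d, f). (d, alpha d f)) w"
 have "homog ?zs" using assms alpha(1) by (auto simp: homogeneous_list_def)
 moreover have "w = betas ?zs"
  using assms alpha(2) by (intro nth_equalityI) (auto simp: homogeneous_list_def split_beta nth_mem)
 ultimately show thesis by (rule that)
qed

lemma betas_homogeneous: "homog zs \<Longrightarrow> homogeneous_list F (betas zs)"
 using beta_carrier by (auto simp: homogeneous_list_def)

lemma op_degree_update: "i < length w \<Longrightarrow> op_degree (w[i := (fst (w ! i), x)]) = op_degree w"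
proof -
 assume i: "i < length w"
 have "map fst (w[i := (fst (w ! i), x)]) = map fst w"
  by (simp add: map_update list_update_id[of "map fst w" i, unfolded nth_map[OF i]])
 then show ?thesis by (simp add: op_degree_def total_degree_def)
qed

lemma free_op_multilinear: "multilinear_ops m F free_op"
 unfolding multilinear_ops_def Let_def
proof (intro ballI conjI allI impI)
 fix w assume w: "w \<in> op_args m F"
 then obtain zs where zs: "homog zs" "w = betas zs" using betas_alpha unfolding op_args_def by blast
 have len: "1 \<le> length zs" "enat (length zs) \<le> m" using w by (auto simp: op_args_def zs(2))
 show "free_op w \<in> carrier (F (op_degree w))"
  unfolding zs(2) op_degree_betas free_op_betas[OF zs(1) len]
  by (rule beta_carrier[OF vert_TD[OF zs(1) len]])
 fix i c x y assume i: "i < length w" and x: "x \<in> carrier (F (fst (w ! i)))" and y: "y \<in> carrier (F (fst (w ! i)))"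
 define e where "e = fst (w ! i)"
 have iz: "i < length zs" "fst (zs ! i) = e" using i by (simp_all add: zs(2) e_def)
 let ?x = "alpha e x" and ?y = "alpha e y"
 note ax = alpha[OF x, folded e_def] and ay = alpha[OF y, folded e_def]
 have upd: "w[i := (e, beta e z)] = betas (zs[i := (e, z)])" for z
  unfolding zs(2) by (simp add: map_update)
 have L: "free_op (w[i := (e, beta e z)]) = beta (op_degree w) (vert (take i (map snd zs) @ z # drop (Suc i) (map snd zs)))"
  if z: "z \<in> span_on (TD e)" for z
 proof -
  have "homog (zs[i := (e, z)])" using zs(1) z set_update_subset_insert[of zs i "(e, z)"] by auto
  from free_op_betas[OF this] len have "free_op (betas (zs[i := (e, z)])) =
    beta (op_degree (zs[i := (e, z)])) (vert (map snd (zs[i := (e, z)])))" by simp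
  moreover have "op_degree (zs[i := (e, z)]) = op_degree w"
   using op_degree_update[OF iz(1), of z] by (simp add: iz(2) zs(2) op_degree_betas)
  moreover have "map snd (zs[i := (e, z)]) = take i (map snd zs) @ z # drop (Suc i) (map snd zs)"
   using iz(1) by (simp add: map_update upd_conv_take_nth_drop take_map drop_map)
  ultimately show ?thesis unfolding upd by simp
 qed
 have "c \<odot>\<^bsub>F e\<^esub> x \<oplus>\<^bsub>F e\<^esub> y = beta e (fscale c ?x + ?y)"
  by (simp add: beta_add[symmetric] beta_scale[symmetric] ax ay)
 then have "free_op (w[i := (e, c \<odot>\<^bsub>F e\<^esub> x \<oplus>\<^bsub>F e\<^esub> y)]) =
   beta (op_degree w) (vert (take i (map snd zs) @ (fscale c ?x + ?y) # drop (Suc i) (map snd zs)))"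
  using L[of "fscale c ?x + ?y"] ax(1) ay(1) by (simp add: span_on_add span_on_fscale)
 also have "\<dots> = c \<odot>\<^bsub>F (op_degree w)\<^esub> free_op (w[i := (e, x)]) \<oplus>\<^bsub>F (op_degree w)\<^esub> free_op (w[i := (e, y)])"
  using L[OF ax(1)] L[OF ay(1)] by (simp add: vert_linear beta_add[symmetric] beta_scale[symmetric] ax(2) ay(2))
 finally show "free_op (w[i := (fst (w ! i), c \<odot>\<^bsub>F (fst (w ! i))\<^esub> x \<oplus>\<^bsub>F (fst (w ! i))\<^esub> y)]) =
   c \<odot>\<^bsub>F (op_degree w)\<^esub> free_op (w[i := (fst (w ! i), x)]) \<oplus>\<^bsub>F (op_degree w)\<^esub> free_op (w[i := (fst (w ! i), y)])"
  by (simp only: e_def)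
qed

lemma betas_permute: "\<sigma> permutes {..<length zs} \<Longrightarrow> permute_list \<sigma> (betas zs) = betas (permute_list \<sigma> zs)"
 by (simp add: permute_list_map)

lemma free_op_antisymmetric: "antisymmetric_ops m F free_op"
 unfolding antisymmetric_ops_def
proof (intro ballI allI impI)
 fix w \<sigma> assume w: "w \<in> op_args m F" and "\<sigma> permutes {..<length w}"
 then obtain zs where zs: "homog zs" "w = betas zs" using betas_alpha unfolding op_args_def by blast
 have len: "1 \<le> length zs" "enat (length zs) \<le> m" using w by (auto simp: op_args_def zs(2))
 have \<sigma>: "\<sigma> permutes {..<length zs}" using \<open>\<sigma> permutes {..<length w}\<close> by (simp add: zs(2))
 let ?zs = "permute_list \<sigma> zs"
 have zs': "homog ?zs" "1 \<le> length ?zs" "enat (length ?zs) \<le> m" using zs(1) len \<sigma> by simp_all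
 have od: "op_degree ?zs = op_degree zs"
  unfolding op_degree_def total_degree_def using \<sigma> sum_list_map_mset_cong[OF mset_permute_list[OF \<sigma>], of fst] by simp
 have "vert (map snd ?zs) - fscale (of_int (chi \<sigma> (map fst zs))) (vert (map snd zs)) \<in> N"
  using vert_permute[OF homog_list_all2[OF zs(1)], of \<sigma>] len \<sigma> by (simp add: permute_list_map)
 from beta_cong[OF this] show "free_op (permute_list \<sigma> w) = of_int (chi \<sigma> (map fst w)) \<odot>\<^bsub>F (op_degree w)\<^esub> free_op w"
  unfolding zs(2) betas_permute[OF \<sigma>] free_op_betas[OF zs(1) len] free_op_betas[OF zs'] op_degree_betas od
  by (simp add: beta_scale comp_def)
qed

lemma free_op_jacobi: "jacobi_ops m F free_op"
 unfolding jacobi_ops_def Let_def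
proof
 fix w assume w: "w \<in> op_args m F"
 then obtain zs where zs: "homog zs" "w = betas zs" using betas_alpha unfolding op_args_def by blast
 have len: "1 \<le> length zs" "enat (length zs) \<le> m" using w by (auto simp: op_args_def zs(2))
 let ?n = "length zs"
 let ?d = "total_degree w + int (length w) - 3"
 define g where "g = (\<lambda>(i, \<sigma>). fscale (of_int (chi \<sigma> (map fst zs) * psign (int (i * (?n - i)))))
  (vert (vert (take i (permute_list \<sigma> (map snd zs))) # drop i (permute_list \<sigma> (map snd zs)))) :: ('k, 'y) dforest)"
 let ?l = "\<lambda>i \<sigma>. free_op ((op_degree (take i (permute_list \<sigma> w)), free_op (take i (permute_list \<sigma> w))) # drop i (permute_list \<sigma> w))"
 let ?h = "\<lambda>(i, \<sigma>). of_int (chi \<sigma> (map fst w) * psign (int (i * (length w - i)))) \<odot>\<^bsub>F ?d\<^esub> ?l i \<sigma>"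
 have summand: "g (i, \<sigma>) \<in> span_on (TD ?d) \<and>
   ?h (i, \<sigma>) = beta ?d (g (i, \<sigma>))" if "(i, \<sigma>) \<in> unsh ?n" for i \<sigma>
 proof -
  have i: "1 \<le> i" "i \<le> ?n" and \<sigma>: "\<sigma> permutes {..<?n}" using unshD[OF that] by auto
  let ?zs = "permute_list \<sigma> zs"
  let ?u = "take i ?zs" and ?v = "drop i ?zs"
  have hz: "homog ?zs" using zs(1) \<sigma> by simp
  have le: "enat i \<le> m" "enat (Suc (?n - i)) \<le> m"
   using len(2) i by (auto intro: order_trans[rotated])
  have u: "homog ?u" "1 \<le> length ?u" "enat (length ?u) \<le> m"
   using hz i le by (auto dest: in_set_takeD)
  let ?y = "(op_degree ?u, vert (map snd ?u)) # ?v"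
  have y: "homog ?y" "1 \<le> length ?y" "enat (length ?y) \<le> m"
   using vert_TD[OF u] hz i le by (auto dest: in_set_dropD)
  have pw: "permute_list \<sigma> w = betas ?zs" unfolding zs(2) by (rule betas_permute[OF \<sigma>])
  have "?l i \<sigma> = free_op (betas ?y)"
   unfolding pw take_map drop_map op_degree_betas free_op_betas[OF u] by simp
  also have "\<dots> = beta (op_degree ?y) (vert (map snd ?y))" by (rule free_op_betas[OF y])
  finally have l: "?l i \<sigma> = beta (op_degree ?y) (vert (map snd ?y))" .
  have "sum_list (map fst ?zs) = sum_list (map fst zs)"
   using sum_list_map_mset_cong[OF mset_permute_list[OF \<sigma>], of fst] .
  moreover have "sum_list (map fst ?u) + sum_list (map fst ?v) = sum_list (map fst ?zs)"
   unfolding sum_list_append[symmetric] map_append[symmetric] append_take_drop_id ..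
  ultimately have od: "op_degree ?y = ?d"
   using i by (simp add: op_degree_def total_degree_def zs(2) comp_def)
  have ms: "map snd ?y = vert (take i (permute_list \<sigma> (map snd zs))) # drop i (permute_list \<sigma> (map snd zs))"
   using \<sigma> by (simp add: permute_list_map take_map drop_map)
  have c: "chi \<sigma> (map fst w) = chi \<sigma> (map fst zs)" "length w = ?n" by (simp_all add: zs(2) comp_def)
  have "vert (map snd ?y) \<in> span_on (TD ?d)" using vert_TD[OF y] unfolding od .
  then show ?thesis unfolding split l od c beta_scale g_def ms by (intro conjI span_on_fscale refl)
 qed
 have "finsum (F ?d) ?h (unsh (length w)) = finsum (F ?d) (\<lambda>p. beta ?d (g p)) (unsh (length w))"
 proof -
  interpret M: Module.module "ring_of_type_algebra :: 'k ring" "F ?d" by (rule F_module)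
  show ?thesis
   by (rule M.finsum_cong') (use summand in \<open>auto simp: zs(2) intro!: beta_carrier\<close>)
 qed
 also have "\<dots> = beta ?d (\<Sum>p\<in>unsh (length w). g p)"
  by (rule finsum_beta[OF finite_unsh]) (use summand in \<open>auto simp: zs(2)\<close>)
 also have "\<dots> = beta ?d 0"
 proof (rule beta_cong)
  show "(\<Sum>p\<in>unsh (length w). g p) - 0 \<in> N"
   using vert_jacobi[OF homog_list_all2[OF zs(1)]] len by (simp add: g_def zs(2))
 qed
 finally show "finsum (F ?d) ?h (unsh (length w)) = \<zero>\<^bsub>F ?d\<^esub>"
  unfolding beta_0 .
qed

lemma free_op_L_algebra: "L_algebra m F free_op"
 unfolding L_algebra_def graded_vector_space_def
 using F_module free_op_multilinear free_op_antisymmetric free_op_jacobi by blast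

end

section \<open>The rule for the operations\<close>

text \<open>Both sides are multilinear in the list \<open>ys\<close>.\<close>

lemma vert_lin_ext:
 assumes "length Ts = length ys"
 shows "vert (map2 (\<lambda>t y. lin_ext (g t) y) Ts ys) = lin_ext (\<lambda>ws. vert (map2 g Ts ws)) (tuples ys)"
proof -
 have "tuples (map2 (\<lambda>t y. lin_ext (g t) y) Ts ys) = lin_ext (\<lambda>ws. tuples (map2 g Ts ws)) (tuples ys)"
  using assms
 proof (induction Ts ys rule: list_induct2)
  case Nil
  show ?case by simp
 next
  case (Cons t Ts y ys)
  have "tuples (map2 (\<lambda>t y. lin_ext (g t) y) (t # Ts) (y # ys)) =
    lin_ext (\<lambda>w. lin_ext (\<lambda>a. lin_ext (\<lambda>ws. lin_ext (\<lambda>as. gen (a # as)) (tuples (map2 g Ts ws))) (tuples ys)) (g t w)) y"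
   by (simp add: Cons.IH lin_ext_comp)
  also have "\<dots> = lin_ext (\<lambda>w. lin_ext (\<lambda>ws. lin_ext (\<lambda>a. lin_ext (\<lambda>as. gen (a # as)) (tuples (map2 g Ts ws))) (g t w)) (tuples ys)) y"
   by (subst lin_ext_swap) (rule refl)
  finally show ?case by (simp add: lin_ext_comp)
 qed
 then show ?thesis by (simp add: vert_def lin_ext_comp)
qed

lemma in_listset: "xs \<in> listset vs \<longleftrightarrow> list_all2 (\<lambda>x v. x \<in> v) xs vs"
 by (induction vs arbitrary: xs) (auto simp: set_Cons_def list_all2_Cons2)

lemma psign_sum: "finite A \<Longrightarrow> psign (\<Sum>a\<in>A. f a) = (\<Prod>a\<in>A. psign (f a))"
 by (induction A rule: finite_induct) (simp_all add: psign_add)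

lemma nth_concat_offset:
 assumes "p < length ws" "a < length (ws ! p)"
 shows "concat ws ! (a + sum_list (map length (take p ws))) = ws ! p ! a"
proof -
 have "concat ws = concat (take p ws) @ ws ! p @ concat (drop (Suc p) ws)"
  unfolding concat_append[symmetric] using id_take_nth_drop[OF assms(1)] by (metis concat.simps(2) concat_append)
 then show ?thesis using assms(2) by (simp add: nth_append length_concat)
qed

lemma concat_upt_offsets:
 assumes "\<And>p. p < k \<Longrightarrow> off p \<le> (off (Suc p) :: nat)"
 shows "concat (map (\<lambda>p. [off p..<off (Suc p)]) [0..<k]) = [off 0..<off k] \<and> off 0 \<le> off k"
 using assms
proof (induction k)
 case (Suc k)
 then have IH: "concat (map (\<lambda>p. [off p..<off (Suc p)]) [0..<k]) = [off 0..<off k]" "off 0 \<le> off k" by auto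
 have "off k \<le> off (Suc k)" using Suc.prems by blast
 then show ?case using IH upt_join[of "off 0" "off k" "off (Suc k)"] by simp
qed simp

lemma pair_prod_psign_index:
 "pair_prod (\<lambda>i j. psign (f i * g j)) [0..<k] = psign (\<Sum>(i, j) \<in> {(i, j). i < j \<and> j < k}. f i * g j)"
proof -
 have "finite {(i, j). i < j \<and> j < (k::nat)}" by (rule finite_subset[of _ "{..<k} \<times> {..<k}"]) auto
 from psign_sum[OF this, of "\<lambda>(i, j). f i * g j"] show ?thesis
  unfolding pair_prod_nth by (auto simp: split_beta intro!: prod.cong)
qed

lemma vert_scaled:
 "vert (map (\<lambda>p. fscale (c p) (gen (s p))) ps) = fscale (prod_list (map c ps)) (gen (Vert (map s ps)))"
proof -
 have "tuples (map (\<lambda>p. fscale (c p) (gen (s p))) ps) = fscale (prod_list (map c ps)) (gen (map s ps))"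
  by (induction ps) (simp_all add: lin_ext_fscale)
 then show ?thesis by (simp add: vert_def lin_ext_fscale)
qed

lemma prod_list_of_int: "prod_list (map (\<lambda>p. of_int (f p)) ps) = (of_int (prod_list (map f ps)) :: 'k::comm_ring_1)"
 by (induction ps) simp_all

definition offset :: "nat tree list \<Rightarrow> nat \<Rightarrow> nat" where
 "offset ts p = sum_list (map arity (take p ts))"

definition shifted :: "nat tree list \<Rightarrow> nat \<Rightarrow> nat tree" where
 "shifted ts p = map_tree (\<lambda>a. a + offset ts p) (ts ! p)"

lemma zeta_comp_shifted: "zeta_comp ts = planar (Vert (map (shifted ts) [0..<length ts]))"
 by (simp add: zeta_comp_def shifted_def[abs_def] offset_def)

lemma offset_Suc: "p < length ts \<Longrightarrow> offset ts (Suc p) = offset ts p + arity (ts ! p)"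
 by (simp add: offset_def take_Suc_conv_app_nth)

lemma offset_mono: "p \<le> q \<Longrightarrow> offset ts p \<le> offset ts q"
proof -
 assume "p \<le> q"
 then have "take q ts = take p ts @ take (q - p) (drop p ts)" by (metis le_add_diff_inverse take_add)
 then show ?thesis by (simp add: offset_def)
qed

lemma shifted_labels:
 assumes "p < length ts" "mset (labels (ts ! p)) = mset [0..<arity (ts ! p)]"
 shows "mset (labels (shifted ts p)) = mset [offset ts p..<offset ts (Suc p)]"
proof -
 have "mset (labels (shifted ts p)) = image_mset (\<lambda>a. a + offset ts p) (mset (labels (ts ! p)))"
  by (simp add: shifted_def)
 also have "\<dots> = mset (map (\<lambda>a. a + offset ts p) [0..<arity (ts ! p)])" unfolding assms(2) by simp
 also have "map (\<lambda>a. a + offset ts p) [0..<arity (ts ! p)] = [offset ts p..<offset ts (Suc p)]"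
  unfolding map_add_upt offset_Suc[OF assms(1)] by (simp add: add.commute)
 finally show ?thesis .
qed

lemma labels_corolla:
 assumes "\<And>p. p < length ts \<Longrightarrow> mset (labels (ts ! p)) = mset [0..<arity (ts ! p)]"
 shows "mset (labels (Vert (map (shifted ts) [0..<length ts]))) = mset [0..<sum_list (map arity ts)]"
proof -
 have "map (\<lambda>p. mset (labels (shifted ts p))) [0..<length ts] =
   map (\<lambda>p. mset [offset ts p..<offset ts (Suc p)]) [0..<length ts]"
  by (rule map_cong[OF refl]) (simp only: atLeastLessThan_iff set_upt shifted_labels assms)
 note eq = this
 have "mset (labels (Vert (map (shifted ts) [0..<length ts]))) =
   sum_list (map (\<lambda>p. mset (labels (shifted ts p))) [0..<length ts])"
  by (simp add: mset_concat comp_def)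
 also have "\<dots> = mset (concat (map (\<lambda>p. [offset ts p..<offset ts (Suc p)]) [0..<length ts]))"
  unfolding eq by (simp add: mset_concat comp_def)
 also have "concat (map (\<lambda>p. [offset ts p..<offset ts (Suc p)]) [0..<length ts]) = [offset ts 0..<offset ts (length ts)]"
  using concat_upt_offsets[of "length ts" "offset ts"] offset_mono[of _ "Suc _" ts] by simp
 finally show ?thesis by (simp add: offset_def)
qed

context free_setting
begin

text \<open>The labels of the grafted trees are shifted to consecutive intervals, so the only pairs that
contribute to the sign and do not lie in one of the trees consist of a decoration of a tree and a
vertex of a later tree. Their contribution is the sign \<open>\<epsilon>\<close> of the rule.\<close>

lemma decorate_corolla:
 assumes Ts: "\<And>j. j < length Ts \<Longrightarrow> Ts ! j \<in> trees m (arity (Ts ! j))"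
  and ws: "length ws = length Ts" "\<And>j. j < length Ts \<Longrightarrow> ws ! j \<in> W (arity (Ts ! j)) (ds ! j)"
 defines "Z \<equiv> Vert (map (shifted Ts) [0..<length Ts])"
  and "\<epsilon> \<equiv> (\<Sum>(i, j) \<in> {(i, j). i < j \<and> j < length Ts}. ds ! i * tdeg (Ts ! j))"
 shows "vert (map2 (\<lambda>t w. decorate 0 w t) Ts ws) = (fscale (of_int (psign \<epsilon>)) (decorate 0 (concat ws) Z) :: _ \<Rightarrow>\<^sub>0 'k)"
proof -
 let ?k = "length Ts"
 define U where "U = shifted Ts"
 have Z: "Z = Vert (map U [0..<?k])" by (simp add: Z_def U_def)
 have off_ws: "offset Ts p = sum_list (map length (take p ws))" for p
 proof -
  have "map arity Ts = map length ws" using ws by (intro nth_equalityI) auto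
  then have "map arity (take p Ts) = map length (take p ws)" unfolding take_map[symmetric] by simp
  then show ?thesis by (simp add: offset_def)
 qed
 note T = labelled[OF Ts]
 have Us: "set (labels (U p)) = {offset Ts p..<offset Ts (Suc p)}" if p: "p < ?k" for p
  unfolding U_def using mset_eq_setD[OF shifted_labels[OF p T(2)[OF p]]] by simp
 have tU: "tdeg (U p) = tdeg (Ts ! p)" for p by (simp add: U_def shifted_def)
 let ?w = "concat ws"
 have nth: "?w ! (a + offset Ts p) = ws ! p ! a" if "p < ?k" "a \<in> set (labels (Ts ! p))" for a p
  unfolding off_ws using that ws T(4)[OF that(1)] by (intro nth_concat_offset) auto
 let ?D = "\<lambda>a. fst (?w ! a)"
 have LU: "leg_sign ?D (U p) = leg_sign (\<lambda>a. fst (ws ! p ! a)) (Ts ! p)" if p: "p < ?k" for p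
 proof -
  have "leg_sign ?D (U p) = leg_sign (\<lambda>a. ?D (a + offset Ts p)) (Ts ! p)"
   unfolding U_def shifted_def by (rule leg_sign_map_mono[OF T(5)[OF p]]) simp
  also have "\<dots> = leg_sign (\<lambda>a. fst (ws ! p ! a)) (Ts ! p)"
   by (rule leg_sign_cong) (simp add: nth[OF p])
  finally show ?thesis .
 qed
 have dU: "ldeg ?D (U p) = ds ! p" if p: "p < ?k" for p
 proof -
  have "ldeg ?D (U p) = sum_list (map (\<lambda>a. ?D (a + offset Ts p)) (labels (Ts ! p)))"
   by (simp add: ldeg_def U_def shifted_def comp_def)
  also have "\<dots> = sum_list (map (\<lambda>a. fst (ws ! p ! a)) (labels (Ts ! p)))"
   by (simp add: nth[OF p] cong: map_cong)
  also have "\<dots> = sum_list (map fst (ws ! p))"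
   using ldeg_nth[OF T(2)[OF p], of "ws ! p" fst] ws(2)[OF p] by (simp add: ldeg_def)
  finally show ?thesis using ws(2)[OF p] by (simp add: total_degree_def)
 qed
 have "leg_sign ?D Z = prod_list (map (leg_sign ?D) (map U [0..<?k])) *
   pair_prod (\<lambda>u v. psign (ldeg ?D u * tdeg v)) (map U [0..<?k])"
  unfolding Z
 proof (rule leg_sign_Vert)
  fix i j a b assume ij: "i < j" "j < length (map U [0..<?k])"
   and a: "a \<in> set (labels (map U [0..<?k] ! i))" and b: "b \<in> set (labels (map U [0..<?k] ! j))"
  then have "a < offset Ts (Suc i)" "offset Ts j \<le> b" using Us by auto
  moreover have "offset Ts (Suc i) \<le> offset Ts j" using offset_mono[of "Suc i" j Ts] ij by simp
  ultimately show "a < b" by simp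
 qed
 also have "pair_prod (\<lambda>u v. psign (ldeg ?D u * tdeg v)) (map U [0..<?k]) =
   pair_prod (\<lambda>i j. psign (ds ! i * tdeg (Ts ! j))) [0..<?k]"
  unfolding pair_prod_map by (rule pair_prod_cong[where R = "\<lambda>_ _. True"]) (simp_all add: dU tU)
 also have "\<dots> = psign \<epsilon>" unfolding \<epsilon>_def by (rule pair_prod_psign_index)
 also have "prod_list (map (leg_sign ?D) (map U [0..<?k])) =
   prod_list (map (\<lambda>p. leg_sign (\<lambda>a. fst (ws ! p ! a)) (Ts ! p)) [0..<?k])"
 proof -
  have "map (leg_sign ?D) (map U [0..<?k]) = map (\<lambda>p. leg_sign (\<lambda>a. fst (ws ! p ! a)) (Ts ! p)) [0..<?k]"
   unfolding map_map by (rule map_cong[OF refl]) (simp add: LU)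
  then show ?thesis by (rule arg_cong)
 qed
 finally have sgn: "leg_sign ?D Z = prod_list (map (\<lambda>p. leg_sign (\<lambda>a. fst (ws ! p ! a)) (Ts ! p)) [0..<?k]) * psign \<epsilon>" .
 have mZ: "map_tree (\<lambda>a. ?w ! a) Z = Vert (map (\<lambda>p. map_tree (\<lambda>a. ws ! p ! a) (Ts ! p)) [0..<?k])"
  unfolding Z by (auto simp: U_def shifted_def tree.map_comp comp_def nth set_tree_labels intro!: tree.map_cong)
 have "map2 (\<lambda>t w. decorate 0 w t :: _ \<Rightarrow>\<^sub>0 'k) Ts ws = map (\<lambda>p. decorate 0 (ws ! p) (Ts ! p)) [0..<?k]"
  using ws(1) by (intro nth_equalityI) auto
 then have "(vert (map2 (\<lambda>t w. decorate 0 w t) Ts ws) :: _ \<Rightarrow>\<^sub>0 'k) =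
   vert (map (\<lambda>p. fscale (of_int (leg_sign (\<lambda>a. fst (ws ! p ! a)) (Ts ! p))) (gen (map_tree (\<lambda>a. ws ! p ! a) (Ts ! p)))) [0..<?k])"
  by (simp add: decorate_def)
 also have "\<dots> = fscale (prod_list (map (\<lambda>p. of_int (leg_sign (\<lambda>a. fst (ws ! p ! a)) (Ts ! p))) [0..<?k]))
   (gen (Vert (map (\<lambda>p. map_tree (\<lambda>a. ws ! p ! a) (Ts ! p)) [0..<?k])))"
  by (rule vert_scaled)
 also have "prod_list (map (\<lambda>p. of_int (leg_sign (\<lambda>a. fst (ws ! p ! a)) (Ts ! p))) [0..<?k]) =
   (of_int (prod_list (map (\<lambda>p. leg_sign (\<lambda>a. fst (ws ! p ! a)) (Ts ! p)) [0..<?k])) :: 'k)"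
  by (rule prod_list_of_int)
 also have "prod_list (map (\<lambda>p. leg_sign (\<lambda>a. fst (ws ! p ! a)) (Ts ! p)) [0..<?k]) = psign \<epsilon> * leg_sign ?D Z"
  unfolding sgn by simp
 finally show "vert (map2 (\<lambda>t w. decorate 0 w t) Ts ws) = (fscale (of_int (psign \<epsilon>)) (decorate 0 (concat ws) Z) :: _ \<Rightarrow>\<^sub>0 'k)"
  unfolding mZ[symmetric] decorate_def by simp
qed

definition conc :: "((int \<times> 'y) list \<Rightarrow>\<^sub>0 'k) \<Rightarrow> ((int \<times> 'y) list \<Rightarrow>\<^sub>0 'k) \<Rightarrow> ((int \<times> 'y) list \<Rightarrow>\<^sub>0 'k)" where
 "conc x y = lin_ext (\<lambda>u. lin_ext (\<lambda>w. gen (u @ w)) y) x"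

lemma append_tensors_Cons: "append_tensors (x # xs) = conc x (append_tensors xs)"
 by (simp add: append_tensors_def conc_def)

lemma conc_diff: "conc (x - x') y = conc x y - conc x' y" "conc x (y - y') = conc x y - conc x y'"
 by (simp_all add: conc_def lin_ext_diff lin_ext_fun_diff)

lemma homogeneous_append: "homogeneous_list Y (u @ w) \<longleftrightarrow> homogeneous_list Y u \<and> homogeneous_list Y w"
 by (auto simp: homogeneous_list_def)

lemma conc_left:
 assumes "x \<in> TR a" "y \<in> span_on (H b)"
 shows "conc x y \<in> TR (a + b)"
 unfolding conc_def
proof (rule TR_induct[OF assms(1) subspace_TR])
 fix w i e c u v assume w: "homogeneous_list Y w" "length w = a" "i < a" "u \<in> carrier (Y e)" "v \<in> carrier (Y e)"
 have "lin_ext (\<lambda>s. gen ((w @ s)[i := (e, c \<odot>\<^bsub>Y e\<^esub> u \<oplus>\<^bsub>Y e\<^esub> v)]) - fscale c (gen ((w @ s)[i := (e, u)])) - gen ((w @ s)[i := (e, v)])) y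
   \<in> TR (a + b)"
 proof (rule subspace_lin_ext[OF subspace_TR])
  fix s assume "s \<in> supp y"
  then have "homogeneous_list Y s" "length s = b" using span_on_keysD[OF assms(2)] by auto
  then show "gen ((w @ s)[i := (e, c \<odot>\<^bsub>Y e\<^esub> u \<oplus>\<^bsub>Y e\<^esub> v)]) - fscale c (gen ((w @ s)[i := (e, u)])) - gen ((w @ s)[i := (e, v)]) \<in> TR (a + b)"
   using w by (intro tensor_relI) (auto simp: homogeneous_append)
 qed
 then show "lin_ext (\<lambda>s. gen (w[i := (e, c \<odot>\<^bsub>Y e\<^esub> u \<oplus>\<^bsub>Y e\<^esub> v)] @ s)) y -
   fscale c (lin_ext (\<lambda>s. gen (w[i := (e, u)] @ s)) y) - lin_ext (\<lambda>s. gen (w[i := (e, v)] @ s)) y \<in> TR (a + b)"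
  using w by (simp add: list_update_append1 lin_ext_fun_diff lin_ext_fun_fscale)
qed

lemma conc_right:
 assumes "x \<in> span_on (H a)" "y \<in> TR b"
 shows "conc x y \<in> TR (a + b)"
 unfolding conc_def
proof (rule subspace_lin_ext[OF subspace_TR], rule TR_induct[OF assms(2) subspace_TR])
 fix s w i e c u v assume "s \<in> supp x"
  and w: "homogeneous_list Y w" "length w = b" "i < b" "u \<in> carrier (Y e)" "v \<in> carrier (Y e)"
 then have s: "homogeneous_list Y s" "length s = a" using span_on_keysD[OF assms(1)] by auto
 have "gen ((s @ w)[a + i := (e, c \<odot>\<^bsub>Y e\<^esub> u \<oplus>\<^bsub>Y e\<^esub> v)]) - fscale c (gen ((s @ w)[a + i := (e, u)])) - gen ((s @ w)[a + i := (e, v)]) \<in> TR (a + b)"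
  using w s by (intro tensor_relI) (auto simp: homogeneous_append)
 moreover have "(s @ w)[a + i := z] = s @ w[i := z]" for z using s by (simp add: list_update_append)
 ultimately show "gen (s @ w[i := (e, c \<odot>\<^bsub>Y e\<^esub> u \<oplus>\<^bsub>Y e\<^esub> v)]) - fscale c (gen (s @ w[i := (e, u)])) - gen (s @ w[i := (e, v)]) \<in> TR (a + b)"
  by simp
qed

lemma conc_span:
 assumes "x \<in> span_on (W a p)" "y \<in> span_on (W b q)"
 shows "conc x y \<in> span_on (W (a + b) (p + q))"
 unfolding conc_def
proof (rule lin_ext_span_on, rule lin_ext_span_on)
 fix u w assume "u \<in> supp x" "w \<in> supp y"
 then show "gen (u @ w) \<in> span_on (W (a + b) (p + q))"
  using span_on_keysD[OF assms(1), of u] span_on_keysD[OF assms(2), of w]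
  by (simp add: homogeneous_append total_degree_def)
qed

lemma append_tensors_span:
 fixes y :: "'j \<Rightarrow> ((int \<times> 'y) list \<Rightarrow>\<^sub>0 'k)"
 shows "(\<And>j. j \<in> set js \<Longrightarrow> y j \<in> span_on (W (n j) (q j))) \<Longrightarrow>
  append_tensors (map y js) \<in> span_on (W (sum_list (map n js)) (sum_list (map q js)))"
proof (induction js)
 case Nil
 show ?case by (simp add: append_tensors_def homogeneous_list_def total_degree_def)
next
 case (Cons j js)
 then show ?case by (simp add: append_tensors_Cons conc_span)
qed

lemma append_tensors_cong:
 "(\<And>j. j \<in> set js \<Longrightarrow> y j \<in> span_on (W (n j) (q j))) \<Longrightarrow>
  (\<And>j. j \<in> set js \<Longrightarrow> x j - y j \<in> TR (n j)) \<Longrightarrow>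
  append_tensors (map x js) - append_tensors (map y js) \<in> TR (sum_list (map n js))"
proof (induction js)
 case Nil
 show ?case by (simp add: free.subspace_0[OF subspace_TR])
next
 case (Cons j js)
 let ?X = "append_tensors (map x js)" and ?Y = "append_tensors (map y js)"
 have Y: "?Y \<in> span_on (H (sum_list (map n js)))"
  using append_tensors_span[of js y n q] Cons.prems(1) by (intro span_W) auto
 have IH: "?X - ?Y \<in> TR (sum_list (map n js))" using Cons.IH Cons.prems by auto
 have yj: "y j \<in> span_on (H (n j))" using Cons.prems(1) by (intro span_W) auto
 have xy: "x j - y j \<in> TR (n j)" using Cons.prems(2) by auto
 then have "x j - y j \<in> span_on (H (n j))" using TR_subset by blast
 then have "y j + (x j - y j) \<in> span_on (H (n j))" by (intro span_on_add yj)
 then have xj: "x j \<in> span_on (H (n j))" by simp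
 have "conc (x j) (?X - ?Y) + conc (x j - y j) ?Y \<in> TR (n j + sum_list (map n js))"
  by (intro free.subspace_add[OF subspace_TR] conc_right[OF xj IH] conc_left[OF xy Y])
 then show ?case by (simp add: append_tensors_Cons conc_diff)
qed

lemma tensor_concat_coset:
 assumes y: "\<And>j. j < k \<Longrightarrow> y j \<in> span_on (W (n j) (q j))"
  and vs: "vs = map (\<lambda>j. y j +o TR (n j)) [0..<k]"
 shows "tensor_concat Y (sum_list (map n [0..<k])) vs = append_tensors (map y [0..<k]) +o TR (sum_list (map n [0..<k]))"
 unfolding tensor_concat_def
proof (rule coset_map_coset[OF subspace_TR])
 show "map y [0..<k] \<in> listset vs"
  unfolding in_listset vs by (simp add: list_all2_conv_all_nth mem_coset_iff free.subspace_0[OF subspace_TR])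
 fix xs assume "xs \<in> listset vs"
 then have la: "list_all2 (\<lambda>x v. x \<in> v) xs vs" unfolding in_listset .
 have xs: "length xs = k" using list_all2_lengthD[OF la] by (simp add: vs)
 have xs2: "xs ! j - y j \<in> TR (n j)" if "j < k" for j
  using list_all2_nthD[OF la, of j] that xs by (simp add: vs mem_coset_iff)
 have "append_tensors (map (\<lambda>j. xs ! j) [0..<k]) - append_tensors (map y [0..<k]) \<in> TR (sum_list (map n [0..<k]))"
  by (rule append_tensors_cong[where q = q]) (use y xs2 in auto)
 then show "append_tensors xs - append_tensors (map y [0..<k]) \<in> TR (sum_list (map n [0..<k]))"
  using xs map_nth[of xs] by simp
qed

lemma corolla_facts:
 assumes Ts: "\<And>j. j < length Ts \<Longrightarrow> Ts ! j \<in> trees m (arity (Ts ! j))"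
  and k: "1 \<le> length Ts" "enat (length Ts) \<le> m"
 shows "vals_le m (Vert (map (shifted Ts) [0..<length Ts]))"
  "mset (labels (Vert (map (shifted Ts) [0..<length Ts]))) = mset [0..<sum_list (map arity Ts)]"
  "tdeg (Vert (map (shifted Ts) [0..<length Ts])) = int (length Ts) - 2 + sum_list (map tdeg Ts)"
proof -
 show "vals_le m (Vert (map (shifted Ts) [0..<length Ts]))"
  using k labelled(1)[OF Ts] by (simp add: shifted_def)
 show "mset (labels (Vert (map (shifted Ts) [0..<length Ts]))) = mset [0..<sum_list (map arity Ts)]"
  by (rule labels_corolla) (rule labelled(2)[OF Ts])
 have "map (\<lambda>p. tdeg (Ts ! p)) [0..<length Ts] = map tdeg Ts"
  by (intro nth_equalityI) auto
 then show "tdeg (Vert (map (shifted Ts) [0..<length Ts])) = int (length Ts) - 2 + sum_list (map tdeg Ts)"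
  by (simp add: shifted_def comp_def)
qed

text \<open>Grafting into a vertex in terms of the operad: both sides are multilinear in the tensors \<open>ys\<close>, which
reduces the claim to lists of decorations.\<close>

lemma vert_attach:
 assumes Ts: "\<And>j. j < length Ts \<Longrightarrow> Ts ! j \<in> trees m (arity (Ts ! j))"
  and ys: "length ys = length Ts" "\<And>j. j < length Ts \<Longrightarrow> ys ! j \<in> span_on (W (arity (Ts ! j)) (ds ! j))"
  and k: "1 \<le> length Ts" "enat (length Ts) \<le> m"
 defines "\<epsilon> \<equiv> (\<Sum>(i, j) \<in> {(i, j). i < j \<and> j < length Ts}. ds ! i * tdeg (Ts ! j))"
 shows "vert (map2 (\<lambda>t y. attach (gen t) y) Ts ys) - fscale (of_int (psign \<epsilon>)) (attach (zeta_comp Ts) (append_tensors ys)) \<in> N"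
proof -
 have 1: "vert (map2 (\<lambda>t y. attach (gen t) y) Ts ys) = lin_ext (\<lambda>ws. vert (map2 (\<lambda>t w. decorate 0 w t) Ts ws)) (tuples ys)"
  unfolding attach_def lin_ext_gen by (rule vert_lin_ext) (simp add: ys(1))
 have 2: "fscale (of_int (psign \<epsilon>)) (attach (zeta_comp Ts) (append_tensors ys)) =
   lin_ext (\<lambda>ws. fscale (of_int (psign \<epsilon>)) (attach (zeta_comp Ts) (gen (concat ws)))) (tuples ys)"
  unfolding append_tensors_tuples lin_ext_fun_fscale
  by (simp add: attach_swap lin_ext_comp)
 show ?thesis
  unfolding 1 2
 proof (rule subspace_lin_ext_diff[OF subspace_N])
  fix ws assume "ws \<in> supp (tuples ys)"
  from keys_tuples[OF this] have ws: "length ws = length Ts" "\<And>j. j < length Ts \<Longrightarrow> ws ! j \<in> supp (ys ! j)"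
   using ys(1) by (auto simp: list_all2_conv_all_nth)
  have wW: "ws ! j \<in> W (arity (Ts ! j)) (ds ! j)" if "j < length Ts" for j
   by (rule span_on_keysD[OF ys(2)[OF that] ws(2)[OF that]])
  have dc: "vert (map2 (\<lambda>t w. decorate 0 w t) Ts ws) =
    (fscale (of_int (psign \<epsilon>)) (decorate 0 (concat ws) (Vert (map (shifted Ts) [0..<length Ts]))) :: _ \<Rightarrow>\<^sub>0 'k)"
   unfolding \<epsilon>_def by (rule decorate_corolla[OF Ts ws(1) wW])
  have "homogeneous_list Y (concat ws)"
   using wW ws(1) by (fastforce simp: homogeneous_list_def in_set_conv_nth)
  moreover have "length (concat ws) = sum_list (map arity Ts)"
  proof -
   have "map length ws = map arity Ts" using wW ws(1) by (intro nth_equalityI) auto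
   then show ?thesis by (simp add: length_concat)
  qed
  ultimately have "concat ws \<in> H (sum_list (map arity Ts))" by simp
  from attach_planar[OF corolla_facts(1,2)[OF Ts k] this, folded zeta_comp_shifted]
  have "attach (zeta_comp Ts) (gen (concat ws)) - decorate 0 (concat ws) (Vert (map (shifted Ts) [0..<length Ts])) \<in> N" .
  from subspace_diff_sym[OF subspace_N subspace_scale_diff[OF subspace_N this]]
  show "vert (map2 (\<lambda>t w. decorate 0 w t) Ts ws) - fscale (of_int (psign \<epsilon>)) (attach (zeta_comp Ts) (gen (concat ws))) \<in> N"
   unfolding dc .
 qed
qed

text \<open>Linearity extends the property of \<^const>\<open>Omega\<close> from trees to all elements.\<close>

lemma Omega_class:
 assumes "x \<in> span_on (trees m n)"
 shows "Omega m n x - x \<in> I n"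
proof -
 interpret L: Vector_Spaces.linear fscale fscale "Omega m n :: 'k forest \<Rightarrow> _"
  by (rule Omega_spec(1)[OF m1])
 from assms show ?thesis
 proof (induction rule: span_on_induct)
  case zero
  show ?case by (simp add: L.zero free.subspace_0[OF subspace_I])
 next
  case (step c t y)
  have "fscale c (Omega m n (gen t) - gen t) + (Omega m n y - y) \<in> I n"
   by (intro free.subspace_add[OF subspace_I] free.subspace_scale[OF subspace_I] Omega_spec(3)[OF m1] step)
  then show ?case by (simp add: L.add L.scale free.scale_right_diff_distrib algebra_simps)
 qed
qed

lemma free_pure_cong: "x - x' \<in> I n \<Longrightarrow> free_pure m Y n p x q v = free_pure m Y n p x' q v"
proof -
 assume "x - x' \<in> I n"
 then have "x +o I n = x' +o I n" by (simp only: coset_eq_iff[OF subspace_I])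
 then show ?thesis by (simp only: free_pure_def Lclass_def)
qed

lemma free_op_free_rule: "free_rule m Y free_op"
 unfolding free_rule_def Let_def
proof (intro allI impI)
 fix Ts ds vs
 assume A: "1 \<le> length Ts \<and> enat (length Ts) \<le> m \<and> length ds = length Ts \<and> length vs = length Ts \<and>
  (\<forall>j < length Ts. Ts ! j \<in> Adm m (arity (Ts ! j)) \<and> vs ! j \<in> carrier (tensor_power Y (arity (Ts ! j)) (ds ! j)))"
 let ?k = "length Ts"
 let ?a = "\<lambda>j. arity (Ts ! j)" and ?n = "sum_list (map arity Ts)"
 let ?p = "int ?k - 2 + sum_list (map tdeg Ts)" and ?q = "sum_list ds"
 let ?e = "\<Sum>(i, j) \<in> {(i, j). i < j \<and> j < ?k}. ds ! i * tdeg (Ts ! j)"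
 have k: "1 \<le> ?k" "enat ?k \<le> m" "length ds = ?k" "length vs = ?k" using A by auto
 have Tt: "Ts ! j \<in> trees m (?a j)" if "j < ?k" for j using A that by (simp add: Adm_def)
 have a1: "1 \<le> ?a j" if "j < ?k" for j
  using labels_nonempty[OF labelled(1)[OF Tt[OF that]]] by (simp add: arity_def Suc_le_eq)
 define y where "y j = repT (?a j) (ds ! j) (vs ! j)" for j
 have y: "y j \<in> span_on (W (?a j) (ds ! j))" "vs ! j = y j +o TR (?a j)" if "j < ?k" for j
 proof -
  have "vs ! j \<in> carrier (tensor_power Y (?a j) (ds ! j))" using A that by blast
  note r = repT[OF this]
  show "y j \<in> span_on (W (?a j) (ds ! j))" unfolding y_def by (rule r(1))
  show "vs ! j = y j +o TR (?a j)" unfolding y_def by (rule r(2))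
 qed
 define ys where "ys = map y [0..<?k]"
 have gT: "gen (Ts ! j) \<in> (span_on (T (?a j) (tdeg (Ts ! j))) :: (_ \<Rightarrow>\<^sub>0 'k) set)" if "j < ?k" for j
  using Tt[OF that] by simp
 define zs where "zs = map (\<lambda>j. (tdeg (Ts ! j) + ds ! j, attach (gen (Ts ! j)) (y j))) [0..<?k]"
 have hz: "homog zs" "1 \<le> length zs" "enat (length zs) \<le> m"
  using k D_TD[OF attach_span[OF gT y(1)]] by (auto simp: zs_def)
 have args: "map (\<lambda>j. (tdeg (Ts ! j) + ds ! j,
   free_pure m Y (?a j) (tdeg (Ts ! j)) (gen (Ts ! j)) (ds ! j) (vs ! j))) [0..<?k] = betas zs"
  using beta_attach[OF gT y(1) a1] y(2) by (simp add: zs_def)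
 have "sum_list (map (\<lambda>j. tdeg (Ts ! j) + ds ! j) [0..<?k]) = sum_list (map tdeg Ts) + sum_list ds"
 proof -
  have "map (\<lambda>j. tdeg (Ts ! j)) [0..<?k] = map tdeg Ts" "map (\<lambda>j. ds ! j) [0..<?k] = ds"
   using k(3) by (auto intro!: nth_equalityI)
  then show ?thesis by (simp only: sum_list_addf)
 qed
 then have od: "op_degree zs = ?p + ?q"
  by (simp add: op_degree_def total_degree_def zs_def comp_def)
 have ms: "map snd zs = map2 (\<lambda>t y. attach (gen t) y) Ts ys"
  unfolding zs_def ys_def by (intro nth_equalityI) auto
 have ly: "length ys = ?k" and ysj: "\<And>j. j < ?k \<Longrightarrow> ys ! j \<in> span_on (W (?a j) (ds ! j))"
  using y(1) by (auto simp: ys_def)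
 have mm: "map ?a [0..<?k] = map arity Ts" "map (\<lambda>j. ds ! j) [0..<?k] = ds"
  using k(3) by (auto intro!: nth_equalityI)
 have Yspan: "append_tensors ys \<in> span_on (W ?n ?q)"
  using append_tensors_span[of "[0..<?k]" y ?a "\<lambda>j. ds ! j"] y(1) by (simp add: ys_def mm)
 have "vs = map (\<lambda>j. y j +o TR (?a j)) [0..<?k]" using y(2) k(4) by (intro nth_equalityI) auto
 from tensor_concat_coset[of ?k y ?a "\<lambda>j. ds ! j", OF y(1) this]
 have tc: "tensor_concat Y ?n vs = append_tensors ys +o TR ?n" by (simp only: mm ys_def)
 have zeta: "zeta_comp Ts \<in> (span_on (T ?n ?p) :: (_ \<Rightarrow>\<^sub>0 'k) set)"
  using planar_T[OF corolla_facts(1,2)[OF Tt k(1,2)]] corolla_facts(3)[OF Tt k(1,2)] by (simp add: zeta_comp_shifted)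
 have n1: "1 \<le> ?n"
 proof -
  have "0 < ?k" using k(1) by (rule less_le_trans[OF zero_less_one])
  then have "?a 0 \<in> set (map arity Ts)" unfolding set_map by (intro imageI nth_mem)
  then have "?a 0 \<le> ?n" by (rule member_le_sum_list) simp
  with a1[OF \<open>0 < ?k\<close>] show ?thesis by simp
 qed
 have "free_op (betas zs) = beta (?p + ?q) (vert (map snd zs))"
  unfolding free_op_betas[OF hz] od ..
 also have "\<dots> = beta (?p + ?q) (fscale (of_int (psign ?e)) (attach (zeta_comp Ts) (append_tensors ys)))"
  unfolding ms by (rule beta_cong[OF vert_attach[OF Tt ly ysj k(1,2)]])
 also have "\<dots> = of_int (psign ?e) \<odot>\<^bsub>F (?p + ?q)\<^esub> beta (?p + ?q) (attach (zeta_comp Ts) (append_tensors ys))"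
  by (rule beta_scale[symmetric])
 also have "beta (?p + ?q) (attach (zeta_comp Ts) (append_tensors ys)) =
   free_pure m Y ?n ?p (zeta_comp Ts) ?q (append_tensors ys +o TR ?n)"
  by (rule beta_attach[OF zeta Yspan n1])
 also have "\<dots> = free_pure m Y ?n ?p (Omega m ?n (zeta_comp Ts)) ?q (append_tensors ys +o TR ?n)"
  by (rule free_pure_cong[OF Omega_class[OF span_T[OF zeta]], symmetric])
 finally show "free_op (map (\<lambda>j. (tdeg (Ts ! j) + ds ! j,
   free_pure m Y (?a j) (tdeg (Ts ! j)) (gen (Ts ! j)) (ds ! j) (vs ! j))) [0..<?k]) =
   of_int (psign ?e) \<odot>\<^bsub>F (?p + ?q)\<^esub> free_pure m Y ?n ?p (Omega m ?n (zeta_comp Ts)) ?q (tensor_concat Y ?n vs)"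
  unfolding args tc .
qed

end

section \<open>Vector spaces as modules\<close>

locale kmodule =
 fixes M :: "('k::field_char_0, 'v) module"
 assumes module: "Module.module (ring_of_type_algebra :: 'k ring) M"
begin

sublocale Module.module "ring_of_type_algebra :: 'k ring" M by (rule module)

lemma scalar [simp]: "c \<in> carrier (ring_of_type_algebra :: 'k ring)"
 by (simp add: ring_of_type_algebra_def)

lemma smult_add_left: "x \<in> carrier M \<Longrightarrow> (a + b) \<odot>\<^bsub>M\<^esub> x = a \<odot>\<^bsub>M\<^esub> x \<oplus>\<^bsub>M\<^esub> b \<odot>\<^bsub>M\<^esub> x"
 using smult_l_distr[of a b x] by (simp add: ring_of_type_algebra_def)

lemma smult_mult: "x \<in> carrier M \<Longrightarrow> (a * b) \<odot>\<^bsub>M\<^esub> x = a \<odot>\<^bsub>M\<^esub> (b \<odot>\<^bsub>M\<^esub> x)"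
 using smult_assoc1[of a b x] by (simp add: ring_of_type_algebra_def)

lemma smult_1 [simp]: "x \<in> carrier M \<Longrightarrow> 1 \<odot>\<^bsub>M\<^esub> x = x"
 using smult_one[of x] by (simp add: ring_of_type_algebra_def)

lemma smult_0 [simp]: "x \<in> carrier M \<Longrightarrow> 0 \<odot>\<^bsub>M\<^esub> x = \<zero>\<^bsub>M\<^esub>"
 using smult_l_null[of x] by (simp add: ring_of_type_algebra_def)

lemma smult_neg_add: "x \<in> carrier M \<Longrightarrow> (- 1) \<odot>\<^bsub>M\<^esub> x \<oplus>\<^bsub>M\<^esub> x = \<zero>\<^bsub>M\<^esub>"
 using smult_add_left[of x "- 1" 1] by simp

end

lemma graded_kmodule: "graded_vector_space V \<Longrightarrow> kmodule (V d)"
 by (simp add: graded_vector_space_def kmodule_def)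

lemma graded_linear_zero:
 assumes "graded_vector_space V" "graded_vector_space W" "graded_linear V W f"
 shows "f d \<zero>\<^bsub>V d\<^esub> = \<zero>\<^bsub>W d\<^esub>"
proof -
 interpret M: kmodule "V d" by (rule graded_kmodule[OF assms(1)])
 interpret W: kmodule "W d" by (rule graded_kmodule[OF assms(2)])
 have "f d \<zero>\<^bsub>V d\<^esub> = f d ((- 1) \<odot>\<^bsub>V d\<^esub> \<zero>\<^bsub>V d\<^esub> \<oplus>\<^bsub>V d\<^esub> \<zero>\<^bsub>V d\<^esub>)" by simp
 also have "\<dots> = (- 1) \<odot>\<^bsub>W d\<^esub> f d \<zero>\<^bsub>V d\<^esub> \<oplus>\<^bsub>W d\<^esub> f d \<zero>\<^bsub>V d\<^esub>"
  using assms(3) unfolding graded_linear_def by (blast intro: M.M.zero_closed)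
 also have "\<dots> = \<zero>\<^bsub>W d\<^esub>"
  using assms(3) unfolding graded_linear_def by (blast intro: W.smult_neg_add M.M.zero_closed)
 finally show ?thesis .
qed

lemma op_argsD:
 assumes "w \<in> op_args m V"
 shows "homogeneous_list V w" "1 \<le> length w" "enat (length w) \<le> m"
 using assms by (auto simp: op_args_def)

lemma op_args_update:
 "w \<in> op_args m V \<Longrightarrow> z \<in> carrier (V e) \<Longrightarrow> w[i := (e, z)] \<in> op_args m V"
 using set_update_subset_insert[of w i "(e, z)"] by (fastforce simp: op_args_def homogeneous_list_def)

lemma multilinear_closed: "multilinear_ops m V l \<Longrightarrow> w \<in> op_args m V \<Longrightarrow> l w \<in> carrier (V (op_degree w))"
 by (simp add: multilinear_ops_def)

lemma multilinear_slot:
 assumes "multilinear_ops m V l" "w \<in> op_args m V" "i < length w" "fst (w ! i) = e"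
  "x \<in> carrier (V e)" "y \<in> carrier (V e)"
 shows "l (w[i := (e, c \<odot>\<^bsub>V e\<^esub> x \<oplus>\<^bsub>V e\<^esub> y)]) =
  c \<odot>\<^bsub>V (op_degree w)\<^esub> l (w[i := (e, x)]) \<oplus>\<^bsub>V (op_degree w)\<^esub> l (w[i := (e, y)])"
 using assms unfolding multilinear_ops_def Let_def by blast

lemma op_degree_slot: "i < length w \<Longrightarrow> fst (w ! i) = e \<Longrightarrow> op_degree (w[i := (e, x)]) = op_degree w"
proof -
 assume i: "i < length w" "fst (w ! i) = e"
 have "map fst (w[i := (e, x)]) = map fst w"
  using i by (simp add: map_update list_update_id[of "map fst w" i, unfolded nth_map[OF i(1)], unfolded i(2)])
 then show ?thesis by (simp add: op_degree_def total_degree_def)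
qed

lemma multilinear_zero:
 assumes V: "graded_vector_space V" and l: "multilinear_ops m V l" and w: "w \<in> op_args m V"
  and i: "i < length w" "fst (w ! i) = e"
 shows "l (w[i := (e, \<zero>\<^bsub>V e\<^esub>)]) = \<zero>\<^bsub>V (op_degree w)\<^esub>"
proof -
 interpret M: kmodule "V e" by (rule graded_kmodule[OF V])
 interpret W: kmodule "V (op_degree w)" by (rule graded_kmodule[OF V])
 have c: "l (w[i := (e, \<zero>\<^bsub>V e\<^esub>)]) \<in> carrier (V (op_degree w))"
  using multilinear_closed[OF l op_args_update[OF w M.M.zero_closed, of i]] op_degree_slot[OF i] by simp
 \<comment> \<open>Multilinearity concerns expressions \<open>c x + y\<close>, so zero is written as \<open>(- 1) 0 + 0\<close>.\<close>
 have "l (w[i := (e, (- 1) \<odot>\<^bsub>V e\<^esub> \<zero>\<^bsub>V e\<^esub> \<oplus>\<^bsub>V e\<^esub> \<zero>\<^bsub>V e\<^esub>)]) =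
  (- 1) \<odot>\<^bsub>V (op_degree w)\<^esub> l (w[i := (e, \<zero>\<^bsub>V e\<^esub>)]) \<oplus>\<^bsub>V (op_degree w)\<^esub> l (w[i := (e, \<zero>\<^bsub>V e\<^esub>)])"
  by (rule multilinear_slot[OF l w i M.M.zero_closed M.M.zero_closed])
 then show ?thesis using W.smult_neg_add[OF c] by simp
qed

lemma admissible_map_tree [simp]: "admissible (map_tree f t) \<longleftrightarrow> admissible t"
proof (induction t)
 case (Vert ts)
 have "(\<exists>a. map_tree f t = Leg a) \<longleftrightarrow> (\<exists>a. t = Leg a)" for t by (cases t) auto
 with Vert show ?case by simp
qed simp

section \<open>Uniqueness of the operations\<close>

context free_setting
begin

lemma F_graded: "graded_vector_space F"
 using F_module by (simp add: graded_vector_space_def)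

text \<open>The component of degree \<open>d\<close>. The reduction to admissible trees need not preserve the degree, but
the relations are homogeneous, so the other components may be dropped.\<close>

definition part :: "int \<Rightarrow> ('k, 'y) dforest \<Rightarrow> ('k, 'y) dforest" where
 "part d = lin_ext (\<lambda>s. if dg fst s = d then gen s else 0)"

lemma part_span: "x \<in> span_on S \<Longrightarrow> part d x \<in> span_on {s \<in> S. dg fst s = d}"
 unfolding part_def by (rule lin_ext_span_on) (auto dest: span_on_keysD)

lemma part_relations: "x \<in> N \<Longrightarrow> part d x \<in> N"
 unfolding relations_def part_def
proof (rule span_lin_ext[OF _ subspace_N[unfolded relations_def]])
 fix r assume "r \<in> Collect (relator m V fst (linear_relators Y))"
 then have r: "relator m V fst (linear_relators Y) r" by simp
 from relator_homogeneous[OF r leaf_homogeneous_linear] obtain p e n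
  where h: "r \<in> span_on {t. valid m V t \<and> tdeg t = p \<and> dg fst t = e \<and> arity t = n}" by blast
 have "lin_ext (\<lambda>s. if dg fst s = d then gen s else 0) r = lin_ext (\<lambda>s. if e = d then gen s else 0) r"
  by (rule lin_ext_cong) (use span_on_keysD[OF h] in auto)
 also have "\<dots> = (if e = d then r else 0)" by (simp add: lin_ext_id)
 also have "\<dots> \<in> N" using relator_in_relations[OF r] by (simp add: free.subspace_0[OF subspace_N])
 finally show "lin_ext (\<lambda>s. if dg fst s = d then gen s else 0) r \<in> free.span (Collect (relator m V fst (linear_relators Y)))"
  unfolding relations_def .
qed

lemma homogeneous_reduction:
 assumes "x \<in> span_on (TD d)"
 obtains x' where "x' \<in> span_on {s \<in> TD d. admissible s}" "x - x' \<in> N"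
proof -
 have "\<forall>s \<in> TD d. \<exists>y. y \<in> span_on {s \<in> TD d. admissible s} \<and> gen s - y \<in> N"
 proof
  fix s assume s: "s \<in> TD d"
  then have "reducible m V fst (linear_relators Y) s" by (intro reducible_valid m1) simp
  then obtain z where z: "z \<in> span_on {u. valid m V u \<and> admissible u \<and> mset (labels u) = mset (labels s)}"
   "gen s - z \<in> N" by blast
  have "part d z \<in> span_on {s \<in> TD d. admissible s}"
   by (rule span_on_mono[OF _ part_span[OF z(1)]]) auto
  moreover have "gen s - part d z \<in> N"
   using part_relations[OF z(2), of d] s by (simp add: part_def lin_ext_diff)
  ultimately show "\<exists>y. y \<in> span_on {s \<in> TD d. admissible s} \<and> gen s - y \<in> N" by blast
 qed
 from bchoice[OF this] obtain g where g: "\<And>s. s \<in> TD d \<Longrightarrow> g s \<in> span_on {s \<in> TD d. admissible s}"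
  "\<And>s. s \<in> TD d \<Longrightarrow> gen s - g s \<in> N" by blast
 have "lin_ext g x \<in> span_on {s \<in> TD d. admissible s}"
  by (rule lin_ext_span_on, rule g(1)) (rule span_on_keysD[OF assms])
 moreover have "lin_ext gen x - lin_ext g x \<in> N"
  by (rule subspace_lin_ext_diff[OF subspace_N], rule g(2)) (rule span_on_keysD[OF assms])
 then have "x - lin_ext g x \<in> N" by (simp add: lin_ext_id)
 ultimately show thesis by (rule that)
qed

text \<open>Numbering the legs of an admissible tree and ordering the children of its vertices gives an
element of \<^const>\<open>Adm\<close>, up to signs.\<close>

lemma beta_admissible:
 assumes s: "s \<in> TD d" "admissible s"
 obtains c t q v where "t \<in> Adm m (arity t)" "v \<in> carrier (tensor_power Y (arity t) q)" "tdeg t + q = d"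
  "beta d (gen s) = c \<odot>\<^bsub>F d\<^esub> free_pure m Y (arity t) (tdeg t) (gen t) q v"
proof -
 define n where "n = arity s"
 let ?t = "num 0 s" and ?w = "labels s"
 let ?L = "leg_sign (\<lambda>a. fst (?w ! a)) ?t"
 have t: "vals_le m ?t" "mset (labels ?t) = mset [0..<n]"
  using s labels_num(1)[of 0 s] by (auto simp: valid_def n_def)
 have w: "?w \<in> H n" using s by (auto simp: valid_def homogeneous_list_iff arity_def n_def)
 have s': "map_tree (\<lambda>a. ?w ! a) ?t = s" using map_tree_num_nth[of s 0] by simp
 have gens: "(gen s :: _ \<Rightarrow>\<^sub>0 'k) = fscale (of_int ?L) (decorate 0 ?w ?t)"
 proof -
  have "of_int ?L * of_int ?L = (1 :: 'k)"
   unfolding of_int_mult[symmetric] leg_sign_square by simp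
  then show ?thesis using s' by (simp add: decorate_def)
 qed
 have "fscale (of_int ?L) (attach (planar ?t) (gen ?w)) - gen s \<in> N"
  unfolding gens by (rule subspace_scale_diff[OF subspace_N attach_planar[OF t w]])
 from beta_cong[OF this, of d] have 1: "beta d (gen s) = beta d (fscale (of_int ?L) (attach (planar ?t) (gen ?w)))" by simp
 let ?u = "nform ?t"
 have sw: "swaps (\<lambda>_. 0) (nform_sign ?t) ?t ?u" by (rule swaps_nform)
 have "of_int (nform_sign ?t) * of_int (nform_sign ?t) = (1 :: 'k)"
  unfolding of_int_mult[symmetric] swaps_square[OF sw] by simp
 then have "gen ?u = (fscale (of_int (nform_sign ?t)) (planar ?t) :: _ \<Rightarrow>\<^sub>0 'k)"
  by (simp add: planar_def)
 then have "gen ?u \<in> (span_on (T n (tdeg ?t)) :: (_ \<Rightarrow>\<^sub>0 'k) set)"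
  using span_on_fscale[OF planar_T[OF t]] by simp
 then have u: "?u \<in> trees m n" "tdeg ?u = tdeg ?t" by auto
 have au: "arity ?u = n" by (rule labelled(6)[OF u(1)])
 have "admissible ?t" using s(2) s' admissible_map_tree by metis
 then have uA: "?u \<in> Adm m (arity ?u)" using admissible_swaps[OF sw] u(1) by (simp add: Adm_def au)
 let ?q = "total_degree ?w"
 have gw: "gen ?w \<in> (span_on (W n ?q) :: (_ \<Rightarrow>\<^sub>0 'k) set)" using w by simp
 then have v: "gen ?w +o TR n \<in> carrier (tensor_power Y (arity ?u) ?q)" unfolding tensor_carrier au by blast
 have "s \<in> D n (tdeg ?t + ?q)" using decorated[OF t w] unfolding s' .
 then have d: "tdeg ?u + ?q = d" using s(1) u(2) by (auto simp: D_def)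
 have n1: "1 \<le> n" using labels_nonempty[of m s] s by (auto simp: valid_def arity_def n_def Suc_le_eq)
 have gu: "gen ?u \<in> (span_on (T n (tdeg ?u)) :: (_ \<Rightarrow>\<^sub>0 'k) set)" using u(1) by simp
 have "beta d (attach (gen ?u) (gen ?w)) = free_pure m Y n (tdeg ?u) (gen ?u) ?q (gen ?w +o TR n)"
  using beta_attach[OF gu gw n1] unfolding d .
 moreover have "fscale (of_int ?L) (attach (planar ?t) (gen ?w)) = fscale (of_int ?L * of_int (nform_sign ?t)) (attach (gen ?u) (gen ?w))"
  by (simp add: planar_def attach_scale_left)
 ultimately have "beta d (gen s) = (of_int ?L * of_int (nform_sign ?t)) \<odot>\<^bsub>F d\<^esub>
   free_pure m Y (arity ?u) (tdeg ?u) (gen ?u) ?q (gen ?w +o TR n)"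
  unfolding 1 au by (simp only: beta_scale[symmetric])
 with uA v d show thesis by (rule that)
qed

lemma free_pure_carrier:
 assumes "t \<in> Adm m (arity t)" "v \<in> carrier (tensor_power Y (arity t) q)"
 shows "free_pure m Y (arity t) (tdeg t) (gen t) q v \<in> carrier (F (tdeg t + q))"
proof -
 have t: "t \<in> trees m (arity t)" using assms(1) by (simp add: Adm_def)
 have n1: "1 \<le> arity t"
  using labels_nonempty[OF labelled(1)[OF t]] by (simp add: arity_def Suc_le_eq)
 have gt: "gen t \<in> (span_on (T (arity t) (tdeg t)) :: (_ \<Rightarrow>\<^sub>0 'k) set)" using t by simp
 from assms(2) obtain y where r: "y \<in> span_on (W (arity t) q)" "v = y +o TR (arity t)"
  unfolding tensor_carrier by blast
 show ?thesis
  unfolding r(2) unfolding beta_attach[OF gt r(1) n1, symmetric]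
  by (rule beta_carrier[OF D_TD[OF attach_span[OF gt r(1)]]])
qed

text \<open>The free space is spanned by the elements on which the rule prescribes the operations.\<close>

lemma F_induct [consumes 1, case_names zero linear pure]:
 assumes f: "f \<in> carrier (F d)" and zero: "P \<zero>\<^bsub>F d\<^esub>"
  and linear: "\<And>c x y. x \<in> carrier (F d) \<Longrightarrow> y \<in> carrier (F d) \<Longrightarrow> P x \<Longrightarrow> P y \<Longrightarrow> P (c \<odot>\<^bsub>F d\<^esub> x \<oplus>\<^bsub>F d\<^esub> y)"
  and pure: "\<And>t q v. t \<in> Adm m (arity t) \<Longrightarrow> v \<in> carrier (tensor_power Y (arity t) q) \<Longrightarrow> tdeg t + q = d \<Longrightarrow>
   P (free_pure m Y (arity t) (tdeg t) (gen t) q v)"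
 shows "P f"
proof -
 interpret M: kmodule "F d" by (rule graded_kmodule[OF F_graded])
 from f obtain x where x: "x \<in> span_on (TD d)" "beta d x = f" by (rule beta_surj)
 from x(1) obtain x' where x': "x' \<in> span_on {s \<in> TD d. admissible s}" "x - x' \<in> N"
  by (rule homogeneous_reduction)
 have "P (beta d x')"
  using x'(1)
 proof (induction rule: span_on_induct)
  case zero
  show ?case unfolding beta_0 by (rule assms(2))
 next
  case (step c s y)
  from step(1) have s: "s \<in> TD d" "admissible s" by auto
  from s obtain b t q v where b: "t \<in> Adm m (arity t)" "v \<in> carrier (tensor_power Y (arity t) q)" "tdeg t + q = d"
   "beta d (gen s) = b \<odot>\<^bsub>F d\<^esub> free_pure m Y (arity t) (tdeg t) (gen t) q v" by (rule beta_admissible)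
  let ?z = "free_pure m Y (arity t) (tdeg t) (gen t) q v"
  have z: "?z \<in> carrier (F d)" using free_pure_carrier[OF b(1,2)] unfolding b(3) .
  have y: "beta d y \<in> carrier (F d)"
   by (rule beta_carrier, rule span_on_mono[OF _ step(2)]) auto
  have "beta d (fscale c (gen s) + y) = (c * b) \<odot>\<^bsub>F d\<^esub> ?z \<oplus>\<^bsub>F d\<^esub> beta d y"
   using z by (simp add: beta_add[symmetric] beta_scale[symmetric] b(4) M.smult_mult)
  then show ?case using linear[OF z y pure[OF b(1-3)] step(3), of "c * b"] by simp
 qed
 with beta_cong[OF x'(2), of d] x(2) show ?thesis by simp
qed

text \<open>By multilinearity the arguments may be replaced, one position after the other, by elements on which
both operations are given by the rule.\<close>

lemma ops_agree:
 assumes l: "multilinear_ops m F l" "free_rule m Y l" and l': "multilinear_ops m F l'" "free_rule m Y l'"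
  and "w \<in> op_args m F"
 shows "l w = l' w"
proof -
 define Pure where "Pure = (\<lambda>z. \<exists>t q v. t \<in> Adm m (arity t) \<and> v \<in> carrier (tensor_power Y (arity t) q) \<and>
  z = (tdeg t + q, free_pure m Y (arity t) (tdeg t) (gen t) q v))"
 have "l w = l' w" if "w \<in> op_args m F" "\<forall>j < length w. i \<le> j \<longrightarrow> Pure (w ! j)" for i w
  using that
 proof (induction i arbitrary: w)
  case 0
  let ?Q = "\<lambda>j z. fst z \<in> Adm m (arity (fst z)) \<and>
    snd (snd z) \<in> carrier (tensor_power Y (arity (fst z)) (fst (snd z))) \<and>
    w ! j = (tdeg (fst z) + fst (snd z), free_pure m Y (arity (fst z)) (tdeg (fst z)) (gen (fst z)) (fst (snd z)) (snd (snd z)))"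
  have "\<forall>j\<in>{..<length w}. \<exists>z. ?Q j z"
  proof
   fix j assume "j \<in> {..<length w}"
   then have "Pure (w ! j)" using 0(2) by simp
   then obtain t q v where "t \<in> Adm m (arity t)" "v \<in> carrier (tensor_power Y (arity t) q)"
    "w ! j = (tdeg t + q, free_pure m Y (arity t) (tdeg t) (gen t) q v)" unfolding Pure_def by blast
   then show "\<exists>z. ?Q j z"
    by (intro exI[of _ "(t, q, v)"]) simp
  qed
  from bchoice[OF this] obtain g where g: "\<And>j. j < length w \<Longrightarrow> fst (g j) \<in> Adm m (arity (fst (g j)))"
   "\<And>j. j < length w \<Longrightarrow> snd (snd (g j)) \<in> carrier (tensor_power Y (arity (fst (g j))) (fst (snd (g j))))"
   "\<And>j. j < length w \<Longrightarrow> w ! j = (tdeg (fst (g j)) + fst (snd (g j)),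
     free_pure m Y (arity (fst (g j))) (tdeg (fst (g j))) (gen (fst (g j))) (fst (snd (g j))) (snd (snd (g j))))"
   by auto
  let ?k = "length w"
  define Ts where "Ts = map (\<lambda>j. fst (g j)) [0..<?k]"
  define ds where "ds = map (\<lambda>j. fst (snd (g j))) [0..<?k]"
  define vs where "vs = map (\<lambda>j. snd (snd (g j))) [0..<?k]"
  have cond: "1 \<le> length Ts \<and> enat (length Ts) \<le> m \<and> length ds = length Ts \<and> length vs = length Ts \<and>
   (\<forall>j < length Ts. Ts ! j \<in> Adm m (arity (Ts ! j)) \<and> vs ! j \<in> carrier (tensor_power Y (arity (Ts ! j)) (ds ! j)))"
   using op_argsD[OF 0(1)] g(1,2) by (simp add: Ts_def ds_def vs_def)
  have w: "w = map (\<lambda>j. (tdeg (Ts ! j) + ds ! j,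
    free_pure m Y (arity (Ts ! j)) (tdeg (Ts ! j)) (gen (Ts ! j)) (ds ! j) (vs ! j))) [0..<length Ts]"
   by (rule nth_equalityI) (simp_all add: Ts_def ds_def vs_def g(3)[symmetric])
  show ?case
   by (subst (1 2) w)
    (rule trans[OF l(2)[unfolded free_rule_def Let_def, rule_format, OF cond]
     l'(2)[unfolded free_rule_def Let_def, rule_format, OF cond, symmetric]])
 next
  case (Suc i)
  show ?case
  proof (cases "i < length w")
   case False
   then show ?thesis using Suc by auto
  next
   case True
   define e where "e = fst (w ! i)"
   have i: "i < length w" "fst (w ! i) = e" using True by (simp_all add: e_def)
   have wi: "snd (w ! i) \<in> carrier (F e)"
    using op_argsD(1)[OF Suc.prems(1)] nth_mem[OF True] by (auto simp: homogeneous_list_def e_def split_beta)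
   have "l (w[i := (e, snd (w ! i))]) = l' (w[i := (e, snd (w ! i))])"
    using wi
   proof (induction rule: F_induct)
    case zero
    show ?case
     by (rule trans[OF multilinear_zero[OF F_graded l(1) Suc.prems(1) i]
      multilinear_zero[OF F_graded l'(1) Suc.prems(1) i, symmetric]])
   next
    case (linear c x y)
    then show ?case
     using multilinear_slot[OF l(1) Suc.prems(1) i linear(1,2), of c]
      multilinear_slot[OF l'(1) Suc.prems(1) i linear(1,2), of c] by simp
   next
    case (pure t q v)
    let ?z = "free_pure m Y (arity t) (tdeg t) (gen t) q v"
    have "?z \<in> carrier (F e)" using free_pure_carrier[OF pure(1,2)] unfolding pure(3) .
    then have "w[i := (e, ?z)] \<in> op_args m F" by (rule op_args_update[OF Suc.prems(1)])
    moreover have "Pure (e, ?z)" unfolding Pure_def using pure by blast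
    then have "\<forall>j < length (w[i := (e, ?z)]). i \<le> j \<longrightarrow> Pure (w[i := (e, ?z)] ! j)"
     using Suc.prems(2) by (simp add: nth_list_update)
    ultimately show ?case by (rule Suc.IH)
   qed
   then show ?thesis by (simp add: e_def)
  qed
 qed
 from this[of w "length w"] assms(5) show ?thesis by simp
qed

lemma op_args_permute: "w \<in> op_args m V' \<Longrightarrow> \<sigma> permutes {..<length w} \<Longrightarrow> permute_list \<sigma> w \<in> op_args m V'"
 by (simp add: op_args_def homogeneous_list_def)

lemma jacobi_args:
 assumes w: "w \<in> op_args m V'" and l: "multilinear_ops m V' l" and i: "1 \<le> i" "i \<le> length w"
 shows "take i w \<in> op_args m V'" "(op_degree (take i w), l (take i w)) # drop i w \<in> op_args m V'"
  "op_degree ((op_degree (take i w), l (take i w)) # drop i w) = total_degree w + int (length w) - 3"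
proof -
 have le: "enat i \<le> m" "enat (Suc (length w - i)) \<le> m"
  using op_argsD(3)[OF w] i by (auto intro: order_trans[rotated])
 show u: "take i w \<in> op_args m V'"
  using w i le by (auto simp: op_args_def homogeneous_list_def dest: in_set_takeD)
 show "(op_degree (take i w), l (take i w)) # drop i w \<in> op_args m V'"
  using w i le multilinear_closed[OF l u] by (auto simp: op_args_def homogeneous_list_def dest: in_set_dropD)
 have "total_degree (take i w) + total_degree (drop i w) = total_degree w"
  unfolding total_degree_def sum_list_append[symmetric] map_append[symmetric] append_take_drop_id ..
 then show "op_degree ((op_degree (take i w), l (take i w)) # drop i w) = total_degree w + int (length w) - 3"
  using i by (simp add: op_degree_def total_degree_def)
qed

lemma total_degree_permute: "\<sigma> permutes {..<length w} \<Longrightarrow> total_degree (permute_list \<sigma> w) = total_degree w"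
 unfolding total_degree_def by (rule sum_list_map_mset_cong) simp

text \<open>The axioms only evaluate the operations at the arguments in \<^const>\<open>op_args\<close>.\<close>

lemma L_algebra_agree:
 assumes A: "L_algebra m V' l" and l': "multilinear_ops m V' l'" and eq: "\<And>w. w \<in> op_args m V' \<Longrightarrow> l' w = l w"
 shows "L_algebra m V' l'"
proof -
 from A have V': "graded_vector_space V'" and l: "multilinear_ops m V' l" "antisymmetric_ops m V' l" "jacobi_ops m V' l"
  by (simp_all add: L_algebra_def)
 have "antisymmetric_ops m V' l'"
  unfolding antisymmetric_ops_def
 proof (intro ballI allI impI)
  fix w \<sigma> assume w: "w \<in> op_args m V'" and \<sigma>: "\<sigma> permutes {..<length w}"
  show "l' (permute_list \<sigma> w) = of_int (chi \<sigma> (map fst w)) \<odot>\<^bsub>V' (op_degree w)\<^esub> l' w"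
   unfolding eq[OF w] eq[OF op_args_permute[OF w \<sigma>]]
   by (rule l(2)[unfolded antisymmetric_ops_def, rule_format, OF w \<sigma>])
 qed
 moreover have "jacobi_ops m V' l'"
  unfolding jacobi_ops_def Let_def
 proof
  fix w assume w: "w \<in> op_args m V'"
  let ?d = "total_degree w + int (length w) - 3"
  interpret M: kmodule "V' ?d" by (rule graded_kmodule[OF V'])
  let ?g = "\<lambda>l (i, \<sigma>). of_int (chi \<sigma> (map fst w) * psign (int (i * (length w - i)))) \<odot>\<^bsub>V' ?d\<^esub>
    l ((op_degree (take i (permute_list \<sigma> w)), l (take i (permute_list \<sigma> w))) # drop i (permute_list \<sigma> w))"
  have g: "?g l' p = ?g l p \<and> ?g l p \<in> carrier (V' ?d)" if "p \<in> unsh (length w)" for p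
  proof -
   obtain i \<sigma> where p: "p = (i, \<sigma>)" by (cases p)
   have i: "1 \<le> i" "i \<le> length w" and \<sigma>: "\<sigma> permutes {..<length w}" using unshD[of i \<sigma>] that p by auto
   let ?w = "permute_list \<sigma> w"
   have i': "i \<le> length ?w" using i by simp
   note ja = jacobi_args[OF op_args_permute[OF w \<sigma>] l(1) i(1) i']
   have "l ((op_degree (take i ?w), l (take i ?w)) # drop i ?w) \<in> carrier (V' ?d)"
    using multilinear_closed[OF l(1) ja(2)] unfolding ja(3) total_degree_permute[OF \<sigma>] by simp
   then show ?thesis unfolding p using eq[OF ja(1)] eq[OF ja(2)] by (simp add: M.smult_closed)
  qed
  have "finsum (V' ?d) (?g l') (unsh (length w)) = finsum (V' ?d) (?g l) (unsh (length w))"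
   by (rule M.M.finsum_cong'[OF refl]) (use g in blast)+
  also have "\<dots> = \<zero>\<^bsub>V' ?d\<^esub>" using l(3) w unfolding jacobi_ops_def Let_def by blast
  finally show "finsum (V' ?d) (?g l') (unsh (length w)) = \<zero>\<^bsub>V' ?d\<^esub>" .
 qed
 ultimately show ?thesis using V' l' by (simp add: L_algebra_def)
qed

end

section \<open>Evaluating decorated trees in an algebra\<close>

definition module_ev :: "('k::field, 'v) module \<Rightarrow> ('t \<Rightarrow> 'v) \<Rightarrow> ('t \<Rightarrow>\<^sub>0 'k) \<Rightarrow> 'v" where
 "module_ev M g x = finsum M (\<lambda>t. coord x t \<odot>\<^bsub>M\<^esub> g t) (supp x)"

context kmodule
begin

lemma module_ev_superset:
 assumes "\<And>t. t \<in> T \<Longrightarrow> g t \<in> carrier M" "finite T" "supp x \<subseteq> T"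
 shows "module_ev M g x = finsum M (\<lambda>t. coord x t \<odot>\<^bsub>M\<^esub> g t) T"
 unfolding module_ev_def
 by (rule M.add.finprod_mono_neutral_cong_left)
  (use assms in \<open>auto simp: in_keys_iff smult_closed\<close>)

lemma module_ev_closed:
 "(\<And>t. t \<in> S \<Longrightarrow> g t \<in> carrier M) \<Longrightarrow> x \<in> span_on S \<Longrightarrow> module_ev M g x \<in> carrier M"
 unfolding module_ev_def by (rule M.finsum_closed) (auto simp: smult_closed dest: span_on_keysD)

lemma module_ev_linear:
 assumes g: "\<And>t. t \<in> S \<Longrightarrow> g t \<in> carrier M" and x: "x \<in> span_on S" and y: "y \<in> span_on S"
 shows "module_ev M g (fscale c x + y) = c \<odot>\<^bsub>M\<^esub> module_ev M g x \<oplus>\<^bsub>M\<^esub> module_ev M g y"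
proof -
 let ?T = "supp x \<union> supp y"
 have T: "t \<in> ?T \<Longrightarrow> g t \<in> carrier M" for t using g span_on_keysD[OF x] span_on_keysD[OF y] by blast
 have fin: "finite ?T" by simp
 have "supp (fscale c x + y) \<subseteq> ?T"
  by (auto simp: in_keys_iff lookup_add)
 have sup: "module_ev M g z = finsum M (\<lambda>t. coord z t \<odot>\<^bsub>M\<^esub> g t) ?T" if "supp z \<subseteq> ?T" for z
  by (rule module_ev_superset[OF _ fin that]) (rule T)
 have cl: "(\<lambda>t. coord z t \<odot>\<^bsub>M\<^esub> g t) \<in> ?T \<rightarrow> carrier M" for z using T by (auto simp: smult_closed)
 have cl': "(\<lambda>t. c \<odot>\<^bsub>M\<^esub> (coord z t \<odot>\<^bsub>M\<^esub> g t)) \<in> ?T \<rightarrow> carrier M" for z using T by (auto simp: smult_closed)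
 have "module_ev M g (fscale c x + y) = finsum M (\<lambda>t. coord (fscale c x + y) t \<odot>\<^bsub>M\<^esub> g t) ?T"
  by (rule sup) fact
 also have "\<dots> = finsum M (\<lambda>t. c \<odot>\<^bsub>M\<^esub> (coord x t \<odot>\<^bsub>M\<^esub> g t) \<oplus>\<^bsub>M\<^esub> coord y t \<odot>\<^bsub>M\<^esub> g t) ?T"
  by (rule M.finsum_cong'[OF refl]) (use T in \<open>auto simp: smult_closed lookup_add smult_add_left smult_mult\<close>)
 also have "\<dots> = finsum M (\<lambda>t. c \<odot>\<^bsub>M\<^esub> (coord x t \<odot>\<^bsub>M\<^esub> g t)) ?T \<oplus>\<^bsub>M\<^esub>
   finsum M (\<lambda>t. coord y t \<odot>\<^bsub>M\<^esub> g t) ?T"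
  by (rule M.finsum_addf[OF cl' cl])
 also have "finsum M (\<lambda>t. c \<odot>\<^bsub>M\<^esub> (coord x t \<odot>\<^bsub>M\<^esub> g t)) ?T =
   c \<odot>\<^bsub>M\<^esub> finsum M (\<lambda>t. coord x t \<odot>\<^bsub>M\<^esub> g t) ?T"
  by (rule finsum_smult_ldistr[OF fin scalar cl, symmetric])
 also have "finsum M (\<lambda>t. coord x t \<odot>\<^bsub>M\<^esub> g t) ?T = module_ev M g x"
  by (rule sup[symmetric]) blast
 also have "finsum M (\<lambda>t. coord y t \<odot>\<^bsub>M\<^esub> g t) ?T = module_ev M g y"
  by (rule sup[symmetric]) blast
 finally show ?thesis .
qed

lemma module_ev_gen: "g t \<in> carrier M \<Longrightarrow> module_ev M g (gen t) = g t"
 by (simp add: module_ev_def)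

lemma module_ev_0: "module_ev M g 0 = \<zero>\<^bsub>M\<^esub>"
 by (simp add: module_ev_def)

end

text \<open>The value of a decorated tree in an algebra, with \<open>f\<close> applied to the decorations. The value of a
tree \<open>t\<close> has degree \<open>dg fst t\<close>.\<close>

fun tree_eval :: "(int \<Rightarrow> 'y \<Rightarrow> 'a) \<Rightarrow> ((int \<times> 'a) list \<Rightarrow> 'a) \<Rightarrow> (int \<times> 'y) tree \<Rightarrow> 'a" where
 "tree_eval f l (Leg b) = f (fst b) (snd b)"
| "tree_eval f l (Vert ts) = l (map (\<lambda>t. (dg fst t, tree_eval f l t)) ts)"

lemma op_degree_append:
 "op_degree (us @ (e, x) # vs) = total_degree us + e + total_degree vs + int (length us + length vs) - 1"
 by (simp add: op_degree_def total_degree_def)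

lemma multilinear_append:
 assumes "multilinear_ops m V l" "us @ (e, x) # vs \<in> op_args m V" "y \<in> carrier (V e)"
 shows "l (us @ (e, c \<odot>\<^bsub>V e\<^esub> x \<oplus>\<^bsub>V e\<^esub> y) # vs) =
  c \<odot>\<^bsub>V (op_degree (us @ (e, x) # vs))\<^esub> l (us @ (e, x) # vs) \<oplus>\<^bsub>V (op_degree (us @ (e, x) # vs))\<^esub> l (us @ (e, y) # vs)"
proof -
 have "x \<in> carrier (V e)" using op_argsD(1)[OF assms(2)] by (simp add: homogeneous_list_def)
 from multilinear_slot[OF assms(1,2) _ _ this assms(3), of "length us" c] show ?thesis
  by (simp add: list_update_append)
qed

lemma multilinear_append_zero:
 assumes "graded_vector_space V" "multilinear_ops m V l" "us @ (e, x) # vs \<in> op_args m V"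
 shows "l (us @ (e, \<zero>\<^bsub>V e\<^esub>) # vs) = \<zero>\<^bsub>V (op_degree (us @ (e, x) # vs))\<^esub>"
 using multilinear_zero[OF assms, of "length us" e] by (simp add: list_update_append)

lemma multilinear_append_scale:
 assumes V: "graded_vector_space V" and l: "multilinear_ops m V l" and w: "us @ (e, x) # vs \<in> op_args m V"
 shows "l (us @ (e, c \<odot>\<^bsub>V e\<^esub> x) # vs) = c \<odot>\<^bsub>V (op_degree (us @ (e, x) # vs))\<^esub> l (us @ (e, x) # vs)"
proof -
 interpret M: kmodule "V e" by (rule graded_kmodule[OF V])
 interpret W: kmodule "V (op_degree (us @ (e, x) # vs))" by (rule graded_kmodule[OF V])
 have x: "x \<in> carrier (V e)" using op_argsD(1)[OF w] by (simp add: homogeneous_list_def)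
 have "l (us @ (e, c \<odot>\<^bsub>V e\<^esub> x) # vs) = l (us @ (e, c \<odot>\<^bsub>V e\<^esub> x \<oplus>\<^bsub>V e\<^esub> \<zero>\<^bsub>V e\<^esub>) # vs)"
  using x by (simp add: M.smult_closed)
 also have "\<dots> = c \<odot>\<^bsub>V (op_degree (us @ (e, x) # vs))\<^esub> l (us @ (e, x) # vs)"
  using multilinear_append[OF l w M.M.zero_closed] multilinear_append_zero[OF V l w] multilinear_closed[OF l w]
  by (simp add: W.smult_closed)
 finally show ?thesis .
qed

lemma chi_adjacent:
 assumes "Suc i < length ds"
 shows "chi (transpose i (Suc i)) ds = - psign (ds ! i * ds ! Suc i)"
proof -
 let ?\<sigma> = "transpose i (Suc i)"
 have "{(p, q). p < q \<and> q < length ds \<and> ?\<sigma> q < ?\<sigma> p} = {(i, Suc i)}"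
  using assms by (auto simp: transpose_def split: if_splits)
 then have "koszul ?\<sigma> ds = psign (ds ! Suc i * ds ! i)" by (simp add: koszul_def)
 then show ?thesis by (simp add: chi_def sign_swap_id mult.commute)
qed

lemma permute_list_adjacent:
 "permute_list (transpose (length us) (Suc (length us))) (us @ y # x # vs) = us @ x # y # vs"
proof (rule nth_equalityI)
 fix j assume "j < length (permute_list (transpose (length us) (Suc (length us))) (us @ y # x # vs))"
 then have j: "j < length us + length vs + 2" by simp
 then have "permute_list (transpose (length us) (Suc (length us))) (us @ y # x # vs) ! j =
   (us @ y # x # vs) ! transpose (length us) (Suc (length us)) j"
  by (simp add: permute_list_def del: upt_Suc)
 also have "\<dots> = (us @ x # y # vs) ! j"
  by (auto simp: transpose_def nth_append nth_Cons split: nat.splits)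
 finally show "permute_list (transpose (length us) (Suc (length us))) (us @ y # x # vs) ! j = (us @ x # y # vs) ! j" .
qed simp

locale free_target = free_setting m Y for m :: enat and Y :: "('k::field_char_0, 'y) graded" +
 fixes A :: "('k, 'a) graded" and lA :: "(int \<times> 'a) list \<Rightarrow> 'a" and f :: "int \<Rightarrow> 'y \<Rightarrow> 'a"
 assumes A: "L_algebra m A lA" and f: "graded_linear Y A f"
begin

lemma A_graded: "graded_vector_space A" and A_ops: "multilinear_ops m A lA"
 and A_anti: "antisymmetric_ops m A lA" and A_jacobi: "jacobi_ops m A lA"
 using A by (simp_all add: L_algebra_def)

lemmas A_module = graded_kmodule[OF A_graded]

abbreviation ph :: "(int \<times> 'y) tree \<Rightarrow> 'a" where "ph \<equiv> tree_eval f lA"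
abbreviation P :: "(int \<times> 'y) tree \<Rightarrow> int \<times> 'a" where "P t \<equiv> (dg fst t, ph t)"
abbreviation VT :: "(int \<times> 'y) tree set" where "VT \<equiv> {t. valid m V t}"

lemma op_degree_P: "op_degree (map P ts) = dg fst (Vert ts)"
 by (simp add: op_degree_def total_degree_def comp_def)

lemma ph_carrier: "valid m V t \<Longrightarrow> ph t \<in> carrier (A (dg fst t))"
proof (induction t)
 case (Leg b)
 then show ?case using f by (cases b) (simp add: graded_linear_def dg_def ldeg_def)
next
 case (Vert ts)
 then have "map P ts \<in> op_args m A" by (auto simp: op_args_def homogeneous_list_def)
 from multilinear_closed[OF A_ops this] show ?case unfolding op_degree_P by simp
qed

lemma P_args:
 assumes "1 \<le> length ts" "enat (length ts) \<le> m" "\<And>t. t \<in> set ts \<Longrightarrow> valid m V t"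
 shows "map P ts \<in> op_args m A"
 using assms ph_carrier by (auto simp: op_args_def homogeneous_list_def)

text \<open>As the homogeneous components of the target are separate spaces, trees of another degree have to be
sent to the zero of \<open>A d\<close> for the linear extension to be defined on all trees.\<close>

definition comp_eval :: "int \<Rightarrow> (int \<times> 'y) tree \<Rightarrow> 'a" where
 "comp_eval d s = (if dg fst s = d then ph s else \<zero>\<^bsub>A d\<^esub>)"

definition ext :: "int \<Rightarrow> ('k, 'y) dforest \<Rightarrow> 'a" where
 "ext d = module_ev (A d) (comp_eval d)"

lemma comp_eval_carrier: "t \<in> VT \<Longrightarrow> comp_eval d t \<in> carrier (A d)"
proof -
 interpret M: kmodule "A d" by (rule A_module)
 assume "t \<in> VT" then show ?thesis using ph_carrier by (auto simp: comp_eval_def)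
qed

lemma ext_closed: "x \<in> span_on VT \<Longrightarrow> ext d x \<in> carrier (A d)"
 unfolding ext_def by (rule kmodule.module_ev_closed[OF A_module comp_eval_carrier])

lemma ext_linear:
 "x \<in> span_on VT \<Longrightarrow> y \<in> span_on VT \<Longrightarrow> ext d (fscale c x + y) = c \<odot>\<^bsub>A d\<^esub> ext d x \<oplus>\<^bsub>A d\<^esub> ext d y"
 unfolding ext_def by (rule kmodule.module_ev_linear[OF A_module comp_eval_carrier])

lemma ext_gen: "valid m V t \<Longrightarrow> ext d (gen t) = comp_eval d t"
 unfolding ext_def by (rule kmodule.module_ev_gen[OF A_module], rule comp_eval_carrier) simp

lemma ext_0: "ext d 0 = \<zero>\<^bsub>A d\<^esub>"
 unfolding ext_def by (rule kmodule.module_ev_0[OF A_module])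

lemma ext_scale: "x \<in> span_on VT \<Longrightarrow> ext d (fscale c x) = c \<odot>\<^bsub>A d\<^esub> ext d x"
proof -
 interpret M: kmodule "A d" by (rule A_module)
 assume "x \<in> span_on VT"
 then show ?thesis using ext_linear[of x 0 d c] ext_closed[of x d] by (simp add: ext_0 M.smult_closed)
qed

lemma ext_diff_zero:
 assumes "x \<in> span_on VT" "y \<in> span_on VT" "ext d x = ext d y"
 shows "ext d (x - y) = \<zero>\<^bsub>A d\<^esub>"
proof -
 interpret M: kmodule "A d" by (rule A_module)
 have "x - y = fscale (- 1) y + x" by (simp add: free.scale_minus_left)
 then show ?thesis
  using ext_linear[OF assms(2,1), of d "- 1"] assms(3) M.smult_neg_add[OF ext_closed[OF assms(2)]] by simp
qed

lemma ext_cong_zero: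
 assumes "x \<in> span_on VT" "y \<in> span_on VT" "ext d (x - y) = \<zero>\<^bsub>A d\<^esub>"
 shows "ext d x = ext d y"
proof -
 interpret M: kmodule "A d" by (rule A_module)
 have "ext d (fscale 1 (x - y) + y) = 1 \<odot>\<^bsub>A d\<^esub> ext d (x - y) \<oplus>\<^bsub>A d\<^esub> ext d y"
  by (rule ext_linear[OF span_on_diff[OF assms(1,2)] assms(2)])
 then show ?thesis using ext_closed[OF assms(2), of d] assms(3) by simp
qed

lemma ext_sum:
 assumes "finite J" "\<And>j. j \<in> J \<Longrightarrow> h j \<in> span_on VT"
 shows "ext d (\<Sum>j\<in>J. h j) = finsum (A d) (\<lambda>j. ext d (h j)) J"
proof -
 interpret M: kmodule "A d" by (rule A_module)
 show ?thesis using assms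
 proof (induction J)
  case empty
  show ?case by (simp add: ext_0)
 next
  case (insert a J)
  have "ext d (fscale 1 (h a) + (\<Sum>j\<in>J. h j)) = 1 \<odot>\<^bsub>A d\<^esub> ext d (h a) \<oplus>\<^bsub>A d\<^esub> ext d (\<Sum>j\<in>J. h j)"
   by (rule ext_linear) (use insert in \<open>auto intro: span_on_sum\<close>)
  moreover have "finsum (A d) (\<lambda>j. ext d (h j)) (insert a J) = ext d (h a) \<oplus>\<^bsub>A d\<^esub> finsum (A d) (\<lambda>j. ext d (h j)) J"
   by (rule M.M.finsum_insert) (use insert in \<open>auto intro!: ext_closed\<close>)
  ultimately show ?case using insert ext_closed[of "h a" d] by simp
 qed
qed

text \<open>An exchange of adjacent children is an instance of the antisymmetry of the operations of \<open>A\<close>.\<close>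

lemma ph_swaps:
 "swaps fst e s s' \<Longrightarrow> valid m V s \<Longrightarrow> ph s = of_int e \<odot>\<^bsub>A (dg fst s')\<^esub> ph s'"
proof (induction rule: swaps.induct)
 case (none t)
 interpret M: kmodule "A (dg fst t)" by (rule A_module)
 show ?case using ph_carrier[OF none] by simp
next
 case (swap x y us vs)
 let ?ts = "us @ y # x # vs" and ?i = "length us"
 let ?\<sigma> = "transpose ?i (Suc ?i)"
 have w: "map P ?ts \<in> op_args m A" by (rule P_args) (use swap in auto)
 have \<sigma>: "?\<sigma> permutes {..<length (map P ?ts)}" by (rule permutes_swap_id) auto
 have "ph (Vert (us @ x # y # vs)) = lA (permute_list ?\<sigma> (map P ?ts))"
  using permute_list_adjacent[of "map P us" "P y" "P x" "map P vs"] by simp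
 also have "\<dots> = of_int (chi ?\<sigma> (map fst (map P ?ts))) \<odot>\<^bsub>A (op_degree (map P ?ts))\<^esub> lA (map P ?ts)"
  by (rule A_anti[unfolded antisymmetric_ops_def, rule_format, OF w \<sigma>])
 also have "chi ?\<sigma> (map fst (map P ?ts)) = - psign (dg fst x * dg fst y)"
  by (subst chi_adjacent) (simp_all add: nth_append mult.commute)
 finally show ?case unfolding op_degree_P by simp
next
 case (ctx e s s' us vs)
 have s: "valid m V s" "valid m V s'" using ctx valid_swaps[OF ctx(1)] by auto
 have w: "map P (us @ s' # vs) \<in> op_args m A" by (rule P_args) (use ctx.prems s in auto)
 have "ph (Vert (us @ s # vs)) = lA (map P us @ (dg fst s', of_int e \<odot>\<^bsub>A (dg fst s')\<^esub> ph s') # map P vs)"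
  using ctx.IH[OF s(1)] swaps_degs(3)[OF ctx(1), of fst] by simp
 also have "\<dots> = of_int e \<odot>\<^bsub>A (op_degree (map P (us @ s' # vs)))\<^esub> ph (Vert (us @ s' # vs))"
  using multilinear_append_scale[OF A_graded A_ops, of "map P us" "dg fst s'" "ph s'" "map P vs"] w by simp
 finally show ?case unfolding op_degree_P .
next
 case (comp e s s' e' s'')
 interpret M: kmodule "A (dg fst s'')" by (rule A_module)
 have s: "valid m V s'" "valid m V s''" using comp(5) valid_swaps[OF comp(1)] valid_swaps[OF comp(2)] by auto
 show ?case
  using comp.IH(1)[OF comp.prems] comp.IH(2)[OF s(1)] swaps_degs(3)[OF comp(2), of fst] ph_carrier[OF s(2)]
  by (simp add: M.smult_mult)
qed

lemma ph_jtree: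
 assumes "1 \<le> i" "i \<le> length ts"
 shows "ph (jtree i ts) = lA ((op_degree (take i (map P ts)), lA (take i (map P ts))) # drop i (map P ts))"
 by (simp add: jtree_def take_map drop_map op_degree_P)

lemma ext_jac:
 assumes ts: "1 \<le> length ts" "enat (length ts) \<le> m" "\<And>t. t \<in> set ts \<Longrightarrow> valid m V t"
 shows "ext d (jac fst ts) = \<zero>\<^bsub>A d\<^esub>"
proof -
 interpret M: kmodule "A d" by (rule A_module)
 let ?n = "length ts"
 let ?w = "map P ts"
 let ?d = "total_degree ?w + int (length ?w) - 3"
 have w: "?w \<in> op_args m A" by (rule P_args[OF ts])
 let ?c = "\<lambda>i \<sigma>. of_int (chi \<sigma> (map (dg fst) ts) * psign (int (i * (?n - i)))) :: 'k"
 let ?h = "\<lambda>p. ext d (case p of (i, \<sigma>) \<Rightarrow> fscale (?c i \<sigma>) (gen (jtree i (permute_list \<sigma> ts))))"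
 have facts: "valid m V (jtree i (permute_list \<sigma> ts)) \<and> dg fst (jtree i (permute_list \<sigma> ts)) = ?d \<and>
   ph (jtree i (permute_list \<sigma> ts)) =
   lA ((op_degree (take i (permute_list \<sigma> ?w)), lA (take i (permute_list \<sigma> ?w))) # drop i (permute_list \<sigma> ?w))"
  if "(i, \<sigma>) \<in> unsh ?n" for i \<sigma>
 proof -
  have i: "1 \<le> i" "i \<le> ?n" and \<sigma>: "\<sigma> permutes {..<?n}" using unshD[OF that] by auto
  let ?ts = "permute_list \<sigma> ts"
  have i': "i \<le> length ?ts" using i by simp
  have "valid m V (jtree i ?ts)" by (rule valid_jtree[OF i(1) i']) (use ts \<sigma> in auto)
  moreover have "dg fst (jtree i ?ts) = ?d"
   unfolding jtree_facts(2)[OF i(1) i'] total_degree_def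
   using sum_list_map_mset_cong[OF mset_permute_list[OF \<sigma>], of "dg fst"] by (simp add: comp_def)
  moreover have "permute_list \<sigma> ?w = map P ?ts" using \<sigma> by (simp add: permute_list_map)
  ultimately show ?thesis unfolding ph_jtree[OF i(1) i'] by simp
 qed
 have "ext d (jac fst ts) = finsum (A d) ?h (unsh ?n)"
  unfolding jac_def by (rule ext_sum[OF finite_unsh]) (use facts in \<open>auto intro!: span_on_fscale\<close>)
 also have "\<dots> = \<zero>\<^bsub>A d\<^esub>"
 proof (cases "d = ?d")
  case True
  let ?g = "\<lambda>(i, \<sigma>). of_int (chi \<sigma> (map fst ?w) * psign (int (i * (length ?w - i)))) \<odot>\<^bsub>A ?d\<^esub>
   lA ((op_degree (take i (permute_list \<sigma> ?w)), lA (take i (permute_list \<sigma> ?w))) # drop i (permute_list \<sigma> ?w))"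
  have "finsum (A d) ?h (unsh ?n) =
    finsum (A d) ?g (unsh ?n)"
  proof (rule M.M.finsum_cong'[OF refl])
   have g: "?h p = ?g p \<and> ?g p \<in> carrier (A d)"
    if p: "p \<in> unsh ?n" for p
   proof -
    obtain i \<sigma> where ip: "p = (i, \<sigma>)" by (cases p)
    note fa = facts[OF p[unfolded ip]]
    have "gen (jtree i (permute_list \<sigma> ts)) \<in> (span_on VT :: (_ \<Rightarrow>\<^sub>0 'k) set)" using fa by simp
    then have e1: "ext d (fscale (?c i \<sigma>) (gen (jtree i (permute_list \<sigma> ts)))) = ?c i \<sigma> \<odot>\<^bsub>A d\<^esub> ph (jtree i (permute_list \<sigma> ts))"
     using fa True by (simp add: ext_scale ext_gen comp_eval_def)
    have mem: "ph (jtree i (permute_list \<sigma> ts)) \<in> carrier (A d)"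
     using ph_carrier[of "jtree i (permute_list \<sigma> ts)"] fa True by simp
    have mf: "map fst ?w = map (dg fst) ts" "length ?w = ?n" by simp_all
    have pe: "lA ((op_degree (take i (permute_list \<sigma> ?w)), lA (take i (permute_list \<sigma> ?w))) # drop i (permute_list \<sigma> ?w)) =
      ph (jtree i (permute_list \<sigma> ts))" using fa by simp
    show ?thesis
     unfolding ip split True[symmetric] pe unfolding mf
     by (rule conjI[OF e1 M.smult_closed[OF M.scalar mem]])
   qed
   then show "?g \<in> unsh ?n \<rightarrow> carrier (A d)" by blast
   fix p assume "p \<in> unsh ?n"
   with g show "?h p = ?g p" by blast
  qed
  also have "\<dots> = \<zero>\<^bsub>A d\<^esub>"
   using A_jacobi[unfolded jacobi_ops_def Let_def, rule_format, OF w] unfolding True length_map .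
  finally show ?thesis .
 next
  case False
  have "?h p = \<zero>\<^bsub>A d\<^esub>" if p: "p \<in> unsh ?n" for p
  proof -
   obtain i \<sigma> where ip: "p = (i, \<sigma>)" by (cases p)
   note fa = facts[OF p[unfolded ip]]
   then show ?thesis unfolding ip split using False by (simp add: ext_scale ext_gen comp_eval_def)
  qed
  then have "finsum (A d) ?h (unsh ?n) =
    finsum (A d) (\<lambda>_. \<zero>\<^bsub>A d\<^esub>) (unsh ?n)"
   by (intro M.M.finsum_cong') auto
  then show ?thesis by simp
 qed
 finally show ?thesis .
qed

lemma ext_context:
 assumes x: "x \<in> span_on (TD e)" and uv: "\<And>t. t \<in> set us \<union> set vs \<Longrightarrow> valid m V t" "enat (length us + length vs + 1) \<le> m"
 defines "D' \<equiv> total_degree (map P us) + e + total_degree (map P vs) + int (length us + length vs) - 1"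
 shows "ext d (lin_ext (\<lambda>t. gen (Vert (us @ t # vs))) x) =
  (if d = D' then lA (map P us @ (e, ext e x) # map P vs) else \<zero>\<^bsub>A d\<^esub>)"
  (is "ext d (?h x) = _")
proof -
 interpret M: kmodule "A d" by (rule A_module)
 have D': "op_degree (map P us @ (e, z) # map P vs) = D'" for z
  by (simp add: op_degree_append D'_def)
 have hV: "?h y \<in> span_on VT" if "y \<in> span_on (TD e)" for y
 proof (rule lin_ext_span_on)
  fix t assume "t \<in> supp y"
  then have "valid m V t" using span_on_keysD[OF that] by auto
  then show "gen (Vert (us @ t # vs)) \<in> span_on VT" using uv by auto
 qed
 have args: "map P us @ (e, z) # map P vs \<in> op_args m A" if "z \<in> carrier (A e)" for z
  using that uv ph_carrier by (auto simp: op_args_def homogeneous_list_def)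
 from x show ?thesis
 proof (induction rule: span_on_induct)
  case zero
  interpret E: kmodule "A e" by (rule A_module)
  show ?case using multilinear_append_zero[OF A_graded A_ops args[OF E.M.zero_closed]] by (simp add: ext_0 D')
 next
  case (step c t y)
  have t: "valid m V t" "dg fst t = e" using step(1) by auto
  have y: "y \<in> span_on VT" using step(2) by (rule TD_valid)
  have gt: "gen t \<in> (span_on (TD e) :: (_ \<Rightarrow>\<^sub>0 'k) set)" using t by simp
  have vt: "valid m V (Vert (us @ t # vs))" using uv t by auto
  have dt: "dg fst (Vert (us @ t # vs)) = D'"
   using D'[of "ph t"] t(2) op_degree_P[of "us @ t # vs"] by simp
  have "ext d (?h (fscale c (gen t) + y)) = ext d (fscale c (gen (Vert (us @ t # vs))) + ?h y)"
   by (simp add: lin_ext_add lin_ext_fscale)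
  also have "\<dots> = c \<odot>\<^bsub>A d\<^esub> comp_eval d (Vert (us @ t # vs)) \<oplus>\<^bsub>A d\<^esub> ext d (?h y)"
   using ext_linear[OF _ hV[OF step(2)], of "gen (Vert (us @ t # vs))" d c] vt ext_gen[OF vt] by simp
  finally have 1: "ext d (?h (fscale c (gen t) + y)) = c \<odot>\<^bsub>A d\<^esub> comp_eval d (Vert (us @ t # vs)) \<oplus>\<^bsub>A d\<^esub> ext d (?h y)" .
  show ?case
  proof (cases "d = D'")
   case True
   have pt: "ph t \<in> carrier (A e)" using ph_carrier[OF t(1)] t(2) by simp
   have "ext e (fscale c (gen t) + y) = c \<odot>\<^bsub>A e\<^esub> ph t \<oplus>\<^bsub>A e\<^esub> ext e y"
    using ext_linear[OF TD_valid[OF gt] y, of e c] ext_gen[OF t(1)] t(2) by (simp add: comp_eval_def)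
   moreover have "lA (map P us @ (e, c \<odot>\<^bsub>A e\<^esub> ph t \<oplus>\<^bsub>A e\<^esub> ext e y) # map P vs) =
     c \<odot>\<^bsub>A D'\<^esub> lA (map P us @ (e, ph t) # map P vs) \<oplus>\<^bsub>A D'\<^esub> lA (map P us @ (e, ext e y) # map P vs)"
    using multilinear_append[OF A_ops args[OF pt] ext_closed[OF y]] unfolding D' .
   ultimately show ?thesis
    using True step(3) dt t(2) unfolding 1 by (simp add: comp_eval_def)
  next
   case False
   then show ?thesis using step(3) dt unfolding 1 by (simp add: comp_eval_def)
  qed
 qed
qed

text \<open>Each kind of relator is one of the axioms: linearity of \<open>f\<close>, antisymmetry, the Jacobi identity, and
multilinearity for the relators that are placed under a vertex.\<close>

lemma ext_relator:
 "relator m V fst (linear_relators Y) r \<Longrightarrow> ext d r = \<zero>\<^bsub>A d\<^esub>"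
proof (induction arbitrary: d rule: relator.induct)
 case (leaf r)
 then obtain e c x y where r: "r = gen (e, c \<odot>\<^bsub>Y e\<^esub> x \<oplus>\<^bsub>Y e\<^esub> y) - fscale c (gen (e, x)) - gen (e, y)"
  and xy: "x \<in> carrier (Y e)" "y \<in> carrier (Y e)" unfolding linear_relators_def by blast
 interpret M: kmodule "A d" by (rule A_module)
 have L: "valid m V (Leg (e, z)) \<and> comp_eval d (Leg (e, z)) = (if d = e then f e z else \<zero>\<^bsub>A d\<^esub>)" if "z \<in> carrier (Y e)" for z
  using that by (simp add: comp_eval_def dg_def ldeg_def)
 let ?z = "c \<odot>\<^bsub>Y e\<^esub> x \<oplus>\<^bsub>Y e\<^esub> y"
 have gL: "gen (Leg (e, z)) \<in> (span_on VT :: (_ \<Rightarrow>\<^sub>0 'k) set)" if "z \<in> carrier (Y e)" for z using that by simp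
 have "f e ?z = c \<odot>\<^bsub>A e\<^esub> f e x \<oplus>\<^bsub>A e\<^esub> f e y"
  using f xy unfolding graded_linear_def by blast
 then have "ext d (gen (Leg (e, ?z))) = ext d (fscale c (gen (Leg (e, x))) + gen (Leg (e, y)))"
  using L xy Y_closed[OF xy] by (simp add: ext_linear[OF gL gL] ext_gen)
 from ext_diff_zero[OF gL[OF Y_closed[OF xy]] span_on_add[OF span_on_fscale[OF gL[OF xy(1)]] gL[OF xy(2)]] this]
 show ?case unfolding r by (simp add: lin_ext_diff lin_ext_fscale lin_ext_add diff_diff_eq)
next
 case (swap s e s')
 interpret M: kmodule "A d" by (rule A_module)
 have s': "valid m V s'" using swap valid_swaps by blast
 have gs: "gen s \<in> (span_on VT :: (_ \<Rightarrow>\<^sub>0 'k) set)" "gen s' \<in> (span_on VT :: (_ \<Rightarrow>\<^sub>0 'k) set)" using swap(1) s' by simp_all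
 show ?case
 proof (rule ext_diff_zero[OF gs(1) span_on_fscale[OF gs(2)]])
  show "ext d (gen s) = ext d (fscale (of_int e) (gen s'))"
   using ph_swaps[OF swap(2,1)] swaps_degs(3)[OF swap(2), of fst]
   by (simp add: ext_scale[OF gs(2)] ext_gen[OF swap(1)] ext_gen[OF s'] comp_eval_def)
 qed
next
 case (jac ts)
 then show ?case by (rule ext_jac)
next
 case (ctx r us vs)
 from relator_homogeneous[OF ctx(1) leaf_homogeneous_linear] obtain p e n
  where h: "r \<in> span_on {t. valid m V t \<and> tdeg t = p \<and> dg fst t = e \<and> arity t = n}" by blast
 have r: "r \<in> span_on (TD e)" by (rule span_on_mono[OF _ h]) auto
 interpret E: kmodule "A e" by (rule A_module)
 have "map P us @ (e, \<zero>\<^bsub>A e\<^esub>) # map P vs \<in> op_args m A"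
  using ctx.hyps ph_carrier by (auto simp: op_args_def homogeneous_list_def)
 from multilinear_append_zero[OF A_graded A_ops this]
 have z: "lA (map P us @ (e, ext e r) # map P vs) =
   \<zero>\<^bsub>A (total_degree (map P us) + e + total_degree (map P vs) + int (length us + length vs) - 1)\<^esub>"
  unfolding ctx.IH by (simp only: op_degree_append length_map)
 have "ext d (lin_ext (\<lambda>t. gen (Vert (us @ t # vs))) r) =
  (if d = total_degree (map P us) + e + total_degree (map P vs) + int (length us + length vs) - 1
   then lA (map P us @ (e, ext e r) # map P vs) else \<zero>\<^bsub>A d\<^esub>)"
  by (rule ext_context[OF r]) (use ctx.hyps in auto)
 then show ?case unfolding z by simp
qed

lemma relator_span: "relator m V fst (linear_relators Y) r \<Longrightarrow> r \<in> span_on VT"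
proof -
 assume "relator m V fst (linear_relators Y) r"
 from relator_homogeneous[OF this leaf_homogeneous_linear] obtain p e n
  where h: "r \<in> span_on {t. valid m V t \<and> tdeg t = p \<and> dg fst t = e \<and> arity t = n}" by blast
 show ?thesis by (rule span_on_mono[OF _ h]) auto
qed

lemma ext_relations:
 assumes "x \<in> N"
 shows "ext d x = \<zero>\<^bsub>A d\<^esub>"
proof -
 interpret M: kmodule "A d" by (rule A_module)
 let ?K = "{x \<in> span_on VT. ext d x = \<zero>\<^bsub>A d\<^esub>}"
 have add: "x + y \<in> ?K" if "x \<in> ?K" "y \<in> ?K" for x y
  using ext_linear[of x y d 1] that by (auto intro: span_on_add)
 have "free.subspace ?K"
  by (rule free.subspaceI) (use add in \<open>auto simp: ext_0 ext_scale intro: span_on_fscale\<close>)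
 moreover have "Collect (relator m V fst (linear_relators Y)) \<subseteq> ?K"
  using relator_span ext_relator by blast
 ultimately have "N \<subseteq> ?K" unfolding relations_def by (rule free.span_minimal[rotated])
 with assms show ?thesis by blast
qed

lemma ext_cong: "x \<in> span_on VT \<Longrightarrow> y \<in> span_on VT \<Longrightarrow> x - y \<in> N \<Longrightarrow> ext d x = ext d y"
 by (rule ext_cong_zero) (simp_all add: ext_relations)

lemma vert_VT:
 assumes "\<And>x. x \<in> set xs \<Longrightarrow> x \<in> span_on VT" "1 \<le> length xs" "enat (length xs) \<le> m"
 shows "vert xs \<in> span_on VT"
 unfolding vert_def
proof (rule lin_ext_span_on)
 fix as assume as: "as \<in> supp (tuples xs)"
 have "valid m V t" if "t \<in> set as" for t
  by (rule keys_tuples_valid[OF as assms(1) that])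
 then show "gen (Vert as) \<in> span_on VT"
  using assms(2,3) length_keys_tuples[OF as] by simp
qed

text \<open>Multilinearity is used position by position; the trees \<open>ts\<close> are the arguments already treated.\<close>

lemma ext_vert_aux:
 assumes "\<And>t. t \<in> set ts \<Longrightarrow> valid m V t" "homog zs" "1 \<le> length ts + length zs" "enat (length ts + length zs) \<le> m"
 shows "ext (total_degree (map P ts) + total_degree zs + int (length ts + length zs) - 2) (vert (map gen ts @ map snd zs)) =
  lA (map P ts @ map (\<lambda>z. (fst z, ext (fst z) (snd z))) zs)"
 using assms
proof (induction zs arbitrary: ts)
 case Nil
 have v: "valid m V (Vert ts)" using Nil by simp
 have "dg fst (Vert ts) = total_degree (map P ts) + int (length ts) - 2"
  unfolding op_degree_P[symmetric] by (simp add: op_degree_def)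
 then show ?case by (simp add: vert_gens ext_gen[OF v] comp_eval_def total_degree_def)
next
 case (Cons z zs)
 obtain e x where z: "z = (e, x)" by (cases z)
 let ?us = "map gen ts :: ('k, 'y) dforest list" and ?vs = "map snd zs"
 let ?Q = "map (\<lambda>z. (fst z, ext (fst z) (snd z))) zs"
 let ?D = "total_degree (map P ts) + total_degree (z # zs) + int (length ts + length (z # zs)) - 2"
 have hz: "homog zs" using Cons.prems(2) by simp
 have D: "op_degree (map P ts @ (e, a) # ?Q) = ?D" for a
  unfolding op_degree_append by (simp add: z total_degree_def comp_def)
 have args: "map P ts @ (e, a) # ?Q \<in> op_args m A" if "a \<in> carrier (A e)" for a
  using that Cons.prems ph_carrier ext_closed[OF TD_valid] by (auto simp: op_args_def homogeneous_list_def)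
 have vV: "vert (?us @ u # ?vs) \<in> span_on VT" if "u \<in> span_on VT" for u
  by (rule vert_VT) (use that Cons.prems TD_valid in auto)
 have "x \<in> span_on (TD e)" using Cons.prems(2) by (simp add: z)
 then have "ext ?D (vert (?us @ x # ?vs)) = lA (map P ts @ (e, ext e x) # ?Q)"
 proof (induction rule: span_on_induct)
  case zero
  interpret E: kmodule "A e" by (rule A_module)
  have "vert (?us @ (0 - 0) # ?vs) = 0" unfolding vert_diff by simp
  then show ?case
   using multilinear_append_zero[OF A_graded A_ops args[OF E.M.zero_closed]] by (simp add: ext_0 D)
 next
  case (step c t y)
  have t: "valid m V t" "dg fst t = e" using step(1) by auto
  have y: "y \<in> span_on VT" by (rule TD_valid[OF step(2)])
  have gt: "gen t \<in> (span_on VT :: (_ \<Rightarrow>\<^sub>0 'k) set)" using t by simp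
  have pt: "ph t \<in> carrier (A e)" using ph_carrier[OF t(1)] t(2) by simp
  have IH: "ext ?D (vert (?us @ gen t # ?vs)) = lA (map P ts @ (e, ph t) # ?Q)"
  proof -
   have v: "s \<in> set (ts @ [t]) \<Longrightarrow> valid m V s" for s using Cons.prems(1) t(1) by auto
   have l: "1 \<le> length (ts @ [t]) + length zs" "enat (length (ts @ [t]) + length zs) \<le> m"
    using Cons.prems(3,4) by simp_all
   have deq: "total_degree (map P (ts @ [t])) + total_degree zs + int (length (ts @ [t]) + length zs) - 2 = ?D"
    by (simp add: total_degree_def z t(2))
   show ?thesis using Cons.IH[OF v hz l, unfolded deq] t(2) by simp
  qed
  have "ext ?D (vert (?us @ (fscale c (gen t) + y) # ?vs)) =
    c \<odot>\<^bsub>A ?D\<^esub> lA (map P ts @ (e, ph t) # ?Q) \<oplus>\<^bsub>A ?D\<^esub> lA (map P ts @ (e, ext e y) # ?Q)"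
   unfolding vert_linear ext_linear[OF vV[OF gt] vV[OF y]] IH step(3) ..
  also have "\<dots> = lA (map P ts @ (e, c \<odot>\<^bsub>A e\<^esub> ph t \<oplus>\<^bsub>A e\<^esub> ext e y) # ?Q)"
   using multilinear_append[OF A_ops args[OF pt] ext_closed[OF y], of c] unfolding D by (rule sym)
  also have "c \<odot>\<^bsub>A e\<^esub> ph t \<oplus>\<^bsub>A e\<^esub> ext e y = ext e (fscale c (gen t) + y)"
   unfolding ext_linear[OF gt y] ext_gen[OF t(1)] comp_eval_def using t(2) by simp
  finally show ?case .
 qed
 then show ?case by (simp add: z)
qed

lemma ext_vert:
 assumes "homog zs" "1 \<le> length zs" "enat (length zs) \<le> m"
 shows "ext (op_degree zs) (vert (map snd zs)) = lA (map (\<lambda>z. (fst z, ext (fst z) (snd z))) zs)"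
proof -
 have od: "op_degree zs = total_degree (map P []) + total_degree zs + int (length ([] :: (int \<times> 'y) tree list) + length zs) - 2"
  by (simp add: op_degree_def total_degree_def)
 show ?thesis unfolding od using ext_vert_aux[of "[]" zs] assms by simp
qed

text \<open>The homomorphism that extends \<open>f\<close>.\<close>

definition lift :: "int \<Rightarrow> ('k, 'y) free_elt \<Rightarrow> 'a" where
 "lift d x = ext d (alpha d x)"

lemma lift_beta: "x \<in> span_on (TD d) \<Longrightarrow> lift d (beta d x) = ext d x"
 unfolding lift_def
 by (rule ext_cong[OF TD_valid[OF alpha(1)[OF beta_carrier]] TD_valid alpha_beta])

lemma lift_graded_linear: "graded_linear F A lift"
 unfolding graded_linear_def
proof (intro conjI allI ballI)
 fix d x assume "x \<in> carrier (F d)"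
 then show "lift d x \<in> carrier (A d)" unfolding lift_def by (rule ext_closed[OF TD_valid[OF alpha(1)]])
next
 fix d c x y assume x: "x \<in> carrier (F d)" and y: "y \<in> carrier (F d)"
 note ax = alpha[OF x] and ay = alpha[OF y]
 have "lift d (c \<odot>\<^bsub>F d\<^esub> beta d (alpha d x) \<oplus>\<^bsub>F d\<^esub> beta d (alpha d y)) = ext d (fscale c (alpha d x) + alpha d y)"
  unfolding beta_scale beta_add by (rule lift_beta[OF span_on_add[OF span_on_fscale[OF ax(1)] ay(1)]])
 also have "\<dots> = c \<odot>\<^bsub>A d\<^esub> lift d x \<oplus>\<^bsub>A d\<^esub> lift d y"
  unfolding lift_def by (rule ext_linear[OF TD_valid[OF ax(1)] TD_valid[OF ay(1)]])
 finally show "lift d (c \<odot>\<^bsub>F d\<^esub> x \<oplus>\<^bsub>F d\<^esub> y) = c \<odot>\<^bsub>A d\<^esub> lift d x \<oplus>\<^bsub>A d\<^esub> lift d y"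
  unfolding ax(2) ay(2) .
qed

lemma lift_op:
 assumes w: "w \<in> op_args m F"
 shows "lift (op_degree w) (free_op w) = lA (map (\<lambda>(d, x). (d, lift d x)) w)"
proof -
 obtain zs where zs: "homog zs" "w = betas zs" using betas_alpha[OF op_argsD(1)[OF w]] .
 have len: "1 \<le> length zs" "enat (length zs) \<le> m" using op_argsD(2,3)[OF w] by (simp_all add: zs(2))
 have eq: "map (\<lambda>(d, x). (d, lift d x)) (betas zs) = map (\<lambda>z. (fst z, ext (fst z) (snd z))) zs"
  unfolding map_map using zs(1) by (intro map_cong[OF refl]) (simp add: lift_beta)
 show ?thesis
  unfolding zs(2) eq op_degree_betas free_op_betas[OF zs(1) len] lift_beta[OF vert_TD[OF zs(1) len]]
  by (rule ext_vert[OF zs(1) len])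
qed

lemma lift_unit: "y \<in> carrier (Y d) \<Longrightarrow> lift d (free_unit m Y d y) = f d y"
proof -
 assume y: "y \<in> carrier (Y d)"
 have "valid m V (Leg (d, y))" "dg fst (Leg (d, y)) = d" using y by (simp_all add: dg_def ldeg_def)
 then show ?thesis
  unfolding free_unit_beta[OF y] by (subst lift_beta) (simp_all add: ext_gen comp_eval_def)
qed

text \<open>A homomorphism is determined on the class of a decorated tree by induction on the tree, since a
vertex is an operation applied to the classes of its children.\<close>

lemma lift_unique:
 assumes \<psi>: "graded_linear F A \<psi>" and op: "\<And>w. w \<in> op_args m F \<Longrightarrow> \<psi> (op_degree w) (free_op w) = lA (map (\<lambda>(d, x). (d, \<psi> d x)) w)"
  and unit: "\<And>d y. y \<in> carrier (Y d) \<Longrightarrow> \<psi> d (free_unit m Y d y) = f d y"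
  and x: "x \<in> carrier (F d)"
 shows "\<psi> d x = lift d x"
proof -
 have tree: "\<psi> (dg fst s) (beta (dg fst s) (gen s)) = ph s" if "valid m V s" for s
  using that
 proof (induction s)
  case (Leg b)
  obtain e y where b: "b = (e, y)" by (cases b)
  then have y: "y \<in> carrier (Y e)" using Leg by simp
  have "dg fst (Leg b) = e" by (simp add: b dg_def ldeg_def)
  then show ?case using unit[OF y] unfolding free_unit_beta[OF y] by (simp add: b)
 next
  case (Vert ts)
  let ?zs = "map (\<lambda>t. (dg fst t, gen t :: _ \<Rightarrow>\<^sub>0 'k)) ts"
  have hz: "homog ?zs" "1 \<le> length ?zs" "enat (length ?zs) \<le> m" using Vert.prems by auto
  have od: "op_degree ?zs = dg fst (Vert ts)" by (simp add: op_degree_def total_degree_def comp_def)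
  have args: "betas ?zs \<in> op_args m F"
   using betas_homogeneous[OF hz(1)] hz(2,3) by (simp add: op_args_def)
  have "map snd ?zs = map gen ts" by simp
  then have "free_op (betas ?zs) = beta (dg fst (Vert ts)) (gen (Vert ts))"
   unfolding free_op_betas[OF hz] od by (simp only: vert_gens)
  then have "\<psi> (dg fst (Vert ts)) (beta (dg fst (Vert ts)) (gen (Vert ts))) =
    lA (map (\<lambda>(d, x). (d, \<psi> d x)) (betas ?zs))"
   using op[OF args] unfolding op_degree_betas od by simp
  also have "map (\<lambda>(d, x). (d, \<psi> d x)) (betas ?zs) = map P ts"
   unfolding map_map using Vert by (intro map_cong[OF refl]) simp
  finally show ?case by simp
 qed
 have "\<psi> d (beta d z) = ext d z" if "z \<in> span_on (TD d)" for z
  using that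
 proof (induction rule: span_on_induct)
  case zero
  show ?case unfolding beta_0 ext_0 by (rule graded_linear_zero[OF F_graded A_graded \<psi>])
 next
  case (step c t y)
  have t: "valid m V t" "dg fst t = d" using step(1) by auto
  have gt: "gen t \<in> (span_on (TD d) :: (_ \<Rightarrow>\<^sub>0 'k) set)" using t by simp
  have "\<psi> d (c \<odot>\<^bsub>F d\<^esub> beta d (gen t) \<oplus>\<^bsub>F d\<^esub> beta d y) = c \<odot>\<^bsub>A d\<^esub> \<psi> d (beta d (gen t)) \<oplus>\<^bsub>A d\<^esub> \<psi> d (beta d y)"
   using \<psi> beta_carrier[OF gt] beta_carrier[OF step(2)] unfolding graded_linear_def by blast
  then show ?case
   using tree[OF t(1)] t
   by (simp add: beta_scale beta_add step(3) ext_linear[OF TD_valid[OF gt] TD_valid[OF step(2)]] ext_gen comp_eval_def)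
 qed
 from this[OF alpha(1)[OF x]] show ?thesis unfolding alpha(2)[OF x] lift_def .
qed

end

context free_setting
begin

lemma free_algebra:
 assumes l: "multilinear_ops m F l" "free_rule m Y l" and A: "L_algebra m A lA" and f: "graded_linear Y A f"
 shows "\<exists>\<phi>. strict_hom m F l A lA \<phi> \<and>
   (\<forall>d. \<forall>y \<in> carrier (Y d). \<phi> d (free_unit m Y d y) = f d y) \<and>
   (\<forall>\<psi>. strict_hom m F l A lA \<psi> \<and>
      (\<forall>d. \<forall>y \<in> carrier (Y d). \<psi> d (free_unit m Y d y) = f d y) \<longrightarrow>
     (\<forall>d. \<forall>x \<in> carrier (F d). \<psi> d x = \<phi> d x))"
proof -
 interpret free_target m Y A lA f by unfold_locales (rule A, rule f)
 have l0: "l w = free_op w" if "w \<in> op_args m F" for w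
  by (rule ops_agree[OF l free_op_multilinear free_op_free_rule that])
 show ?thesis
 proof (intro exI conjI allI ballI impI)
  show "strict_hom m F l A lA lift"
   unfolding strict_hom_def using lift_graded_linear lift_op l0 by simp
  show "lift d (free_unit m Y d y) = f d y" if "y \<in> carrier (Y d)" for d y
   by (rule lift_unit[OF that])
  fix \<psi> d x
  assume \<psi>: "strict_hom m F l A lA \<psi> \<and> (\<forall>d. \<forall>y \<in> carrier (Y d). \<psi> d (free_unit m Y d y) = f d y)"
   and x: "x \<in> carrier (F d)"
  have op: "\<psi> (op_degree w) (free_op w) = lA (map (\<lambda>(d, x). (d, \<psi> d x)) w)" if w: "w \<in> op_args m F" for w
  proof -
   have "\<psi> (op_degree w) (l w) = lA (map (\<lambda>(d, x). (d, \<psi> d x)) w)"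
    using \<psi> w unfolding strict_hom_def by blast
   then show ?thesis unfolding l0[OF w] .
  qed
  show "\<psi> d x = lift d x"
   by (rule lift_unique[OF _ op _ x]) (use \<psi> in \<open>auto simp: strict_hom_def\<close>)
 qed
qed

end

theorem theorem3p3:
 fixes m :: enat
  and Y :: "('k::field_char_0, 'y) graded"
 assumes "1 \<le> m"
  and "graded_vector_space Y"
 shows
  "(\<exists>l. multilinear_ops m (free_space m Y) l \<and> free_rule m Y l) \<and>
   (\<forall>l l'. multilinear_ops m (free_space m Y) l \<and> free_rule m Y l \<and>
       multilinear_ops m (free_space m Y) l' \<and> free_rule m Y l' \<longrightarrow>
    (\<forall>w \<in> op_args m (free_space m Y). l w = l' w)) \<and>
   (\<forall>l. multilinear_ops m (free_space m Y) l \<and> free_rule m Y l \<longrightarrow>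
    L_algebra m (free_space m Y) l \<and>
    graded_linear Y (free_space m Y) (free_unit m Y) \<and>
    (\<forall>(A :: ('k, 'a) graded) lA f.
      L_algebra m A lA \<and> graded_linear Y A f \<longrightarrow>
      (\<exists>\<phi>. strict_hom m (free_space m Y) l A lA \<phi> \<and>
         (\<forall>d. \<forall>y \<in> carrier (Y d). \<phi> d (free_unit m Y d y) = f d y) \<and>
         (\<forall>\<psi>. strict_hom m (free_space m Y) l A lA \<psi> \<and>
            (\<forall>d. \<forall>y \<in> carrier (Y d). \<psi> d (free_unit m Y d y) = f d y) \<longrightarrow>
          (\<forall>d. \<forall>x \<in> carrier (free_space m Y d). \<psi> d x = \<phi> d x)))))"
proof -
 interpret free_setting m Y by unfold_locales (rule assms)+
 show ?thesis
 proof (intro conjI allI impI ballI)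
  show "\<exists>l. multilinear_ops m F l \<and> free_rule m Y l"
   using free_op_multilinear free_op_free_rule by blast
 next
  fix l l' w assume "multilinear_ops m F l \<and> free_rule m Y l \<and> multilinear_ops m F l' \<and> free_rule m Y l'"
   and w: "w \<in> op_args m F"
  then show "l w = l' w" by (intro ops_agree) auto
 next
  fix l assume l: "multilinear_ops m F l \<and> free_rule m Y l"
  show "L_algebra m F l"
   using l by (intro L_algebra_agree[OF free_op_L_algebra] ops_agree[OF _ _ free_op_multilinear free_op_free_rule]) auto
 next
  show "graded_linear Y F (free_unit m Y)" by (rule free_unit_linear)
 next
  fix l and A :: "('k, 'a) graded" and lA f
  assume "multilinear_ops m F l \<and> free_rule m Y l" "L_algebra m A lA \<and> graded_linear Y A f"
  then show "\<exists>\<phi>. strict_hom m F l A lA \<phi> \<and>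
    (\<forall>d. \<forall>y \<in> carrier (Y d). \<phi> d (free_unit m Y d y) = f d y) \<and>
    (\<forall>\<psi>. strict_hom m F l A lA \<psi> \<and>
       (\<forall>d. \<forall>y \<in> carrier (Y d). \<psi> d (free_unit m Y d y) = f d y) \<longrightarrow>
      (\<forall>d. \<forall>x \<in> carrier (F d). \<psi> d x = \<phi> d x))"
   by (intro free_algebra) auto
 qed
qed

end
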